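(* Let $M \subset \mathbb{P}^N$ be a locally closed complex submanifold equipped with a contact structure $H \subset TM$. Then for a general point $z \in M$, the system of contact fundamental forms $S_z \subset U(\mathfrak{n}_z)^*$ of $M\subset\mathbb{P}^N$ at $z$ is a contact symbol system on the graded Heisenberg algebra $\mathfrak{n}_z$, where $\mathfrak{n}_z$ is the symbol algebra of $H\subset TM$ at $z$.
   Context: We work over $\mathbb{C}$; manifolds, bundles, functions are holomorphic. "For a general point $z\in M$" means for all $z$ outside some nowhere dense closed analytic subset of $M$. **Heisenberg algebras and contact symbol systems.** A graded Heisenberg algebra is a graded Lie algebra $\mathfrak{h}=\mathfrak{h}_1\oplus\mathfrak{h}_2$ with center $\mathfrak{h}_2$, $\dim\mathfrak{h}_2=1$, whose bracket gives a nondegenerate skew form $\wedge^2\mathfrak{h}_1\to\mathfrak{h}_2$. Its Heisenberg group $\mathcal{H}$ is the unipotent algebraic group with Lie algebra $\mathfrak{h}$ for which $\exp:\mathfrak{h}\to\mathcal{H}$ is biregular; $0\in\mathcal{H}$ denotes the identity. Let $U(\mathfrak{h})=\oplus_{k\ge0}U_k(\mathfrak{h})$ be the universal enveloping algebra, graded by giving $\mathfrak{h}_i$ degree $i$, and $U(\mathfrak{h})^*=\oplus_{k\ge 0}U_k(\mathfrak{h})^*$ its graded dual. Regarding $U(\mathfrak{h})$ as left-invariant differential operators on $\mathcal{H}$, the pairing $(P,f)\mapsto (Pf)(0)$ identifies $U(\mathfrak{h})^*$ with the space of polynomial functions on $\mathcal{H}$, and $U_k(\mathfrak{h})^*$ with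 those of weighted degree $k$ in exponential coordinates (linear coordinates on $\mathfrak{h}_1$ have weight 1, on $\mathfrak{h}_2$ weight 2). Let $\rho_2:U_2(\mathfrak{h})^*\to\mathfrak{h}_2^*$ be the restriction map dual to the inclusion $\mathfrak{h}_2\hookrightarrow U_2(\mathfrak{h})$. A contact symbol system on $\mathfrak{h}$ is a finite-dimensional graded subspace $S=\oplus_{k\ge0}S^k\subset U(\mathfrak{h})^*$, $S^k\subset U_k(\mathfrak{h})^*$, such that $S^0=\mathbb{C}$, $S^1=\mathfrak{h}_1^*$, $\rho_2(S^2)=\mathfrak{h}_2^*$, and $S$ (as a space of functions on $\mathcal{H}$) is preserved by all right-invariant vector fields on $\mathcal{H}$. **Symbol algebra.** A contact structure on a complex manifold $M$ is a corank-one subbundle $H\subset TM$ such that the Lie bracket of vector fields induces a nondegenerate form $\wedge^2H_z\to T_zM/H_z$ at each $z$. The symbol algebra at $z$ is the graded Heisenberg algebra $\mathfrak{n}_z=\mathfrak{n}_{z,1}\oplus\mathfrak{n}_{z,2}$, $\mathfrak{n}_{z,1}=H_z$, $\mathfrak{n}_{z,2}=T_zM/H_z$, with this bracket. **Weighted jets.** Local functions have weighted order $0$ as differential operators, a nonzero local vector field has weighted order 1 if it is a section of $H$ and 2 otherwise, and a monomial $\xi_1\cdots\xi_r$ in vector fields has weighted order the sum of the weighted orders; an operator has weighted order $\le k$ if all its monomial terms do. Let $\mathbf{m}_z^{k+1}\subset\mathcal{O}_{M,z}$ be the ideal of germs $\varphi$ such that $P\varphi$ vanishes at $z$ for every local operator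 $P$ of weighted order $\le k$ (and $\mathbf{m}_z^0=\mathcal{O}_{M,z}$). Put $J^k_z=\mathcal{O}_{M,z}/\mathbf{m}_z^{k+1}$; these are the fibers of a vector bundle $J^k$. The kernel $\mathbf{m}_z^k/\mathbf{m}_z^{k+1}$ of $J^k_z\to J^{k-1}_z$ is identified with $U_k(\mathfrak{n}_z)^*$: a germ $\varphi\in\mathbf{m}_z^k$ corresponds to the functional sending $v_1\cdots v_r$ ($v_i\in\mathfrak{n}_z$ homogeneous, degrees adding up to $k$) to $(\xi_1\cdots\xi_r\varphi)(z)$, where $\xi_i$ is any local vector field representing $v_i$ at $z$, chosen as a section of $H$ when $v_i\in\mathfrak{n}_{z,1}$. **Contact fundamental forms.** Let $M\subset\mathbb{P}^N$ carry a contact structure, let $\mathcal{L}$ be the restriction to $M$ of the hyperplane line bundle, and let $W\subset H^0(M,\mathcal{L})$ be the linear system giving the embedding (restrictions of linear forms). Put $W_z^k:=W\cap\mathbf{m}_z^k\cdot\mathcal{O}(\mathcal{L})_z$. Taking weighted $k$-jets gives a homomorphism ${\rm CF}_z^k:W_z^k/W_z^{k+1}\to U_k(\mathfrak{n}_z)^*\otimes\mathcal{L}_z$, the $k$-th contact fundamental form. Let $S_z^k\subset U_k(\mathfrak{n}_z)^*$ be its image after a local trivialization of $\mathcal{L}$ at $z$ (the result is independent of the choice). The system of contact fundamental forms at $z$ is $S_z=\oplus_kS_z^k\subset U(\mathfrak{n}_z)^*$. *)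

theory Defs
  imports "HOL-Analysis.Analysis" "HOL-Algebra.Module" "HOL-Library.Function_Algebras"
begin

section \<open>Spaces of complex-valued functions, and their quotients\<close>

definition cscale :: "complex \<Rightarrow> ('a \<Rightarrow> complex) \<Rightarrow> 'a \<Rightarrow> complex" where
  "cscale c f = (\<lambda>x. c * f x)"

interpretation cfun: vector_space cscale
  by unfold_locales (auto simp: cscale_def fun_eq_iff algebra_simps)

definition complex_field :: "complex ring" where
  "complex_field = \<lparr>carrier = UNIV, monoid.mult = (*), one = 1, ring.zero = 0, add = (+)\<rparr>"

definition coset :: "('a \<Rightarrow> complex) set \<Rightarrow> ('a \<Rightarrow> complex) \<Rightarrow> ('a \<Rightarrow> complex) set" where
  "coset W f = (\<lambda>w. f + w) ` W"

definition coset_add ::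
    "('a \<Rightarrow> complex) set \<Rightarrow> ('a \<Rightarrow> complex) set \<Rightarrow> ('a \<Rightarrow> complex) set" where
  "coset_add A B = {f + g | f g. f \<in> A \<and> g \<in> B}"

text \<open>Scalar multiplication in a quotient by \<open>W\<close>; adding \<open>W\<close> matters only for \<open>c = 0\<close>.\<close>

definition coset_scale ::
    "('a \<Rightarrow> complex) set \<Rightarrow> complex \<Rightarrow> ('a \<Rightarrow> complex) set \<Rightarrow> ('a \<Rightarrow> complex) set" where
  "coset_scale W c A = {cscale c f + w | f w. f \<in> A \<and> w \<in> W}"

text \<open>The dual of a complex vector space; functionals are extended by zero off the carrier.\<close>

definition lin_dual :: "(complex, 'a, 'b) module_scheme \<Rightarrow> ('a \<Rightarrow> complex) set" where
  "lin_dual V = {l. (\<forall>x. x \<notin> carrier V \<longrightarrow> l x = 0)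
     \<and> (\<forall>x\<in>carrier V. \<forall>y\<in>carrier V. l (x \<oplus>\<^bsub>V\<^esub> y) = l x + l y)
     \<and> (\<forall>c. \<forall>x\<in>carrier V. l (c \<odot>\<^bsub>V\<^esub> x) = c * l x)}"


section \<open>Graded Heisenberg algebras\<close>

text \<open>The fields \<open>mult\<close> and \<open>one\<close> inherited from \<open>module\<close> play no role for Lie algebras.\<close>

record 'a graded_lie = "(complex, 'a) module" +
  bracket :: "'a \<Rightarrow> 'a \<Rightarrow> 'a"
  grade :: "nat \<Rightarrow> 'a set"

definition lie_algebra :: "('a, 'b) graded_lie_scheme \<Rightarrow> bool" where
  "lie_algebra \<hh> \<longleftrightarrow> Module.module complex_field \<hh>
     \<and> (\<forall>x\<in>carrier \<hh>. \<forall>y\<in>carrier \<hh>. bracket \<hh> x y \<in> carrier \<hh>)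
     \<and> (\<forall>x\<in>carrier \<hh>. \<forall>y\<in>carrier \<hh>. \<forall>w\<in>carrier \<hh>.
          bracket \<hh> (x \<oplus>\<^bsub>\<hh>\<^esub> y) w = bracket \<hh> x w \<oplus>\<^bsub>\<hh>\<^esub> bracket \<hh> y w
        \<and> bracket \<hh> w (x \<oplus>\<^bsub>\<hh>\<^esub> y) = bracket \<hh> w x \<oplus>\<^bsub>\<hh>\<^esub> bracket \<hh> w y)
     \<and> (\<forall>c. \<forall>x\<in>carrier \<hh>. \<forall>y\<in>carrier \<hh>.
          bracket \<hh> (c \<odot>\<^bsub>\<hh>\<^esub> x) y = c \<odot>\<^bsub>\<hh>\<^esub> bracket \<hh> x y
        \<and> bracket \<hh> x (c \<odot>\<^bsub>\<hh>\<^esub> y) = c \<odot>\<^bsub>\<hh>\<^esub> bracket \<hh> x y)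
     \<and> (\<forall>x\<in>carrier \<hh>. bracket \<hh> x x = \<zero>\<^bsub>\<hh>\<^esub>)
     \<and> (\<forall>x\<in>carrier \<hh>. \<forall>y\<in>carrier \<hh>. \<forall>w\<in>carrier \<hh>.
          bracket \<hh> x (bracket \<hh> y w) \<oplus>\<^bsub>\<hh>\<^esub> bracket \<hh> y (bracket \<hh> w x)
            \<oplus>\<^bsub>\<hh>\<^esub> bracket \<hh> w (bracket \<hh> x y) = \<zero>\<^bsub>\<hh>\<^esub>)"

definition finite_dimensional :: "(complex, 'a, 'b) module_scheme \<Rightarrow> bool" where
  "finite_dimensional V \<longleftrightarrow> (\<exists>B. finite B \<and> B \<subseteq> carrier V
     \<and> (\<forall>X. submodule X complex_field V \<and> B \<subseteq> X \<longrightarrow> X = carrier V))"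

definition graded_heisenberg :: "('a, 'b) graded_lie_scheme \<Rightarrow> bool" where
  "graded_heisenberg \<hh> \<longleftrightarrow> lie_algebra \<hh> \<and> finite_dimensional \<hh>
     \<and> submodule (grade \<hh> 1) complex_field \<hh> \<and> submodule (grade \<hh> 2) complex_field \<hh>
     \<and> (\<forall>d. d \<noteq> 1 \<and> d \<noteq> 2 \<longrightarrow> grade \<hh> d = {\<zero>\<^bsub>\<hh>\<^esub>})
     \<and> (\<forall>x\<in>carrier \<hh>. \<exists>!p. p \<in> grade \<hh> 1 \<times> grade \<hh> 2 \<and> x = fst p \<oplus>\<^bsub>\<hh>\<^esub> snd p)
     \<and> (\<forall>i j. \<forall>x\<in>grade \<hh> i. \<forall>y\<in>grade \<hh> j. bracket \<hh> x y \<in> grade \<hh> (i + j))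
     \<and> {x \<in> carrier \<hh>. \<forall>y\<in>carrier \<hh>. bracket \<hh> x y = \<zero>\<^bsub>\<hh>\<^esub>} = grade \<hh> 2
     \<and> (\<exists>e\<in>grade \<hh> 2. e \<noteq> \<zero>\<^bsub>\<hh>\<^esub> \<and> (\<forall>x\<in>grade \<hh> 2. \<exists>c. x = c \<odot>\<^bsub>\<hh>\<^esub> e))
     \<and> (\<forall>x\<in>grade \<hh> 1. (\<forall>y\<in>grade \<hh> 1. bracket \<hh> x y = \<zero>\<^bsub>\<hh>\<^esub>) \<longrightarrow> x = \<zero>\<^bsub>\<hh>\<^esub>)"


section \<open>The universal enveloping algebra and its graded dual\<close>

text \<open>
  \<open>U(\<hh>)\<close> is the free associative algebra on the underlying set of \<open>\<hh>\<close> (finitely supported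
  functions on words) modulo the two-sided ideal that makes \<open>x \<mapsto> [x]\<close> linear and
  \<open>xy - yx = bracket x y\<close>.
\<close>

definition word :: "'a list \<Rightarrow> 'a list \<Rightarrow> complex" where
  "word w = (\<lambda>u. if u = w then 1 else 0)"

definition free_algebra :: "('a, 'b) graded_lie_scheme \<Rightarrow> ('a list \<Rightarrow> complex) set" where
  "free_algebra \<hh> = cfun.span (word ` lists (carrier \<hh>))"

definition free_mult ::
    "('a list \<Rightarrow> complex) \<Rightarrow> ('a list \<Rightarrow> complex) \<Rightarrow> 'a list \<Rightarrow> complex" where
  "free_mult a b = (\<lambda>w. \<Sum>i\<le>length w. a (take i w) * b (drop i w))"

definition uea_ideal :: "('a, 'b) graded_lie_scheme \<Rightarrow> ('a list \<Rightarrow> complex) set" where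
  "uea_ideal \<hh> = cfun.span (
      {word (u @ [x \<oplus>\<^bsub>\<hh>\<^esub> y] @ v) - word (u @ [x] @ v) - word (u @ [y] @ v) | u v x y.
         u \<in> lists (carrier \<hh>) \<and> v \<in> lists (carrier \<hh>) \<and> x \<in> carrier \<hh> \<and> y \<in> carrier \<hh>}
    \<union> {word (u @ [c \<odot>\<^bsub>\<hh>\<^esub> x] @ v) - cscale c (word (u @ [x] @ v)) | u v c x.
         u \<in> lists (carrier \<hh>) \<and> v \<in> lists (carrier \<hh>) \<and> x \<in> carrier \<hh>}
    \<union> {word (u @ [x, y] @ v) - word (u @ [y, x] @ v) - word (u @ [bracket \<hh> x y] @ v) | u v x y.
         u \<in> lists (carrier \<hh>) \<and> v \<in> lists (carrier \<hh>) \<and> x \<in> carrier \<hh> \<and> y \<in> carrier \<hh>})"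

definition uea :: "('a, 'b) graded_lie_scheme \<Rightarrow> (complex, ('a list \<Rightarrow> complex) set) module" where
  "uea \<hh> = \<lparr>carrier = coset (uea_ideal \<hh>) ` free_algebra \<hh>,
     monoid.mult = (\<lambda>A B. {free_mult a b + i | a b i. a \<in> A \<and> b \<in> B \<and> i \<in> uea_ideal \<hh>}),
     one = coset (uea_ideal \<hh>) (word []),
     ring.zero = uea_ideal \<hh>,
     add = coset_add,
     smult = coset_scale (uea_ideal \<hh>)\<rparr>"

text \<open>The monomial \<open>v\<^sub>1 \<cdots> v\<^sub>r\<close> in \<open>U(\<hh>)\<close>.\<close>

definition uea_monomial :: "('a, 'b) graded_lie_scheme \<Rightarrow> 'a list \<Rightarrow> ('a list \<Rightarrow> complex) set" where
  "uea_monomial \<hh> w = coset (uea_ideal \<hh>) (word w)"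

definition homogeneous_word ::
    "('a, 'b) graded_lie_scheme \<Rightarrow> 'a list \<Rightarrow> nat list \<Rightarrow> bool" where
  "homogeneous_word \<hh> w ds \<longleftrightarrow> list_all2 (\<lambda>x d. d \<in> {1, 2} \<and> x \<in> grade \<hh> d) w ds"

definition uea_grade :: "('a, 'b) graded_lie_scheme \<Rightarrow> nat \<Rightarrow> ('a list \<Rightarrow> complex) set set" where
  "uea_grade \<hh> k = coset (uea_ideal \<hh>) `
     cfun.span {word w | w ds. homogeneous_word \<hh> w ds \<and> sum_list ds = k}"

text \<open>\<open>U\<^sub>k(\<hh>)\<^sup>*\<close>, regarded inside the dual of \<open>U(\<hh>)\<close> by extending by zero to the
  other graded pieces.\<close>

definition uea_dual ::
    "('a, 'b) graded_lie_scheme \<Rightarrow> nat \<Rightarrow> (('a list \<Rightarrow> complex) set \<Rightarrow> complex) set" where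
  "uea_dual \<hh> k = {l \<in> lin_dual (uea \<hh>). \<forall>j. j \<noteq> k \<longrightarrow> (\<forall>A\<in>uea_grade \<hh> j. l A = 0)}"

text \<open>The restriction map \<open>\<rho>\<^sub>2\<close> along \<open>\<hh>\<^sub>2 \<hookrightarrow> U\<^sub>2(\<hh>)\<close>.\<close>

definition restrict_h2 ::
    "('a, 'b) graded_lie_scheme \<Rightarrow> (('a list \<Rightarrow> complex) set \<Rightarrow> complex) \<Rightarrow> 'a \<Rightarrow> complex" where
  "restrict_h2 \<hh> l = (\<lambda>x. if x \<in> grade \<hh> 2 then l (uea_monomial \<hh> [x]) else 0)"


section \<open>The Heisenberg group\<close>

text \<open>
  The Heisenberg group in exponential coordinates: the underlying variety is \<open>\<hh>\<close>, the exponential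
  map is the identity, and the group law is the Baker-Campbell-Hausdorff product, whose higher terms
  vanish because \<open>\<hh>\<close> is two-step nilpotent.  The identity element is \<open>\<zero>\<close>, and
  one-parameter subgroups are \<open>t \<mapsto> t \<odot> x\<close>.
\<close>

definition heis_mult :: "('a, 'b) graded_lie_scheme \<Rightarrow> 'a \<Rightarrow> 'a \<Rightarrow> 'a" where
  "heis_mult \<hh> x y = (x \<oplus>\<^bsub>\<hh>\<^esub> y) \<oplus>\<^bsub>\<hh>\<^esub> ((1/2) \<odot>\<^bsub>\<hh>\<^esub> bracket \<hh> x y)"

text \<open>Only the values on the carrier are meaningful, hence the last rule.\<close>

inductive_set poly_functions :: "('a, 'b) graded_lie_scheme \<Rightarrow> ('a \<Rightarrow> complex) set"
  for \<hh> :: "('a, 'b) graded_lie_scheme" where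
  const: "(\<lambda>x. c) \<in> poly_functions \<hh>"
| linear: "l \<in> lin_dual \<hh> \<Longrightarrow> l \<in> poly_functions \<hh>"
| add: "f \<in> poly_functions \<hh> \<Longrightarrow> g \<in> poly_functions \<hh> \<Longrightarrow> (\<lambda>x. f x + g x) \<in> poly_functions \<hh>"
| mult: "f \<in> poly_functions \<hh> \<Longrightarrow> g \<in> poly_functions \<hh> \<Longrightarrow> (\<lambda>x. f x * g x) \<in> poly_functions \<hh>"
| agree: "f \<in> poly_functions \<hh> \<Longrightarrow> (\<And>x. x \<in> carrier \<hh> \<Longrightarrow> g x = f x) \<Longrightarrow> g \<in> poly_functions \<hh>"

definition left_invariant ::
    "('a, 'b) graded_lie_scheme \<Rightarrow> 'a \<Rightarrow> ('a \<Rightarrow> complex) \<Rightarrow> 'a \<Rightarrow> complex" where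
  "left_invariant \<hh> x f = (\<lambda>g. deriv (\<lambda>t. f (heis_mult \<hh> g (t \<odot>\<^bsub>\<hh>\<^esub> x))) 0)"

definition right_invariant ::
    "('a, 'b) graded_lie_scheme \<Rightarrow> 'a \<Rightarrow> ('a \<Rightarrow> complex) \<Rightarrow> 'a \<Rightarrow> complex" where
  "right_invariant \<hh> x f = (\<lambda>g. deriv (\<lambda>t. f (heis_mult \<hh> (t \<odot>\<^bsub>\<hh>\<^esub> x) g)) 0)"

text \<open>
  A space \<open>S\<close> of functionals on \<open>U(\<hh>)\<close> as a space of polynomial functions on the group: \<open>f\<close>
  corresponds to the functional \<open>P \<mapsto> (P f)(0)\<close>, where \<open>U(\<hh>)\<close> acts by left-invariant
  differential operators.
\<close>

definition functions_of ::
    "('a, 'b) graded_lie_scheme \<Rightarrow> (('a list \<Rightarrow> complex) set \<Rightarrow> complex) set \<Rightarrow> ('a \<Rightarrow> complex) set" where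
  "functions_of \<hh> S = {f \<in> poly_functions \<hh>. \<exists>l\<in>S. \<forall>w\<in>lists (carrier \<hh>).
     l (uea_monomial \<hh> w) = foldr (left_invariant \<hh>) w f \<zero>\<^bsub>\<hh>\<^esub>}"


section \<open>Contact symbol systems\<close>

text \<open>
  A graded subspace is given by its family of graded pieces \<open>S k\<close>; the space itself is their sum.
  Since \<open>U\<^sub>0(\<hh>) = \<complex>\<close> and \<open>U\<^sub>1(\<hh>) = \<hh>\<^sub>1\<close>, the conditions in degrees 0 and 1
  say that these pieces are everything.
\<close>

definition contact_symbol_system ::
    "('a, 'b) graded_lie_scheme \<Rightarrow> (nat \<Rightarrow> (('a list \<Rightarrow> complex) set \<Rightarrow> complex) set) \<Rightarrow> bool" where
  "contact_symbol_system \<hh> S \<longleftrightarrow> graded_heisenberg \<hh>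
     \<and> (\<forall>k. cfun.subspace (S k) \<and> S k \<subseteq> uea_dual \<hh> k)
     \<and> (\<exists>B. finite B \<and> cfun.span (\<Union>k. S k) \<subseteq> cfun.span B)
     \<and> S 0 = uea_dual \<hh> 0
     \<and> S 1 = uea_dual \<hh> 1
     \<and> restrict_h2 \<hh> ` S 2 = lin_dual (\<hh>\<lparr>carrier := grade \<hh> 2\<rparr>)
     \<and> (\<forall>x\<in>carrier \<hh>. \<forall>f\<in>functions_of \<hh> (cfun.span (\<Union>k. S k)).
          right_invariant \<hh> x f \<in> functions_of \<hh> (cfun.span (\<Union>k. S k)))"


section \<open>Projective space and its submanifolds\<close>

text \<open>The projective space of lines in \<open>complex ^ 'n\<close>; its dimension is \<open>CARD('n) - 1\<close>.\<close>

typedef 'n proj = "{L :: (complex ^ 'n) set. \<exists>v. v \<noteq> 0 \<and> L = range (\<lambda>c. c *s v)}"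
  by (rule exI[of _ "range (\<lambda>c. c *s 1)"]) (auto intro!: exI[of _ 1])

definition line :: "complex ^ 'n \<Rightarrow> 'n proj" where
  "line v = Abs_proj (range (\<lambda>c. c *s v))"

definition cone :: "'n proj set \<Rightarrow> (complex ^ 'n) set" where
  "cone U = {v. v \<noteq> 0 \<and> line v \<in> U}"

instantiation proj :: (finite) topological_space
begin

definition open_proj :: "'a proj set \<Rightarrow> bool" where
  "open_proj U \<longleftrightarrow> open (cone U)"

instance
proof
  have "cone (UNIV :: 'a proj set) = - {0}"
    by (auto simp: cone_def)
  then show "open (UNIV :: 'a proj set)"
    by (simp add: open_proj_def open_Compl)
next
  fix S T :: "'a proj set"
  assume "open S" "open T"
  moreover have "cone (S \<inter> T) = cone S \<inter> cone T"
    by (auto simp: cone_def)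
  ultimately show "open (S \<inter> T)"
    by (simp add: open_proj_def open_Int)
next
  fix K :: "'a proj set set"
  assume "\<forall>S\<in>K. open S"
  moreover have "cone (\<Union>K) = \<Union>(cone ` K)"
    by (auto simp: cone_def)
  ultimately show "open (\<Union>K)"
    by (auto simp: open_proj_def)
qed

end

definition cholomorphic_on :: "(complex ^ 'n \<Rightarrow> complex) \<Rightarrow> (complex ^ 'n) set \<Rightarrow> bool" where
  "cholomorphic_on F V \<longleftrightarrow>
     (\<forall>x\<in>V. \<exists>F'. (F has_derivative F') (at x) \<and> (\<forall>c v. F' (c *s v) = c * F' v))"

definition proj_holomorphic_on :: "('n proj \<Rightarrow> complex) \<Rightarrow> 'n::finite proj set \<Rightarrow> bool" where
  "proj_holomorphic_on f U \<longleftrightarrow> open U \<and> cholomorphic_on (\<lambda>v. f (line v)) (cone U)"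

text \<open>Locally the common zero set of holomorphic functions with linearly independent
  differentials; the differentials are pulled back to the cone.\<close>

definition locally_closed_submanifold :: "'n::finite proj set \<Rightarrow> bool" where
  "locally_closed_submanifold M \<longleftrightarrow> (\<forall>p\<in>M. \<exists>U (g :: nat \<Rightarrow> 'n proj \<Rightarrow> complex) r.
     open U \<and> p \<in> U \<and> (\<forall>i<r. proj_holomorphic_on (g i) U)
     \<and> M \<inter> U = {q\<in>U. \<forall>i<r. g i q = 0}
     \<and> (\<forall>x\<in>cone U. \<forall>a. (\<forall>v. (\<Sum>i<r. a i * frechet_derivative (\<lambda>y. g i (line y)) (at x) v) = 0)
          \<longrightarrow> (\<forall>i<r. a i = (0::complex))))"


section \<open>Germs of functions, tangent vectors and vector fields\<close>

text \<open>Germs at \<open>p\<close> on \<open>M\<close> are represented by total functions.\<close>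

definition germ_eq :: "'n::finite proj set \<Rightarrow> 'n proj \<Rightarrow> ('n proj \<Rightarrow> complex) \<Rightarrow> ('n proj \<Rightarrow> complex) \<Rightarrow> bool" where
  "germ_eq M p f g \<longleftrightarrow> (\<exists>U. open U \<and> p \<in> U \<and> (\<forall>q\<in>M \<inter> U. f q = g q))"

definition holomorphic_at :: "'n::finite proj set \<Rightarrow> 'n proj \<Rightarrow> ('n proj \<Rightarrow> complex) \<Rightarrow> bool" where
  "holomorphic_at M p f \<longleftrightarrow>
     (\<exists>U F. p \<in> U \<and> proj_holomorphic_on F U \<and> (\<forall>q\<in>M \<inter> U. f q = F q))"

type_synonym 'n tvec = "('n proj \<Rightarrow> complex) \<Rightarrow> complex"
type_synonym 'n vfield = "'n proj \<Rightarrow> 'n tvec"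

text \<open>Tangent vectors are derivations of the local ring at \<open>p\<close>, extended by zero to functions
  that do not represent a holomorphic germ.\<close>

definition tangent_space :: "'n::finite proj set \<Rightarrow> 'n proj \<Rightarrow> 'n tvec set" where
  "tangent_space M p = {D.
     (\<forall>f. \<not> holomorphic_at M p f \<longrightarrow> D f = 0)
     \<and> (\<forall>f g. holomorphic_at M p f \<and> holomorphic_at M p g \<longrightarrow>
          (germ_eq M p f g \<longrightarrow> D f = D g)
        \<and> D (\<lambda>q. f q + g q) = D f + D g
        \<and> D (\<lambda>q. f q * g q) = f p * D g + g p * D f)
     \<and> (\<forall>c f. holomorphic_at M p f \<longrightarrow> D (\<lambda>q. c * f q) = c * D f)}"

definition vector_field_at :: "'n::finite proj set \<Rightarrow> 'n proj \<Rightarrow> 'n vfield \<Rightarrow> bool" where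
  "vector_field_at M p \<xi> \<longleftrightarrow> (\<exists>U. open U \<and> p \<in> U \<and> (\<forall>q\<in>M \<inter> U. \<xi> q \<in> tangent_space M q
     \<and> (\<forall>f. holomorphic_at M q f \<longrightarrow> holomorphic_at M q (\<lambda>q'. \<xi> q' f))))"

definition section_at :: "'n::finite proj set \<Rightarrow> ('n proj \<Rightarrow> 'n tvec set) \<Rightarrow> 'n proj \<Rightarrow> 'n vfield \<Rightarrow> bool" where
  "section_at M H p \<xi> \<longleftrightarrow> vector_field_at M p \<xi>
     \<and> (\<exists>U. open U \<and> p \<in> U \<and> (\<forall>q\<in>M \<inter> U. \<xi> q \<in> H q))"

text \<open>The case distinction keeps the bracket a tangent vector in the sense of
  \<open>tangent_space\<close>.\<close>

definition lie_bracket :: "'n::finite proj set \<Rightarrow> 'n vfield \<Rightarrow> 'n vfield \<Rightarrow> 'n vfield" where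
  "lie_bracket M \<xi> \<eta> = (\<lambda>q f. if holomorphic_at M q f
     then \<xi> q (\<lambda>q'. \<eta> q' f) - \<eta> q (\<lambda>q'. \<xi> q' f) else 0)"


section \<open>Contact structures and symbol algebras\<close>

definition corank_one_subbundle :: "'n::finite proj set \<Rightarrow> ('n proj \<Rightarrow> 'n tvec set) \<Rightarrow> bool" where
  "corank_one_subbundle M H \<longleftrightarrow> (\<forall>p\<in>M.
     cfun.subspace (H p) \<and> H p \<subseteq> tangent_space M p
     \<and> (\<exists>D\<in>tangent_space M p - H p. \<forall>E\<in>tangent_space M p. \<exists>c. E - cscale c D \<in> H p)
     \<and> (\<exists>U r (X :: nat \<Rightarrow> 'n vfield). open U \<and> p \<in> U
          \<and> (\<forall>q\<in>M \<inter> U. (\<forall>i<r. vector_field_at M q (X i))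
             \<and> inj_on (\<lambda>i. X i q) {..<r} \<and> cfun.independent ((\<lambda>i. X i q) ` {..<r})
             \<and> cfun.span ((\<lambda>i. X i q) ` {..<r}) = H q)))"

text \<open>The form \<open>\<And>\<^sup>2 H\<^sub>z \<rightarrow> T\<^sub>z M / H\<^sub>z\<close> induced by the Lie bracket.\<close>

definition bracket_form ::
    "'n::finite proj set \<Rightarrow> ('n proj \<Rightarrow> 'n tvec set) \<Rightarrow> 'n proj \<Rightarrow> 'n tvec \<Rightarrow> 'n tvec \<Rightarrow> 'n tvec set" where
  "bracket_form M H z v w = (THE C. \<exists>\<xi> \<eta>. section_at M H z \<xi> \<and> section_at M H z \<eta>
     \<and> \<xi> z = v \<and> \<eta> z = w \<and> C = coset (H z) (lie_bracket M \<xi> \<eta> z))"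

definition contact_structure :: "'n::finite proj set \<Rightarrow> ('n proj \<Rightarrow> 'n tvec set) \<Rightarrow> bool" where
  "contact_structure M H \<longleftrightarrow> corank_one_subbundle M H
     \<and> (\<forall>z\<in>M. \<forall>v\<in>H z. (\<forall>w\<in>H z. bracket_form M H z v w = H z) \<longrightarrow> v = 0)"

text \<open>Elements of \<open>\<nn>\<^sub>z = H\<^sub>z \<oplus> T\<^sub>z M / H\<^sub>z\<close> are pairs; \<open>H z\<close> is the zero coset.\<close>

definition symbol_algebra ::
    "'n::finite proj set \<Rightarrow> ('n proj \<Rightarrow> 'n tvec set) \<Rightarrow> 'n proj \<Rightarrow> ('n tvec \<times> 'n tvec set) graded_lie" where
  "symbol_algebra M H z = \<lparr>carrier = H z \<times> coset (H z) ` tangent_space M z,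
     monoid.mult = undefined,
     one = undefined,
     ring.zero = (0, H z),
     add = (\<lambda>(v, A) (w, B). (v + w, coset_add A B)),
     smult = (\<lambda>c (v, A). (cscale c v, coset_scale (H z) c A)),
     bracket = (\<lambda>(v, A) (w, B). (0, bracket_form M H z v w)),
     grade = (\<lambda>d. if d = 1 then H z \<times> {H z}
                  else if d = 2 then {0} \<times> coset (H z) ` tangent_space M z
                  else {(0, H z)})\<rparr>"


section \<open>Weighted jets\<close>

text \<open>\<open>weighted_operator M H z k P\<close>: the local differential operator \<open>P\<close> at \<open>z\<close> has weighted
  order at most \<open>k\<close>.\<close>

inductive weighted_operator ::
    "'n::finite proj set \<Rightarrow> ('n proj \<Rightarrow> 'n tvec set) \<Rightarrow> 'n proj \<Rightarrow> nat
      \<Rightarrow> (('n proj \<Rightarrow> complex) \<Rightarrow> 'n proj \<Rightarrow> complex) \<Rightarrow> bool"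
  for M :: "'n::finite proj set" and H :: "'n proj \<Rightarrow> 'n tvec set" and z :: "'n proj" where
  "function": "holomorphic_at M z g \<Longrightarrow> weighted_operator M H z 0 (\<lambda>f q. g q * f q)"
| horizontal: "section_at M H z \<xi> \<Longrightarrow> weighted_operator M H z 1 (\<lambda>f q. \<xi> q f)"
| vfield: "vector_field_at M z \<xi> \<Longrightarrow> weighted_operator M H z 2 (\<lambda>f q. \<xi> q f)"
| comp: "weighted_operator M H z k P \<Longrightarrow> weighted_operator M H z l Q
    \<Longrightarrow> weighted_operator M H z (k + l) (\<lambda>f. P (Q f))"
| add: "weighted_operator M H z k P \<Longrightarrow> weighted_operator M H z k Q
    \<Longrightarrow> weighted_operator M H z k (\<lambda>f q. P f q + Q f q)"
| mono: "weighted_operator M H z k P \<Longrightarrow> k \<le> l \<Longrightarrow> weighted_operator M H z l P"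

text \<open>\<open>\<m>\<^sub>z\<^sup>k\<close>: killed at \<open>z\<close> by all operators of weighted order at most \<open>k - 1\<close>.\<close>

definition weighted_ideal ::
    "'n::finite proj set \<Rightarrow> ('n proj \<Rightarrow> 'n tvec set) \<Rightarrow> 'n proj \<Rightarrow> nat \<Rightarrow> ('n proj \<Rightarrow> complex) set" where
  "weighted_ideal M H z k = {f. holomorphic_at M z f
     \<and> (\<forall>j<k. \<forall>P. weighted_operator M H z j P \<longrightarrow> P f z = 0)}"

definition represents ::
    "'n::finite proj set \<Rightarrow> ('n proj \<Rightarrow> 'n tvec set) \<Rightarrow> 'n proj
      \<Rightarrow> nat \<Rightarrow> 'n tvec \<times> 'n tvec set \<Rightarrow> 'n vfield \<Rightarrow> bool" where
  "represents M H z d v \<xi> \<longleftrightarrow>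
     (d = 1 \<and> section_at M H z \<xi> \<and> v = (\<xi> z, H z))
   \<or> (d = 2 \<and> vector_field_at M z \<xi> \<and> v = (0, coset (H z) (\<xi> z)))"

text \<open>\<open>l\<close> is the element of \<open>U\<^sub>k(\<nn>\<^sub>z)\<^sup>*\<close> corresponding to the germ
  \<open>f \<in> \<m>\<^sub>z\<^sup>k\<close>.\<close>

definition jet_symbol ::
    "'n::finite proj set \<Rightarrow> ('n proj \<Rightarrow> 'n tvec set) \<Rightarrow> 'n proj \<Rightarrow> nat \<Rightarrow> ('n proj \<Rightarrow> complex)
      \<Rightarrow> ((('n tvec \<times> 'n tvec set) list \<Rightarrow> complex) set \<Rightarrow> complex) \<Rightarrow> bool" where
  "jet_symbol M H z k f l \<longleftrightarrow> f \<in> weighted_ideal M H z k \<and> l \<in> uea_dual (symbol_algebra M H z) k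
     \<and> (\<forall>w ds \<xi>s. homogeneous_word (symbol_algebra M H z) w ds \<and> sum_list ds = k
          \<and> length \<xi>s = length w \<and> (\<forall>i<length w. represents M H z (ds ! i) (w ! i) (\<xi>s ! i))
        \<longrightarrow> l (uea_monomial (symbol_algebra M H z) w) = foldr (\<lambda>\<xi> f q. \<xi> q f) \<xi>s f z)"


section \<open>Contact fundamental forms\<close>

text \<open>Germs at \<open>z\<close> of sections of the hyperplane bundle over \<open>M\<close>, as functions on the cone that are
  homogeneous of degree one.\<close>

definition hyperplane_section_at :: "'n::finite proj set \<Rightarrow> 'n proj \<Rightarrow> (complex ^ 'n \<Rightarrow> complex) \<Rightarrow> bool" where
  "hyperplane_section_at M z s \<longleftrightarrow> (\<exists>U F. open U \<and> z \<in> U \<and> cholomorphic_on F (cone U)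
     \<and> (\<forall>v\<in>cone U. \<forall>c. c \<noteq> 0 \<longrightarrow> F (c *s v) = c * F v)
     \<and> (\<forall>v\<in>cone (M \<inter> U). s v = F v))"

definition local_trivialization :: "'n::finite proj set \<Rightarrow> 'n proj \<Rightarrow> (complex ^ 'n \<Rightarrow> complex) \<Rightarrow> bool" where
  "local_trivialization M z s \<longleftrightarrow> hyperplane_section_at M z s \<and> (\<forall>v\<in>cone {z}. s v \<noteq> 0)"

definition equals_product_at ::
    "'n::finite proj set \<Rightarrow> 'n proj \<Rightarrow> (complex ^ 'n \<Rightarrow> complex) \<Rightarrow> ('n proj \<Rightarrow> complex)
      \<Rightarrow> (complex ^ 'n \<Rightarrow> complex) \<Rightarrow> bool" where
  "equals_product_at M z \<sigma> f s \<longleftrightarrow>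
     (\<exists>U. open U \<and> z \<in> U \<and> (\<forall>v\<in>cone (M \<inter> U). \<sigma> v = f (line v) * s v))"

text \<open>Linear forms stand for their restrictions to \<open>M\<close>: only these restrictions
  enter below.\<close>

definition linear_forms :: "(complex ^ 'n \<Rightarrow> complex) set" where
  "linear_forms = range (\<lambda>a v. \<Sum>i\<in>UNIV. a $ i * v $ i)"

text \<open>\<open>W\<^sub>z\<^sup>k = W \<inter> \<m>\<^sub>z\<^sup>k \<cdot> \<O>(L)\<^sub>z\<close>; single products suffice because \<open>L\<close>
  has rank one.\<close>

definition weighted_system ::
    "'n::finite proj set \<Rightarrow> ('n proj \<Rightarrow> 'n tvec set) \<Rightarrow> 'n proj \<Rightarrow> nat \<Rightarrow> (complex ^ 'n \<Rightarrow> complex) set" where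
  "weighted_system M H z k = {\<sigma> \<in> linear_forms. \<exists>f\<in>weighted_ideal M H z k.
     \<exists>s. hyperplane_section_at M z s \<and> equals_product_at M z \<sigma> f s}"

text \<open>The image of the \<open>k\<close>-th contact fundamental form at \<open>z\<close>, read off in the local
  trivialization \<open>s\<close>.\<close>

definition contact_fundamental_forms ::
    "'n::finite proj set \<Rightarrow> ('n proj \<Rightarrow> 'n tvec set) \<Rightarrow> 'n proj \<Rightarrow> (complex ^ 'n \<Rightarrow> complex)
      \<Rightarrow> nat \<Rightarrow> ((('n tvec \<times> 'n tvec set) list \<Rightarrow> complex) set \<Rightarrow> complex) set" where
  "contact_fundamental_forms M H z s k = {l. \<exists>\<sigma>\<in>weighted_system M H z k. \<exists>f.
     equals_product_at M z \<sigma> f s \<and> jet_symbol M H z k f l}"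


section \<open>General points\<close>

definition closed_analytic_subset :: "'n::finite proj set \<Rightarrow> 'n proj set \<Rightarrow> bool" where
  "closed_analytic_subset M A \<longleftrightarrow> A \<subseteq> M \<and> (\<forall>p\<in>M. \<exists>U F. open U \<and> p \<in> U \<and> finite F
     \<and> (\<forall>f\<in>F. \<forall>q\<in>M \<inter> U. holomorphic_at M q f)
     \<and> A \<inter> U = {q\<in>M \<inter> U. \<forall>f\<in>F. f q = 0})"

definition nowhere_dense_in :: "'n::finite proj set \<Rightarrow> 'n proj set \<Rightarrow> bool" where
  "nowhere_dense_in M A \<longleftrightarrow>
     (top_of_set M) interior_of ((top_of_set M) closure_of A) = {}"

end

theory Submission
  imports Defs "HOL-Complex_Analysis.Conformal_Mappings"
begin

lemma bounded_linear_smult_vec: "bounded_linear (\<lambda>t. t *s (v :: complex ^ 'n))"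
  by (simp add: linear_conv_bounded_linear[symmetric] linear_iff vector_sadd_rdistrib vec_eq_iff)

lemma bounded_linear_vec_smult: "bounded_linear (\<lambda>v. (c::complex) *s (v :: complex ^ 'n))"
  by (simp add: linear_conv_bounded_linear[symmetric] linear_iff vector_add_ldistrib vec_eq_iff)

lemma continuous_on_smult_vec [continuous_intros]:
  fixes f :: "'a::topological_space \<Rightarrow> complex" and g :: "'a \<Rightarrow> complex ^ 'n"
  assumes "continuous_on S f" "continuous_on S g"
  shows "continuous_on S (\<lambda>x. f x *s g x)"
  unfolding vector_scalar_mult_def
  by (intro continuous_on_vec_lambda continuous_on_mult continuous_on_component assms)

lemma cholomorphic_onD:
  assumes "cholomorphic_on F V" "x \<in> V"
  shows "(F has_derivative frechet_derivative F (at x)) (at x)"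
    and "frechet_derivative F (at x) (c *s v) = c * frechet_derivative F (at x) v"
proof -
  obtain F' where F': "(F has_derivative F') (at x)" "\<forall>c v. F' (c *s v) = c * F' v"
    using assms by (auto simp: cholomorphic_on_def)
  then show "(F has_derivative frechet_derivative F (at x)) (at x)"
    by (metis frechet_derivative_at)
  show "frechet_derivative F (at x) (c *s v) = c * frechet_derivative F (at x) v"
    using F' by (metis frechet_derivative_at)
qed

lemma cholomorphic_on_imp_continuous_on: "cholomorphic_on F V \<Longrightarrow> continuous_on V F"
  by (meson cholomorphic_onD(1) continuous_at_imp_continuous_on has_derivative_continuous)

lemma cholomorphic_on_subset: "cholomorphic_on F V \<Longrightarrow> U \<subseteq> V \<Longrightarrow> cholomorphic_on F U"
  by (auto simp: cholomorphic_on_def)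

lemma cholomorphic_on_const: "cholomorphic_on (\<lambda>x. c) V"
  unfolding cholomorphic_on_def by (auto intro!: exI[of _ "\<lambda>x. 0"])

lemma cholomorphic_on_component: "cholomorphic_on (\<lambda>x. x $ i) V"
  unfolding cholomorphic_on_def
  using bounded_linear_imp_has_derivative[OF bounded_linear_vec_nth[of i]]
  by (metis vector_smult_component)

lemma cholomorphic_on_add:
  assumes "cholomorphic_on f V" "cholomorphic_on g V"
  shows "cholomorphic_on (\<lambda>x. f x + g x) V"
  unfolding cholomorphic_on_def
proof
  fix x assume "x \<in> V"
  then show "\<exists>F'. ((\<lambda>x. f x + g x) has_derivative F') (at x) \<and> (\<forall>c v. F' (c *s v) = c * F' v)"
    using has_derivative_add[OF cholomorphic_onD(1)[OF assms(1)] cholomorphic_onD(1)[OF assms(2)]]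
      cholomorphic_onD(2)[OF assms(1)] cholomorphic_onD(2)[OF assms(2)]
    by (auto simp: algebra_simps intro!: exI)
qed

lemma cholomorphic_on_mult:
  assumes "cholomorphic_on f V" "cholomorphic_on g V"
  shows "cholomorphic_on (\<lambda>x. f x * g x) V"
  unfolding cholomorphic_on_def
proof
  fix x assume "x \<in> V"
  then show "\<exists>F'. ((\<lambda>x. f x * g x) has_derivative F') (at x) \<and> (\<forall>c v. F' (c *s v) = c * F' v)"
    using has_derivative_mult[OF cholomorphic_onD(1)[OF assms(1)] cholomorphic_onD(1)[OF assms(2)]]
      cholomorphic_onD(2)[OF assms(1)] cholomorphic_onD(2)[OF assms(2)]
    by (auto simp: algebra_simps intro!: exI)
qed

lemma cholomorphic_on_inverse:
  assumes "cholomorphic_on f V" "\<And>x. x \<in> V \<Longrightarrow> f x \<noteq> 0"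
  shows "cholomorphic_on (\<lambda>x. inverse (f x)) V"
  unfolding cholomorphic_on_def
proof
  fix x assume x: "x \<in> V"
  then show "\<exists>F'. ((\<lambda>x. inverse (f x)) has_derivative F') (at x) \<and> (\<forall>c v. F' (c *s v) = c * F' v)"
    using Deriv.has_derivative_inverse[OF assms(2) cholomorphic_onD(1)[OF assms(1)]]
      cholomorphic_onD(2)[OF assms(1)]
    by (auto simp: algebra_simps intro!: exI)
qed

lemma cholomorphic_on_transform:
  assumes "cholomorphic_on f V" "open V" "\<And>x. x \<in> V \<Longrightarrow> g x = f x"
  shows "cholomorphic_on g V"
  unfolding cholomorphic_on_def
proof
  fix x assume x: "x \<in> V"
  have "(g has_derivative F') (at x)" if "(f has_derivative F') (at x)" for F'
    using that by (rule has_derivative_transform_within_open[OF _ assms(2) x]) (simp add: assms(3))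
  then show "\<exists>F'. (g has_derivative F') (at x) \<and> (\<forall>c v. F' (c *s v) = c * F' v)"
    using assms(1) x by (meson cholomorphic_on_def)
qed

lemma cholomorphic_on_compose:
  fixes G :: "complex ^ 'm \<Rightarrow> complex ^ 'n"
  assumes F: "cholomorphic_on F V" and "\<And>x. x \<in> U \<Longrightarrow> G x \<in> V"
    and G: "\<And>i. cholomorphic_on (\<lambda>x. G x $ i) U"
  shows "cholomorphic_on (\<lambda>x. F (G x)) U"
  unfolding cholomorphic_on_def
proof
  fix x assume x: "x \<in> U"
  define G' where "G' h = (\<chi> i. frechet_derivative (\<lambda>x. G x $ i) (at x) h)" for h
  have 1: "(G has_derivative G') (at x)"
    unfolding has_derivative_componentwise_within[of G]
  proof
    fix b :: "complex ^ 'n" assume "b \<in> Basis"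
    then obtain i u where b: "b = axis i u" by (auto simp: Basis_vec_def)
    have "((\<lambda>x. G x \<bullet> axis i u) has_derivative (\<lambda>h. G' h \<bullet> axis i u)) (at x)"
      unfolding inner_axis G'_def vec_lambda_beta
      by (intro has_derivative_inner_left cholomorphic_onD(1)[OF G x])
    then show "((\<lambda>x. G x \<bullet> b) has_derivative (\<lambda>h. G' h \<bullet> b)) (at x)"
      by (simp add: b)
  qed
  have "((\<lambda>x. F (G x)) has_derivative (\<lambda>h. frechet_derivative F (at (G x)) (G' h))) (at x)"
    by (rule has_derivative_compose[OF 1 cholomorphic_onD(1)[OF F]]) (simp add: assms x)
  moreover have "G' (c *s v) = c *s G' v" for c v
    by (simp add: G'_def vec_eq_iff cholomorphic_onD(2)[OF G x])
  ultimately show "\<exists>F'. ((\<lambda>x. F (G x)) has_derivative F') (at x) \<and> (\<forall>c v. F' (c *s v) = c * F' v)"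
    using cholomorphic_onD(2)[OF F assms(2)[OF x]] by (auto intro!: exI)
qed

lemma field_derivative_along_line:
  fixes v :: "complex ^ 'n"
  assumes "cholomorphic_on F V" "x + t *s v \<in> V"
  shows "((\<lambda>t. F (x + t *s v)) has_field_derivative frechet_derivative F (at (x + t *s v)) v) (at t)"
proof -
  have "((\<lambda>t. x + t *s v) has_derivative (\<lambda>t. t *s v)) (at t)"
    by (auto intro!: derivative_eq_intros bounded_linear.has_derivative[OF bounded_linear_smult_vec])
  from has_derivative_compose[OF this cholomorphic_onD(1)[OF assms]]
  moreover have "(\<lambda>h. frechet_derivative F (at (x + t *s v)) (h *s v)) = (*) (frechet_derivative F (at (x + t *s v)) v)"
    by (simp add: fun_eq_iff cholomorphic_onD(2)[OF assms])
  ultimately show ?thesis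
    by (simp add: has_field_derivative_def)
qed

definition deriv_blinfun :: "(complex ^ 'n \<Rightarrow> complex) \<Rightarrow> complex ^ 'n \<Rightarrow> (complex ^ 'n) \<Rightarrow>\<^sub>L complex" where
  "deriv_blinfun F x = Blinfun (frechet_derivative F (at x))"

lemma deriv_blinfun_apply:
  assumes "cholomorphic_on F V" "x \<in> V"
  shows "blinfun_apply (deriv_blinfun F x) = frechet_derivative F (at x)"
  unfolding deriv_blinfun_def
  using cholomorphic_onD(1)[OF assms] bounded_linear_Blinfun_apply has_derivative_bounded_linear by blast

lemma cholomorphic_on_parametric_integral:
  fixes F :: "complex ^ 'n \<Rightarrow> complex" and a \<kappa> :: "real \<Rightarrow> complex" and w :: "real \<Rightarrow> complex ^ 'n"
  assumes F: "cholomorphic_on F V"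
    and cont: "continuous_on {0..1} a" "continuous_on {0..1} \<kappa>" "continuous_on {0..1} w"
    and V: "\<And>x t. x \<in> U \<Longrightarrow> t \<in> {0..1} \<Longrightarrow> a t *s x + w t \<in> V"
  shows "continuous_on U (\<lambda>x. integral {0..1} (\<lambda>t. \<kappa> t * F (a t *s x + w t)))" (is ?C)
    and "\<lbrakk>open U; convex U; continuous_on V (deriv_blinfun F)\<rbrakk>
      \<Longrightarrow> cholomorphic_on (\<lambda>x. integral {0..1} (\<lambda>t. \<kappa> t * F (a t *s x + w t))) U"
proof -
  note cF = cholomorphic_on_imp_continuous_on[OF F]
  have c1: "continuous_on (U \<times> {0..1}) (\<lambda>z. a (snd z) *s fst z + w (snd z))"
    by (intro continuous_intros continuous_on_compose2[OF cont(1)] continuous_on_compose2[OF cont(3)]) auto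
  have ck: "continuous_on (U \<times> {0..1}) (\<lambda>z. \<kappa> (snd z))" "continuous_on (U \<times> {0..1}) (\<lambda>z. a (snd z))"
    by (intro continuous_intros continuous_on_compose2[OF cont(2)] continuous_on_compose2[OF cont(1)]; auto)+
  have c2: "continuous_on (U \<times> {0..1}) (\<lambda>(x,t). \<kappa> t * F (a t *s x + w t))"
    unfolding case_prod_beta
    by (intro continuous_intros ck continuous_on_compose2[OF cF c1]) (auto simp: V)
  show ?C
    using integral_continuous_on_param[of U 0 1 "\<lambda>x t. \<kappa> t * F (a t *s x + w t)"] c2 by simp
  assume U: "open U" "convex U" and cD: "continuous_on V (deriv_blinfun F)"
  define fx where "fx x t = blinfun_mult_right (\<kappa> t * a t) o\<^sub>L deriv_blinfun F (a t *s x + w t)" for x t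
  have fx_apply: "blinfun_apply (fx x t) h = \<kappa> t * a t * frechet_derivative F (at (a t *s x + w t)) h"
    if "x \<in> U" "t \<in> {0..1}" for x t h
    unfolding fx_def by (simp add: deriv_blinfun_apply[OF F V[OF that]] blinfun_mult_right.rep_eq)
  have 1: "((\<lambda>x. \<kappa> t * F (a t *s x + w t)) has_derivative blinfun_apply (fx x t)) (at x within U)"
    if "x \<in> U" "t \<in> {0..1}" for x t
  proof -
    have "((\<lambda>x. a t *s x + w t) has_derivative (\<lambda>h. a t *s h)) (at x within U)"
      by (auto intro!: derivative_eq_intros bounded_linear.has_derivative[OF bounded_linear_vec_smult])
    from has_derivative_compose[OF this cholomorphic_onD(1)[OF F V[OF that]]]
    have "((\<lambda>x. \<kappa> t * F (a t *s x + w t)) has_derivative (\<lambda>h. \<kappa> t * frechet_derivative F (at (a t *s x + w t)) (a t *s h))) (at x within U)"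
      by (intro has_derivative_mult_right)
    moreover have "(\<lambda>h. \<kappa> t * frechet_derivative F (at (a t *s x + w t)) (a t *s h)) = blinfun_apply (fx x t)"
      by (simp add: fun_eq_iff fx_apply[OF that] cholomorphic_onD(2)[OF F V[OF that]])
    ultimately show ?thesis by simp
  qed
  have cfx: "continuous_on (U \<times> {0..1}) (\<lambda>(x, t). fx x t)"
    unfolding case_prod_beta fx_def
    by (intro continuous_intros continuous_on_compose2[OF cD c1] ck
          bounded_linear.continuous_on[OF bounded_linear_blinfun_mult_right] ) (auto simp: V)
  show "cholomorphic_on (\<lambda>x. integral {0..1} (\<lambda>t. \<kappa> t * F (a t *s x + w t))) U"
    unfolding cholomorphic_on_def
  proof
    fix x assume x: "x \<in> U"
    have i: "(\<lambda>t. \<kappa> t * F (a t *s x + w t)) integrable_on cbox 0 1" if "x \<in> U" for x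
    proof (rule integrable_continuous)
      have "continuous_on {0..1} ((\<lambda>(x,t). \<kappa> t * F (a t *s x + w t)) \<circ> Pair x)"
        by (intro continuous_on_compose continuous_on_subset[OF c2] continuous_intros) (auto simp: that)
      then show "continuous_on (cbox 0 1) (\<lambda>t. \<kappa> t * F (a t *s x + w t))"
        by (simp add: o_def)
    qed
    have "((\<lambda>x. integral (cbox 0 1) (\<lambda>t. \<kappa> t * F (a t *s x + w t))) has_derivative integral (cbox 0 1) (fx x)) (at x within U)"
      by (rule leibniz_rule[OF 1 i _ x U(2)]) (use cfx in auto)
    then have d: "((\<lambda>x. integral {0..1} (\<lambda>t. \<kappa> t * F (a t *s x + w t))) has_derivative integral {0..1} (fx x)) (at x)"
      using U(1) x by (simp add: at_within_open[of x U])
    have cfx1: "continuous_on {0..1} (fx x)"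
    proof -
      have "continuous_on {0..1} ((\<lambda>(x,t). fx x t) \<circ> Pair x)"
        by (intro continuous_on_compose continuous_on_subset[OF cfx] continuous_intros) (auto simp: x)
      then show ?thesis by (simp add: o_def)
    qed
    then have int: "fx x integrable_on {0..1}" by (rule integrable_continuous_real)
    have ev: "integral {0..1} (fx x) h = integral {0..1} (\<lambda>t. fx x t h)" for h
      by (rule blinfun_apply_integral[OF int])
    have "integral {0..1} (fx x) (c *s v) = c * integral {0..1} (fx x) v" for c v
    proof -
      have "integral {0..1} (\<lambda>t. fx x t (c *s v)) = integral {0..1} (\<lambda>t. c * fx x t v)"
        by (rule integral_cong) (simp add: fx_apply[OF x] cholomorphic_onD(2)[OF F V[OF x]])
      then show ?thesis by (simp add: ev)
    qed
    with d show "\<exists>F'. ((\<lambda>x. integral {0..1} (\<lambda>t. \<kappa> t * F (a t *s x + w t))) has_derivative F') (at x) \<and> (\<forall>c v. F' (c *s v) = c * F' v)"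
      by blast
  qed
qed

lemma norm_smult_vec: "norm (c *s (v :: complex ^ 'n)) = norm c * norm v"
  by (simp add: norm_vec_def norm_mult L2_set_right_distrib)

lemma frechet_derivative_expansion:
  assumes "cholomorphic_on F V" "x \<in> V"
  shows "frechet_derivative F (at x) v = (\<Sum>j\<in>UNIV. v $ j * frechet_derivative F (at x) (axis j 1))"
proof -
  have lin: "linear (frechet_derivative F (at x))"
    using cholomorphic_onD(1)[OF assms] has_derivative_linear by blast
  have "frechet_derivative F (at x) v = frechet_derivative F (at x) (\<Sum>j\<in>UNIV. v $ j *s axis j 1)"
    by (simp add: basis_expansion)
  also have "\<dots> = (\<Sum>j\<in>UNIV. frechet_derivative F (at x) (v $ j *s axis j 1))"
    by (rule linear_sum[OF lin])
  finally show ?thesis by (simp add: cholomorphic_onD(2)[OF assms])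
qed

lemma frechet_derivative_circle_integral:
  fixes v :: "complex ^ 'n"
  assumes F: "cholomorphic_on F V" and r: "r > 0"
    and disc: "\<And>t. t \<in> cball 0 r \<Longrightarrow> x + t *s v \<in> V"
  shows "frechet_derivative F (at x) v =
    integral {0..1} (\<lambda>t. exp (- 2 * of_real pi * \<i> * of_real t) / of_real r
       * F (1 *s x + (of_real r * exp (2 * of_real pi * \<i> * of_real t)) *s v))"
proof -
  define h where "h t = F (x + t *s v)" for t
  have d: "(h has_field_derivative frechet_derivative F (at (x + t *s v)) v) (at t)" if "t \<in> cball 0 r" for t
    unfolding h_def by (rule field_derivative_along_line[OF F disc[OF that]])
  have "h holomorphic_on ball 0 r"
    by (rule holomorphic_onI) (meson d ball_subset_cball field_differentiable_at_within field_differentiable_def subsetD)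
  moreover have "continuous_on (cball 0 r) h"
    by (rule continuous_at_imp_continuous_on) (meson DERIV_isCont d)
  ultimately have "(h has_field_derivative (1 / (2 * of_real pi * \<i>) * contour_integral (circlepath 0 r) (\<lambda>u. h u / (u-0)^2))) (at 0)"
    using Cauchy_derivative_integral_circlepath(2)[of 0 r h 0] r by simp
  with d[of 0] r have "frechet_derivative F (at x) v = 1 / (2 * of_real pi * \<i>) * contour_integral (circlepath 0 r) (\<lambda>u. h u / (u-0)^2)"
    using DERIV_unique by fastforce
  also have "\<dots> = integral {0..1} (\<lambda>t. 1 / (2 * of_real pi * \<i>) * (h (circlepath 0 r t) / (circlepath 0 r t)^2 * vector_derivative (circlepath 0 r) (at t)))"
    unfolding contour_integral_integral by (subst integral_mult_right[symmetric]) (simp only: diff_0_right)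
  also have "\<dots> = integral {0..1} (\<lambda>t. exp (- 2 * of_real pi * \<i> * of_real t) / of_real r
       * F (1 *s x + (of_real r * exp (2 * of_real pi * \<i> * of_real t)) *s v))"
    unfolding vector_derivative_circlepath
    by (rule integral_cong)
      (use r in \<open>simp add: circlepath h_def exp_minus field_simps power2_eq_square\<close>)
  finally show ?thesis .
qed

lemma
  fixes F :: "complex ^ 'n \<Rightarrow> complex"
  assumes F: "cholomorphic_on F V" and V: "open V"
  shows continuous_on_deriv_blinfun: "continuous_on V (deriv_blinfun F)"
    and cholomorphic_on_frechet_derivative: "cholomorphic_on (\<lambda>x. frechet_derivative F (at x) v) V"
proof -
  have loc: "\<exists>e>0. ball x0 e \<subseteq> V \<and> continuous_on (ball x0 e) (\<lambda>x. frechet_derivative F (at x) v)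
      \<and> (continuous_on V (deriv_blinfun F) \<longrightarrow> cholomorphic_on (\<lambda>x. frechet_derivative F (at x) v) (ball x0 e))"
    if x0: "x0 \<in> V" for x0 v
  proof -
    obtain e where e: "e > 0" "ball x0 (2 * e) \<subseteq> V"
      using V x0 unfolding open_contains_ball
      by (metis field_sum_of_halves half_gt_zero mult_2)
    define r where "r = e / (norm v + 1)"
    have r: "r > 0" using e(1) by (simp add: r_def add_nonneg_pos)
    have rv: "r * norm v < e"
      using e(1) add_nonneg_pos[OF norm_ge_zero zero_less_one, of v]
      by (simp add: r_def pos_divide_less_eq distrib_left)
    have disc: "x + t *s v \<in> V" if "x \<in> ball x0 e" "t \<in> cball 0 r" for x t
    proof -
      have "norm (t *s v) \<le> r * norm v" using that(2) by (simp add: norm_smult_vec mult_right_mono)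
      then have "norm (t *s v) < e" using rv by simp
      then have "dist x0 (x + t *s v) < 2 * e"
        using that(1) norm_triangle_ineq[of "x - x0" "t *s v"] by (simp add: dist_norm norm_minus_commute algebra_simps)
      then show ?thesis using e(2) by auto
    qed
    have eq: "frechet_derivative F (at x) v =
      integral {0..1} (\<lambda>t. exp (- 2 * of_real pi * \<i> * of_real t) / of_real r
         * F (1 *s x + (of_real r * exp (2 * of_real pi * \<i> * of_real t)) *s v))" if "x \<in> ball x0 e" for x
      by (rule frechet_derivative_circle_integral[OF F r disc[OF that]])
    have in_V: "1 *s x + (of_real r * exp (2 * of_real pi * \<i> * of_real t)) *s v \<in> V" if "x \<in> ball x0 e" for x t
    proof -
      have "norm (of_real r * exp (2 * of_real pi * \<i> * of_real t)) \<le> r"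
        using r norm_exp_i_times[of "2 * pi * t"] by (simp add: norm_mult mult_ac)
      then show ?thesis using disc[OF that] by simp
    qed
    note par = cholomorphic_on_parametric_integral[OF F, where a="\<lambda>t. 1" and U="ball x0 e"
        and \<kappa>="\<lambda>t. exp (- 2 * of_real pi * \<i> * of_real t) / of_real r"
        and w="\<lambda>t. (of_real r * exp (2 * of_real pi * \<i> * of_real t)) *s v"]
    have "continuous_on (ball x0 e) (\<lambda>x. integral {0..1} (\<lambda>t. exp (- 2 * of_real pi * \<i> * of_real t) / of_real r
         * F (1 *s x + (of_real r * exp (2 * of_real pi * \<i> * of_real t)) *s v)))"
      by (rule par(1)) (use r in_V in \<open>auto intro!: continuous_intros\<close>)
    then have "continuous_on (ball x0 e) (\<lambda>x. frechet_derivative F (at x) v)"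
      by (rule continuous_on_eq) (simp add: eq)
    moreover have "cholomorphic_on (\<lambda>x. frechet_derivative F (at x) v) (ball x0 e)" if "continuous_on V (deriv_blinfun F)"
      by (rule cholomorphic_on_transform[OF par(2)])
        (use r in_V eq that in \<open>auto intro!: continuous_intros\<close>)
    moreover have "ball x0 e \<subseteq> V" using e by (auto simp: subset_iff)
    ultimately show ?thesis using e(1) by blast
  qed
  show c: "continuous_on V (deriv_blinfun F)"
  proof (rule continuous_on_blinfun_componentwise)
    fix v :: "complex ^ 'n"
    have "isCont (\<lambda>x. frechet_derivative F (at x) v) x" if "x \<in> V" for x
      using loc[OF that, of v] by (metis centre_in_ball continuous_on_eq_continuous_at open_ball)
    then have "continuous_on V (\<lambda>x. frechet_derivative F (at x) v)"
      by (simp add: continuous_at_imp_continuous_on)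
    then show "continuous_on V (\<lambda>x. deriv_blinfun F x v)"
      by (rule continuous_on_eq) (simp add: deriv_blinfun_apply[OF F])
  qed
  show "cholomorphic_on (\<lambda>x. frechet_derivative F (at x) v) V"
    using loc c unfolding cholomorphic_on_def by (meson centre_in_ball)
qed

lemma hadamard:
  fixes F :: "complex ^ 'n \<Rightarrow> complex"
  assumes F: "cholomorphic_on F (ball x0 e)" "e > 0"
  obtains h where "\<And>j. cholomorphic_on (h j) (ball x0 e)"
    and "\<And>x. x \<in> ball x0 e \<Longrightarrow> F x = F x0 + (\<Sum>j\<in>UNIV. (x $ j - x0 $ j) * h j x)"
    and "\<And>j. h j x0 = frechet_derivative F (at x0) (axis j 1)"
proof -
  define G where "G j x = frechet_derivative F (at x) (axis j 1)" for j x
  define h where "h j x = integral {0..1} (\<lambda>t. 1 * G j (of_real t *s x + of_real (1 - t) *s x0))" for j x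
  have G: "cholomorphic_on (G j) (ball x0 e)" for j
    unfolding G_def by (rule cholomorphic_on_frechet_derivative[OF F(1)]) simp
  have seg: "of_real t *s x + of_real (1 - t) *s x0 \<in> ball x0 e" if "x \<in> ball x0 e" "t \<in> {0..1}" for x t
  proof -
    have *: "complex_of_real s *s y = s *\<^sub>R y" for s and y :: "complex ^ 'n"
      unfolding vec_eq_iff vector_scaleR_component by (simp add: scaleR_conv_of_real)
    have "(1 - t) *\<^sub>R x0 + t *\<^sub>R x \<in> ball x0 e"
      using that F(2) convexD_alt[OF convex_ball, of x0 x0 e x t] by auto
    then show ?thesis by (simp only: * add.commute)
  qed
  show ?thesis
  proof (rule that[of h])
    show "cholomorphic_on (h j) (ball x0 e)" for j
      unfolding h_def
      by (rule cholomorphic_on_parametric_integral(2)[OF G _ _ _ seg])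
        (auto intro!: continuous_intros continuous_on_deriv_blinfun[OF G])
    have eq0: "of_real t *s x0 + of_real (1 - t) *s x0 = x0" for t
      by (simp add: vec_eq_iff algebra_simps)
    show "h j x0 = frechet_derivative F (at x0) (axis j 1)" for j
      unfolding h_def G_def eq0 by simp
    fix x assume x: "x \<in> ball x0 e"
    define g where "g t = F (x0 + t *s (x - x0))" for t
    have rw: "of_real t *s x + of_real (1 - t) *s x0 = x0 + of_real t *s (x - x0)" for t
      by (simp add: vec_eq_iff algebra_simps)
    have "((\<lambda>t. g (of_real t)) has_vector_derivative (\<Sum>j\<in>UNIV. (x $ j - x0 $ j) * G j (of_real t *s x + of_real (1 - t) *s x0))) (at t within {0..1})"
      if t: "t \<in> {0..1}" for t
    proof -
      have in_ball: "x0 + of_real t *s (x - x0) \<in> ball x0 e" using seg[OF x t] by (simp only: rw)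
      have "(g has_field_derivative frechet_derivative F (at (x0 + of_real t *s (x - x0))) (x - x0)) (at (of_real t))"
        unfolding g_def by (rule field_derivative_along_line[OF F(1) in_ball])
      also have "frechet_derivative F (at (x0 + of_real t *s (x - x0))) (x - x0) = (\<Sum>j\<in>UNIV. (x $ j - x0 $ j) * G j (of_real t *s x + of_real (1 - t) *s x0))"
        by (subst frechet_derivative_expansion[OF F(1) in_ball]) (simp only: rw G_def vector_minus_component)
      finally show ?thesis
        by (rule has_vector_derivative_real_field)
    qed
    then have ftc: "((\<lambda>t. \<Sum>j\<in>UNIV. (x $ j - x0 $ j) * G j (of_real t *s x + of_real (1 - t) *s x0)) has_integral g (of_real 1) - g (of_real 0)) {0..1}"
      by (intro fundamental_theorem_of_calculus) auto
    have "(\<lambda>t. G j (of_real t *s x + of_real (1 - t) *s x0)) integrable_on {0..1}" for j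
      by (intro integrable_continuous_real continuous_on_compose2[OF cholomorphic_on_imp_continuous_on[OF G]] continuous_intros
          image_subsetI seg[OF x])
    then have "((\<lambda>t. \<Sum>j\<in>UNIV. (x $ j - x0 $ j) * G j (of_real t *s x + of_real (1 - t) *s x0)) has_integral (\<Sum>j\<in>UNIV. (x $ j - x0 $ j) * h j x)) {0..1}"
      unfolding h_def by (intro has_integral_sum has_integral_mult_right integrable_integral) auto
    with ftc have "g (of_real 1) - g (of_real 0) = (\<Sum>j\<in>UNIV. (x $ j - x0 $ j) * h j x)"
      by (rule has_integral_unique)
    then show "F x = F x0 + (\<Sum>j\<in>UNIV. (x $ j - x0 $ j) * h j x)"
      by (simp add: g_def algebra_simps)
  qed
qed

subsection \<open>Projective space\<close>

definition rep :: "'n::finite proj \<Rightarrow> complex ^ 'n" where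
  "rep q = (SOME v. v \<noteq> 0 \<and> line v = q)"

definition lform :: "complex ^ 'n::finite \<Rightarrow> complex ^ 'n \<Rightarrow> complex" where
  "lform a v = (\<Sum>j\<in>UNIV. a $ j * v $ j)"

definition ratio :: "complex ^ 'n::finite \<Rightarrow> 'n \<Rightarrow> 'n proj \<Rightarrow> complex" where
  "ratio a i q = lform a (rep q) / rep q $ i"

definition affine_chart :: "'n::finite \<Rightarrow> 'n proj set" where
  "affine_chart i = {q. rep q $ i \<noteq> 0}"

definition sect :: "'n::finite \<Rightarrow> 'n proj \<Rightarrow> complex ^ 'n" where
  "sect i q = (1 / rep q $ i) *s rep q"

lemma line_eq_iff:
  fixes v w :: "complex ^ 'n::finite"
  assumes "v \<noteq> 0" "w \<noteq> 0"
  shows "line v = line w \<longleftrightarrow> (\<exists>c. c \<noteq> 0 \<and> w = c *s v)"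
proof -
  have 1: "line v = line w \<longleftrightarrow> range (\<lambda>c. c *s v) = range (\<lambda>c. c *s w)"
    unfolding line_def using assms by (subst Abs_proj_inject) auto
  show ?thesis
  proof
    assume "line v = line w"
    then have "1 *s w \<in> range (\<lambda>c. c *s v)" unfolding 1 by blast
    then show "\<exists>c. c \<noteq> 0 \<and> w = c *s v" using assms by auto
  next
    assume "\<exists>c. c \<noteq> 0 \<and> w = c *s v"
    then obtain c where c: "c \<noteq> 0" "w = c *s v" by blast
    have "d *s v = (d / c) *s w" for d using c by (simp add: vector_smult_assoc)
    then have "d *s v \<in> range (\<lambda>c. c *s w)" for d by (metis rangeI)
    then show "line v = line w" unfolding 1 using c by (auto simp: vector_smult_assoc)
  qed
qed

lemma ex_line: "\<exists>v. v \<noteq> 0 \<and> line v = (q :: 'n::finite proj)"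
  unfolding line_def using Rep_proj[of q] by (auto simp: Rep_proj_inverse) (metis Rep_proj_inverse)

lemma rep_nonzero: "rep q \<noteq> 0" and line_rep [simp]: "line (rep q) = q"
  unfolding rep_def using someI_ex[OF ex_line[of q]] by auto

lemma rep_line:
  assumes "v \<noteq> 0" obtains c where "c \<noteq> 0" "rep (line v) = c *s v"
  using line_eq_iff[OF assms rep_nonzero, of "line v"] by auto

lemma in_cone_iff: "v \<in> cone U \<longleftrightarrow> v \<noteq> 0 \<and> line v \<in> U"
  by (simp add: cone_def)

lemma lform_smult: "lform a (c *s v) = c * lform a v"
  by (simp add: lform_def sum_distrib_left mult_ac)

lemma lform_axis [simp]: "lform (axis j 1) v = v $ j"
  unfolding lform_def axis_def by (simp add: if_distrib[of "\<lambda>x. x * _"] cong: if_cong)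

lemma lform_linear: "lform (c *s a + d *s b) v = c * lform a v + d * lform b v"
  by (simp add: lform_def sum_distrib_left algebra_simps sum.distrib)

lemma linear_forms_eq: "linear_forms = range lform"
  by (auto simp: linear_forms_def lform_def[abs_def])

lemma affine_chart_line: "v \<noteq> 0 \<Longrightarrow> line v \<in> affine_chart i \<longleftrightarrow> v $ i \<noteq> 0"
  by (rule rep_line[of v]) (auto simp: affine_chart_def)

lemma ratio_line: "v \<noteq> 0 \<Longrightarrow> ratio a i (line v) = lform a v / v $ i"
  by (rule rep_line[of v]) (auto simp: ratio_def lform_smult)

lemma sect_line: "v \<noteq> 0 \<Longrightarrow> sect i (line v) = (1 / v $ i) *s v"
  by (rule rep_line[of v]) (auto simp: sect_def vec_eq_iff)

lemma sect_component: "sect i q $ j = ratio (axis j 1) i q"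
  by (simp add: sect_def ratio_def)

lemma line_sect: "q \<in> affine_chart i \<Longrightarrow> line (sect i q) = q"
  and sect_nonzero: "q \<in> affine_chart i \<Longrightarrow> sect i q \<noteq> 0"
proof -
  assume "q \<in> affine_chart i"
  then have 0: "rep q $ i \<noteq> 0" by (simp add: affine_chart_def)
  with rep_nonzero[of q] show "sect i q \<noteq> 0" by (auto simp: sect_def vec_eq_iff)
  then have "line (sect i q) = line (rep q)"
    using 0 rep_nonzero[of q] by (subst line_eq_iff) (auto simp: sect_def vector_smult_assoc intro!: exI[of _ "rep q $ i"])
  then show "line (sect i q) = q" by simp
qed

lemma ex_affine_chart: "\<exists>i. q \<in> affine_chart i"
  using rep_nonzero[of q] by (auto simp: affine_chart_def vec_eq_iff)

lemma ratio_linear: "ratio (c *s a + d *s b) i q = c * ratio a i q + d * ratio b i q"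
  by (simp add: ratio_def lform_linear add_divide_distrib)

lemma ratio_self: "q \<in> affine_chart i \<Longrightarrow> ratio (axis i 1) i q = 1"
  by (simp add: ratio_def affine_chart_def)

lemma ratio_expand: "ratio a i q = (\<Sum>j\<in>UNIV. a $ j * ratio (axis j 1) i q)"
  by (simp add: ratio_def lform_def[of a] sum_divide_distrib)

lemma open_proj_iff: "open U \<longleftrightarrow> open (cone U)"
  by (simp add: open_proj_def)

lemma open_image_line:
  assumes "open S" "0 \<notin> S" shows "open (line ` S)"
proof -
  have "cone (line ` S) = (\<Union>c\<in>-{0}. (\<lambda>v. c *s v) -` S)"
  proof (intro equalityI subsetI)
    fix v assume "v \<in> cone (line ` S)"
    then obtain w where w: "w \<in> S" "line v = line w" "v \<noteq> 0" by (auto simp: in_cone_iff)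
    with assms(2) show "v \<in> (\<Union>c\<in>-{0}. (\<lambda>v. c *s v) -` S)" by (subst (asm) line_eq_iff) auto
  next
    fix v assume "v \<in> (\<Union>c\<in>-{0}. (\<lambda>v. c *s v) -` S)"
    then obtain c where c: "c \<noteq> 0" "c *s v \<in> S" by auto
    with assms(2) have v: "v \<noteq> 0" by auto
    then have "line v = line (c *s v)" using c by (subst line_eq_iff) auto
    with c v show "v \<in> cone (line ` S)" by (auto simp: in_cone_iff)
  qed
  moreover have "open ((\<lambda>v. c *s v) -` S)" for c
    by (rule open_vimage[OF assms(1)]) (intro continuous_intros)
  ultimately show ?thesis by (auto simp: open_proj_iff)
qed

lemma open_cone: "open U \<Longrightarrow> open (cone U)"
  by (simp add: open_proj_iff)

lemma continuous_on_line: "0 \<notin> S \<Longrightarrow> continuous_on S line"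
proof (rule continuous_on_subset[of "-{0}"])
  show "continuous_on (-{0}) (line :: complex ^ 'a \<Rightarrow> _)"
  proof (subst continuous_on_open_vimage)
    show "\<forall>B. open B \<longrightarrow> open ((line :: complex ^ 'a \<Rightarrow> _) -` B \<inter> - {0})"
    proof (intro allI impI)
      fix B :: "'a proj set" assume "open B"
      moreover have "line -` B \<inter> - {0} = cone B" by (auto simp: in_cone_iff)
      ultimately show "open (line -` B \<inter> - {0})" by (simp add: open_cone)
    qed
  qed auto
qed auto

lemma open_sect_vimage:
  assumes "open V" shows "open {q \<in> affine_chart i. sect i q \<in> V}"
proof -
  have nz: "v \<noteq> 0" if "v $ i \<noteq> 0" for v :: "complex ^ 'a" using that by auto
  have "cone {q \<in> affine_chart i. sect i q \<in> V} = {v \<in> {v. v $ i \<noteq> 0}. (1 / v $ i) *s v \<in> V}"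
    by (auto simp: in_cone_iff affine_chart_line sect_line affine_chart_line[OF nz] sect_line[OF nz] nz)
  moreover have op: "open {v :: complex ^ 'a. v $ i \<noteq> 0}"
    by (intro open_Collect_neq continuous_intros)
  have "continuous_on {v :: complex ^ 'a. v $ i \<noteq> 0} (\<lambda>v. (1 / v $ i) *s v)"
    by (intro continuous_intros) auto
  then have "open ((\<lambda>v. (1 / v $ i) *s v) -` V \<inter> {v. v $ i \<noteq> 0})"
    using continuous_on_open_vimage[OF op] assms by blast
  then have "open {v \<in> {v. v $ i \<noteq> 0}. (1 / v $ i) *s v \<in> V}"
    by (simp add: vimage_def Int_def conj_commute)
  ultimately show ?thesis by (simp add: open_proj_iff)
qed

lemma open_affine_chart: "open (affine_chart i)"
  using open_sect_vimage[of UNIV i] by simp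

subsection \<open>Holomorphic functions on open sets\<close>

lemma proj_holomorphic_on_open: "proj_holomorphic_on f U \<Longrightarrow> open U"
  by (simp add: proj_holomorphic_on_def)

lemma cone_mono: "U \<subseteq> V \<Longrightarrow> cone U \<subseteq> cone V"
  by (auto simp: in_cone_iff)

lemma proj_holomorphic_on_subset: "proj_holomorphic_on f V \<Longrightarrow> open U \<Longrightarrow> U \<subseteq> V \<Longrightarrow> proj_holomorphic_on f U"
  unfolding proj_holomorphic_on_def using cholomorphic_on_subset cone_mono by blast

lemma proj_holomorphic_on_const: "open U \<Longrightarrow> proj_holomorphic_on (\<lambda>q. c) U"
  by (simp add: proj_holomorphic_on_def cholomorphic_on_const)

lemma proj_holomorphic_on_add:
  "proj_holomorphic_on f U \<Longrightarrow> proj_holomorphic_on g U \<Longrightarrow> proj_holomorphic_on (\<lambda>q. f q + g q) U"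
  by (simp add: proj_holomorphic_on_def cholomorphic_on_add)

lemma proj_holomorphic_on_mult:
  "proj_holomorphic_on f U \<Longrightarrow> proj_holomorphic_on g U \<Longrightarrow> proj_holomorphic_on (\<lambda>q. f q * g q) U"
  by (simp add: proj_holomorphic_on_def cholomorphic_on_mult)

lemma open_nonvanishing:
  assumes "proj_holomorphic_on f U" shows "open {q \<in> U. f q \<noteq> 0}"
proof -
  have "open ((\<lambda>v. f (line v)) -` (-{0}) \<inter> cone U)"
    using assms cholomorphic_on_imp_continuous_on open_cone
    by (metis continuous_on_open_vimage open_Compl closed_singleton proj_holomorphic_on_def)
  moreover have "(\<lambda>v. f (line v)) -` (-{0}) \<inter> cone U = cone {q \<in> U. f q \<noteq> 0}"
    by (auto simp: in_cone_iff)
  ultimately show ?thesis by (simp add: open_proj_iff)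
qed

lemma proj_holomorphic_on_inverse:
  assumes "proj_holomorphic_on f U"
  shows "proj_holomorphic_on (\<lambda>q. inverse (f q)) {q \<in> U. f q \<noteq> 0}"
proof -
  have "cholomorphic_on (\<lambda>v. f (line v)) (cone {q \<in> U. f q \<noteq> 0})"
    using assms unfolding proj_holomorphic_on_def by (elim conjE cholomorphic_on_subset) (auto simp: in_cone_iff)
  then show ?thesis
    using open_nonvanishing[OF assms] unfolding proj_holomorphic_on_def
    by (intro conjI cholomorphic_on_inverse) (auto simp: in_cone_iff)
qed

lemma proj_holomorphic_on_comp_sect:
  assumes "cholomorphic_on G V" "open V"
  shows "proj_holomorphic_on (\<lambda>q. G (sect i q)) {q \<in> affine_chart i. sect i q \<in> V}"
  unfolding proj_holomorphic_on_def
proof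
  let ?U = "{q \<in> affine_chart i. sect i q \<in> V}"
  have nz: "v \<noteq> 0" if "v $ i \<noteq> 0" for v :: "complex ^ 'a" using that by auto
  show op: "open ?U" by (rule open_sect_vimage[OF assms(2)])
  have c: "cone ?U = {v. v $ i \<noteq> 0 \<and> (1 / v $ i) *s v \<in> V}"
    by (auto simp: in_cone_iff affine_chart_line sect_line affine_chart_line[OF nz] sect_line[OF nz] nz)
  have "cholomorphic_on (\<lambda>v. G ((1 / v $ i) *s v)) (cone ?U)"
  proof (rule cholomorphic_on_compose[OF assms(1)])
    fix j show "cholomorphic_on (\<lambda>v. ((1 / v $ i) *s v) $ j) (cone ?U)"
      unfolding vector_smult_component divide_inverse
      by (intro cholomorphic_on_mult cholomorphic_on_const cholomorphic_on_inverse cholomorphic_on_component)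
        (auto simp: c)
  qed (auto simp: c)
  then show "cholomorphic_on (\<lambda>v. G (sect i (line v))) (cone ?U)"
    by (rule cholomorphic_on_transform[OF _ open_cone[OF op]]) (auto simp: in_cone_iff sect_line)
qed

lemma proj_holomorphic_on_ratio: "proj_holomorphic_on (ratio a i) (affine_chart i)"
proof -
  have "cholomorphic_on (\<lambda>v. \<Sum>j\<in>A. a $ j * v $ j) UNIV" if "finite A" for A
    using that by induction (auto intro!: cholomorphic_on_const cholomorphic_on_add cholomorphic_on_mult cholomorphic_on_component)
  from proj_holomorphic_on_comp_sect[OF this[OF finite_class.finite_UNIV] open_UNIV, of i]
  have *: "proj_holomorphic_on (\<lambda>q. lform a (sect i q)) (affine_chart i)"
    by (simp add: lform_def)
  have "(\<lambda>q. lform a (sect i q)) = ratio a i"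
    by (simp add: fun_eq_iff sect_def lform_smult ratio_def)
  with * show ?thesis by simp
qed

section \<open>The local ring and its derivations\<close>

abbreviation near :: "'n::finite proj set \<Rightarrow> 'n proj \<Rightarrow> 'n proj filter" where
  "near M p \<equiv> inf (nhds p) (principal M)"

lemma eventually_near: "(\<forall>\<^sub>F q in near M p. P q) \<longleftrightarrow> (\<exists>U. open U \<and> p \<in> U \<and> (\<forall>q\<in>M \<inter> U. P q))"
  unfolding eventually_inf_principal eventually_nhds by blast

lemma near_self: "(\<forall>\<^sub>F q in near M p. P q) \<Longrightarrow> p \<in> M \<Longrightarrow> P p"
  unfolding eventually_near by blast

lemma near_near: "(\<forall>\<^sub>F q in near M p. P q) \<Longrightarrow> (\<forall>\<^sub>F y in near M p. \<forall>\<^sub>F q in near M y. P q)"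
  unfolding eventually_near by blast

lemma near_in: "\<forall>\<^sub>F q in near M p. q \<in> M"
  unfolding eventually_near by auto

lemma near_open: "open U \<Longrightarrow> p \<in> U \<Longrightarrow> \<forall>\<^sub>F q in near M p. q \<in> U"
  unfolding eventually_near by auto

lemma germ_eq_iff: "germ_eq M p f g \<longleftrightarrow> (\<forall>\<^sub>F q in near M p. f q = g q)"
  by (simp add: germ_eq_def eventually_near)

lemma holomorphic_at_iff:
  "holomorphic_at M p f \<longleftrightarrow> (\<exists>U F. p \<in> U \<and> proj_holomorphic_on F U \<and> (\<forall>q\<in>M \<inter> U. f q = F q))"
  by (simp add: holomorphic_at_def)

lemma holomorphic_at_near:
  assumes "holomorphic_at M p f" shows "\<forall>\<^sub>F q in near M p. holomorphic_at M q f"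
  using assms unfolding holomorphic_at_def eventually_near
  by (meson IntD2 proj_holomorphic_on_open)

lemma holomorphic_at_cong:
  assumes "holomorphic_at M p f" "\<forall>\<^sub>F q in near M p. f q = g q"
  shows "holomorphic_at M p g"
proof -
  obtain U F where U: "p \<in> U" "proj_holomorphic_on F U" "\<forall>q\<in>M \<inter> U. f q = F q"
    using assms(1) by (auto simp: holomorphic_at_def)
  obtain V where V: "open V" "p \<in> V" "\<forall>q\<in>M \<inter> V. f q = g q"
    using assms(2) by (auto simp: eventually_near)
  have "proj_holomorphic_on F (U \<inter> V)"
    using V proj_holomorphic_on_open[OF U(2)] by (intro proj_holomorphic_on_subset[OF U(2)] open_Int) auto
  moreover have "\<forall>q\<in>M \<inter> (U \<inter> V). g q = F q" using U(3) V(3) by (metis IntE IntI)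
  ultimately show ?thesis using U V unfolding holomorphic_at_def by (intro exI[of _ "U \<inter> V"] exI[of _ F]) auto
qed

lemma holomorphic_at_restrict:
  assumes "p \<in> U" "proj_holomorphic_on F U" shows "holomorphic_at M p F"
  using assms by (auto simp: holomorphic_at_def)

lemma holomorphic_at_const: "holomorphic_at M p (\<lambda>q. c)"
  by (rule holomorphic_at_restrict[of p UNIV]) (auto intro: proj_holomorphic_on_const)

lemma
  assumes "holomorphic_at M p f" "holomorphic_at M p g"
  shows holomorphic_at_add: "holomorphic_at M p (\<lambda>q. f q + g q)"
    and holomorphic_at_mult: "holomorphic_at M p (\<lambda>q. f q * g q)"
proof -
  obtain U F where U: "p \<in> U" "proj_holomorphic_on F U" "\<forall>q\<in>M \<inter> U. f q = F q"
    using assms(1) by (auto simp: holomorphic_at_def)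
  obtain V G where V: "p \<in> V" "proj_holomorphic_on G V" "\<forall>q\<in>M \<inter> V. g q = G q"
    using assms(2) by (auto simp: holomorphic_at_def)
  have op: "open (U \<inter> V)" using U(2) V(2) by (auto dest: proj_holomorphic_on_open)
  have FG: "proj_holomorphic_on F (U \<inter> V)" "proj_holomorphic_on G (U \<inter> V)"
    using proj_holomorphic_on_subset[OF U(2) op] proj_holomorphic_on_subset[OF V(2) op] by auto
  show "holomorphic_at M p (\<lambda>q. f q + g q)" "holomorphic_at M p (\<lambda>q. f q * g q)"
    using proj_holomorphic_on_add[OF FG] proj_holomorphic_on_mult[OF FG] U V
    unfolding holomorphic_at_def by (metis (no_types, lifting) IntE IntI)+
qed

lemma holomorphic_at_nonzero:
  assumes "holomorphic_at M p f" "p \<in> M" "f p \<noteq> 0"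
  shows "\<forall>\<^sub>F q in near M p. f q \<noteq> 0" and holomorphic_at_inverse: "holomorphic_at M p (\<lambda>q. inverse (f q))"
proof -
  obtain U F where U: "p \<in> U" "proj_holomorphic_on F U" "\<forall>q\<in>M \<inter> U. f q = F q"
    using assms(1) by (auto simp: holomorphic_at_def)
  let ?V = "{q \<in> U. F q \<noteq> 0}"
  have "open ?V" "p \<in> ?V" using U assms open_nonvanishing by auto
  then show "\<forall>\<^sub>F q in near M p. f q \<noteq> 0" using U(3) by (auto simp: eventually_near)
  show "holomorphic_at M p (\<lambda>q. inverse (f q))"
    using proj_holomorphic_on_inverse[OF U(2)] \<open>p \<in> ?V\<close> U(3)
    unfolding holomorphic_at_def by (intro exI[of _ ?V]) auto
qed

lemma holomorphic_at_cmult: "holomorphic_at M p f \<Longrightarrow> holomorphic_at M p (\<lambda>q. c * f q)"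
  by (intro holomorphic_at_mult holomorphic_at_const)

lemma holomorphic_at_diff: "holomorphic_at M p f \<Longrightarrow> holomorphic_at M p g \<Longrightarrow> holomorphic_at M p (\<lambda>q. f q - g q)"
  using holomorphic_at_add[OF _ holomorphic_at_cmult[of M p g "-1"]] by simp

lemma holomorphic_at_sum:
  "(\<And>i. i \<in> I \<Longrightarrow> holomorphic_at M p (f i)) \<Longrightarrow> holomorphic_at M p (\<lambda>q. \<Sum>i\<in>I. f i q)"
  by (induction I rule: infinite_finite_induct) (auto intro: holomorphic_at_const holomorphic_at_add)

lemma holomorphic_at_prod:
  "(\<And>i. i \<in> I \<Longrightarrow> holomorphic_at M p (f i)) \<Longrightarrow> holomorphic_at M p (\<lambda>q. \<Prod>i\<in>I. f i q)"
  by (induction I rule: infinite_finite_induct) (auto intro: holomorphic_at_const holomorphic_at_mult)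

lemma holomorphic_at_ratio: "p \<in> affine_chart i \<Longrightarrow> holomorphic_at M p (ratio a i)"
  by (rule holomorphic_at_restrict[OF _ proj_holomorphic_on_ratio])

lemma holomorphic_at_comp_sect:
  assumes "cholomorphic_on G V" "open V" "p \<in> affine_chart i" "sect i p \<in> V"
  shows "holomorphic_at M p (\<lambda>q. G (sect i q))"
  by (rule holomorphic_at_restrict[OF _ proj_holomorphic_on_comp_sect[OF assms(1,2)]]) (use assms in auto)

subsection \<open>Tangent vectors\<close>

lemma
  assumes "D \<in> tangent_space M p"
  shows tangent_off: "\<not> holomorphic_at M p f \<Longrightarrow> D f = 0"
    and tangent_germ: "holomorphic_at M p f \<Longrightarrow> \<forall>\<^sub>F q in near M p. f q = g q \<Longrightarrow> D f = D g"
    and tangent_add: "holomorphic_at M p f \<Longrightarrow> holomorphic_at M p g \<Longrightarrow> D (\<lambda>q. f q + g q) = D f + D g"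
    and tangent_mult: "holomorphic_at M p f \<Longrightarrow> holomorphic_at M p g \<Longrightarrow>
      D (\<lambda>q. f q * g q) = f p * D g + g p * D f"
    and tangent_cmult: "holomorphic_at M p f \<Longrightarrow> D (\<lambda>q. c * f q) = c * D f"
proof -
  have *: "germ_eq M p f g \<Longrightarrow> holomorphic_at M p f \<Longrightarrow> D f = D g"
    using assms holomorphic_at_cong unfolding tangent_space_def germ_eq_iff by blast
  show "holomorphic_at M p f \<Longrightarrow> \<forall>\<^sub>F q in near M p. f q = g q \<Longrightarrow> D f = D g"
    using * by (simp add: germ_eq_iff)
qed (use assms in \<open>auto simp: tangent_space_def\<close>)

lemma tangent_const:
  assumes "D \<in> tangent_space M p" shows "D (\<lambda>q. c) = 0"
proof -
  have "D (\<lambda>q. 1 * 1) = 1 * D (\<lambda>q. 1) + 1 * D (\<lambda>q. 1)"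
    by (rule tangent_mult[OF assms]) (rule holomorphic_at_const)+
  then have "D (\<lambda>q. 1) = 0" by simp
  with tangent_cmult[OF assms holomorphic_at_const, of c 1] show ?thesis by simp
qed

lemma tangent_sum:
  assumes "D \<in> tangent_space M p" "\<And>i. i \<in> I \<Longrightarrow> holomorphic_at M p (f i)"
  shows "D (\<lambda>q. \<Sum>i\<in>I. f i q) = (\<Sum>i\<in>I. D (f i))"
  using assms(2)
proof (induction I rule: infinite_finite_induct)
  case (insert x F)
  then have "D (\<lambda>q. f x q + (\<Sum>i\<in>F. f i q)) = D (f x) + D (\<lambda>q. \<Sum>i\<in>F. f i q)"
    by (intro tangent_add[OF assms(1)] holomorphic_at_sum) auto
  with insert show ?case by simp
qed (auto simp: tangent_const[OF assms(1)])

lemma tangent_diff: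
  assumes "D \<in> tangent_space M p" "holomorphic_at M p f" "holomorphic_at M p g"
  shows "D (\<lambda>q. f q - g q) = D f - D g"
  using tangent_add[OF assms(1,2) holomorphic_at_cmult[OF assms(3), of "-1"]] tangent_cmult[OF assms(1,3), of "-1"]
  by simp

lemma tangent_subspace: "cfun.subspace (tangent_space M p)"
proof (rule cfun.subspaceI)
  show "0 \<in> tangent_space M p" by (auto simp: tangent_space_def)
next
  fix x y assume "x \<in> tangent_space M p" "y \<in> tangent_space M p"
  then show "x + y \<in> tangent_space M p"
    unfolding tangent_space_def by (auto simp: algebra_simps)
next
  fix c x assume "x \<in> tangent_space M p"
  then show "cscale c x \<in> tangent_space M p"
    unfolding tangent_space_def by (auto simp: algebra_simps cscale_def)
qed

definition tangent_coords :: "'n::finite \<Rightarrow> 'n tvec \<Rightarrow> complex ^ 'n" where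
  "tangent_coords i D = (\<chi> j. D (ratio (axis j 1) i))"

lemma tangent_frechet:
  assumes D: "D \<in> tangent_space M p" and p: "p \<in> M" "p \<in> affine_chart i"
    and F: "proj_holomorphic_on F U" "p \<in> U" "\<forall>\<^sub>F q in near M p. f q = F q"
  shows "D f = frechet_derivative (\<lambda>v. F (line v)) (at (sect i p)) (tangent_coords i D)"
proof -
  let ?x = "sect i p" and ?F = "\<lambda>v. F (line v)"
  have x: "?x \<in> cone U"
    using F p by (simp add: in_cone_iff sect_nonzero line_sect)
  have U: "open (cone U)" using F(1) open_cone proj_holomorphic_on_open by blast
  obtain e where e: "e > 0" "ball ?x e \<subseteq> cone U"
    using U x unfolding open_contains_ball by blast
  have cF: "cholomorphic_on ?F (ball ?x e)"
    using F(1) e(2) cholomorphic_on_subset by (auto simp: proj_holomorphic_on_def)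
  from hadamard[OF cF e(1)] obtain h where h: "\<And>j. cholomorphic_on (h j) (ball ?x e)"
    "\<And>x. x \<in> ball ?x e \<Longrightarrow> ?F x = ?F ?x + (\<Sum>j\<in>UNIV. (x $ j - ?x $ j) * h j x)"
    "\<And>j. h j ?x = frechet_derivative ?F (at ?x) (axis j 1)" by blast
  have hh: "holomorphic_at M p (\<lambda>q. h j (sect i q))" for j
    by (rule holomorphic_at_comp_sect[OF h(1)]) (use p e in auto)
  have hr: "holomorphic_at M p (\<lambda>q. ratio (axis j 1) i q - ?x $ j)" for j
    by (intro holomorphic_at_diff holomorphic_at_const holomorphic_at_ratio p)
  have "\<forall>\<^sub>F q in near M p. q \<in> {q \<in> affine_chart i. sect i q \<in> ball ?x e}"
    by (rule near_open[OF open_sect_vimage]) (use p e in auto)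
  then have ev: "\<forall>\<^sub>F q in near M p. F q = F p + (\<Sum>j\<in>UNIV. (ratio (axis j 1) i q - ?x $ j) * h j (sect i q))"
  proof eventually_elim
    case (elim q)
    then have "?F (sect i q) = ?F ?x + (\<Sum>j\<in>UNIV. (sect i q $ j - ?x $ j) * h j (sect i q))"
      by (intro h(2)) simp
    then show ?case using elim p by (simp add: line_sect sect_component)
  qed
  have hF: "holomorphic_at M p F" using F holomorphic_at_restrict by blast
  have "D f = D F"
    using tangent_germ[OF D hF] F(3) by (metis (mono_tags, lifting) eventually_mono)
  also have "\<dots> = D (\<lambda>q. F p + (\<Sum>j\<in>UNIV. (ratio (axis j 1) i q - ?x $ j) * h j (sect i q)))"
    by (rule tangent_germ[OF D hF ev])
  also have "\<dots> = D (\<lambda>q. F p) + D (\<lambda>q. \<Sum>j\<in>UNIV. (ratio (axis j 1) i q - ?x $ j) * h j (sect i q))"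
    by (rule tangent_add[OF D]; intro holomorphic_at_const holomorphic_at_sum holomorphic_at_mult hh hr)
  also have "D (\<lambda>q. \<Sum>j\<in>UNIV. (ratio (axis j 1) i q - ?x $ j) * h j (sect i q)) =
      (\<Sum>j\<in>UNIV. D (\<lambda>q. (ratio (axis j 1) i q - ?x $ j) * h j (sect i q)))"
    by (rule tangent_sum[OF D]; intro holomorphic_at_mult hh hr)
  also have "\<dots> = (\<Sum>j\<in>UNIV. D (ratio (axis j 1) i) * h j ?x)"
    by (rule sum.cong[OF refl], subst tangent_mult[OF D hr hh],
        subst tangent_diff[OF D holomorphic_at_ratio[OF p(2)] holomorphic_at_const])
      (simp add: tangent_const[OF D] sect_component)
  finally have "D f = (\<Sum>j\<in>UNIV. tangent_coords i D $ j * frechet_derivative ?F (at ?x) (axis j 1))"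
    by (simp add: tangent_const[OF D] h(3) tangent_coords_def)
  then show ?thesis
    using frechet_derivative_expansion[OF cF, of ?x "tangent_coords i D"] e(1) by simp
qed

lemma tangent_eqI:
  assumes "D \<in> tangent_space M p" "E \<in> tangent_space M p" "p \<in> M" "p \<in> affine_chart i"
    and "\<And>a. D (ratio a i) = E (ratio a i)"
  shows "D = E"
proof
  fix f
  show "D f = E f"
  proof (cases "holomorphic_at M p f")
    case True
    then obtain U F where U: "p \<in> U" "proj_holomorphic_on F U" "\<forall>q\<in>M \<inter> U. f q = F q"
      by (auto simp: holomorphic_at_def)
    then have "\<forall>\<^sub>F q in near M p. f q = F q"
      by (auto simp: eventually_near dest: proj_holomorphic_on_open)
    then show ?thesis
      using tangent_frechet[OF assms(1,3,4) U(2,1)] tangent_frechet[OF assms(2,3,4) U(2,1)] assms(5)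
      by (simp add: tangent_coords_def)
  qed (use tangent_off assms in metis)
qed

subsection \<open>Vector fields\<close>

lemma vector_field_at_iff:
  "vector_field_at M p \<xi> \<longleftrightarrow> (\<forall>\<^sub>F q in near M p. \<xi> q \<in> tangent_space M q
     \<and> (\<forall>f. holomorphic_at M q f \<longrightarrow> holomorphic_at M q (\<lambda>q'. \<xi> q' f)))"
  by (simp add: vector_field_at_def eventually_near)

lemma section_at_iff:
  "section_at M H p \<xi> \<longleftrightarrow> vector_field_at M p \<xi> \<and> (\<forall>\<^sub>F q in near M p. \<xi> q \<in> H q)"
  by (simp add: section_at_def eventually_near)

lemma vector_field_near: "vector_field_at M p \<xi> \<Longrightarrow> \<forall>\<^sub>F q in near M p. vector_field_at M q \<xi>"
  unfolding vector_field_at_iff by (rule near_near)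

lemma section_near: "section_at M H p \<xi> \<Longrightarrow> \<forall>\<^sub>F q in near M p. section_at M H q \<xi>"
  unfolding section_at_iff eventually_conj_iff by (elim conjE) (rule conjI[OF vector_field_near near_near])

lemma vector_field_tangent: "vector_field_at M p \<xi> \<Longrightarrow> p \<in> M \<Longrightarrow> \<xi> p \<in> tangent_space M p"
  unfolding vector_field_at_iff by (auto dest: near_self)

lemma vector_field_holomorphic:
  "vector_field_at M p \<xi> \<Longrightarrow> p \<in> M \<Longrightarrow> holomorphic_at M p f \<Longrightarrow> holomorphic_at M p (\<lambda>q. \<xi> q f)"
  unfolding vector_field_at_iff by (drule near_self) auto

lemma section_in: "section_at M H p \<xi> \<Longrightarrow> p \<in> M \<Longrightarrow> \<xi> p \<in> H p"
  unfolding section_at_iff using near_self by blast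

lemma section_vf: "section_at M H p \<xi> \<Longrightarrow> vector_field_at M p \<xi>"
  by (simp add: section_at_iff)

lemma vector_field_zero: "vector_field_at M p (\<lambda>q. 0)"
  unfolding vector_field_at_iff
  by (auto simp: holomorphic_at_const intro!: always_eventually cfun.subspace_0[OF tangent_subspace])

lemma vector_field_add:
  assumes "vector_field_at M p \<xi>" "vector_field_at M p \<eta>"
  shows "vector_field_at M p (\<lambda>q. \<xi> q + \<eta> q)"
  using assms unfolding vector_field_at_iff
  by eventually_elim (auto intro!: cfun.subspace_add[OF tangent_subspace] holomorphic_at_add)

lemma vector_field_scale:
  assumes "vector_field_at M p \<xi>" "holomorphic_at M p c"
  shows "vector_field_at M p (\<lambda>q. cscale (c q) (\<xi> q))"
  using assms(1) holomorphic_at_near[OF assms(2)] unfolding vector_field_at_iff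
proof eventually_elim
  case (elim q)
  then have "cscale (c q) (\<xi> q) \<in> tangent_space M q"
    using cfun.subspace_scale[OF tangent_subspace] by blast
  moreover have "holomorphic_at M q (\<lambda>q'. cscale (c q') (\<xi> q') f)" if "holomorphic_at M q f" for f
    unfolding cscale_def using elim that by (intro holomorphic_at_mult) auto
  ultimately show ?case by blast
qed

lemma vector_field_diff:
  assumes "vector_field_at M p \<xi>" "vector_field_at M p \<eta>"
  shows "vector_field_at M p (\<lambda>q. \<xi> q - \<eta> q)"
  using vector_field_add[OF assms(1) vector_field_scale[OF assms(2) holomorphic_at_const[of _ _ "-1"]]]
  by (simp add: cscale_def fun_diff_def plus_fun_def)

lemma vector_field_sum:
  assumes "\<And>i. i \<in> I \<Longrightarrow> vector_field_at M p (X i)"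
  shows "vector_field_at M p (\<lambda>q. \<Sum>i\<in>I. X i q)"
  using assms by (induction I rule: infinite_finite_induct) (auto intro: vector_field_zero vector_field_add)

lemma sum_fun_apply: "(\<Sum>i\<in>I. X i) f = (\<Sum>i\<in>I. X i f)" for X :: "'a \<Rightarrow> 'b \<Rightarrow> complex"
  by (induction I rule: infinite_finite_induct) auto

lemma vector_field_cong:
  assumes "vector_field_at M p \<xi>" "\<forall>\<^sub>F q in near M p. \<xi> q = \<eta> q"
  shows "vector_field_at M p \<eta>"
  using assms(1) near_near[OF assms(2)] assms(2) unfolding vector_field_at_iff
proof eventually_elim
  case (elim q)
  have "holomorphic_at M q (\<lambda>q'. \<eta> q' f)" if "holomorphic_at M q f" for f
  proof (rule holomorphic_at_cong)
    show "holomorphic_at M q (\<lambda>q'. \<xi> q' f)" using elim that by blast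
    show "\<forall>\<^sub>F q' in near M q. \<xi> q' f = \<eta> q' f" using elim(2) by eventually_elim simp
  qed
  with elim show ?case by simp
qed

lemma lie_bracket_tangent:
  assumes \<xi>: "vector_field_at M p \<xi>" and \<eta>: "vector_field_at M p \<eta>" and p: "p \<in> M"
  shows "lie_bracket M \<xi> \<eta> p \<in> tangent_space M p"
proof -
  have T: "\<xi> p \<in> tangent_space M p" "\<eta> p \<in> tangent_space M p"
    using assms vector_field_tangent by blast+
  have half: "(f q = g q \<longrightarrow> True) \<and> \<alpha> p (\<lambda>q. \<beta> q (\<lambda>q. f q + g q)) = \<alpha> p (\<lambda>q. \<beta> q f) + \<alpha> p (\<lambda>q. \<beta> q g)
     \<and> \<alpha> p (\<lambda>q. \<beta> q (\<lambda>q. f q * g q)) = f p * \<alpha> p (\<lambda>q. \<beta> q g) + \<alpha> p f * \<beta> p g + g p * \<alpha> p (\<lambda>q. \<beta> q f) + \<alpha> p g * \<beta> p f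
     \<and> \<alpha> p (\<lambda>q. \<beta> q (\<lambda>q. c * f q)) = c * \<alpha> p (\<lambda>q. \<beta> q f)"
    if f: "holomorphic_at M p f" and g: "holomorphic_at M p g"
      and \<alpha>: "vector_field_at M p \<alpha>" and \<beta>: "vector_field_at M p \<beta>" for f g \<alpha> \<beta> c q
  proof (intro conjI)
    have A: "\<alpha> p \<in> tangent_space M p" using \<alpha> p by (rule vector_field_tangent)
    have ev: "\<forall>\<^sub>F q in near M p. holomorphic_at M q f \<and> holomorphic_at M q g \<and> \<beta> q \<in> tangent_space M q"
      using holomorphic_at_near[OF f] holomorphic_at_near[OF g] \<beta>[unfolded vector_field_at_iff]
      by eventually_elim auto
    have h: "holomorphic_at M p (\<lambda>q. \<beta> q f)" "holomorphic_at M p (\<lambda>q. \<beta> q g)"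
      using f g \<beta> p by (auto intro: vector_field_holomorphic)
    have "\<forall>\<^sub>F q in near M p. \<beta> q f + \<beta> q g = \<beta> q (\<lambda>q. f q + g q)"
      using ev by eventually_elim (auto simp: tangent_add)
    from tangent_germ[OF A holomorphic_at_add[OF h] this]
    show "\<alpha> p (\<lambda>q. \<beta> q (\<lambda>q. f q + g q)) = \<alpha> p (\<lambda>q. \<beta> q f) + \<alpha> p (\<lambda>q. \<beta> q g)"
      by (simp add: tangent_add[OF A h])
    have "\<forall>\<^sub>F q in near M p. c * \<beta> q f = \<beta> q (\<lambda>q. c * f q)"
      using ev by eventually_elim (auto simp: tangent_cmult)
    from tangent_germ[OF A holomorphic_at_cmult[OF h(1)] this]
    show "\<alpha> p (\<lambda>q. \<beta> q (\<lambda>q. c * f q)) = c * \<alpha> p (\<lambda>q. \<beta> q f)"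
      by (simp add: tangent_cmult[OF A h(1)])
    have "\<forall>\<^sub>F q in near M p. f q * \<beta> q g + g q * \<beta> q f = \<beta> q (\<lambda>q. f q * g q)"
      using ev by eventually_elim (auto simp: tangent_mult)
    from tangent_germ[OF A _ this, symmetric]
    show "\<alpha> p (\<lambda>q. \<beta> q (\<lambda>q. f q * g q)) = f p * \<alpha> p (\<lambda>q. \<beta> q g) + \<alpha> p f * \<beta> p g + g p * \<alpha> p (\<lambda>q. \<beta> q f) + \<alpha> p g * \<beta> p f"
      using f g h by (simp add: tangent_add[OF A] tangent_mult[OF A] holomorphic_at_mult holomorphic_at_add mult.commute)
  qed auto
  show ?thesis
    unfolding tangent_space_def lie_bracket_def mem_Collect_eq
  proof (intro conjI allI impI; (elim conjE)?)
    fix f g assume f: "holomorphic_at M p f" and g: "holomorphic_at M p g"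
    note half[OF f g \<xi> \<eta>] half[OF f g \<eta> \<xi>]
    then show "(if holomorphic_at M p (\<lambda>q. f q + g q) then \<xi> p (\<lambda>q'. \<eta> q' (\<lambda>q. f q + g q)) - \<eta> p (\<lambda>q'. \<xi> q' (\<lambda>q. f q + g q)) else 0) =
       (if holomorphic_at M p f then \<xi> p (\<lambda>q'. \<eta> q' f) - \<eta> p (\<lambda>q'. \<xi> q' f) else 0) +
       (if holomorphic_at M p g then \<xi> p (\<lambda>q'. \<eta> q' g) - \<eta> p (\<lambda>q'. \<xi> q' g) else 0)"
      using f g holomorphic_at_add[OF f g] by simp
    show "(if holomorphic_at M p (\<lambda>q. f q * g q) then \<xi> p (\<lambda>q'. \<eta> q' (\<lambda>q. f q * g q)) - \<eta> p (\<lambda>q'. \<xi> q' (\<lambda>q. f q * g q)) else 0) =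
       f p * (if holomorphic_at M p g then \<xi> p (\<lambda>q'. \<eta> q' g) - \<eta> p (\<lambda>q'. \<xi> q' g) else 0) +
       g p * (if holomorphic_at M p f then \<xi> p (\<lambda>q'. \<eta> q' f) - \<eta> p (\<lambda>q'. \<xi> q' f) else 0)"
      using f g holomorphic_at_mult[OF f g] half[OF f g \<xi> \<eta>] half[OF f g \<eta> \<xi>] by (simp add: algebra_simps)
  next
    fix c f assume f: "holomorphic_at M p f"
    show "(if holomorphic_at M p (\<lambda>q. c * f q) then \<xi> p (\<lambda>q'. \<eta> q' (\<lambda>q. c * f q)) - \<eta> p (\<lambda>q'. \<xi> q' (\<lambda>q. c * f q)) else 0) =
       c * (if holomorphic_at M p f then \<xi> p (\<lambda>q'. \<eta> q' f) - \<eta> p (\<lambda>q'. \<xi> q' f) else 0)"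
      using f holomorphic_at_cmult[OF f] half[OF f f \<xi> \<eta>] half[OF f f \<eta> \<xi>] by (simp add: algebra_simps)
  next
    fix f g assume f: "holomorphic_at M p f" and g: "holomorphic_at M p g" and fg: "germ_eq M p f g"
    have eq: "\<alpha> p (\<lambda>q'. \<beta> q' f) = \<alpha> p (\<lambda>q'. \<beta> q' g)" if \<alpha>: "vector_field_at M p \<alpha>" and \<beta>: "vector_field_at M p \<beta>" for \<alpha> \<beta>
    proof (rule tangent_germ[of "\<alpha> p"])
      show "\<alpha> p \<in> tangent_space M p" using \<alpha> p by (rule vector_field_tangent)
      show "holomorphic_at M p (\<lambda>q'. \<beta> q' f)" using \<beta> p f by (rule vector_field_holomorphic)
      show "\<forall>\<^sub>F q in near M p. \<beta> q f = \<beta> q g"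
        using near_near[OF fg[unfolded germ_eq_iff]] \<beta>[unfolded vector_field_at_iff] holomorphic_at_near[OF f]
        by eventually_elim (auto intro: tangent_germ)
    qed
    show "(if holomorphic_at M p f then \<xi> p (\<lambda>q'. \<eta> q' f) - \<eta> p (\<lambda>q'. \<xi> q' f) else 0) =
       (if holomorphic_at M p g then \<xi> p (\<lambda>q'. \<eta> q' g) - \<eta> p (\<lambda>q'. \<xi> q' g) else 0)"
      using f g by (simp only: eq[OF \<xi> \<eta>] eq[OF \<eta> \<xi>] if_True)
  qed auto
qed

section \<open>Charts\<close>

definition clinear_form :: "(complex ^ 'n \<Rightarrow> complex) \<Rightarrow> bool" where
  "clinear_form l \<longleftrightarrow> (\<forall>x y. l (x + y) = l x + l y) \<and> (\<forall>c x. l (c *s x) = c * l x)"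

lemma clinear_form_add: "clinear_form l \<Longrightarrow> l (x + y) = l x + l y"
  and clinear_form_scale: "clinear_form l \<Longrightarrow> l (c *s x) = c * l x"
  by (auto simp: clinear_form_def)

lemma clinear_form_sum:
  assumes "clinear_form l" shows "l (\<Sum>j\<in>A. c j *s b j) = (\<Sum>j\<in>A. c j * l (b j))"
proof -
  have "l (0 *s 0) = 0 * l 0" using assms unfolding clinear_form_def by blast
  then have "l 0 = 0" by simp
  then show ?thesis
    using assms by (induction A rule: infinite_finite_induct) (auto simp: clinear_form_def)
qed

lemma clinear_form_diff:
  assumes "clinear_form l" shows "l (x - y) = l x - l y"
proof -
  have "l (x + (-1) *s y) = l x + (-1) * l y" using assms unfolding clinear_form_def by metis
  then show ?thesis by simp
qed

lemma dual_vectors: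
  fixes l :: "nat \<Rightarrow> complex ^ 'n \<Rightarrow> complex"
  assumes "\<And>i. i < r \<Longrightarrow> clinear_form (l i)"
    and "\<And>a. (\<And>v. (\<Sum>i<r. a i * l i v) = 0) \<Longrightarrow> (\<And>i. i < r \<Longrightarrow> a i = 0)"
  shows "\<exists>b. \<forall>i<r. \<forall>j<r. l i (b j) = (if i = j then 1 else 0)"
  using assms
proof (induction r)
  case (Suc r)
  have "\<exists>b. \<forall>i<r. \<forall>j<r. l i (b j) = (if i = j then 1 else 0)"
  proof (rule Suc.IH)
    fix a and i :: nat assume a: "\<And>v. (\<Sum>i<r. a i * l i v) = 0" and i: "i < r"
    have "(\<Sum>i<Suc r. (if i = r then 0 else a i) * l i v) = 0" for v
      using a[of v] by (simp cong: sum.cong_simp)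
    from Suc.prems(2)[OF this, of i] i show "a i = 0" by auto
  qed (use Suc.prems(1) in auto)
  then obtain b where b: "\<And>i j. i < r \<Longrightarrow> j < r \<Longrightarrow> l i (b j) = (if i = j then 1 else 0)" by blast
  have lin: "clinear_form (l i)" if "i \<le> r" for i using Suc.prems(1) that by simp
  have "\<exists>v. l r v - (\<Sum>j<r. l r (b j) * l j v) \<noteq> 0"
  proof (rule ccontr)
    assume "\<nexists>v. l r v - (\<Sum>j<r. l r (b j) * l j v) \<noteq> 0"
    then have *: "l r v = (\<Sum>j<r. l r (b j) * l j v)" for v by (metis right_minus_eq)
    have "(\<Sum>i<Suc r. (if i = r then 1 else - l r (b i)) * l i v) = (\<Sum>i<r. - (l r (b i) * l i v)) + l r v" for v
      by (simp cong: sum.cong_simp)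
    then have "(\<Sum>i<Suc r. (if i = r then 1 else - l r (b i)) * l i v) = 0" for v
      by (subst (asm) *) (simp only: sum_negf add.left_inverse)
    from Suc.prems(2)[OF this, of r] show False by simp
  qed
  then obtain v where v: "l r v - (\<Sum>j<r. l r (b j) * l j v) \<noteq> 0" by blast
  define w where "w = (1 / (l r v - (\<Sum>j<r. l r (b j) * l j v))) *s (v - (\<Sum>j<r. l j v *s b j))"
  have lw: "l i w = (l i v - (\<Sum>j<r. l j v * l i (b j))) / (l r v - (\<Sum>j<r. l r (b j) * l j v))" if "i \<le> r" for i
    unfolding w_def clinear_form_scale[OF lin[OF that]] clinear_form_diff[OF lin[OF that]]
      clinear_form_sum[OF lin[OF that]] by simp
  have w0: "l i w = 0" if "i < r" for i
    using that by (simp add: lw b if_distrib cong: if_cong)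
  have w1: "l r w = 1" using v by (simp add: lw mult.commute)
  show ?case
  proof (intro exI allI impI)
    fix i j assume "i < Suc r" "j < Suc r"
    moreover have "l i (b j - l r (b j) *s w) = l i (b j) - l r (b j) * l i w" if "i \<le> r" for i j
      using lin[OF that] by (simp add: clinear_form_diff) (simp add: clinear_form_def)
    ultimately show "l i ((\<lambda>j. if j = r then w else b j - l r (b j) *s w) j) = (if i = j then 1 else 0)"
      by (auto simp: less_Suc_eq w0 w1 b)
  qed
qed auto

text \<open>
  A submanifold is flat in suitable ambient coordinates: with \<open>b j\<close> dual to the differentials of the
  equations \<open>g j\<close>, the map \<open>\<Phi> x = (x - x0) + (\<Sum>j. (g j x - dg j (x - x0)) *s b j)\<close> is
  tangent to the identity at \<open>x0\<close> and satisfies \<open>dg j \<circ> \<Phi> = g j\<close>, so it carries the cone over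
  \<open>M\<close> to the common kernel \<open>K\<close> of the differentials.
\<close>

lemma flattening:
  fixes M :: "'n::finite proj set"
  assumes M: "locally_closed_submanifold M" and p: "p \<in> M" "p \<in> affine_chart i"
  obtains \<Phi> \<psi> :: "complex ^ 'n \<Rightarrow> complex ^ 'n" and V K e where
    "e > 0" "open V" "sect i p \<in> V" "0 \<notin> V" "\<Phi> (sect i p) = 0"
    "homeomorphism V (ball 0 e) \<Phi> \<psi>"
    "\<And>k. cholomorphic_on (\<lambda>x. \<Phi> x $ k) V"
    "\<And>k. cholomorphic_on (\<lambda>y. \<psi> y $ k) (ball 0 e)"
    "(\<psi> has_derivative (\<lambda>h. h)) (at 0)"
    "\<And>x. x \<in> V \<Longrightarrow> line x \<in> M \<longleftrightarrow> \<Phi> x \<in> K"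
    "\<And>x y. x \<in> K \<Longrightarrow> y \<in> K \<Longrightarrow> x + y \<in> K" "\<And>c x. x \<in> K \<Longrightarrow> c *s x \<in> K"
    "\<And>D. D \<in> tangent_space M p \<Longrightarrow> tangent_coords i D \<in> K"
proof -
  from bspec[OF M[unfolded locally_closed_submanifold_def] p(1)]
  obtain U and g :: "nat \<Rightarrow> 'n proj \<Rightarrow> complex" and r where U: "open U" "p \<in> U" and g: "\<forall>j<r. proj_holomorphic_on (g j) U"
    and MU: "M \<inter> U = {q\<in>U. \<forall>j<r. g j q = 0}"
    and indep: "\<forall>x\<in>cone U. \<forall>a. (\<forall>v. (\<Sum>j<r. a j * frechet_derivative (\<lambda>y. g j (line y)) (at x) v) = 0)
          \<longrightarrow> (\<forall>j<r. a j = (0::complex))"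
    by (elim exE conjE) (rule that)
  define x0 where "x0 = sect i p"
  define G where "G j v = g j (line v)" for j v
  define l where "l j = frechet_derivative (G j) (at x0)" for j
  have x0: "x0 \<in> cone U" using U p by (simp add: x0_def in_cone_iff sect_nonzero line_sect)
  have cU: "open (cone U)" using U open_cone by blast
  have G: "cholomorphic_on (G j) (cone U)" if "j < r" for j
    using g that by (simp add: G_def[abs_def] proj_holomorphic_on_def)
  have dlin: "clinear_form (frechet_derivative (G j) (at x))" if "j < r" "x \<in> cone U" for j x
    using cholomorphic_onD[OF G[OF that(1)] that(2)] has_derivative_linear
    by (fastforce simp: clinear_form_def linear_add)
  have l: "clinear_form (l j)" if "j < r" for j
    using dlin[OF that x0] by (simp add: l_def)
  have "\<exists>b. \<forall>i<r. \<forall>j<r. l i (b j) = (if i = j then 1 else 0)"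
  proof (rule dual_vectors[OF l])
    fix a k assume "\<And>v. (\<Sum>j<r. a j * l j v) = 0" "k < r"
    then show "a k = 0" using indep x0 unfolding l_def G_def[abs_def] by blast
  qed
  then obtain b where b: "\<And>i j. i < r \<Longrightarrow> j < r \<Longrightarrow> l i (b j) = (if i = j then 1 else 0)" by blast
  define \<Phi> where "\<Phi> x = (x - x0) + (\<Sum>j<r. (G j x - l j (x - x0)) *s b j)" for x
  define \<Phi>' where "\<Phi>' x = Blinfun (\<lambda>h. h + (\<Sum>j<r. (frechet_derivative (G j) (at x) h - l j h) *s b j))" for x
  define K where "K = {y. \<forall>j<r. l j y = 0}"
  have lder: "(l j has_derivative l j) F" if "j < r" for j F
    using cholomorphic_onD(1)[OF G[OF that] x0] unfolding l_def
    by (blast intro: has_derivative_bounded_linear bounded_linear_imp_has_derivative)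
  have d0: "(\<Phi> has_derivative (\<lambda>h. h + (\<Sum>j<r. (frechet_derivative (G j) (at x) h - l j h) *s b j))) (at x)"
    if "x \<in> cone U" for x
  proof -
    have "((\<lambda>x. (G j x - l j (x - x0)) *s b j) has_derivative (\<lambda>h. (frechet_derivative (G j) (at x) h - l j h) *s b j)) (at x)"
      if "j < r" for j
    proof -
      have "((\<lambda>x. l j (x - x0)) has_derivative (\<lambda>h. l j h)) (at x)"
        by (rule has_derivative_compose[OF _ lder[OF that]]) (auto intro!: derivative_eq_intros)
      then have "((\<lambda>x. G j x - l j (x - x0)) has_derivative (\<lambda>h. frechet_derivative (G j) (at x) h - l j h)) (at x)"
        by (intro has_derivative_diff cholomorphic_onD(1)[OF G]) (use that \<open>x \<in> cone U\<close> in auto)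
      then show ?thesis by (rule bounded_linear.has_derivative[OF bounded_linear_smult_vec])
    qed
    then show ?thesis unfolding \<Phi>_def[abs_def]
      by (intro has_derivative_add has_derivative_sum) (auto intro!: derivative_eq_intros)
  qed
  have ap: "blinfun_apply (\<Phi>' x) = (\<lambda>h. h + (\<Sum>j<r. (frechet_derivative (G j) (at x) h - l j h) *s b j))"
    if "x \<in> cone U" for x
    unfolding \<Phi>'_def by (rule bounded_linear_Blinfun_apply[OF has_derivative_bounded_linear[OF d0[OF that]]])
  have d: "(\<Phi> has_derivative blinfun_apply (\<Phi>' x)) (at x)" if "x \<in> cone U" for x
    using d0[OF that] by (simp add: ap[OF that])
  have ct: "continuous_on (cone U) \<Phi>'"
  proof (rule continuous_on_blinfun_componentwise)
    fix h :: "complex ^ 'n"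
    have "continuous_on (cone U) (\<lambda>x. h + (\<Sum>j<r. (frechet_derivative (G j) (at x) h - l j h) *s b j))"
      by (intro continuous_intros cholomorphic_on_imp_continuous_on[OF cholomorphic_on_frechet_derivative[OF G cU]]) auto
    then show "continuous_on (cone U) (\<lambda>x. \<Phi>' x h)"
      by (rule continuous_on_eq) (simp add: ap)
  qed
  have id0: "\<Phi>' x0 = id_blinfun"
    by (rule blinfun_eqI) (simp add: ap[OF x0] l_def)
  then have inv: "id_blinfun o\<^sub>L \<Phi>' x0 = id_blinfun" by (simp add: blinfun_eqI)
  obtain U' W \<psi> \<psi>' where U': "open U'" "U' \<subseteq> cone U" "x0 \<in> U'" and W: "open W" "\<Phi> x0 \<in> W"
    and hom: "homeomorphism U' W \<Phi> \<psi>"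
    and \<psi>: "\<And>y. y \<in> W \<Longrightarrow> (\<psi> has_derivative \<psi>' y) (at y)"
      "\<And>y. y \<in> W \<Longrightarrow> \<psi>' y = inv_into UNIV (blinfun_apply (\<Phi>' (\<psi> y)))"
      "\<And>y. y \<in> W \<Longrightarrow> bij (blinfun_apply (\<Phi>' (\<psi> y)))"
    by (rule inverse_function_theorem[OF cU d ct x0 inv]) auto
  have l0: "l j 0 = 0" if "j < r" for j using clinear_form_sum[OF l[OF that], of _ _ "{}"] by simp
  have \<Phi>0: "\<Phi> x0 = 0"
  proof -
    have "G j x0 = 0" if "j < r" for j
      using MU p U that by (auto simp: G_def x0_def line_sect)
    then show ?thesis by (simp add: \<Phi>_def l0)
  qed
  have l\<Phi>: "l k (\<Phi> x) = G k x" if "k < r" for k x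
  proof -
    have "l k (\<Phi> x) = l k (x - x0) + (\<Sum>j<r. (G j x - l j (x - x0)) * l k (b j))"
      unfolding \<Phi>_def clinear_form_add[OF l[OF that]] clinear_form_sum[OF l[OF that]] ..
    then show ?thesis using that by (simp add: b if_distrib cong: if_cong)
  qed
  obtain e where e: "e > 0" "ball 0 e \<subseteq> W" using W \<Phi>0 by (metis open_contains_ball)
  define V where "V = U' \<inter> \<Phi> -` ball 0 e"
  have \<Phi>U': "continuous_on U' \<Phi>" and \<psi>W: "\<psi> ` W = U'" "\<Phi> ` U' = W"
    "\<And>x. x \<in> U' \<Longrightarrow> \<psi> (\<Phi> x) = x" "\<And>y. y \<in> W \<Longrightarrow> \<Phi> (\<psi> y) = y" "continuous_on W \<psi>"
    using hom by (auto simp: homeomorphism_def)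
  have \<psi>0: "\<psi> 0 = x0" using \<psi>W(3)[OF U'(3)] \<Phi>0 by simp
  show ?thesis
  proof (rule that[of e V \<Phi> \<psi> K])
    show "e > 0" by fact
    show "open V" unfolding V_def using \<Phi>U' U'(1) by (metis Int_commute continuous_on_open_vimage open_ball)
    show "sect i p \<in> V" "\<Phi> (sect i p) = 0" using U'(3) e \<Phi>0 by (auto simp: V_def x0_def)
    show "0 \<notin> V" using U'(2) by (auto simp: V_def in_cone_iff)
    have "\<Phi> ` V = ball 0 e"
    proof (intro equalityI subsetI)
      fix y :: "complex ^ 'n" assume "y \<in> ball 0 e"
      then have "y \<in> W" using e by auto
      then have "\<Phi> (\<psi> y) = y" "\<psi> y \<in> U'" using \<psi>W by auto
      with \<open>y \<in> ball 0 e\<close> show "y \<in> \<Phi> ` V" unfolding V_def by (metis (no_types) IntI imageI vimageI)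
    qed (auto simp: V_def)
    moreover have "\<psi> ` ball 0 e = V"
    proof (intro equalityI subsetI)
      fix x assume "x \<in> V"
      then show "x \<in> \<psi> ` ball 0 e" using \<psi>W(3) unfolding V_def by (metis IntE image_eqI vimageE)
    qed (use e \<psi>W in \<open>auto simp: V_def\<close>)
    ultimately show "homeomorphism V (ball 0 e) \<Phi> \<psi>"
      unfolding homeomorphism_def using \<psi>W e \<Phi>U' by (auto simp: V_def intro: continuous_on_subset)
    show "cholomorphic_on (\<lambda>x. \<Phi> x $ k) V" for k
      unfolding cholomorphic_on_def
    proof
      fix x assume "x \<in> V"
      then have x: "x \<in> cone U" using U'(2) by (auto simp: V_def)
      have "\<forall>c v. blinfun_apply (\<Phi>' x) (c *s v) = c *s blinfun_apply (\<Phi>' x) v"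
        using dlin[OF _ x] l
        by (auto simp: ap[OF x] vec.scale_sum_right vector_add_ldistrib clinear_form_def vector_smult_assoc
            simp flip: right_diff_distrib intro!: sum.cong)
      then show "\<exists>F'. ((\<lambda>x. \<Phi> x $ k) has_derivative F') (at x) \<and> (\<forall>c v. F' (c *s v) = c * F' v)"
        using bounded_linear.has_derivative[OF bounded_linear_vec_nth d[OF x]] by (auto intro!: exI)
    qed
    show "cholomorphic_on (\<lambda>y. \<psi> y $ k) (ball 0 e)" for k
      unfolding cholomorphic_on_def
    proof
      fix y :: "complex ^ 'n" assume "y \<in> ball 0 e"
      then have y: "y \<in> W" using e by auto
      then have x: "\<psi> y \<in> cone U" using \<psi>W U'(2) by auto
      let ?f = "blinfun_apply (\<Phi>' (\<psi> y))"
      have hom: "?f (c *s v) = c *s ?f v" for c v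
        using dlin[OF _ x] l
        by (auto simp: ap[OF x] vec.scale_sum_right vector_add_ldistrib clinear_form_def vector_smult_assoc
            simp flip: right_diff_distrib intro!: sum.cong)
      have "inv_into UNIV ?f (c *s v) = c *s inv_into UNIV ?f v" for c v
        using \<psi>(3)[OF y] hom by (metis bij_inv_eq_iff)
      then show "\<exists>F'. ((\<lambda>y. \<psi> y $ k) has_derivative F') (at y) \<and> (\<forall>c v. F' (c *s v) = c * F' v)"
        using bounded_linear.has_derivative[OF bounded_linear_vec_nth \<psi>(1)[OF y]] \<psi>(2)[OF y] by (auto intro!: exI)
    qed
    have "\<psi>' 0 = (\<lambda>h. h)"
    proof -
      have "blinfun_apply (\<Phi>' (\<psi> 0)) = id" by (simp add: \<psi>0 id0 id_def id_blinfun.rep_eq fun_eq_iff)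
      then show ?thesis using \<psi>(2)[of 0] e by (auto simp: id_def[symmetric] subset_iff)
    qed
    then show "(\<psi> has_derivative (\<lambda>h. h)) (at 0)" using \<psi>(1)[of 0] e by (auto simp: subset_iff)
    show "line x \<in> M \<longleftrightarrow> \<Phi> x \<in> K" if "x \<in> V" for x
    proof -
      have "line x \<in> U" using that U'(2) by (auto simp: V_def in_cone_iff)
      then have "line x \<in> M \<longleftrightarrow> (\<forall>j<r. G j x = 0)" using MU by (auto simp: G_def)
      then show ?thesis by (auto simp: K_def l\<Phi>)
    qed
    show "x + y \<in> K" if "x \<in> K" "y \<in> K" for x y using that l by (auto simp: K_def clinear_form_def)
    show "c *s x \<in> K" if "x \<in> K" for c x using that l by (auto simp: K_def clinear_form_def)
    show "tangent_coords i D \<in> K" if D: "D \<in> tangent_space M p" for D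
      unfolding K_def
    proof (intro CollectI allI impI)
      fix j assume j: "j < r"
      have "\<forall>\<^sub>F q in near M p. (0::complex) = g j q"
        using near_open[OF U] near_in by eventually_elim (use MU j in auto)
      from tangent_frechet[OF D p g[rule_format, OF j] U(2) this]
      show "l j (tangent_coords i D) = 0"
        using tangent_const[OF D] by (simp add: l_def G_def[abs_def] x0_def)
    qed
  qed
qed

lemma has_derivative_vecI:
  fixes G :: "'a::real_normed_vector \<Rightarrow> complex ^ 'n"
  assumes "\<And>k. ((\<lambda>x. G x $ k) has_derivative (\<lambda>h. G' h $ k)) (at x)"
  shows "(G has_derivative G') (at x)"
  unfolding has_derivative_componentwise_within[of G]
proof
  fix b :: "complex ^ 'n" assume "b \<in> Basis"
  then obtain k u where b: "b = axis k u" by (auto simp: Basis_vec_def)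
  show "((\<lambda>x. G x \<bullet> b) has_derivative (\<lambda>h. G' h \<bullet> b)) (at x)"
    unfolding b inner_axis by (intro has_derivative_inner_left assms)
qed

lemma has_derivative_along_line:
  fixes \<psi> :: "complex ^ 'm \<Rightarrow> complex ^ 'n"
  assumes "\<And>k. cholomorphic_on (\<lambda>y. \<psi> y $ k) B" "y + t *s u \<in> B"
  shows "((\<lambda>t. \<psi> (y + t *s u)) has_derivative
    (\<lambda>h. h *s (\<chi> k. frechet_derivative (\<lambda>y. \<psi> y $ k) (at (y + t *s u)) u))) (at t)"
proof (rule has_derivative_vecI)
  fix k
  show "((\<lambda>t. \<psi> (y + t *s u) $ k) has_derivative
    (\<lambda>h. (h *s (\<chi> k. frechet_derivative (\<lambda>y. \<psi> y $ k) (at (y + t *s u)) u)) $ k)) (at t)"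
    using field_derivative_along_line[OF assms] 
    by (simp add: has_field_derivative_def mult_commute_abs)
qed

lemma isCont_eventually_in: "isCont c t \<Longrightarrow> open U \<Longrightarrow> c t \<in> U \<Longrightarrow> eventually (\<lambda>s. c s \<in> U) (nhds t)"
  unfolding continuous_at_open eventually_nhds by blast

lemma derivative_along_curve:
  assumes F: "proj_holomorphic_on F U" "line (c t) \<in> U" "\<And>q. q \<in> M \<Longrightarrow> q \<in> U \<Longrightarrow> f q = F q"
    and c: "(c has_derivative (\<lambda>h. h *s c')) (at t)" "c t \<noteq> 0" "eventually (\<lambda>s. line (c s) \<in> M) (nhds t)"
  shows "((\<lambda>s. f (line (c s))) has_field_derivative frechet_derivative (\<lambda>v. F (line v)) (at (c t)) c') (at t)"
proof -
  have F': "cholomorphic_on (\<lambda>v. F (line v)) (cone U)" "open (cone U)"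
    using F(1) by (auto simp: proj_holomorphic_on_def intro: open_cone)
  have ct: "c t \<in> cone U" using F(2) c(2) by (simp add: in_cone_iff)
  from has_derivative_compose[OF c(1) cholomorphic_onD(1)[OF F'(1) ct]]
  have d: "((\<lambda>s. F (line (c s))) has_field_derivative frechet_derivative (\<lambda>v. F (line v)) (at (c t)) c') (at t)"
    by (simp add: has_field_derivative_def cholomorphic_onD(2)[OF F'(1) ct] mult_commute_abs)
  have "isCont c t" using c(1) by (rule has_derivative_continuous)
  then have "eventually (\<lambda>s. c s \<in> cone U) (nhds t)"
    using F'(2) ct by (rule isCont_eventually_in)
  then have "eventually (\<lambda>s. f (line (c s)) = F (line (c s))) (nhds t)"
    using c(3) by eventually_elim (auto simp: in_cone_iff F(3))
  from DERIV_cong_ev[OF refl this refl] d show ?thesis by (rule iffD2)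
qed

lemma holomorphic_along_curve:
  assumes f: "holomorphic_at M (line (c t)) f"
    and c: "(c has_derivative (\<lambda>h. h *s c')) (at t)" "c t \<noteq> 0" "eventually (\<lambda>s. line (c s) \<in> M) (nhds t)"
  shows "(\<lambda>s. f (line (c s))) field_differentiable (at t)"
proof -
  obtain U F where "line (c t) \<in> U" "proj_holomorphic_on F U" "\<forall>q\<in>M \<inter> U. f q = F q"
    using f by (auto simp: holomorphic_at_def)
  then show ?thesis using derivative_along_curve[OF _ _ _ c] field_differentiable_def by (metis IntI)
qed

definition uniqueness_domain :: "'n::finite proj set \<Rightarrow> 'n proj set \<Rightarrow> bool" where
  "uniqueness_domain M U \<longleftrightarrow> (\<forall>f B. (\<forall>q\<in>M \<inter> U. holomorphic_at M q f) \<and> open B \<and> M \<inter> U \<inter> B \<noteq> {}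
     \<and> (\<forall>q\<in>M \<inter> U \<inter> B. f q = 0) \<longrightarrow> (\<forall>q\<in>M \<inter> U. f q = 0))"

text \<open>
  In a flat chart any two points of \<open>M\<close> lie on a complex line, along which a holomorphic function of
  one variable is determined by its values near one point.
\<close>

lemma identity_theorem:
  fixes M :: "'n::finite proj set"
  assumes M: "locally_closed_submanifold M" and p: "p \<in> M"
  obtains U where "open U" "p \<in> U" "uniqueness_domain M U"
proof -
  obtain i where i: "p \<in> affine_chart i" using ex_affine_chart by blast
  obtain \<Phi> \<psi> :: "complex ^ 'n \<Rightarrow> complex ^ 'n" and V K e where ch:
    "e > 0" "open V" "sect i p \<in> V" "0 \<notin> V" "homeomorphism V (ball 0 e) \<Phi> \<psi>"
    "\<And>k. cholomorphic_on (\<lambda>y. \<psi> y $ k) (ball 0 e)"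
    "\<And>x. x \<in> V \<Longrightarrow> line x \<in> M \<longleftrightarrow> \<Phi> x \<in> K"
    "\<And>x y. x \<in> K \<Longrightarrow> y \<in> K \<Longrightarrow> x + y \<in> K" "\<And>c x. x \<in> K \<Longrightarrow> c *s x \<in> K"
    by (rule flattening[OF M p i]) (rule that, assumption+)
  have hom: "\<And>x. x \<in> V \<Longrightarrow> \<psi> (\<Phi> x) = x" "\<And>x. x \<in> V \<Longrightarrow> \<Phi> x \<in> ball 0 e"
    "\<And>y. y \<in> ball 0 e \<Longrightarrow> \<psi> y \<in> V" "\<And>y. y \<in> ball 0 e \<Longrightarrow> \<Phi> (\<psi> y) = y"
    using ch(5) by (auto simp: homeomorphism_def)
  show ?thesis
  proof (rule that[of "line ` V"])
    show "open (line ` V)" by (rule open_image_line) (use ch in auto)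
    show "p \<in> line ` V" using ch(3) line_sect[OF i] by force
    show "uniqueness_domain M (line ` V)"
      unfolding uniqueness_domain_def
    proof (intro allI impI ballI, elim conjE)
    fix f B q assume f: "\<forall>q\<in>M \<inter> line ` V. holomorphic_at M q f" and B: "open B" "M \<inter> line ` V \<inter> B \<noteq> {}"
      and f0: "\<forall>q\<in>M \<inter> line ` V \<inter> B. f q = 0" and q: "q \<in> M \<inter> line ` V"
    note f = f[rule_format] and f0 = f0[rule_format]
    obtain x where x: "x \<in> V" "line x \<in> M" "line x \<in> B" using B by auto
    obtain x' where x': "x' \<in> V" "line x' = q" "q \<in> M" using q by auto
    define u where "u = \<Phi> x' - \<Phi> x"
    have K: "\<Phi> x + t *s u \<in> K" for t
      using ch(7)[OF x(1)] ch(7)[OF x'(1)] x x' ch(8) ch(9)[of "\<Phi> x" "1 - t"] ch(9)[of "\<Phi> x'" t]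
      by (auto simp: u_def algebra_simps) (metis (no_types, lifting) ab_semigroup_add_class.add_ac(1) add.commute diff_add_eq)
    define T where "T = {t. \<Phi> x + t *s u \<in> ball 0 e}"
    have cl: "continuous_on UNIV (\<lambda>t. \<Phi> x + t *s u)" by (intro continuous_intros)
    have T: "open T" unfolding T_def using cl open_vimage[of "ball 0 e" "\<lambda>t. \<Phi> x + t *s u"] by (simp add: vimage_def)
    have "convex T"
    proof (rule convexI)
      fix s t and a b :: real assume *: "s \<in> T" "t \<in> T" "0 \<le> a" "0 \<le> b" "a + b = 1"
      then have "a *\<^sub>R (\<Phi> x + s *s u) + b *\<^sub>R (\<Phi> x + t *s u) \<in> ball 0 e"
        by (intro convexD[OF convex_ball]) (auto simp: T_def)
      moreover have "a *\<^sub>R (\<Phi> x + s *s u) + b *\<^sub>R (\<Phi> x + t *s u) = \<Phi> x + (a *\<^sub>R s + b *\<^sub>R t) *s u"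
      proof -
        have "a *\<^sub>R \<Phi> x + b *\<^sub>R \<Phi> x = \<Phi> x" using *(5) by (metis scaleR_add_left scaleR_one)
        moreover have "(r *\<^sub>R z) *s u = r *\<^sub>R (z *s u)" for r z by (simp add: vec_eq_iff)
        ultimately show ?thesis by (simp add: scaleR_add_right vector_sadd_rdistrib algebra_simps)
      qed
      ultimately show "a *\<^sub>R s + b *\<^sub>R t \<in> T" by (simp add: T_def)
    qed
    then have conn: "connected T" by (rule convex_connected)
    have T01: "0 \<in> T" "1 \<in> T" using hom(2)[OF x(1)] hom(2)[OF x'(1)] by (auto simp: T_def u_def)
    define h where "h t = f (line (\<psi> (\<Phi> x + t *s u)))" for t
    have inM: "line (\<psi> (\<Phi> x + t *s u)) \<in> M \<inter> line ` V" if "t \<in> T" for t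
      using that ch(7)[OF hom(3)] hom(3,4) K by (auto simp: T_def)
    have "h field_differentiable (at t)" if t: "t \<in> T" for t
      unfolding h_def
    proof (rule holomorphic_along_curve)
      show "holomorphic_at M (line (\<psi> (\<Phi> x + t *s u))) f" using inM[OF t] f by blast
      show "((\<lambda>t. \<psi> (\<Phi> x + t *s u)) has_derivative (\<lambda>h. h *s (\<chi> k. frechet_derivative (\<lambda>y. \<psi> y $ k) (at (\<Phi> x + t *s u)) u))) (at t)"
        by (rule has_derivative_along_line[OF ch(6)]) (use t in \<open>simp add: T_def\<close>)
      show "\<psi> (\<Phi> x + t *s u) \<noteq> 0" using hom(3)[of "\<Phi> x + t *s u"] t ch(4) by (auto simp: T_def)
      show "eventually (\<lambda>s. line (\<psi> (\<Phi> x + s *s u)) \<in> M) (nhds t)"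
        using eventually_nhds_in_open[OF T t] by eventually_elim (use inM in blast)
    qed
    then have holo: "h holomorphic_on T" by (meson field_differentiable_at_within holomorphic_onI)
    define S where "S = {t \<in> T. line (\<psi> (\<Phi> x + t *s u)) \<in> B}"
    have "continuous_on T (\<lambda>t. line (\<psi> (\<Phi> x + t *s u)))"
    proof (rule continuous_on_compose2[OF continuous_on_line[OF ch(4)]])
      show "continuous_on T (\<lambda>t. \<psi> (\<Phi> x + t *s u))"
        by (rule continuous_on_compose2[OF homeomorphism_cont2[OF ch(5)] continuous_on_subset[OF cl]])
          (auto simp: T_def)
      show "(\<lambda>t. \<psi> (\<Phi> x + t *s u)) ` T \<subseteq> V"
        using hom(3) unfolding T_def by blast
    qed
    then have "open S" unfolding S_def using T B(1) continuous_on_open_vimage[OF T, of "\<lambda>t. line (\<psi> (\<Phi> x + t *s u))"]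
      by (simp add: vimage_def Int_def conj_commute)
    moreover have "0 \<in> S" using T01 x hom(1)[OF x(1)] by (simp add: S_def)
    ultimately have lim: "0 islimpt S" by (metis interior_limit_point interior_open)
    have "h 1 = 0"
      by (rule analytic_continuation[OF holo T conn _ T01(1) lim _ T01(2)])
        (use inM f0 in \<open>auto simp: S_def h_def\<close>)
    then show "f q = 0" using hom(1)[OF x'(1)] x' by (simp add: h_def u_def)
    qed
  qed
qed

lemma tangent_vector_extends:
  fixes M :: "'n::finite proj set"
  assumes M: "locally_closed_submanifold M" and p: "p \<in> M" and D: "D \<in> tangent_space M p"
  obtains \<xi> where "vector_field_at M p \<xi>" "\<xi> p = D"
proof -
  obtain i where i: "p \<in> affine_chart i" using ex_affine_chart by blast
  obtain \<Phi> \<psi> :: "complex ^ 'n \<Rightarrow> complex ^ 'n" and V K e where ch: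
    "e > 0" "open V" "sect i p \<in> V" "0 \<notin> V" "homeomorphism V (ball 0 e) \<Phi> \<psi>"
    "\<And>k. cholomorphic_on (\<lambda>y. \<psi> y $ k) (ball 0 e)"
    "\<And>x. x \<in> V \<Longrightarrow> line x \<in> M \<longleftrightarrow> \<Phi> x \<in> K"
    "\<And>x y. x \<in> K \<Longrightarrow> y \<in> K \<Longrightarrow> x + y \<in> K" "\<And>c x. x \<in> K \<Longrightarrow> c *s x \<in> K"
    "\<And>k. cholomorphic_on (\<lambda>x. \<Phi> x $ k) V" "(\<psi> has_derivative (\<lambda>h. h)) (at 0)" "\<Phi> (sect i p) = 0"
    and "\<And>D. D \<in> tangent_space M p \<Longrightarrow> tangent_coords i D \<in> K"
    by (rule flattening[OF M p i]) (rule that, assumption+)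
  then have uK: "tangent_coords i D \<in> K" using D by blast
  have hom: "\<And>x. x \<in> V \<Longrightarrow> \<psi> (\<Phi> x) = x" "\<And>x. x \<in> V \<Longrightarrow> \<Phi> x \<in> ball 0 e"
    "\<And>y. y \<in> ball 0 e \<Longrightarrow> \<psi> y \<in> V" "\<And>y. y \<in> ball 0 e \<Longrightarrow> \<Phi> (\<psi> y) = y"
    using ch(5) by (auto simp: homeomorphism_def)
  define u where "u = tangent_coords i D"
  define c where "c q t = \<psi> (\<Phi> (sect i q) + t *s u)" for q t
  define c' where "c' x = (\<chi> k. frechet_derivative (\<lambda>y. \<psi> y $ k) (at (\<Phi> x)) u)" for x
  define \<xi> where "\<xi> q f = (if holomorphic_at M q f then deriv (\<lambda>t. f (line (c q t))) 0 else 0)" for q f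
  define N where "N = {q \<in> affine_chart i. sect i q \<in> V}"
  have N: "open N" "p \<in> N" unfolding N_def using open_sect_vimage ch i by auto
  have c0: "c q 0 = sect i q" "line (c q 0) = q" "c q 0 \<noteq> 0" if "q \<in> N" for q
    using that hom(1) by (auto simp: c_def N_def line_sect sect_nonzero)
  have cd: "(c q has_derivative (\<lambda>h. h *s c' (sect i q))) (at 0)" if "q \<in> N" for q
    using has_derivative_along_line[OF ch(6), of "\<Phi> (sect i q)" 0 u] hom(2) that
    by (simp add: c_def[abs_def] c'_def N_def)
  have cM: "eventually (\<lambda>t. line (c q t) \<in> M) (nhds 0)" if "q \<in> N" "q \<in> M" for q
  proof -
    have q: "sect i q \<in> V" "\<Phi> (sect i q) \<in> K" using that ch(7)[of "sect i q"] by (auto simp: N_def line_sect)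
    have "continuous_on UNIV (\<lambda>t. \<Phi> (sect i q) + t *s u)" by (intro continuous_intros)
    then have "open ((\<lambda>t. \<Phi> (sect i q) + t *s u) -` ball 0 e)" by (intro open_vimage) auto
    then have "eventually (\<lambda>t. t \<in> (\<lambda>t. \<Phi> (sect i q) + t *s u) -` ball 0 e) (nhds 0)"
      by (rule eventually_nhds_in_open) (use hom(2)[OF q(1)] in simp)
    then show ?thesis
    proof eventually_elim
      case (elim t)
      then have "c q t \<in> V" "\<Phi> (c q t) = \<Phi> (sect i q) + t *s u" using hom(3,4) by (auto simp: c_def)
      then show ?case using ch(7,8,9) q uK by (simp add: u_def)
    qed
  qed
  have diff: "(\<lambda>t. f (line (c q t))) field_differentiable (at 0)" if "holomorphic_at M q f" "q \<in> N" "q \<in> M" for q f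
    by (rule holomorphic_along_curve[OF _ cd _ cM]) (use that c0 in auto)
  have tan: "\<xi> q \<in> tangent_space M q" if q: "q \<in> N" "q \<in> M" for q
    unfolding tangent_space_def mem_Collect_eq
  proof (intro conjI allI impI; (elim conjE)?)
    fix f g assume f: "holomorphic_at M q f" and g: "holomorphic_at M q g"
    note d = diff[OF f q] diff[OF g q]
    show "\<xi> q (\<lambda>q. f q + g q) = \<xi> q f + \<xi> q g"
      using f g holomorphic_at_add[OF f g] d by (simp add: \<xi>_def)
    show "\<xi> q (\<lambda>q. f q * g q) = f q * \<xi> q g + g q * \<xi> q f"
      using f g holomorphic_at_mult[OF f g] d by (simp add: \<xi>_def c0(2)[OF q(1)])
  next
    fix f g assume f: "holomorphic_at M q f" and g: "holomorphic_at M q g" and fg: "germ_eq M q f g"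
    then obtain U where U: "open U" "q \<in> U" "\<forall>q\<in>M \<inter> U. f q = g q" by (auto simp: germ_eq_def)
    have "isCont (c q) 0" using cd[OF q(1)] by (rule has_derivative_continuous)
    moreover have "open (cone U)" "c q 0 \<in> cone U" using U open_cone c0[OF q(1)] by (auto simp: in_cone_iff)
    ultimately have "eventually (\<lambda>t. c q t \<in> cone U) (nhds 0)"
      by (rule isCont_eventually_in)
    then have "eventually (\<lambda>t. f (line (c q t)) = g (line (c q t))) (nhds 0)"
      using cM[OF q] by eventually_elim (use U in \<open>auto simp: in_cone_iff\<close>)
    then show "\<xi> q f = \<xi> q g" using f g by (simp add: \<xi>_def deriv_cong_ev)
  next
    fix a f assume f: "holomorphic_at M q f"
    then show "\<xi> q (\<lambda>q. a * f q) = a * \<xi> q f"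
      using holomorphic_at_cmult[OF f] diff[OF f q] by (simp add: \<xi>_def)
  qed (simp add: \<xi>_def)
  have val: "\<xi> q f = frechet_derivative (\<lambda>v. F (line v)) (at (sect i q)) (c' (sect i q))"
    if q: "q \<in> N" "q \<in> M" and F: "proj_holomorphic_on F U" "q \<in> U" "\<And>q. q \<in> M \<Longrightarrow> q \<in> U \<Longrightarrow> f q = F q" for q f F U
  proof -
    have "holomorphic_at M q f" using F by (auto simp: holomorphic_at_def)
    moreover have "((\<lambda>t. f (line (c q t))) has_field_derivative frechet_derivative (\<lambda>v. F (line v)) (at (c q 0)) (c' (sect i q))) (at 0)"
      by (rule derivative_along_curve[OF F(1) _ F(3) cd[OF q(1)] _ cM[OF q]]) (use F c0[OF q(1)] in auto)
    ultimately show ?thesis using c0[OF q(1)] by (simp add: \<xi>_def DERIV_imp_deriv)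
  qed
  have c'k: "cholomorphic_on (\<lambda>x. c' x $ k) V" for k
    unfolding c'_def vec_lambda_beta
    by (rule cholomorphic_on_compose[OF cholomorphic_on_frechet_derivative[OF ch(6)] _ ch(10)]) (use hom in auto)
  have hol: "holomorphic_at M q (\<lambda>q'. \<xi> q' f)" if f: "holomorphic_at M q f" and q: "q \<in> N" "q \<in> M" for q f
  proof -
    obtain U F where U: "q \<in> U" "proj_holomorphic_on F U" "\<forall>q\<in>M \<inter> U. f q = F q"
      using f by (auto simp: holomorphic_at_def)
    have F: "cholomorphic_on (\<lambda>v. F (line v)) (cone U)" "open (cone U)"
      using U(2) by (auto simp: proj_holomorphic_on_def intro: open_cone)
    define G where "G x = (\<Sum>k\<in>UNIV. c' x $ k * frechet_derivative (\<lambda>v. F (line v)) (at x) (axis k 1))" for x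
    have sumG: "cholomorphic_on (\<lambda>x. \<Sum>k\<in>A. c' x $ k * frechet_derivative (\<lambda>v. F (line v)) (at x) (axis k 1)) (V \<inter> cone U)"
      if "finite A" for A
      using that
      by induction (auto intro!: cholomorphic_on_const cholomorphic_on_add cholomorphic_on_mult
          cholomorphic_on_subset[OF c'k] cholomorphic_on_subset[OF cholomorphic_on_frechet_derivative[OF F]])
    have "holomorphic_at M q (\<lambda>q. G (sect i q))"
      unfolding G_def
      by (rule holomorphic_at_comp_sect[OF sumG]) (use q U ch(2) F(2) in \<open>auto simp: N_def in_cone_iff sect_nonzero line_sect\<close>)
    moreover have "\<forall>\<^sub>F q' in near M q. G (sect i q') = \<xi> q' f"
      using near_open[OF N(1) q(1)] near_open[OF proj_holomorphic_on_open[OF U(2)] U(1)] near_in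
    proof eventually_elim
      case (elim q')
      have "sect i q' \<in> cone U" using elim by (auto simp: N_def in_cone_iff sect_nonzero line_sect)
      then have "frechet_derivative (\<lambda>v. F (line v)) (at (sect i q')) (c' (sect i q')) = G (sect i q')"
        unfolding G_def by (rule frechet_derivative_expansion[OF F(1)])
      then show ?case using val[OF elim(1,3) U(2) elim(2)] U(3) by auto
    qed
    ultimately show ?thesis by (rule holomorphic_at_cong)
  qed
  show ?thesis
  proof (rule that[of \<xi>])
    show "vector_field_at M p \<xi>"
      unfolding vector_field_at_iff using near_open[OF N] near_in
      by eventually_elim (use tan hol in blast)
    have c'p: "c' (sect i p) = u"
    proof -
      have "frechet_derivative (\<lambda>y. \<psi> y $ k) (at 0) u = u $ k" for k
        using bounded_linear.has_derivative[OF bounded_linear_vec_nth ch(11), of k] by (metis frechet_derivative_at)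
      then show ?thesis by (simp add: c'_def ch(12) vec_eq_iff)
    qed
    show "\<xi> p = D"
    proof
      fix f show "\<xi> p f = D f"
      proof (cases "holomorphic_at M p f")
        case True
        then obtain U F where U: "p \<in> U" "proj_holomorphic_on F U" "\<forall>q\<in>M \<inter> U. f q = F q"
          by (auto simp: holomorphic_at_def)
        then have "\<forall>\<^sub>F q in near M p. f q = F q" by (auto simp: eventually_near dest: proj_holomorphic_on_open)
        from tangent_frechet[OF D p i U(2,1) this] val[OF N(2) p U(2,1)] U(3) c'p
        show ?thesis by (simp add: u_def)
      qed (simp add: \<xi>_def tangent_off[OF D])
    qed
  qed
qed

section \<open>Adapted frames\<close>

lemma comb_apply: "(\<Sum>i\<in>I. cscale (c i) (X i)) f = (\<Sum>i\<in>I. c i * X i f)"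
  by (simp add: sum_fun_apply cscale_def)

lemma sum_times_delta:
  fixes c x :: "nat \<Rightarrow> complex"
  assumes "j < r" "\<And>i. i < r \<Longrightarrow> x i = (if i = j then 1 else 0)"
  shows "(\<Sum>i<r. c i * x i) = c j"
proof -
  have "(\<Sum>i<r. c i * x i) = (\<Sum>i<r. if i = j then c i else 0)"
    by (rule sum.cong) (auto simp: assms(2))
  then show ?thesis using assms(1) by simp
qed

lemma in_span_family_iff:
  "v \<in> cfun.span (f ` {..<r::nat}) \<longleftrightarrow> (\<exists>c. v = (\<Sum>i<r. cscale (c i) (f i)))"
proof
  assume "v \<in> cfun.span (f ` {..<r})"
  then show "\<exists>c. v = (\<Sum>i<r. cscale (c i) (f i))"
  proof (induction rule: cfun.span_induct_alt)
    case base
    show ?case by (intro exI[of _ "\<lambda>i. 0"]) simp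
  next
    case (step c x y)
    then obtain d j where d: "y = (\<Sum>i<r. cscale (d i) (f i))" "j < r" "x = f j" by auto
    have "(\<Sum>i<r. cscale (if i = j then c else 0) (f i)) = cscale c x"
      using d by (simp add: if_distrib[of "\<lambda>c. cscale c _"] cong: if_cong)
    then have "cscale c x + y = (\<Sum>i<r. cscale ((if i = j then c else 0) + d i) (f i))"
      by (simp add: cfun.scale_left_distrib sum.distrib d)
    then show ?case by (intro exI[of _ "\<lambda>i. (if i = j then c else 0) + d i"])
  qed
qed (auto intro!: cfun.span_sum cfun.span_scale intro: cfun.span_base)

lemma in_span_familyE:
  assumes "v \<in> cfun.span (f ` {..<r::nat})"
  obtains c where "v = (\<Sum>i<r. cscale (c i) (f i))"
  using assms unfolding in_span_family_iff by (elim exE)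

lemma comb_in_span: "(\<Sum>i<r. cscale (c i) (f i)) \<in> cfun.span (f ` {..<r::nat})"
  by (intro cfun.span_sum cfun.span_scale cfun.span_base) auto

lemma tangent_nonzero:
  assumes "D \<in> tangent_space M p" "D \<noteq> 0" "p \<in> M" "p \<in> affine_chart k"
  obtains b where "D (ratio b k) \<noteq> 0"
  using tangent_eqI[OF assms(1) cfun.subspace_0[OF tangent_subspace] assms(3,4)] assms(2) by auto

text \<open>
  Gaussian elimination over the local ring: the next field, freed of its components along the
  previous ones, is nonzero at \<open>p\<close>, hence pairs to a unit with some affine coordinate function.
\<close>

lemma dual_frame_exists:
  fixes Y :: "nat \<Rightarrow> 'n::finite vfield"
  assumes p: "p \<in> M" "p \<in> affine_chart k"
    and "\<And>i. i < r \<Longrightarrow> vector_field_at M p (Y i)"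
    and "\<forall>c. (\<Sum>i<r. cscale (c i) (Y i p)) = 0 \<longrightarrow> (\<forall>i<r. c i = 0)"
  shows "\<exists>X a. (\<forall>i<r. vector_field_at M p (X i)) \<and> (\<forall>\<^sub>F q in near M p.
    (\<forall>i<r. \<forall>j<r. X i q (ratio (a j) k) = (if i = j then 1 else 0))
    \<and> cfun.span ((\<lambda>i. X i q) ` {..<r}) = cfun.span ((\<lambda>i. Y i q) ` {..<r}))"
  using assms(3,4)
proof (induction r)
  case (Suc r)
  have "\<exists>X a. (\<forall>i<r. vector_field_at M p (X i)) \<and> (\<forall>\<^sub>F q in near M p.
    (\<forall>i<r. \<forall>j<r. X i q (ratio (a j) k) = (if i = j then 1 else 0))
    \<and> cfun.span ((\<lambda>i. X i q) ` {..<r}) = cfun.span ((\<lambda>i. Y i q) ` {..<r}))"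
  proof (rule Suc.IH; (intro allI impI)?)
    fix c and i :: nat assume c: "(\<Sum>i<r. cscale (c i) (Y i p)) = 0" and i: "i < r"
    have "(\<Sum>i<Suc r. cscale (if i = r then 0 else c i) (Y i p)) = 0"
      using c by (simp cong: sum.cong_simp)
    from Suc.prems(2)[rule_format, of "\<lambda>i. if i = r then 0 else c i" i, OF this] i show "c i = 0" by (simp split: if_splits)
  qed (use Suc.prems(1) in auto)
  then obtain X a where X: "\<And>i. i < r \<Longrightarrow> vector_field_at M p (X i)"
    and ev: "\<forall>\<^sub>F q in near M p. (\<forall>i<r. \<forall>j<r. X i q (ratio (a j) k) = (if i = j then 1 else 0))
      \<and> cfun.span ((\<lambda>i. X i q) ` {..<r}) = cfun.span ((\<lambda>i. Y i q) ` {..<r})" by blast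
  have Yr: "vector_field_at M p (Y r)" using Suc.prems(1) by simp
  define Z where "Z q = Y r q - (\<Sum>j<r. cscale (Y r q (ratio (a j) k)) (X j q))" for q
  have Z: "vector_field_at M p Z"
    unfolding Z_def[abs_def]
    by (intro vector_field_diff vector_field_sum vector_field_scale X Yr vector_field_holomorphic[OF Yr p(1)] holomorphic_at_ratio p) auto
  have "Z p \<noteq> 0"
  proof
    assume "Z p = 0"
    then have "(\<Sum>j<r. cscale (Y r p (ratio (a j) k)) (X j p)) = Y r p" by (simp add: Z_def)
    then have "Y r p \<in> cfun.span ((\<lambda>i. X i p) ` {..<r})"
      using comb_in_span[of "\<lambda>j. Y r p (ratio (a j) k)" "\<lambda>i. X i p" r] by (simp only:)
    then have "Y r p \<in> cfun.span ((\<lambda>i. Y i p) ` {..<r})" using near_self[OF ev p(1)] by auto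
    then obtain c where c: "Y r p = (\<Sum>i<r. cscale (c i) (Y i p))" by (rule in_span_familyE)
    have "(\<Sum>i<Suc r. cscale (if i = r then - 1 else c i) (Y i p)) = (\<Sum>i<r. cscale (c i) (Y i p)) - Y r p"
      by (simp cong: sum.cong_simp)
    then have "(\<Sum>i<Suc r. cscale (if i = r then - 1 else c i) (Y i p)) = 0" using c by simp
    from Suc.prems(2)[rule_format, of "\<lambda>i. if i = r then - 1 else c i" r, OF this] show False by simp
  qed
  then obtain b where b: "Z p (ratio b k) \<noteq> 0"
    using tangent_nonzero[OF vector_field_tangent[OF Z p(1)] _ p] by blast
  have hb: "holomorphic_at M p (\<lambda>q. Z q (ratio b k))"
    by (rule vector_field_holomorphic[OF Z p(1) holomorphic_at_ratio[OF p(2)]])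
  define X' where "X' i q = (let W = cscale (inverse (Z q (ratio b k))) (Z q) in
    if i = r then W else X i q - cscale (X i q (ratio b k)) W)" for i q
  have vW: "vector_field_at M p (\<lambda>q. cscale (inverse (Z q (ratio b k))) (Z q))"
    by (intro vector_field_scale Z holomorphic_at_inverse[OF hb p(1) b])
  have vX': "vector_field_at M p (X' i)" if "i < Suc r" for i
  proof (cases "i = r")
    case True
    then show ?thesis using vW by (simp add: X'_def[abs_def] Let_def)
  next
    case False
    with that have "i < r" by simp
    then show ?thesis unfolding X'_def[abs_def] Let_def if_not_P[OF False]
      by (intro vector_field_diff X vector_field_scale[OF vW] vector_field_holomorphic[OF X p(1)] holomorphic_at_ratio p)
  qed
  have "\<forall>\<^sub>F q in near M p. (\<forall>i<Suc r. \<forall>j<Suc r. X' i q (ratio ((a(r := b)) j) k) = (if i = j then 1 else 0))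
    \<and> cfun.span ((\<lambda>i. X' i q) ` {..<Suc r}) = cfun.span ((\<lambda>i. Y i q) ` {..<Suc r})"
    using ev holomorphic_at_nonzero(1)[OF hb p(1) b]
  proof eventually_elim
    case (elim q)
    then have d: "\<And>i j. i < r \<Longrightarrow> j < r \<Longrightarrow> X i q (ratio (a j) k) = (if i = j then 1 else 0)"
      and sp: "cfun.span ((\<lambda>i. X i q) ` {..<r}) = cfun.span ((\<lambda>i. Y i q) ` {..<r})"
      and nz: "Z q (ratio b k) \<noteq> 0" by auto
    define W where "W = cscale (inverse (Z q (ratio b k))) (Z q)"
    have X'_q: "X' i q = (if i = r then W else X i q - cscale (X i q (ratio b k)) W)" for i
      by (simp add: X'_def W_def Let_def)
    have Zj: "Z q (ratio (a j) k) = 0" if "j < r" for j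
      using sum_times_delta[OF that, of "\<lambda>i. X i q (ratio (a j) k)" "\<lambda>i. Y r q (ratio (a i) k)"] d that
      by (simp add: Z_def comb_apply)
    have Wj: "W (ratio (a j) k) = 0" if "j < r" for j using Zj[OF that] by (simp add: W_def cscale_def)
    have Wb: "W (ratio b k) = 1" using nz by (simp add: W_def cscale_def)
    have ZW: "Z q = cscale (Z q (ratio b k)) W" using nz by (simp add: W_def)
    let ?S = "cfun.span ((\<lambda>i. Y i q) ` {..<Suc r})" and ?S' = "cfun.span ((\<lambda>i. X' i q) ` {..<Suc r})"
    have 1: "X' i q (ratio ((a(r := b)) j) k) = (if i = j then 1 else 0)" if "i < Suc r" "j < Suc r" for i j
      using that by (auto simp: X'_q Wj Wb d cscale_def less_Suc_eq)
    have XS: "X i q \<in> ?S" if "i < r" for i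
    proof -
      have "X i q \<in> cfun.span ((\<lambda>i. Y i q) ` {..<r})" unfolding sp[symmetric] by (intro cfun.span_base imageI) (use that in simp)
      also have "\<dots> \<subseteq> ?S" by (rule cfun.span_mono) auto
      finally show ?thesis .
    qed
    have YS: "Y r q \<in> ?S" by (intro cfun.span_base imageI) simp
    have "Z q \<in> ?S" unfolding Z_def
      by (intro cfun.span_diff cfun.span_sum cfun.span_scale XS YS) auto
    then have WS: "W \<in> ?S" unfolding W_def by (rule cfun.span_scale)
    have 2: "?S' \<subseteq> ?S"
    proof (rule cfun.span_minimal)
      show "(\<lambda>i. X' i q) ` {..<Suc r} \<subseteq> ?S"
        using WS XS by (auto simp: X'_q less_Suc_eq intro!: cfun.span_diff cfun.span_scale)
    qed simp
    have W': "W \<in> ?S'" using cfun.span_base[of "X' r q" "(\<lambda>i. X' i q) ` {..<Suc r}"] by (simp add: X'_q)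
    have X'S: "X i q \<in> ?S'" if "i < r" for i
    proof -
      have "X' i q \<in> ?S'" by (intro cfun.span_base imageI) (use that in simp)
      then have "X' i q + cscale (X i q (ratio b k)) W \<in> ?S'" using W' by (intro cfun.span_add cfun.span_scale)
      then show ?thesis using that by (simp add: X'_q)
    qed
    have Y'S: "Y i q \<in> ?S'" if "i < r" for i
    proof -
      have "Y i q \<in> cfun.span ((\<lambda>i. X i q) ` {..<r})" unfolding sp by (intro cfun.span_base imageI) (use that in simp)
      also have "\<dots> \<subseteq> ?S'" by (rule cfun.span_minimal) (use X'S in auto)
      finally show ?thesis .
    qed
    have "Z q + (\<Sum>j<r. cscale (Y r q (ratio (a j) k)) (X j q)) \<in> ?S'"
      by (subst ZW) (intro cfun.span_add cfun.span_sum cfun.span_scale W' X'S, auto)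
    then have "Y r q \<in> ?S'" by (simp add: Z_def)
    then have 3: "?S \<subseteq> ?S'"
      using Y'S by (intro cfun.span_minimal) (auto simp: less_Suc_eq)
    from 1 have "\<forall>i<Suc r. \<forall>j<Suc r. X' i q (ratio ((a(r := b)) j) k) = (if i = j then 1 else 0)" by simp
    moreover from 2 3 have "?S' = ?S" by (rule subset_antisym)
    ultimately show ?case by (rule conjI)
  qed
  then have "(\<forall>i<Suc r. vector_field_at M p (X' i)) \<and> (\<forall>\<^sub>F q in near M p. (\<forall>i<Suc r. \<forall>j<Suc r. X' i q (ratio ((a(r := b)) j) k) = (if i = j then 1 else 0))
    \<and> cfun.span ((\<lambda>i. X' i q) ` {..<Suc r}) = cfun.span ((\<lambda>i. Y i q) ` {..<Suc r}))"
    using vX' by simp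
  then show ?case by (intro exI)
qed (auto intro!: always_eventually)

text \<open>
  Near a point, \<open>H\<close> has a frame \<open>X\<close> dual to affine coordinate functions, completed by a field \<open>T\<close>
  transversal to \<open>H\<close>; then the components of a vector field are holomorphic, being
  derivatives of coordinate functions.
\<close>

definition adapted_frame ::
    "'n::finite proj set \<Rightarrow> ('n proj \<Rightarrow> 'n tvec set) \<Rightarrow> 'n \<Rightarrow> nat \<Rightarrow> (nat \<Rightarrow> 'n vfield)
      \<Rightarrow> (nat \<Rightarrow> complex ^ 'n) \<Rightarrow> 'n vfield \<Rightarrow> complex ^ 'n \<Rightarrow> 'n proj \<Rightarrow> bool" where
  "adapted_frame M H k r X a T b q \<longleftrightarrow> q \<in> M \<and> q \<in> affine_chart k
     \<and> (\<forall>i<r. section_at M H q (X i)) \<and> vector_field_at M q T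
     \<and> (\<forall>i<r. \<forall>j<r. X i q (ratio (a j) k) = (if i = j then 1 else 0))
     \<and> (\<forall>j<r. T q (ratio (a j) k) = 0) \<and> T q (ratio b k) = 1
     \<and> (\<forall>D\<in>H q. D = (\<Sum>i<r. cscale (D (ratio (a i) k)) (X i q)))
     \<and> (\<forall>D\<in>tangent_space M q. D = (\<Sum>i<r. cscale (D (ratio (a i) k)) (X i q))
          + cscale (D (ratio b k) - (\<Sum>i<r. D (ratio (a i) k) * X i q (ratio b k))) (T q))"

lemma tangent_expansion:
  assumes sub: "cfun.subspace Hq" and "D0 \<in> Tq" and D0: "\<And>E. E \<in> Tq \<Longrightarrow> \<exists>c. E - cscale c D0 \<in> Hq"
    and T: "t \<in> Tq" and D: "D \<in> Tq"
    and H: "\<And>E. E \<in> Hq \<Longrightarrow> \<exists>c. E = (\<Sum>i<r. cscale (c i) (X i))"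
    and dual: "\<And>i j. i < r \<Longrightarrow> j < r \<Longrightarrow> X i (\<phi> j) = (if i = j then 1 else 0)"
      "\<And>j. j < r \<Longrightarrow> t (\<phi> j) = 0" "t \<tau> = 1"
  shows "D = (\<Sum>i<(r::nat). cscale (D (\<phi> i)) (X i)) + cscale (D \<tau> - (\<Sum>i<r. D (\<phi> i) * X i \<tau>)) t"
proof -
  have coeff: "c j = E (\<phi> j)" if "E = (\<Sum>i<r. cscale (c i) (X i)) + cscale s t" "j < r" for E c s j
  proof -
    have "E (\<phi> j) = (\<Sum>i<r. c i * X i (\<phi> j)) + s * t (\<phi> j)"
      unfolding that(1) plus_fun_apply comb_apply by (simp add: cscale_def)
    then show ?thesis
      using sum_times_delta[OF that(2), of "\<lambda>i. X i (\<phi> j)" c] that(2) by (simp add: dual)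
  qed
  have "t \<notin> Hq"
  proof
    assume "t \<in> Hq"
    then obtain c where c: "t = (\<Sum>i<r. cscale (c i) (X i))" using H by blast
    then have "c j = 0" if "j < r" for j using coeff[of t c 0 j] that dual(2) c by simp
    then have "t = 0" using c by simp
    then show False using dual(3) by simp
  qed
  obtain c0 where c0: "t - cscale c0 D0 \<in> Hq" using D0 T by blast
  obtain c1 where c1: "D - cscale c1 D0 \<in> Hq" using D0 D by blast
  have "c0 \<noteq> 0" using c0 \<open>t \<notin> Hq\<close> by auto
  then have "(D - cscale c1 D0) - cscale (c1 / c0) (t - cscale c0 D0) = D - cscale (c1 / c0) t"
    by (simp add: cfun.scale_right_diff_distrib)
  then have "D - cscale (c1 / c0) t \<in> Hq"
    using c0 c1 cfun.subspace_diff[OF sub] cfun.subspace_scale[OF sub] by metis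
  then obtain e where "D - cscale (c1 / c0) t = (\<Sum>i<r. cscale (e i) (X i))" using H by blast
  then have De: "D = (\<Sum>i<r. cscale (e i) (X i)) + cscale (c1 / c0) t" by (simp add: algebra_simps)
  have e: "e j = D (\<phi> j)" if "j < r" for j by (rule coeff[OF De that])
  have "D \<tau> = (\<Sum>i<r. e i * X i \<tau>) + c1 / c0" by (subst De, unfold plus_fun_apply comb_apply) (simp add: cscale_def dual(3))
  then have s: "c1 / c0 = D \<tau> - (\<Sum>i<r. D (\<phi> i) * X i \<tau>)" by (simp add: e)
  have "(\<Sum>i<r. cscale (e i) (X i)) = (\<Sum>i<r. cscale (D (\<phi> i)) (X i))"
    by (rule sum.cong) (auto simp: e)
  then show ?thesis using De unfolding s by (simp only:)
qed

lemma adapted_frame_exists: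
  fixes M :: "'n::finite proj set"
  assumes M: "locally_closed_submanifold M" and H: "corank_one_subbundle M H" and p: "p \<in> M"
  obtains k r X a T b where "\<forall>\<^sub>F q in near M p. adapted_frame M H k r X a T b q"
proof -
  obtain k where k: "p \<in> affine_chart k" using ex_affine_chart by blast
  have Hsub: "cfun.subspace (H q)" "H q \<subseteq> tangent_space M q" 
    "\<exists>D\<in>tangent_space M q - H q. \<forall>E\<in>tangent_space M q. \<exists>c. E - cscale c D \<in> H q" if "q \<in> M" for q
    using bspec[OF H[unfolded corank_one_subbundle_def] that] by (auto simp only:)
  have "\<exists>U r (X :: nat \<Rightarrow> 'n vfield). open U \<and> p \<in> U
        \<and> (\<forall>q\<in>M \<inter> U. (\<forall>i<r. vector_field_at M q (X i))
           \<and> inj_on (\<lambda>i. X i q) {..<r} \<and> cfun.independent ((\<lambda>i. X i q) ` {..<r})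
           \<and> cfun.span ((\<lambda>i. X i q) ` {..<r}) = H q)"
    using bspec[OF H[unfolded corank_one_subbundle_def] p] by (elim conjE)
  then obtain U r and Y :: "nat \<Rightarrow> 'n vfield" where raw: "open U \<and> p \<in> U
        \<and> (\<forall>q\<in>M \<inter> U. (\<forall>i<r. vector_field_at M q (Y i))
           \<and> inj_on (\<lambda>i. Y i q) {..<r} \<and> cfun.independent ((\<lambda>i. Y i q) ` {..<r})
           \<and> cfun.span ((\<lambda>i. Y i q) ` {..<r}) = H q)"
    by (elim exE) (rule that)
  have U: "open U" "p \<in> U"
    and Y: "\<And>q i. q \<in> M \<inter> U \<Longrightarrow> i < r \<Longrightarrow> vector_field_at M q (Y i)"
      "\<And>q. q \<in> M \<inter> U \<Longrightarrow> inj_on (\<lambda>i. Y i q) {..<r}" "\<And>q. q \<in> M \<inter> U \<Longrightarrow> cfun.independent ((\<lambda>i. Y i q) ` {..<r})"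
      "\<And>q. q \<in> M \<inter> U \<Longrightarrow> cfun.span ((\<lambda>i. Y i q) ` {..<r}) = H q"
    using raw by simp_all
  have pU: "p \<in> M \<inter> U" using p U by simp
  have indep: "\<forall>c. (\<Sum>i<r. cscale (c i) (Y i p)) = 0 \<longrightarrow> (\<forall>i<r. c i = 0)"
  proof (intro allI impI)
    fix c i assume that: "(\<Sum>i<r. cscale (c i) (Y i p)) = 0" "i < r"
    let ?g = "the_inv_into {..<r} (\<lambda>i. Y i p)"
    have "(\<Sum>v\<in>(\<lambda>i. Y i p) ` {..<r}. cscale (c (?g v)) v) = (\<Sum>i<r. cscale (c i) (Y i p))"
      by (subst sum.reindex[OF Y(2)[OF pU]]) (auto simp: the_inv_into_f_f[OF Y(2)[OF pU]] intro: sum.cong)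
    then have "c (?g (Y i p)) = 0"
      by (intro cfun.independentD[OF Y(3)[OF pU], where u = "\<lambda>v. c (?g v)"]) (use that in auto)
    then show "c i = 0" using that by (simp add: the_inv_into_f_f[OF Y(2)[OF pU]])
  qed
  from dual_frame_exists[of p M k r Y, OF p k Y(1)[OF pU] indep]
  obtain X a where X: "\<And>i. i < r \<Longrightarrow> vector_field_at M p (X i)"
    and ev: "\<forall>\<^sub>F q in near M p. (\<forall>i<r. \<forall>j<r. X i q (ratio (a j) k) = (if i = j then 1 else 0))
      \<and> cfun.span ((\<lambda>i. X i q) ` {..<r}) = cfun.span ((\<lambda>i. Y i q) ` {..<r})" by blast
  have evH: "\<forall>\<^sub>F q in near M p. cfun.span ((\<lambda>i. X i q) ` {..<r}) = H q"
    using ev near_open[OF U] near_in by eventually_elim (use Y(4) in auto)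
  obtain D0 where D0: "D0 \<in> tangent_space M p - H p" using Hsub(3)[OF p] by blast
  then obtain T0 where T0: "vector_field_at M p T0" "T0 p = D0"
    using tangent_vector_extends[OF M p] by blast
  define T1 where "T1 q = T0 q - (\<Sum>j<r. cscale (T0 q (ratio (a j) k)) (X j q))" for q
  have T1: "vector_field_at M p T1"
    unfolding T1_def[abs_def]
    by (intro vector_field_diff vector_field_sum vector_field_scale X T0 vector_field_holomorphic[OF T0(1) p] holomorphic_at_ratio k) auto
  have "T1 p \<noteq> 0"
  proof
    assume "T1 p = 0"
    then have "(\<Sum>j<r. cscale (T0 p (ratio (a j) k)) (X j p)) = D0" by (simp add: T1_def T0)
    then have "D0 \<in> cfun.span ((\<lambda>i. X i p) ` {..<r})"
      using comb_in_span[of "\<lambda>j. T0 p (ratio (a j) k)" "\<lambda>i. X i p" r] by (simp only:)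
    then show False using near_self[OF evH p] D0 by simp
  qed
  then obtain b where b: "T1 p (ratio b k) \<noteq> 0"
    using tangent_nonzero[OF vector_field_tangent[OF T1 p] _ p k] by blast
  have hb: "holomorphic_at M p (\<lambda>q. T1 q (ratio b k))"
    by (rule vector_field_holomorphic[OF T1 p holomorphic_at_ratio[OF k]])
  define T where "T q = cscale (inverse (T1 q (ratio b k))) (T1 q)" for q
  have T: "vector_field_at M p T" unfolding T_def[abs_def]
    by (intro vector_field_scale T1 holomorphic_at_inverse[OF hb p b])
  have evX: "\<forall>\<^sub>F q in near M p. \<forall>i<r. section_at M H q (X i)"
  proof -
    have "\<forall>\<^sub>F q in near M p. section_at M H q (X i)" if "i < r" for i
    proof (rule section_near)
      show "section_at M H p (X i)"
        unfolding section_at_iff using X[OF that] evH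
        by (auto elim!: eventually_mono intro: cfun.span_base that)
    qed
    then have "\<forall>i\<in>{..<r}. \<forall>\<^sub>F q in near M p. section_at M H q (X i)" by blast
    then have "\<forall>\<^sub>F q in near M p. \<forall>i\<in>{..<r}. section_at M H q (X i)"
      by (subst eventually_ball_finite_distrib) auto
    then show ?thesis by eventually_elim auto
  qed
  show ?thesis
  proof (rule that[of k r X a T b])
    show "\<forall>\<^sub>F q in near M p. adapted_frame M H k r X a T b q"
      using ev evH evX near_open[OF open_affine_chart k] near_in holomorphic_at_nonzero(1)[OF hb p b] vector_field_near[OF T]
    proof eventually_elim
      case (elim q)
      then have q: "q \<in> M" "q \<in> affine_chart k" and nz: "T1 q (ratio b k) \<noteq> 0"
        and d: "\<And>i j. i < r \<Longrightarrow> j < r \<Longrightarrow> X i q (ratio (a j) k) = (if i = j then 1 else 0)"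
        and sp: "cfun.span ((\<lambda>i. X i q) ` {..<r}) = H q" by auto
      have T1j: "T1 q (ratio (a j) k) = 0" if "j < r" for j
        using sum_times_delta[OF that, of "\<lambda>i. X i q (ratio (a j) k)" "\<lambda>i. T0 q (ratio (a i) k)"] d that
        by (simp add: T1_def comb_apply)
      have Tj: "T q (ratio (a j) k) = 0" if "j < r" for j using T1j[OF that] by (simp add: T_def cscale_def)
      have Tb: "T q (ratio b k) = 1" using nz by (simp add: T_def cscale_def)
      have Hex: "\<exists>c. E = (\<Sum>i<r. cscale (c i) (X i q))" if "E \<in> H q" for E
        by (rule in_span_familyE[of E "\<lambda>i. X i q" r]) (use that sp in auto)
      have expH: "D = (\<Sum>i<r. cscale (D (ratio (a i) k)) (X i q))" if DH: "D \<in> H q" for D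
      proof -
        obtain c where c: "D = (\<Sum>i<r. cscale (c i) (X i q))" using Hex[OF DH] by (elim exE)
        have "D (ratio (a j) k) = c j" if "j < r" for j
          unfolding c comb_apply by (rule sum_times_delta[OF that d[OF _ that]])
        then show ?thesis using c by simp
      qed
      obtain D1 where D1: "D1 \<in> tangent_space M q" "\<And>E. E \<in> tangent_space M q \<Longrightarrow> \<exists>c. E - cscale c D1 \<in> H q"
        using Hsub(3)[OF q(1)] by blast
      have expT: "D = (\<Sum>i<r. cscale (D (ratio (a i) k)) (X i q))
          + cscale (D (ratio b k) - (\<Sum>i<r. D (ratio (a i) k) * X i q (ratio b k))) (T q)"
        if "D \<in> tangent_space M q" for D
        by (rule tangent_expansion[where X = "\<lambda>i. X i q" and \<phi> = "\<lambda>i. ratio (a i) k" and t = "T q", OF Hsub(1)[OF q(1)] D1 vector_field_tangent[OF elim(7) q(1)] that Hex d Tj Tb])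
      show ?case
        unfolding adapted_frame_def
        by (intro conjI ballI allI impI; (rule q elim(7) Tb)?)
          (rule elim(3)[rule_format] d Tj expH expT; assumption)+
    qed
  qed
qed

section \<open>Functionals on the enveloping algebra\<close>

text \<open>
  A linear functional on \<open>U(\<hh>)\<close> is the same as a function on words over \<open>\<hh>\<close> that respects the
  defining relations.
\<close>

definition word_functional :: "('a, 'b) graded_lie_scheme \<Rightarrow> ('a list \<Rightarrow> complex) \<Rightarrow> bool" where
  "word_functional \<hh> L \<longleftrightarrow> (\<forall>u\<in>lists (carrier \<hh>). \<forall>v\<in>lists (carrier \<hh>). \<forall>x\<in>carrier \<hh>. \<forall>y\<in>carrier \<hh>.
     L (u @ [x \<oplus>\<^bsub>\<hh>\<^esub> y] @ v) = L (u @ [x] @ v) + L (u @ [y] @ v)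
     \<and> (\<forall>c. L (u @ [c \<odot>\<^bsub>\<hh>\<^esub> x] @ v) = c * L (u @ [x] @ v))
     \<and> L (u @ [x, y] @ v) = L (u @ [y, x] @ v) + L (u @ [bracket \<hh> x y] @ v))"

definition eval_words :: "('a list \<Rightarrow> complex) \<Rightarrow> ('a list \<Rightarrow> complex) \<Rightarrow> complex" where
  "eval_words L a = (\<Sum>w | a w \<noteq> 0. a w * L w)"

definition functional_of :: "('a, 'b) graded_lie_scheme \<Rightarrow> ('a list \<Rightarrow> complex) \<Rightarrow> ('a list \<Rightarrow> complex) set \<Rightarrow> complex" where
  "functional_of \<hh> L A = (if A \<in> carrier (uea \<hh>) then eval_words L (SOME a. a \<in> A) else 0)"

lemma eval_words_superset:
  assumes "finite F" "{w. a w \<noteq> 0} \<subseteq> F" shows "eval_words L a = (\<Sum>w\<in>F. a w * L w)"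
  unfolding eval_words_def by (rule sum.mono_neutral_left) (use assms in auto)

lemma eval_words_add:
  assumes "finite {w. a w \<noteq> 0}" "finite {w. b w \<noteq> 0}"
  shows "eval_words L (a + b) = eval_words L a + eval_words L b"
proof -
  let ?F = "{w. a w \<noteq> 0} \<union> {w. b w \<noteq> 0}"
  have "finite ?F" using assms by simp
  moreover have "{w. (a + b) w \<noteq> 0} \<subseteq> ?F" by auto
  ultimately show ?thesis
    by (subst (1 2 3) eval_words_superset[of ?F]) (auto simp: sum.distrib algebra_simps)
qed

lemma eval_words_scale: "eval_words L (cscale c a) = c * eval_words L a"
  by (cases "c = 0") (simp_all add: eval_words_def cscale_def sum_distrib_left mult_ac)

lemma eval_words_word: "eval_words L (word w) = L w"
  by (simp add: eval_words_def word_def)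

lemma finite_support_word: "finite {u. word w u \<noteq> 0}"
  by (simp add: word_def)

lemma finite_support_span:
  assumes "a \<in> cfun.span B" "\<And>b. b \<in> B \<Longrightarrow> finite {w. b w \<noteq> (0::complex)}"
  shows "finite {w. a w \<noteq> 0}"
  using assms(1)
proof (induction rule: cfun.span_induct_alt)
  case (step c x y)
  have "{w. (cscale c x + y) w \<noteq> 0} \<subseteq> {w. x w \<noteq> 0} \<union> {w. y w \<noteq> 0}" by (auto simp: cscale_def)
  then show ?case using step assms(2) by (meson finite_UnI finite_subset)
qed simp

lemma finite_support_add: "finite {w. a w \<noteq> 0} \<Longrightarrow> finite {w. b w \<noteq> 0} \<Longrightarrow> finite {w. (a + b) w \<noteq> (0::complex)}"
  by (rule finite_subset[of _ "{w. a w \<noteq> 0} \<union> {w. b w \<noteq> 0}"]) auto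

lemma finite_support_diff: "finite {w. a w \<noteq> 0} \<Longrightarrow> finite {w. b w \<noteq> 0} \<Longrightarrow> finite {w. (a - b) w \<noteq> (0::complex)}"
  by (rule finite_subset[of _ "{w. a w \<noteq> 0} \<union> {w. b w \<noteq> 0}"]) auto

lemma finite_support_scale: "finite {w. a w \<noteq> 0} \<Longrightarrow> finite {w. cscale c a w \<noteq> (0::complex)}"
  by (rule finite_subset[of _ "{w. a w \<noteq> 0}"]) (auto simp: cscale_def)

lemma eval_words_diff:
  assumes "finite {w. a w \<noteq> 0}" "finite {w. b w \<noteq> 0}"
  shows "eval_words L (a - b) = eval_words L a - eval_words L b"
proof -
  have "a - b = a + cscale (-1) b" by (simp add: cscale_def fun_eq_iff)
  then show ?thesis
    using eval_words_add[OF assms(1) finite_support_scale[OF assms(2), of "-1"], of L]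
    by (simp only: eval_words_scale mult_minus1 diff_conv_add_uminus)
qed

lemma eval_words_span:
  assumes "a \<in> cfun.span B" "\<And>b. b \<in> B \<Longrightarrow> finite {w. b w \<noteq> (0::complex)}" "\<And>b. b \<in> B \<Longrightarrow> eval_words L b = 0"
  shows "eval_words L a = 0"
proof -
  have "finite {w. a w \<noteq> 0} \<and> eval_words L a = 0"
    using assms(1)
  proof (induction rule: cfun.span_induct_alt)
    case (step c x y)
    then have "finite {w. cscale c x w \<noteq> 0}" by (intro finite_support_scale assms(2))
    then show ?case
      using step by (simp only: eval_words_add finite_support_add) (simp add: eval_words_scale assms(3))
  qed (simp add: eval_words_def)
  then show ?thesis by simp
qed

lemma eval_words_relation:
  "eval_words L (word u - word v - word w) = L u - L v - L w"
  "eval_words L (word u - cscale c (word v)) = L u - c * L v"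
  by (simp_all only: eval_words_diff finite_support_diff finite_support_scale finite_support_word
      eval_words_scale eval_words_word)

lemma word_functionalD:
  assumes "word_functional \<hh> L" "u \<in> lists (carrier \<hh>)" "v \<in> lists (carrier \<hh>)" "x \<in> carrier \<hh>"
  shows "y \<in> carrier \<hh> \<Longrightarrow> L (u @ [x \<oplus>\<^bsub>\<hh>\<^esub> y] @ v) = L (u @ [x] @ v) + L (u @ [y] @ v)"
    and "L (u @ [c \<odot>\<^bsub>\<hh>\<^esub> x] @ v) = c * L (u @ [x] @ v)"
    and "y \<in> carrier \<hh> \<Longrightarrow> L (u @ [x, y] @ v) = L (u @ [y, x] @ v) + L (u @ [bracket \<hh> x y] @ v)"
  using assms unfolding word_functional_def by blast+

lemma word_functional_diff:
  assumes "word_functional \<hh> F" "word_functional \<hh> G"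
  shows "word_functional \<hh> (\<lambda>w. F w - G w)"
  unfolding word_functional_def
proof (intro ballI conjI allI, goal_cases)
  case (1 u v x y)
  then show ?case by (simp only: word_functionalD(1)[OF assms(1)] word_functionalD(1)[OF assms(2)] add_diff_add)
next
  case (2 u v x y c)
  then show ?case by (simp only: word_functionalD(2)[OF assms(1)] word_functionalD(2)[OF assms(2)] right_diff_distrib)
next
  case (3 u v x y)
  then show ?case
    unfolding word_functionalD(3)[OF assms(1) 3] word_functionalD(3)[OF assms(2) 3] by (simp only: add_diff_add)
qed

lemma ideal_eval:
  assumes L: "word_functional \<hh> L" and a: "a \<in> uea_ideal \<hh>"
  shows "finite {w. a w \<noteq> 0}" "eval_words L a = 0"
proof -
  note fin = finite_support_diff finite_support_scale finite_support_word
  show "finite {w. a w \<noteq> 0}"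
    by (rule finite_support_span[OF a[unfolded uea_ideal_def]]) (auto intro!: fin)
  show "eval_words L a = 0"
  proof (rule eval_words_span[OF a[unfolded uea_ideal_def]], goal_cases)
    case (2 b)
    then show ?case
      apply (elim UnE CollectE exE conjE)
      subgoal by (simp only: eval_words_relation word_functionalD(1)[OF L]) simp
      subgoal by (simp only: eval_words_relation word_functionalD(2)[OF L]) simp
      subgoal for u v x y
        using word_functionalD(3)[OF L, of u v x y] by (simp only: eval_words_relation) simp
      done
  qed (auto intro!: fin)
qed

lemma coset_eq_iff:
  assumes "cfun.subspace W" shows "coset W f = coset W g \<longleftrightarrow> f - g \<in> W"
proof
  assume "coset W f = coset W g"
  moreover have "f \<in> coset W f"
    using cfun.subspace_0[OF assms] unfolding coset_def by (auto intro!: image_eqI[of _ _ 0])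
  ultimately obtain w where "w \<in> W" "f = g + w" by (auto simp: coset_def)
  then show "f - g \<in> W" by simp
next
  have *: "coset W f \<subseteq> coset W g" if "f - g \<in> W" for f g
  proof
    fix h assume "h \<in> coset W f"
    then obtain w where "w \<in> W" "h = f + w" by (auto simp: coset_def)
    then show "h \<in> coset W g"
      using cfun.subspace_add[OF assms that] unfolding coset_def
      by (intro image_eqI[of _ _ "(f - g) + w"]) auto
  qed
  assume fg: "f - g \<in> W"
  then have "g - f \<in> W" using cfun.subspace_neg[OF assms fg] by simp
  with fg show "coset W f = coset W g" using * by (simp add: subset_antisym)
qed

lemma coset_self: "cfun.subspace W \<Longrightarrow> f \<in> coset W f"
  unfolding coset_def by (rule image_eqI[of _ _ 0]) (auto simp: cfun.subspace_0)

lemma coset_zero: "coset W 0 = W"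
  by (simp add: coset_def)

lemma coset_add_coset:
  assumes "cfun.subspace W" shows "coset_add (coset W f) (coset W g) = coset W (f + g)"
proof (intro equalityI subsetI)
  fix h assume "h \<in> coset_add (coset W f) (coset W g)"
  then obtain v w where "v \<in> W" "w \<in> W" "h = (f + v) + (g + w)" by (auto simp: coset_add_def coset_def)
  then show "h \<in> coset W (f + g)"
    unfolding coset_def using cfun.subspace_add[OF assms] by (intro image_eqI[of _ _ "v + w"]) (auto simp: algebra_simps)
next
  fix h assume "h \<in> coset W (f + g)"
  then obtain w where w: "w \<in> W" "h = f + g + w" by (auto simp: coset_def)
  then have "h = (f + w) + g" by simp
  moreover have "f + w \<in> coset W f" using w by (simp add: coset_def)
  moreover have "g \<in> coset W g" by (rule coset_self[OF assms])
  ultimately show "h \<in> coset_add (coset W f) (coset W g)" unfolding coset_add_def by blast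
qed

lemma coset_scale_coset:
  assumes "cfun.subspace W" shows "coset_scale W c (coset W f) = coset W (cscale c f)"
proof (intro equalityI subsetI)
  fix h assume "h \<in> coset_scale W c (coset W f)"
  then obtain v w where vw: "v \<in> W" "w \<in> W" "h = cscale c (f + v) + w" by (auto simp: coset_scale_def coset_def)
  then have "h = cscale c f + (cscale c v + w)" by (simp add: cfun.scale_right_distrib)
  then show "h \<in> coset W (cscale c f)"
    unfolding coset_def using cfun.subspace_add[OF assms cfun.subspace_scale[OF assms vw(1)] vw(2)] by blast
next
  fix h assume "h \<in> coset W (cscale c f)"
  then obtain w where w: "w \<in> W" "h = cscale c f + w" by (auto simp: coset_def)
  then show "h \<in> coset_scale W c (coset W f)" unfolding coset_scale_def using coset_self[OF assms, of f] by blast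
qed

lemma subspace_ideal: "cfun.subspace (uea_ideal \<hh>)"
  unfolding uea_ideal_def by simp

lemma free_algebra_word: "w \<in> lists (carrier \<hh>) \<Longrightarrow> word w \<in> free_algebra \<hh>"
  unfolding free_algebra_def by (rule cfun.span_base) simp

lemma subspace_free: "cfun.subspace (free_algebra \<hh>)"
  unfolding free_algebra_def by simp

lemma uea_simps:
  "carrier (uea \<hh>) = coset (uea_ideal \<hh>) ` free_algebra \<hh>"
  "A \<oplus>\<^bsub>uea \<hh>\<^esub> B = coset_add A B" "c \<odot>\<^bsub>uea \<hh>\<^esub> A = coset_scale (uea_ideal \<hh>) c A"
  by (simp_all add: uea_def)

lemma functional_of_coset:
  assumes L: "word_functional \<hh> L" and a: "a \<in> free_algebra \<hh>"
  shows "functional_of \<hh> L (coset (uea_ideal \<hh>) a) = eval_words L a"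
proof -
  let ?A = "coset (uea_ideal \<hh>) a"
  have "(SOME a. a \<in> ?A) \<in> ?A" by (rule someI[of _ a]) (rule coset_self[OF subspace_ideal])
  then obtain i where i: "i \<in> uea_ideal \<hh>" "(SOME a. a \<in> ?A) = a + i" by (auto simp: coset_def)
  have "finite {w. a w \<noteq> 0}"
    by (rule finite_support_span[OF a[unfolded free_algebra_def]]) (auto simp: finite_support_word)
  then have "eval_words L (a + i) = eval_words L a"
    using ideal_eval[OF L i(1)] by (simp add: eval_words_add)
  then show ?thesis using a i by (simp add: functional_of_def uea_simps)
qed

lemma functional_of:
  assumes L: "word_functional \<hh> L"
  shows "functional_of \<hh> L \<in> lin_dual (uea \<hh>)"
    and "w \<in> lists (carrier \<hh>) \<Longrightarrow> functional_of \<hh> L (uea_monomial \<hh> w) = L w"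
proof -
  have fin: "finite {w. a w \<noteq> 0}" if "a \<in> free_algebra \<hh>" for a
    by (rule finite_support_span[OF that[unfolded free_algebra_def]]) (auto simp: finite_support_word)
  show "functional_of \<hh> L \<in> lin_dual (uea \<hh>)"
    unfolding lin_dual_def mem_Collect_eq
  proof (intro conjI allI impI ballI)
    fix A assume "A \<notin> carrier (uea \<hh>)"
    then show "functional_of \<hh> L A = 0" by (simp add: functional_of_def)
  next
    fix A B assume "A \<in> carrier (uea \<hh>)" "B \<in> carrier (uea \<hh>)"
    then obtain a b where ab: "a \<in> free_algebra \<hh>" "b \<in> free_algebra \<hh>"
      "A = coset (uea_ideal \<hh>) a" "B = coset (uea_ideal \<hh>) b" by (auto simp: uea_simps)
    then show "functional_of \<hh> L (A \<oplus>\<^bsub>uea \<hh>\<^esub> B) = functional_of \<hh> L A + functional_of \<hh> L B"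
      by (simp add: uea_simps coset_add_coset[OF subspace_ideal] functional_of_coset[OF L]
          cfun.subspace_add[OF subspace_free] eval_words_add fin)
  next
    fix c A assume "A \<in> carrier (uea \<hh>)"
    then obtain a where a: "a \<in> free_algebra \<hh>" "A = coset (uea_ideal \<hh>) a" by (auto simp: uea_simps)
    then show "functional_of \<hh> L (c \<odot>\<^bsub>uea \<hh>\<^esub> A) = c * functional_of \<hh> L A"
      by (simp add: uea_simps coset_scale_coset[OF subspace_ideal] functional_of_coset[OF L]
          cfun.subspace_scale[OF subspace_free] eval_words_scale)
  qed
  show "functional_of \<hh> L (uea_monomial \<hh> w) = L w" if "w \<in> lists (carrier \<hh>)"
    unfolding uea_monomial_def using that
    by (simp add: functional_of_coset[OF L] free_algebra_word eval_words_word)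
qed

lemma lin_dual_coset:
  assumes l: "l \<in> lin_dual (uea \<hh>)"
  shows "a \<in> free_algebra \<hh> \<Longrightarrow> b \<in> free_algebra \<hh> \<Longrightarrow>
      l (coset (uea_ideal \<hh>) (a + b)) = l (coset (uea_ideal \<hh>) a) + l (coset (uea_ideal \<hh>) b)"
    and "a \<in> free_algebra \<hh> \<Longrightarrow> l (coset (uea_ideal \<hh>) (cscale c a)) = c * l (coset (uea_ideal \<hh>) a)"
    and "a \<in> free_algebra \<hh> \<Longrightarrow> b \<in> free_algebra \<hh> \<Longrightarrow>
      l (coset (uea_ideal \<hh>) (a - b)) = l (coset (uea_ideal \<hh>) a) - l (coset (uea_ideal \<hh>) b)"
    and "a \<in> uea_ideal \<hh> \<Longrightarrow> a \<in> free_algebra \<hh> \<Longrightarrow> l (coset (uea_ideal \<hh>) a) = 0"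
proof -
  let ?c = "coset (uea_ideal \<hh>)"
  have add: "l (?c (a + b)) = l (?c a) + l (?c b)" if "a \<in> free_algebra \<hh>" "b \<in> free_algebra \<hh>" for a b
    using l that unfolding lin_dual_def by (auto simp: uea_simps coset_add_coset[OF subspace_ideal])
  have scale: "l (?c (cscale c a)) = c * l (?c a)" if "a \<in> free_algebra \<hh>" for c a
    using l that unfolding lin_dual_def by (auto simp: uea_simps coset_scale_coset[OF subspace_ideal])
  show "a \<in> free_algebra \<hh> \<Longrightarrow> b \<in> free_algebra \<hh> \<Longrightarrow> l (?c (a + b)) = l (?c a) + l (?c b)"
    "a \<in> free_algebra \<hh> \<Longrightarrow> l (?c (cscale c a)) = c * l (?c a)" by (fact add scale)+
  show "l (?c (a - b)) = l (?c a) - l (?c b)" if "a \<in> free_algebra \<hh>" "b \<in> free_algebra \<hh>"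
  proof -
    have "a - b = a + cscale (-1) b" by (simp add: cscale_def fun_eq_iff)
    then show ?thesis using add[OF that(1) cfun.subspace_scale[OF subspace_free that(2)], of "-1"] scale[OF that(2), of "-1"]
      by (simp only: mult_minus1 diff_conv_add_uminus)
  qed
  show "l (?c a) = 0" if "a \<in> uea_ideal \<hh>"
  proof -
    have "?c a = ?c 0" using that by (subst coset_eq_iff[OF subspace_ideal]) simp
    also have "l (?c 0) = 0" using scale[OF cfun.subspace_0[OF subspace_free], of 0] by simp
    finally show ?thesis .
  qed
qed

lemma uea_ideal_relations:
  assumes "u \<in> lists (carrier \<hh>)" "v \<in> lists (carrier \<hh>)" "x \<in> carrier \<hh>"
  shows "y \<in> carrier \<hh> \<Longrightarrow> word (u @ [x \<oplus>\<^bsub>\<hh>\<^esub> y] @ v) - word (u @ [x] @ v) - word (u @ [y] @ v) \<in> uea_ideal \<hh>"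
    and "word (u @ [c \<odot>\<^bsub>\<hh>\<^esub> x] @ v) - cscale c (word (u @ [x] @ v)) \<in> uea_ideal \<hh>"
    and "y \<in> carrier \<hh> \<Longrightarrow> word (u @ [x, y] @ v) - word (u @ [y, x] @ v) - word (u @ [bracket \<hh> x y] @ v) \<in> uea_ideal \<hh>"
  unfolding uea_ideal_def
  subgoal by (rule cfun.span_base, rule UnI1, rule UnI1, use assms in blast)
  subgoal by (rule cfun.span_base, rule UnI1, rule UnI2, use assms in blast)
  subgoal by (rule cfun.span_base, rule UnI2, use assms in blast)
  done

lemma word_functional_of_dual:
  assumes l: "l \<in> lin_dual (uea \<hh>)" and "Module.module complex_field \<hh>"
    and br: "\<And>x y. x \<in> carrier \<hh> \<Longrightarrow> y \<in> carrier \<hh> \<Longrightarrow> bracket \<hh> x y \<in> carrier \<hh>"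
  shows "word_functional \<hh> (\<lambda>w. l (uea_monomial \<hh> w))"
proof -
  interpret \<hh>: Module.module complex_field \<hh> by fact
  have sm: "c \<odot>\<^bsub>\<hh>\<^esub> x \<in> carrier \<hh>" if "x \<in> carrier \<hh>" for c x
    using \<hh>.smult_closed[of c x] that by (simp add: complex_field_def)
  let ?c = "coset (uea_ideal \<hh>)"
  note ld = lin_dual_coset[OF l]
  have gen: "word w1 - word w2 - word w3 \<in> uea_ideal \<hh> \<Longrightarrow> w1 \<in> lists (carrier \<hh>) \<Longrightarrow> w2 \<in> lists (carrier \<hh>)
    \<Longrightarrow> w3 \<in> lists (carrier \<hh>) \<Longrightarrow> l (?c (word w1)) = l (?c (word w2)) + l (?c (word w3))" for w1 w2 w3
    using ld(4)[of "word w1 - word w2 - word w3"] 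
    by (simp add: ld(3) free_algebra_word cfun.subspace_diff[OF subspace_free] diff_eq_eq add.commute)
  show ?thesis
    unfolding word_functional_def uea_monomial_def
  proof (intro ballI conjI allI)
    fix u v x y assume m: "u \<in> lists (carrier \<hh>)" "v \<in> lists (carrier \<hh>)" "x \<in> carrier \<hh>" "y \<in> carrier \<hh>"
    show "l (?c (word (u @ [x \<oplus>\<^bsub>\<hh>\<^esub> y] @ v))) = l (?c (word (u @ [x] @ v))) + l (?c (word (u @ [y] @ v)))"
      by (rule gen[OF uea_ideal_relations(1)]) (use m in auto)
    show "l (?c (word (u @ [x, y] @ v))) = l (?c (word (u @ [y, x] @ v))) + l (?c (word (u @ [bracket \<hh> x y] @ v)))"
      by (rule gen[OF uea_ideal_relations(3)]) (use m br in auto)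
    fix c
    have "word (u @ [c \<odot>\<^bsub>\<hh>\<^esub> x] @ v) - cscale c (word (u @ [x] @ v)) \<in> uea_ideal \<hh>"
      using m by (intro uea_ideal_relations)
    moreover have f: "word (u @ [x] @ v) \<in> free_algebra \<hh>" "word (u @ [c \<odot>\<^bsub>\<hh>\<^esub> x] @ v) \<in> free_algebra \<hh>"
      using m sm by (auto intro!: free_algebra_word)
    ultimately have "l (?c (word (u @ [c \<odot>\<^bsub>\<hh>\<^esub> x] @ v) - cscale c (word (u @ [x] @ v)))) = 0"
      by (intro ld(4) cfun.subspace_diff[OF subspace_free] cfun.subspace_scale[OF subspace_free])
    then show "l (?c (word (u @ [c \<odot>\<^bsub>\<hh>\<^esub> x] @ v))) = c * l (?c (word (u @ [x] @ v)))"
      using f by (simp add: ld(2,3) cfun.subspace_scale[OF subspace_free])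
  qed
qed

lemma lin_dual_eqI:
  assumes l: "l \<in> lin_dual (uea \<hh>)" "l' \<in> lin_dual (uea \<hh>)"
    and eq: "\<And>w. w \<in> lists (carrier \<hh>) \<Longrightarrow> l (uea_monomial \<hh> w) = l' (uea_monomial \<hh> w)"
  shows "l = l'"
proof
  fix A
  show "l A = l' A"
  proof (cases "A \<in> carrier (uea \<hh>)")
    case True
    then obtain a where a: "a \<in> free_algebra \<hh>" "A = coset (uea_ideal \<hh>) a" by (auto simp: uea_simps)
    have "a \<in> free_algebra \<hh> \<and> l (coset (uea_ideal \<hh>) a) = l' (coset (uea_ideal \<hh>) a)"
      using a(1) unfolding free_algebra_def
    proof (induction rule: cfun.span_induct_alt)
      case base
      show ?case using lin_dual_coset(4)[OF l(1) cfun.subspace_0[OF subspace_ideal] cfun.subspace_0[OF subspace_free]]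
          lin_dual_coset(4)[OF l(2) cfun.subspace_0[OF subspace_ideal] cfun.subspace_0[OF subspace_free]]
        by (simp add: cfun.span_zero flip: zero_fun_def)
    next
      case (step c x y)
      then obtain w where w: "x = word w" "w \<in> lists (carrier \<hh>)" by auto
      have x: "x \<in> free_algebra \<hh>" using w(1) free_algebra_word[OF w(2)] by simp
      have y: "y \<in> free_algebra \<hh>" using step by (simp add: free_algebra_def)
      have cx: "cscale c x \<in> free_algebra \<hh>" by (rule cfun.subspace_scale[OF subspace_free x])
      have "l (coset (uea_ideal \<hh>) (cscale c x + y)) = l' (coset (uea_ideal \<hh>) (cscale c x + y))"
        unfolding lin_dual_coset(1)[OF l(1) cx y] lin_dual_coset(1)[OF l(2) cx y]
          lin_dual_coset(2)[OF l(1) x] lin_dual_coset(2)[OF l(2) x]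
        using step(2) eq[OF w(2)] by (simp add: w(1) uea_monomial_def)
      then show ?case
        using cfun.subspace_add[OF subspace_free cx y] by (simp add: plus_fun_def free_algebra_def)
    qed
    then show ?thesis using a by simp
  qed (use l in \<open>auto simp: lin_dual_def\<close>)
qed

lemma homogeneous_in_lists:
  assumes "homogeneous_word \<hh> w ds" "grade \<hh> 1 \<subseteq> carrier \<hh>" "grade \<hh> 2 \<subseteq> carrier \<hh>"
  shows "w \<in> lists (carrier \<hh>)"
  using assms(1) unfolding homogeneous_word_def
  by (induction rule: list_all2_induct) (use assms(2,3) in auto)

lemma uea_dual_iff:
  assumes "grade \<hh> 1 \<subseteq> carrier \<hh>" "grade \<hh> 2 \<subseteq> carrier \<hh>"
  shows "l \<in> uea_dual \<hh> k \<longleftrightarrow> l \<in> lin_dual (uea \<hh>)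
    \<and> (\<forall>w ds. homogeneous_word \<hh> w ds \<longrightarrow> sum_list ds \<noteq> k \<longrightarrow> l (uea_monomial \<hh> w) = 0)"
proof safe
  assume l: "l \<in> uea_dual \<hh> k"
  then show "l \<in> lin_dual (uea \<hh>)" by (simp add: uea_dual_def)
  fix w ds assume w: "homogeneous_word \<hh> w ds" "sum_list ds \<noteq> k"
  then have "uea_monomial \<hh> w \<in> uea_grade \<hh> (sum_list ds)"
    unfolding uea_grade_def uea_monomial_def by (intro imageI cfun.span_base) auto
  then show "l (uea_monomial \<hh> w) = 0" using l w by (auto simp: uea_dual_def)
next
  assume l: "l \<in> lin_dual (uea \<hh>)"
    and h: "\<forall>w ds. homogeneous_word \<hh> w ds \<longrightarrow> sum_list ds \<noteq> k \<longrightarrow> l (uea_monomial \<hh> w) = 0"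
  have "l (coset (uea_ideal \<hh>) a) = 0" if "j \<noteq> k" "a \<in> cfun.span {word w |w ds. homogeneous_word \<hh> w ds \<and> sum_list ds = j}" for j a
  proof -
    have "a \<in> free_algebra \<hh> \<and> l (coset (uea_ideal \<hh>) a) = 0"
      using that(2)
    proof (induction rule: cfun.span_induct_alt)
      case base
      show ?case using lin_dual_coset(4)[OF l cfun.subspace_0[OF subspace_ideal] cfun.subspace_0[OF subspace_free]]
        cfun.subspace_0[OF subspace_free, of \<hh>] by (simp flip: zero_fun_def)
    next
      case (step c x y)
      then obtain w ds where w: "x = word w" "homogeneous_word \<hh> w ds" "sum_list ds = j" by auto
      have x: "x \<in> free_algebra \<hh>" using w(1) free_algebra_word[OF homogeneous_in_lists[OF w(2) assms]] by simp
      have cx: "cscale c x \<in> free_algebra \<hh>" by (rule cfun.subspace_scale[OF subspace_free x])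
      have "l (coset (uea_ideal \<hh>) x) = 0" using h w that(1) by (auto simp: uea_monomial_def)
      then have "l (coset (uea_ideal \<hh>) (cscale c x + y)) = 0"
        using step(2) by (simp add: lin_dual_coset(1)[OF l cx] lin_dual_coset(2)[OF l x])
      then show ?case using step cfun.subspace_add[OF subspace_free cx, of y] by (simp add: plus_fun_def)
    qed
    then show ?thesis by simp
  qed
  then show "l \<in> uea_dual \<hh> k" using l by (auto simp: uea_dual_def uea_grade_def)
qed

lemma word_functional_zeroI:
  assumes L: "word_functional \<hh> L" and g: "grade \<hh> 1 \<subseteq> carrier \<hh>" "grade \<hh> 2 \<subseteq> carrier \<hh>"
    and dec: "\<And>x. x \<in> carrier \<hh> \<Longrightarrow> \<exists>y\<in>grade \<hh> 1. \<exists>z\<in>grade \<hh> 2. x = y \<oplus>\<^bsub>\<hh>\<^esub> z"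
    and h: "\<And>w ds. homogeneous_word \<hh> w ds \<Longrightarrow> L w = 0" and w: "w \<in> lists (carrier \<hh>)"
  shows "L w = 0"
proof -
  have "L (u @ w) = 0" if "homogeneous_word \<hh> u ds" for u ds
    using w that
  proof (induction w arbitrary: u ds rule: lists.induct)
    case Nil
    then show ?case using h by simp
  next
    case (Cons x w)
    obtain y z where yz: "y \<in> grade \<hh> 1" "z \<in> grade \<hh> 2" "x = y \<oplus>\<^bsub>\<hh>\<^esub> z" using dec Cons by blast
    have "L (u @ [x] @ w) = L (u @ [y] @ w) + L (u @ [z] @ w)"
      using L homogeneous_in_lists[OF Cons.prems g] yz g Cons.hyps unfolding word_functional_def by blast
    moreover have "homogeneous_word \<hh> (u @ [y]) (ds @ [1])" "homogeneous_word \<hh> (u @ [z]) (ds @ [2])"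
      using Cons.prems yz by (auto simp: homogeneous_word_def list_all2_appendI)
    then have "L ((u @ [y]) @ w) = 0" "L ((u @ [z]) @ w) = 0" using Cons.IH by blast+
    ultimately show ?case by simp
  qed
  from this[of "[]" "[]"] show ?thesis by (simp add: homogeneous_word_def)
qed

lemma uea_dual_eqI:
  assumes mod: "Module.module complex_field \<hh>"
    and br: "\<And>x y. x \<in> carrier \<hh> \<Longrightarrow> y \<in> carrier \<hh> \<Longrightarrow> bracket \<hh> x y \<in> carrier \<hh>"
    and g: "grade \<hh> 1 \<subseteq> carrier \<hh>" "grade \<hh> 2 \<subseteq> carrier \<hh>"
    and dec: "\<And>x. x \<in> carrier \<hh> \<Longrightarrow> \<exists>y\<in>grade \<hh> 1. \<exists>z\<in>grade \<hh> 2. x = y \<oplus>\<^bsub>\<hh>\<^esub> z"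
    and l: "l \<in> uea_dual \<hh> k" "l' \<in> uea_dual \<hh> k"
    and eq: "\<And>w ds. homogeneous_word \<hh> w ds \<Longrightarrow> sum_list ds = k \<Longrightarrow> l (uea_monomial \<hh> w) = l' (uea_monomial \<hh> w)"
  shows "l = l'"
proof (rule lin_dual_eqI)
  show ld: "l \<in> lin_dual (uea \<hh>)" "l' \<in> lin_dual (uea \<hh>)" using l by (auto simp: uea_dual_def)
  fix w assume w: "w \<in> lists (carrier \<hh>)"
  have wf: "word_functional \<hh> (\<lambda>w. l (uea_monomial \<hh> w) - l' (uea_monomial \<hh> w))"
    by (rule word_functional_diff[OF word_functional_of_dual[OF ld(1) mod br] word_functional_of_dual[OF ld(2) mod br]])
  have "l (uea_monomial \<hh> w) - l' (uea_monomial \<hh> w) = 0" if "homogeneous_word \<hh> w ds" for w ds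
    using eq[OF that] l that uea_dual_iff[OF g] by (cases "sum_list ds = k") auto
  from word_functional_zeroI[OF wf g dec this w]
  have "l (uea_monomial \<hh> w) - l' (uea_monomial \<hh> w) = 0" .
  then show "l (uea_monomial \<hh> w) = l' (uea_monomial \<hh> w)" by simp
qed

definition shift :: "('a, 'b) graded_lie_scheme \<Rightarrow> 'a \<Rightarrow> (('a list \<Rightarrow> complex) set \<Rightarrow> complex) \<Rightarrow> ('a list \<Rightarrow> complex) set \<Rightarrow> complex" where
  "shift \<hh> x l = functional_of \<hh> (\<lambda>w. l (uea_monomial \<hh> (x # w)))"

lemma shift:
  assumes "l \<in> lin_dual (uea \<hh>)" "Module.module complex_field \<hh>"
    and "\<And>x y. x \<in> carrier \<hh> \<Longrightarrow> y \<in> carrier \<hh> \<Longrightarrow> bracket \<hh> x y \<in> carrier \<hh>" "x \<in> carrier \<hh>"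
  shows "shift \<hh> x l \<in> lin_dual (uea \<hh>)"
    and "w \<in> lists (carrier \<hh>) \<Longrightarrow> shift \<hh> x l (uea_monomial \<hh> w) = l (uea_monomial \<hh> (x # w))"
proof -
  have L: "word_functional \<hh> (\<lambda>w. l (uea_monomial \<hh> w))"
    by (rule word_functional_of_dual[OF assms(1-3)])
  have "word_functional \<hh> (\<lambda>w. l (uea_monomial \<hh> (x # w)))"
    unfolding word_functional_def
  proof (intro ballI)
    fix u v y z assume m: "u \<in> lists (carrier \<hh>)" "v \<in> lists (carrier \<hh>)" "y \<in> carrier \<hh>" "z \<in> carrier \<hh>"
    then have "x # u \<in> lists (carrier \<hh>)" using assms(4) by simp
    from L[unfolded word_functional_def, rule_format, OF this m(2-4)]
    show "l (uea_monomial \<hh> (x # u @ [y \<oplus>\<^bsub>\<hh>\<^esub> z] @ v)) = l (uea_monomial \<hh> (x # u @ [y] @ v)) + l (uea_monomial \<hh> (x # u @ [z] @ v)) \<and>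
       (\<forall>c. l (uea_monomial \<hh> (x # u @ [c \<odot>\<^bsub>\<hh>\<^esub> y] @ v)) = c * l (uea_monomial \<hh> (x # u @ [y] @ v))) \<and>
       l (uea_monomial \<hh> (x # u @ [y, z] @ v)) = l (uea_monomial \<hh> (x # u @ [z, y] @ v)) + l (uea_monomial \<hh> (x # u @ [bracket \<hh> y z] @ v))"
      by simp
  qed
  from functional_of[OF this] show "shift \<hh> x l \<in> lin_dual (uea \<hh>)"
    "w \<in> lists (carrier \<hh>) \<Longrightarrow> shift \<hh> x l (uea_monomial \<hh> w) = l (uea_monomial \<hh> (x # w))"
    by (simp_all add: shift_def)
qed

section \<open>Polynomial functions on the Heisenberg group\<close>

locale heisenberg_coordinates =
  fixes \<hh> :: "('a, 'b) graded_lie_scheme"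
  assumes lie: "lie_algebra \<hh>"
    and nilpotent: "\<And>x y z. x \<in> carrier \<hh> \<Longrightarrow> y \<in> carrier \<hh> \<Longrightarrow> z \<in> carrier \<hh>
      \<Longrightarrow> bracket \<hh> x (bracket \<hh> y z) = \<zero>\<^bsub>\<hh>\<^esub>"
begin

lemma module: "Module.module complex_field \<hh>"
  and bracket_closed: "x \<in> carrier \<hh> \<Longrightarrow> y \<in> carrier \<hh> \<Longrightarrow> bracket \<hh> x y \<in> carrier \<hh>"
  and bracket_add_left: "x \<in> carrier \<hh> \<Longrightarrow> y \<in> carrier \<hh> \<Longrightarrow> w \<in> carrier \<hh> \<Longrightarrow>
    bracket \<hh> (x \<oplus>\<^bsub>\<hh>\<^esub> y) w = bracket \<hh> x w \<oplus>\<^bsub>\<hh>\<^esub> bracket \<hh> y w"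
  and bracket_add_right: "x \<in> carrier \<hh> \<Longrightarrow> y \<in> carrier \<hh> \<Longrightarrow> w \<in> carrier \<hh> \<Longrightarrow>
    bracket \<hh> w (x \<oplus>\<^bsub>\<hh>\<^esub> y) = bracket \<hh> w x \<oplus>\<^bsub>\<hh>\<^esub> bracket \<hh> w y"
  and bracket_smult_left: "x \<in> carrier \<hh> \<Longrightarrow> y \<in> carrier \<hh> \<Longrightarrow>
    bracket \<hh> (c \<odot>\<^bsub>\<hh>\<^esub> x) y = c \<odot>\<^bsub>\<hh>\<^esub> bracket \<hh> x y"
  and bracket_smult_right: "x \<in> carrier \<hh> \<Longrightarrow> y \<in> carrier \<hh> \<Longrightarrow>
    bracket \<hh> x (c \<odot>\<^bsub>\<hh>\<^esub> y) = c \<odot>\<^bsub>\<hh>\<^esub> bracket \<hh> x y"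
  using lie unfolding lie_algebra_def by (simp_all only:)

sublocale m: Module.module complex_field \<hh>
  by (rule module)

lemma smult_closed: "x \<in> carrier \<hh> \<Longrightarrow> c \<odot>\<^bsub>\<hh>\<^esub> x \<in> carrier \<hh>"
  using m.smult_closed[of c x] by (simp add: complex_field_def)

lemma smult_zero: "x \<in> carrier \<hh> \<Longrightarrow> 0 \<odot>\<^bsub>\<hh>\<^esub> x = \<zero>\<^bsub>\<hh>\<^esub>"
  using m.smult_l_null[of x] by (simp add: complex_field_def)

lemma smult_r_zero: "c \<odot>\<^bsub>\<hh>\<^esub> \<zero>\<^bsub>\<hh>\<^esub> = \<zero>\<^bsub>\<hh>\<^esub>"
  using m.smult_r_null[of c] by (simp add: complex_field_def)

lemma lin_dualD:
  assumes "l \<in> lin_dual \<hh>" "x \<in> carrier \<hh>"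
  shows "y \<in> carrier \<hh> \<Longrightarrow> l (x \<oplus>\<^bsub>\<hh>\<^esub> y) = l x + l y" and "l (c \<odot>\<^bsub>\<hh>\<^esub> x) = c * l x"
  using assms by (auto simp: lin_dual_def)

lemma lin_dual_zero: "l \<in> lin_dual \<hh> \<Longrightarrow> l \<zero>\<^bsub>\<hh>\<^esub> = 0"
  using lin_dualD(2)[of l "\<zero>\<^bsub>\<hh>\<^esub>" 0] smult_zero[of "\<zero>\<^bsub>\<hh>\<^esub>"] by simp

lemma heis_mult_closed: "x \<in> carrier \<hh> \<Longrightarrow> y \<in> carrier \<hh> \<Longrightarrow> heis_mult \<hh> x y \<in> carrier \<hh>"
  by (simp add: heis_mult_def smult_closed bracket_closed)

lemma lin_dual_heis_mult:
  assumes "l \<in> lin_dual \<hh>" "x \<in> carrier \<hh>" "y \<in> carrier \<hh>"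
  shows "l (heis_mult \<hh> x y) = l x + l y + l (bracket \<hh> x y) / 2"
  using assms by (simp add: heis_mult_def lin_dualD smult_closed bracket_closed)

lemma bracket_zero:
  assumes "g \<in> carrier \<hh>"
  shows "bracket \<hh> g \<zero>\<^bsub>\<hh>\<^esub> = \<zero>\<^bsub>\<hh>\<^esub>" "bracket \<hh> \<zero>\<^bsub>\<hh>\<^esub> g = \<zero>\<^bsub>\<hh>\<^esub>"
  using bracket_smult_left[OF m.zero_closed assms, of 0] bracket_smult_right[OF assms m.zero_closed, of 0]
  by (simp_all add: smult_zero bracket_closed assms)

lemma heis_mult_zero:
  assumes "g \<in> carrier \<hh>" "x \<in> carrier \<hh>"
  shows "heis_mult \<hh> g (0 \<odot>\<^bsub>\<hh>\<^esub> x) = g" "heis_mult \<hh> (0 \<odot>\<^bsub>\<hh>\<^esub> x) g = g"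
  using assms by (simp_all add: heis_mult_def bracket_smult_left bracket_smult_right smult_zero bracket_closed smult_r_zero bracket_zero)

lemma heis_mult_identity:
  assumes "x \<in> carrier \<hh>"
  shows "heis_mult \<hh> \<zero>\<^bsub>\<hh>\<^esub> x = x" "heis_mult \<hh> x \<zero>\<^bsub>\<hh>\<^esub> = x"
  using heis_mult_zero[OF assms m.zero_closed] by (simp_all add: smult_zero)

text \<open>
  Left and right invariant fields differ only in the side of the translation, so a flag
  lets one argument treat both.
\<close>

definition flow :: "bool \<Rightarrow> 'a \<Rightarrow> 'a \<Rightarrow> complex \<Rightarrow> 'a" where
  "flow b x g t = (if b then heis_mult \<hh> g (t \<odot>\<^bsub>\<hh>\<^esub> x) else heis_mult \<hh> (t \<odot>\<^bsub>\<hh>\<^esub> x) g)"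

definition invariant_field :: "bool \<Rightarrow> 'a \<Rightarrow> ('a \<Rightarrow> complex) \<Rightarrow> 'a \<Rightarrow> complex" where
  "invariant_field b x f g = deriv (\<lambda>t. f (flow b x g t)) 0"

lemma invariant_field_left: "left_invariant \<hh> x f = invariant_field True x f"
  and invariant_field_right: "right_invariant \<hh> x f = invariant_field False x f"
  by (simp_all add: left_invariant_def right_invariant_def invariant_field_def[abs_def] flow_def)

lemma flow_closed: "g \<in> carrier \<hh> \<Longrightarrow> x \<in> carrier \<hh> \<Longrightarrow> flow b x g t \<in> carrier \<hh>"
  by (simp add: flow_def heis_mult_closed smult_closed)

lemma flow_zero: "g \<in> carrier \<hh> \<Longrightarrow> x \<in> carrier \<hh> \<Longrightarrow> flow b x g 0 = g"
  by (simp add: flow_def heis_mult_zero)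

definition commutator_term :: "bool \<Rightarrow> 'a \<Rightarrow> 'a \<Rightarrow> 'a" where
  "commutator_term b x g = (if b then bracket \<hh> g x else bracket \<hh> x g)"

lemma commutator_term_closed: "x \<in> carrier \<hh> \<Longrightarrow> g \<in> carrier \<hh> \<Longrightarrow> commutator_term b x g \<in> carrier \<hh>"
  by (simp add: commutator_term_def bracket_closed)

lemma lin_dual_flow:
  assumes "l \<in> lin_dual \<hh>" "x \<in> carrier \<hh>" "g \<in> carrier \<hh>"
  shows "l (flow b x g t) = l g + t * (l x + l (commutator_term b x g) / 2)"
  using assms
  by (simp add: flow_def commutator_term_def lin_dual_heis_mult smult_closed lin_dualD bracket_smult_left bracket_smult_right
      bracket_closed algebra_simps)

lemma invariant_field_linear:
  assumes "l \<in> lin_dual \<hh>" "x \<in> carrier \<hh>" "g \<in> carrier \<hh>"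
  shows "invariant_field b x l g = l x + l (commutator_term b x g) / 2"
proof -
  have "((\<lambda>t. l g + t * (l x + l (commutator_term b x g) / 2)) has_field_derivative (l x + l (commutator_term b x g) / 2)) (at 0)"
    by (auto intro!: derivative_eq_intros)
  then show ?thesis unfolding invariant_field_def using assms by (simp add: lin_dual_flow DERIV_imp_deriv)
qed

lemma invariant_field_cong:
  assumes "\<And>g. g \<in> carrier \<hh> \<Longrightarrow> f g = f' g" "x \<in> carrier \<hh>" "g \<in> carrier \<hh>"
  shows "invariant_field b x f g = invariant_field b x f' g"
  using assms by (simp add: invariant_field_def flow_closed)

lemma poly_differentiable:
  assumes "f \<in> poly_functions \<hh>" "x \<in> carrier \<hh>" "g \<in> carrier \<hh>"
  shows "(\<lambda>t. f (flow b x g t)) field_differentiable (at 0)"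
  using assms
proof (induction f)
  case (linear l)
  have "(\<lambda>t. l g + t * (l x + l (commutator_term b x g) / 2)) field_differentiable at 0"
    by (intro derivative_intros)
  then show ?case using linear by (simp add: lin_dual_flow)
next
  case (agree f h)
  then show ?case by (simp add: flow_closed)
qed (auto intro!: field_differentiable_add field_differentiable_mult)

lemma invariant_field_const: "invariant_field b x (\<lambda>g. c) = (\<lambda>g. 0)"
  by (simp add: invariant_field_def[abs_def])

lemma
  assumes "f \<in> poly_functions \<hh>" "h \<in> poly_functions \<hh>" "x \<in> carrier \<hh>" "g \<in> carrier \<hh>"
  shows invariant_field_add: "invariant_field b x (\<lambda>g. f g + h g) g = invariant_field b x f g + invariant_field b x h g"
    and invariant_field_mult: "invariant_field b x (\<lambda>g. f g * h g) g = f g * invariant_field b x h g + invariant_field b x f g * h g"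
  using poly_differentiable[OF assms(1,3,4)] poly_differentiable[OF assms(2,3,4)] assms
  by (simp_all add: invariant_field_def flow_zero)

lemma commutator_dual:
  assumes "l \<in> lin_dual \<hh>" "x \<in> carrier \<hh>"
  shows "(\<lambda>g. if g \<in> carrier \<hh> then l (commutator_term b x g) else 0) \<in> lin_dual \<hh>"
  using assms unfolding lin_dual_def[of \<hh>, THEN eq_reflection] mem_Collect_eq
  by (auto simp: commutator_term_def bracket_add_left bracket_add_right bracket_smult_left bracket_smult_right
      bracket_closed smult_closed)

lemma poly_invariant_field:
  assumes "f \<in> poly_functions \<hh>" "x \<in> carrier \<hh>"
  shows "invariant_field b x f \<in> poly_functions \<hh>"
  using assms(1)
proof induction
  case (const c)
  show ?case unfolding invariant_field_const by (rule poly_functions.const)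
next
  case (linear l)
  have "(\<lambda>g. l x + (1/2) * (if g \<in> carrier \<hh> then l (commutator_term b x g) else 0)) \<in> poly_functions \<hh>"
    by (intro poly_functions.add poly_functions.mult poly_functions.const poly_functions.linear commutator_dual linear assms(2))
  then show ?case
    by (rule poly_functions.agree) (simp add: invariant_field_linear[OF linear assms(2)])
next
  case (add f h)
  show ?case
    by (rule poly_functions.agree[OF poly_functions.add[OF add.IH]]) (simp add: invariant_field_add add.hyps assms(2))
next
  case (mult f h)
  show ?case
    by (rule poly_functions.agree[OF poly_functions.add[OF poly_functions.mult[OF mult.hyps(1) mult.IH(2)] poly_functions.mult[OF mult.IH(1) mult.hyps(2)]]])
      (simp add: invariant_field_mult mult.hyps assms(2))
next
  case (agree f h)
  show ?case
    by (rule poly_functions.agree[OF agree.IH]) (rule invariant_field_cong, auto simp: agree.hyps assms(2))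
qed

lemma invariant_fields_commute:
  assumes "f \<in> poly_functions \<hh>" "x \<in> carrier \<hh>" "y \<in> carrier \<hh>" "g \<in> carrier \<hh>"
  shows "invariant_field True x (invariant_field False y f) g = invariant_field False y (invariant_field True x f) g"
  using assms(1,4)
proof (induction arbitrary: g)
  case (const c)
  show ?case by (simp add: invariant_field_const)
next
  case (linear l)
  have *: "invariant_field b x (invariant_field b' y l) g = l (commutator_term b' y x) / 2"
    if "x \<in> carrier \<hh>" "y \<in> carrier \<hh>" for b b' x y
  proof -
    define l' where "l' g = (if g \<in> carrier \<hh> then l (commutator_term b' y g) else 0)" for g
    have l': "l' \<in> lin_dual \<hh>" unfolding l'_def by (rule commutator_dual[OF linear(1) that(2)])
    have P: "l' \<in> poly_functions \<hh>" "(\<lambda>g. 1/2 * l' g) \<in> poly_functions \<hh>"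
      by (intro poly_functions.mult poly_functions.const poly_functions.linear l')+
    have "invariant_field b x (invariant_field b' y l) g = invariant_field b x (\<lambda>g. l y + 1/2 * l' g) g"
      by (rule invariant_field_cong) (auto simp: l'_def invariant_field_linear[OF linear(1) that(2)] that linear(2))
    also have "\<dots> = invariant_field b x (\<lambda>g. l y) g + invariant_field b x (\<lambda>g. 1/2 * l' g) g"
      by (rule invariant_field_add[OF poly_functions.const P(2) that(1) linear(2)])
    also have "invariant_field b x (\<lambda>g. 1/2 * l' g) g = 1/2 * invariant_field b x l' g + invariant_field b x (\<lambda>g. 1/2) g * l' g"
      by (rule invariant_field_mult[OF poly_functions.const P(1) that(1) linear(2)])
    also have "invariant_field b x l' g = l' x + l' (commutator_term b x g) / 2"
      by (rule invariant_field_linear[OF l' that(1) linear(2)])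
    also have "l' (commutator_term b x g) = 0"
    proof -
      have "bracket \<hh> (bracket \<hh> u v) w = \<zero>\<^bsub>\<hh>\<^esub>" if "u \<in> carrier \<hh>" "v \<in> carrier \<hh>" "w \<in> carrier \<hh>" for u v w
      proof -
        let ?z = "bracket \<hh> u v"
        have z: "?z \<in> carrier \<hh>" using that bracket_closed by simp
        have alt: "bracket \<hh> k k = \<zero>\<^bsub>\<hh>\<^esub>" if "k \<in> carrier \<hh>" for k using lie that unfolding lie_algebra_def by blast
        have "\<zero>\<^bsub>\<hh>\<^esub> = bracket \<hh> (?z \<oplus>\<^bsub>\<hh>\<^esub> w) (?z \<oplus>\<^bsub>\<hh>\<^esub> w)" using z that by (simp add: alt)
        also have "\<dots> = (bracket \<hh> ?z ?z \<oplus>\<^bsub>\<hh>\<^esub> bracket \<hh> ?z w) \<oplus>\<^bsub>\<hh>\<^esub> (bracket \<hh> w ?z \<oplus>\<^bsub>\<hh>\<^esub> bracket \<hh> w w)"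
          using z that by (simp only: bracket_add_left[OF z that(3) m.add.m_closed[OF z that(3)]] bracket_add_right)
        also have "\<dots> = bracket \<hh> ?z w"
          using z that by (simp add: alt nilpotent bracket_closed)
        finally show ?thesis by simp
      qed
      then show ?thesis
        using linear that by (simp add: l'_def commutator_term_def nilpotent bracket_closed lin_dual_zero)
    qed
    finally show ?thesis using that by (simp add: l'_def invariant_field_const)
  qed
  show ?case using assms(2,3) by (simp add: * commutator_term_def)
next
  case (add f h)
  have *: "invariant_field b x (invariant_field b' y (\<lambda>g. f g + h g)) g =
      invariant_field b x (invariant_field b' y f) g + invariant_field b x (invariant_field b' y h) g"
    if "x \<in> carrier \<hh>" "y \<in> carrier \<hh>" for b b' x y
  proof -
    have "invariant_field b x (invariant_field b' y (\<lambda>g. f g + h g)) g =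
        invariant_field b x (\<lambda>g. invariant_field b' y f g + invariant_field b' y h g) g"
      by (rule invariant_field_cong) (auto simp: invariant_field_add add.hyps that add.prems)
    then show ?thesis by (simp add: invariant_field_add poly_invariant_field add.hyps that add.prems)
  qed
  show ?case by (simp add: * assms(2,3) add.IH[OF add.prems])
next
  case (mult f h)
  have *: "invariant_field b x (invariant_field b' y (\<lambda>g. f g * h g)) g =
      f g * invariant_field b x (invariant_field b' y h) g + invariant_field b x f g * invariant_field b' y h g
      + (invariant_field b' y f g * invariant_field b x h g + invariant_field b x (invariant_field b' y f) g * h g)"
    if "x \<in> carrier \<hh>" "y \<in> carrier \<hh>" for b b' x y
  proof -
    have "invariant_field b x (invariant_field b' y (\<lambda>g. f g * h g)) g =
        invariant_field b x (\<lambda>g. f g * invariant_field b' y h g + invariant_field b' y f g * h g) g"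
      by (rule invariant_field_cong) (auto simp: invariant_field_mult mult.hyps that mult.prems)
    then show ?thesis
      by (simp add: invariant_field_add invariant_field_mult poly_functions.mult poly_invariant_field mult.hyps that mult.prems)
  qed
  show ?case by (simp add: * assms(2,3) mult.IH[OF mult.prems])
next
  case (agree f h)
  have *: "invariant_field b x (invariant_field b' y h) g = invariant_field b x (invariant_field b' y f) g"
    if "x \<in> carrier \<hh>" "y \<in> carrier \<hh>" for b b' x y
    by (rule invariant_field_cong[OF invariant_field_cong]) (auto simp: agree.hyps that agree.prems)
  show ?case by (simp add: * assms(2,3) agree.IH[OF agree.prems])
qed

lemma foldr_left_invariant_poly:
  assumes "f \<in> poly_functions \<hh>" "w \<in> lists (carrier \<hh>)"
  shows "foldr (left_invariant \<hh>) w f \<in> poly_functions \<hh>"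
  using assms(2) by induction (auto simp: assms(1) invariant_field_left intro: poly_invariant_field)

lemma foldr_left_right:
  assumes f: "f \<in> poly_functions \<hh>" and w: "w \<in> lists (carrier \<hh>)" and x: "x \<in> carrier \<hh>" and g: "g \<in> carrier \<hh>"
  shows "foldr (left_invariant \<hh>) w (right_invariant \<hh> x f) g = right_invariant \<hh> x (foldr (left_invariant \<hh>) w f) g"
  using w g
proof (induction arbitrary: g)
  case (Cons y w)
  have "left_invariant \<hh> y (foldr (left_invariant \<hh>) w (right_invariant \<hh> x f)) g
      = left_invariant \<hh> y (right_invariant \<hh> x (foldr (left_invariant \<hh>) w f)) g"
    unfolding invariant_field_left[of y] by (rule invariant_field_cong) (auto simp: Cons)
  also have "\<dots> = right_invariant \<hh> x (left_invariant \<hh> y (foldr (left_invariant \<hh>) w f)) g"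
    unfolding invariant_field_left[of y] invariant_field_right
    by (rule invariant_fields_commute[OF foldr_left_invariant_poly[OF f]]) (use Cons x in auto)
  finally show ?case by simp
qed simp

text \<open>
  Left and right invariant fields agree at the identity and commute, so the right invariant field of
  \<open>x\<close> acts on functionals by \<open>l \<mapsto> l (x \<cdot>)\<close>.
\<close>

lemma functions_of_right_invariant:
  assumes S: "S \<subseteq> lin_dual (uea \<hh>)" "\<And>l. l \<in> S \<Longrightarrow> shift \<hh> x l \<in> S"
    and x: "x \<in> carrier \<hh>" and f: "f \<in> functions_of \<hh> S"
  shows "right_invariant \<hh> x f \<in> functions_of \<hh> S"
proof -
  obtain l where fp: "f \<in> poly_functions \<hh>" and l: "l \<in> S"
    "\<And>w. w \<in> lists (carrier \<hh>) \<Longrightarrow> l (uea_monomial \<hh> w) = foldr (left_invariant \<hh>) w f \<zero>\<^bsub>\<hh>\<^esub>"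
    using f by (auto simp: functions_of_def)
  have "shift \<hh> x l (uea_monomial \<hh> w) = foldr (left_invariant \<hh>) w (right_invariant \<hh> x f) \<zero>\<^bsub>\<hh>\<^esub>"
    if w: "w \<in> lists (carrier \<hh>)" for w
  proof -
    have "shift \<hh> x l (uea_monomial \<hh> w) = l (uea_monomial \<hh> (x # w))"
      by (rule shift(2)[OF _ module bracket_closed x w]) (use l S in auto)
    also have "\<dots> = left_invariant \<hh> x (foldr (left_invariant \<hh>) w f) \<zero>\<^bsub>\<hh>\<^esub>"
      using l(2)[of "x # w"] w x by simp
    also have "\<dots> = right_invariant \<hh> x (foldr (left_invariant \<hh>) w f) \<zero>\<^bsub>\<hh>\<^esub>"
      using x by (simp add: left_invariant_def right_invariant_def heis_mult_identity smult_closed)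
    also have "\<dots> = foldr (left_invariant \<hh>) w (right_invariant \<hh> x f) \<zero>\<^bsub>\<hh>\<^esub>"
      by (rule foldr_left_right[OF fp w x m.zero_closed, symmetric])
    finally show ?thesis .
  qed
  moreover have "right_invariant \<hh> x f \<in> poly_functions \<hh>"
    unfolding invariant_field_right by (rule poly_invariant_field[OF fp x])
  ultimately show ?thesis using S(2)[OF l(1)] unfolding functions_of_def by blast
qed

end

section \<open>Normal form of weighted operators\<close>

definition frame_field :: "nat \<Rightarrow> (nat \<Rightarrow> 'n vfield) \<Rightarrow> 'n vfield \<Rightarrow> nat \<Rightarrow> 'n::finite vfield" where
  "frame_field r X T i = (if i < r then X i else T)"

definition frame_weight :: "nat \<Rightarrow> nat \<Rightarrow> nat" where
  "frame_weight r i = (if i < r then 1 else 2)"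

definition frame_words :: "nat \<Rightarrow> nat \<Rightarrow> nat list set" where
  "frame_words r l = {w. set w \<subseteq> {..r} \<and> sum_list (map (frame_weight r) w) \<le> l}"

definition frame_op :: "nat \<Rightarrow> (nat \<Rightarrow> 'n vfield) \<Rightarrow> 'n vfield \<Rightarrow> nat list \<Rightarrow> ('n::finite proj \<Rightarrow> complex) \<Rightarrow> 'n proj \<Rightarrow> complex" where
  "frame_op r X T w f = foldr (\<lambda>i f q. frame_field r X T i q f) w f"

lemma frame_op_simps [simp]:
  "frame_op r X T [] f = f" "frame_op r X T (i # w) f = (\<lambda>q. frame_field r X T i q (frame_op r X T w f))"
  by (simp_all add: frame_op_def)

lemma finite_frame_words: "finite (frame_words r l)"
proof (rule finite_subset)
  have len: "length w \<le> sum_list (map (frame_weight r) w)" for w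
    by (induction w) (auto simp: frame_weight_def)
  show "frame_words r l \<subseteq> {w. set w \<subseteq> {..r} \<and> length w \<le> l}"
    using len by (auto simp: frame_words_def intro: order_trans)
qed (simp add: finite_lists_length_le)

lemma frame_words_mono: "l \<le> l' \<Longrightarrow> frame_words r l \<subseteq> frame_words r l'"
  by (auto simp: frame_words_def)

locale framed =
  fixes M :: "'n::finite proj set" and H :: "'n proj \<Rightarrow> 'n tvec set" and k r X a T b and z :: "'n proj"
  assumes z: "z \<in> M" and frame: "\<forall>\<^sub>F q in near M z. adapted_frame M H k r X a T b q"
begin

lemma framed_near: "\<forall>\<^sub>F y in near M z. framed M H k r X a T b y"
  using near_near[OF frame] near_in by eventually_elim (simp add: framed_def)

lemma adapted: "adapted_frame M H k r X a T b z"
  using near_self[OF frame z] .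

lemma z_chart: "z \<in> affine_chart k"
  using adapted by (simp add: adapted_frame_def)

lemma X_section: "i < r \<Longrightarrow> section_at M H z (X i)" and T_field: "vector_field_at M z T"
  using adapted unfolding adapted_frame_def by blast+

lemma dual: "i < r \<Longrightarrow> j < r \<Longrightarrow> X i z (ratio (a j) k) = (if i = j then 1 else 0)"
  "j < r \<Longrightarrow> T z (ratio (a j) k) = 0" "T z (ratio b k) = 1"
  using adapted unfolding adapted_frame_def by blast+

lemma frame_field_vector: "vector_field_at M z (frame_field r X T i)"
  by (cases "i < r") (auto simp: frame_field_def T_field intro: section_vf X_section)

lemma frame_op_holomorphic: "holomorphic_at M z f \<Longrightarrow> holomorphic_at M z (frame_op r X T w f)"
  by (induction w) (auto intro: vector_field_holomorphic[OF frame_field_vector z])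

lemma frame_op_germ:
  assumes "holomorphic_at M z f" "\<forall>\<^sub>F q in near M z. f q = g q"
  shows "\<forall>\<^sub>F q in near M z. frame_op r X T w f q = frame_op r X T w g q"
  using assms
proof (induction w)
  case (Cons i w)
  from near_near[OF Cons.IH[OF Cons.prems]] framed_near holomorphic_at_near[OF Cons.prems(1)]
  show ?case
  proof eventually_elim
    case (elim q)
    interpret q: framed M H k r X a T b q by (rule elim(2))
    have "frame_field r X T i q (frame_op r X T w f) = frame_field r X T i q (frame_op r X T w g)"
      by (rule tangent_germ[OF vector_field_tangent[OF q.frame_field_vector q.z] q.frame_op_holomorphic[OF elim(3)] elim(1)])
    then show ?case by simp
  qed
qed simp

lemma frame_op_linear:
  assumes "\<And>j. j \<in> J \<Longrightarrow> holomorphic_at M z (f j)" "finite J"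
  shows "\<forall>\<^sub>F q in near M z. frame_op r X T w (\<lambda>q. \<Sum>j\<in>J. c j * f j q) q = (\<Sum>j\<in>J. c j * frame_op r X T w (f j) q)"
proof (induction w)
  case (Cons i w)
  have "\<forall>\<^sub>F q in near M z. \<forall>j\<in>J. holomorphic_at M q (f j)"
    using assms by (subst eventually_ball_finite_distrib) (auto intro: holomorphic_at_near)
  with near_near[OF Cons] framed_near show ?case
  proof eventually_elim
    case (elim q)
    interpret q: framed M H k r X a T b q by (rule elim(2))
    note D = vector_field_tangent[OF q.frame_field_vector q.z, of i]
    have h: "holomorphic_at M q (\<lambda>q. c j * frame_op r X T w (f j) q)" if "j \<in> J" for j
      using elim(3) that by (intro holomorphic_at_cmult q.frame_op_holomorphic) blast
    have "\<forall>\<^sub>F y in near M q. (\<Sum>j\<in>J. c j * frame_op r X T w (f j) y) = frame_op r X T w (\<lambda>q. \<Sum>j\<in>J. c j * f j q) y"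
      using elim(1) by eventually_elim (rule sym)
    from tangent_germ[OF D holomorphic_at_sum[OF h] this]
    have "frame_field r X T i q (frame_op r X T w (\<lambda>q. \<Sum>j\<in>J. c j * f j q)) =
        frame_field r X T i q (\<lambda>q. \<Sum>j\<in>J. c j * frame_op r X T w (f j) q)" by simp
    also have "\<dots> = (\<Sum>j\<in>J. frame_field r X T i q (\<lambda>q. c j * frame_op r X T w (f j) q))"
      by (rule tangent_sum[OF D h])
    also have "\<dots> = (\<Sum>j\<in>J. c j * frame_field r X T i q (frame_op r X T w (f j)))"
      by (rule sum.cong[OF refl], rule tangent_cmult[OF D q.frame_op_holomorphic]) (use elim(3) in blast)
    finally show ?case by simp
  qed
qed simp

text \<open>
  By the Leibniz rule every weighted operator is a combination, with holomorphic coefficients, of the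
  finitely many words in the frame of at most its weight.
\<close>

definition comb_op :: "(('n proj \<Rightarrow> complex) \<times> nat list) list \<Rightarrow> ('n proj \<Rightarrow> complex) \<Rightarrow> 'n proj \<Rightarrow> complex" where
  "comb_op cs f q = (\<Sum>(c, w)\<leftarrow>cs. c q * frame_op r X T w f q)"

definition normal_form :: "nat \<Rightarrow> (('n proj \<Rightarrow> complex) \<Rightarrow> 'n proj \<Rightarrow> complex) \<Rightarrow> bool" where
  "normal_form l P \<longleftrightarrow> (\<exists>cs. (\<forall>(c, w)\<in>set cs. holomorphic_at M z c \<and> w \<in> frame_words r l)
     \<and> (\<forall>\<^sub>F y in near M z. \<forall>f. holomorphic_at M y f \<longrightarrow> P f y = comb_op cs f y))"

lemma comb_op_simps [simp]: "comb_op [] f = (\<lambda>q. 0)"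
  "comb_op ((c, w) # cs) f = (\<lambda>q. c q * frame_op r X T w f q + comb_op cs f q)"
  "comb_op (cs @ ds) f q = comb_op cs f q + comb_op ds f q"
  by (simp_all add: comb_op_def fun_eq_iff)

lemma comb_op_holomorphic:
  assumes "\<forall>(c, w)\<in>set cs. holomorphic_at M z c" "holomorphic_at M z f"
  shows "holomorphic_at M z (comb_op cs f)"
  using assms(1)
  by (induction cs) (auto intro!: holomorphic_at_const holomorphic_at_add holomorphic_at_mult frame_op_holomorphic assms(2))

lemma holomorphic_list_near:
  assumes "\<forall>(c, w)\<in>set cs. holomorphic_at M z c \<and> w \<in> A"
  shows "\<forall>\<^sub>F y in near M z. \<forall>(c, w)\<in>set cs. holomorphic_at M y c"
  using assms by (subst eventually_ball_finite_distrib) (auto simp: case_prod_beta intro: holomorphic_at_near)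

lemma normal_formI:
  assumes "\<forall>(c, w)\<in>set cs. holomorphic_at M z c \<and> w \<in> frame_words r l"
    and "\<forall>\<^sub>F y in near M z. \<forall>f. holomorphic_at M y f \<longrightarrow> P f y = comb_op cs f y"
  shows "normal_form l P"
  unfolding normal_form_def using assms by (intro exI[of _ cs]) simp

lemma normal_formE:
  assumes "normal_form l P"
  obtains cs where "\<forall>(c, w)\<in>set cs. holomorphic_at M z c \<and> w \<in> frame_words r l"
    and "\<forall>\<^sub>F y in near M z. \<forall>f. holomorphic_at M y f \<longrightarrow> P f y = comb_op cs f y"
  using assms unfolding normal_form_def by (elim exE conjE) (rule that)

lemma normal_form_holomorphic:
  assumes "normal_form l P" "holomorphic_at M z f" shows "holomorphic_at M z (P f)"
proof -
  obtain cs where cs: "\<forall>(c, w)\<in>set cs. holomorphic_at M z c \<and> w \<in> frame_words r l"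
    "\<forall>\<^sub>F y in near M z. \<forall>f. holomorphic_at M y f \<longrightarrow> P f y = comb_op cs f y"
    using assms(1) by (rule normal_formE)
  show ?thesis
  proof (rule holomorphic_at_cong)
    show "holomorphic_at M z (comb_op cs f)" by (rule comb_op_holomorphic[OF _ assms(2)]) (use cs(1) in auto)
    show "\<forall>\<^sub>F q in near M z. comb_op cs f q = P f q"
      using cs(2) holomorphic_at_near[OF assms(2)] by eventually_elim simp
  qed
qed

lemma normal_form_mono: "normal_form l P \<Longrightarrow> l \<le> l' \<Longrightarrow> normal_form l' P"
  by (erule normal_formE, rule normal_formI) (use frame_words_mono[of l l' r] in \<open>auto split: prod.splits\<close>)

lemma normal_form_add:
  assumes "normal_form l P" "normal_form l Q" shows "normal_form l (\<lambda>f q. P f q + Q f q)"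
proof -
  obtain cs where cs: "\<forall>(c, w)\<in>set cs. holomorphic_at M z c \<and> w \<in> frame_words r l"
    "\<forall>\<^sub>F y in near M z. \<forall>f. holomorphic_at M y f \<longrightarrow> P f y = comb_op cs f y"
    using assms(1) by (rule normal_formE)
  obtain ds where ds: "\<forall>(c, w)\<in>set ds. holomorphic_at M z c \<and> w \<in> frame_words r l"
    "\<forall>\<^sub>F y in near M z. \<forall>f. holomorphic_at M y f \<longrightarrow> Q f y = comb_op ds f y"
    using assms(2) by (rule normal_formE)
  show ?thesis
  proof (rule normal_formI[of "cs @ ds"])
    show "\<forall>\<^sub>F y in near M z. \<forall>f. holomorphic_at M y f \<longrightarrow> P f y + Q f y = comb_op (cs @ ds) f y"
      using cs(2) ds(2) by eventually_elim simp
  qed (use cs(1) ds(1) in auto)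
qed

lemma normal_form_scale:
  assumes "normal_form l P" "holomorphic_at M z g" shows "normal_form l (\<lambda>f q. g q * P f q)"
proof -
  obtain cs where cs: "\<forall>(c, w)\<in>set cs. holomorphic_at M z c \<and> w \<in> frame_words r l"
    "\<forall>\<^sub>F y in near M z. \<forall>f. holomorphic_at M y f \<longrightarrow> P f y = comb_op cs f y"
    using assms(1) by (rule normal_formE)
  have *: "comb_op (map (\<lambda>(c, w). (\<lambda>q. g q * c q, w)) cs) f y = g y * comb_op cs f y" for f y
    by (induction cs) (auto simp: algebra_simps)
  show ?thesis
  proof (rule normal_formI[of "map (\<lambda>(c, w). (\<lambda>q. g q * c q, w)) cs"])
    show "\<forall>\<^sub>F y in near M z. \<forall>f. holomorphic_at M y f \<longrightarrow> g y * P f y = comb_op (map (\<lambda>(c, w). (\<lambda>q. g q * c q, w)) cs) f y"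
      using cs(2) by eventually_elim (simp add: *)
  qed (use cs(1) assms(2) in \<open>auto intro: holomorphic_at_mult\<close>)
qed

lemma derivation_comb_op:
  assumes "\<forall>(c, w)\<in>set cs. holomorphic_at M z c" "holomorphic_at M z f"
  shows "frame_field r X T i z (comb_op cs f) =
    comb_op (map (\<lambda>(c, w). (\<lambda>q. frame_field r X T i q c, w)) cs @ map (\<lambda>(c, w). (c, i # w)) cs) f z"
proof -
  note D = vector_field_tangent[OF frame_field_vector z, of i]
  show ?thesis
    using assms(1)
  proof (induction cs)
    case Nil
    then show ?case by (simp add: tangent_const[OF D])
  next
    case (Cons cw cs)
    obtain c w where cw: "cw = (c, w)" by fastforce
    have c: "holomorphic_at M z c" and w: "holomorphic_at M z (frame_op r X T w f)"
      and cs: "holomorphic_at M z (comb_op cs f)"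
      using Cons.prems by (auto simp: cw intro: frame_op_holomorphic comb_op_holomorphic assms(2))
    show ?case
      using Cons tangent_add[OF D holomorphic_at_mult[OF c w] cs] tangent_mult[OF D c w]
      by (simp add: cw algebra_simps)
  qed
qed

lemma normal_form_field:
  assumes "normal_form l P" "i \<le> r"
  shows "normal_form (frame_weight r i + l) (\<lambda>f q. frame_field r X T i q (P f))"
proof -
  obtain cs where cs: "\<forall>(c, w)\<in>set cs. holomorphic_at M z c \<and> w \<in> frame_words r l"
    "\<forall>\<^sub>F y in near M z. \<forall>f. holomorphic_at M y f \<longrightarrow> P f y = comb_op cs f y"
    using assms(1) by (rule normal_formE)
  let ?ds = "map (\<lambda>(c, w). (\<lambda>q. frame_field r X T i q c, w)) cs @ map (\<lambda>(c, w). (c, i # w)) cs"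
  show ?thesis
  proof (rule normal_formI[of ?ds])
    show "\<forall>(c, w)\<in>set ?ds. holomorphic_at M z c \<and> w \<in> frame_words r (frame_weight r i + l)"
      using cs(1) assms(2) vector_field_holomorphic[OF frame_field_vector z]
      by (auto simp: frame_words_def split: prod.splits) (fastforce simp: frame_words_def)+
    show "\<forall>\<^sub>F y in near M z. \<forall>f. holomorphic_at M y f \<longrightarrow> frame_field r X T i y (P f) = comb_op ?ds f y"
      using near_near[OF cs(2)] framed_near holomorphic_list_near[OF cs(1)]
    proof eventually_elim
      case (elim y)
      interpret y: framed M H k r X a T b y by (rule elim(2))
      show ?case
      proof (intro allI impI)
        fix f assume f: "holomorphic_at M y f"
        have "\<forall>\<^sub>F q in near M y. comb_op cs f q = P f q"
          using elim(1) holomorphic_at_near[OF f] by eventually_elim simp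
        from tangent_germ[OF vector_field_tangent[OF y.frame_field_vector y.z] y.comb_op_holomorphic[OF elim(3) f] this, of i]
        show "frame_field r X T i y (P f) = comb_op ?ds f y"
          using y.derivation_comb_op[OF elim(3) f, of i] by simp
      qed
    qed
  qed
qed

lemma normal_form_word:
  assumes "normal_form l Q" "set w \<subseteq> {..r}"
  shows "normal_form (sum_list (map (frame_weight r) w) + l) (\<lambda>f. frame_op r X T w (Q f))"
  using assms(2)
proof (induction w)
  case (Cons i w)
  then show ?case using normal_form_field[of _ "\<lambda>f. frame_op r X T w (Q f)" i] by (simp add: add.assoc)
qed (simp add: assms(1))

lemma normal_form_zero: "normal_form l (\<lambda>f q. 0)"
  by (rule normal_formI[of "[]"]) auto

lemma normal_form_cong:
  assumes "normal_form l P" "\<forall>\<^sub>F y in near M z. \<forall>f. holomorphic_at M y f \<longrightarrow> P f y = Q f y"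
  shows "normal_form l Q"
proof -
  obtain cs where cs: "\<forall>(c, w)\<in>set cs. holomorphic_at M z c \<and> w \<in> frame_words r l"
    "\<forall>\<^sub>F y in near M z. \<forall>f. holomorphic_at M y f \<longrightarrow> P f y = comb_op cs f y"
    using assms(1) by (rule normal_formE)
  have "\<forall>\<^sub>F y in near M z. \<forall>f. holomorphic_at M y f \<longrightarrow> Q f y = comb_op cs f y"
    using cs(2) assms(2) by eventually_elim simp
  with cs(1) show ?thesis by (rule normal_formI)
qed

lemma normal_form_comp:
  assumes P: "normal_form l P" and Q: "normal_form l' Q" and near: "\<forall>\<^sub>F y in near M z. \<forall>f. holomorphic_at M y f \<longrightarrow> holomorphic_at M y (Q f)"
  shows "normal_form (l + l') (\<lambda>f. P (Q f))"
proof -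
  obtain cs where cs: "\<forall>(c, w)\<in>set cs. holomorphic_at M z c \<and> w \<in> frame_words r l"
    "\<forall>\<^sub>F y in near M z. \<forall>f. holomorphic_at M y f \<longrightarrow> P f y = comb_op cs f y"
    using P by (rule normal_formE)
  have "normal_form (l + l') (\<lambda>f q. comb_op cs (Q f) q)"
    using cs(1)
  proof (induction cs)
    case (Cons cw cs)
    obtain c w where cw: "cw = (c, w)" by fastforce
    have "normal_form (l + l') (\<lambda>f q. c q * frame_op r X T w (Q f) q)"
      using Cons.prems normal_form_mono[OF normal_form_word[OF Q, of w], of "l + l'"]
      by (intro normal_form_scale) (auto simp: cw frame_words_def)
    then show ?case using Cons by (simp add: cw normal_form_add)
  qed (simp add: normal_form_zero)
  then show ?thesis
    by (rule normal_form_cong) (use cs(2) near in eventually_elim, simp)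
qed

end

lemma weighted_operator_near:
  assumes "weighted_operator M H z l P" shows "\<forall>\<^sub>F y in near M z. weighted_operator M H y l P"
  using assms
proof induction
  case ("function" g)
  from holomorphic_at_near[OF this] show ?case by eventually_elim (rule weighted_operator.function)
next
  case (horizontal \<xi>)
  from section_near[OF this] show ?case by eventually_elim (rule weighted_operator.horizontal)
next
  case (vfield \<xi>)
  from vector_field_near[OF this] show ?case by eventually_elim (rule weighted_operator.vfield)
next
  case (comp k P l Q)
  from comp.IH show ?case by eventually_elim (rule weighted_operator.comp)
next
  case (add k P Q)
  from add.IH show ?case by eventually_elim (rule weighted_operator.add)
next
  case (mono k P l)
  from mono.IH show ?case by eventually_elim (rule weighted_operator.mono[OF _ mono.hyps(2)])
qed

context framed begin

lemma section_expansion: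
  assumes "section_at M H z \<xi>"
  shows "\<forall>\<^sub>F q in near M z. \<xi> q = (\<Sum>i<r. cscale (\<xi> q (ratio (a i) k)) (X i q))"
  using frame assms[unfolded section_at_iff, THEN conjunct2]
  by eventually_elim (unfold adapted_frame_def, blast)

lemma field_expansion:
  assumes "vector_field_at M z \<xi>"
  shows "\<forall>\<^sub>F q in near M z. \<xi> q = (\<Sum>i<r. cscale (\<xi> q (ratio (a i) k)) (X i q))
     + cscale (\<xi> q (ratio b k) - (\<Sum>i<r. \<xi> q (ratio (a i) k) * X i q (ratio b k))) (T q)"
  using frame vector_field_near[OF assms] near_in
proof eventually_elim
  case (elim q)
  from vector_field_tangent[OF elim(2,3)] elim(1) show ?case unfolding adapted_frame_def by blast
qed

lemma component_holomorphic:
  assumes "vector_field_at M z \<xi>"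
  shows "holomorphic_at M z (\<lambda>q. \<xi> q (ratio c k))"
    and "holomorphic_at M z (\<lambda>q. \<xi> q (ratio b k) - (\<Sum>i<r. \<xi> q (ratio (a i) k) * X i q (ratio b k)))"
proof -
  have *: "holomorphic_at M z (\<lambda>q. \<eta> q (ratio c k))" if "vector_field_at M z \<eta>" for \<eta> c
    by (rule vector_field_holomorphic[OF that z holomorphic_at_ratio[OF z_chart]])
  show "holomorphic_at M z (\<lambda>q. \<xi> q (ratio c k))" by (rule *[OF assms])
  show "holomorphic_at M z (\<lambda>q. \<xi> q (ratio b k) - (\<Sum>i<r. \<xi> q (ratio (a i) k) * X i q (ratio b k)))"
    by (intro holomorphic_at_diff holomorphic_at_sum holomorphic_at_mult * assms section_vf[OF X_section]) auto
qed

lemma comb_op_upt: "comb_op (map (\<lambda>i. (c i, [i])) [0..<n]) f q = (\<Sum>i<n. c i q * frame_field r X T i q f)"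
  by (induction n) auto

lemma normal_form_function:
  assumes "holomorphic_at M z g" shows "normal_form 0 (\<lambda>f q. g q * f q)"
  by (rule normal_formI[of "[(g, [])]"]) (use assms in \<open>auto simp: frame_words_def\<close>)

lemma normal_form_horizontal:
  assumes "section_at M H z \<xi>" shows "normal_form 1 (\<lambda>f q. \<xi> q f)"
proof (rule normal_formI[of "map (\<lambda>i. (\<lambda>q. \<xi> q (ratio (a i) k), [i])) [0..<r]"])
  show "\<forall>\<^sub>F y in near M z. \<forall>f. holomorphic_at M y f \<longrightarrow>
      \<xi> y f = comb_op (map (\<lambda>i. (\<lambda>q. \<xi> q (ratio (a i) k), [i])) [0..<r]) f y"
    using section_expansion[OF assms]
  proof eventually_elim
    case (elim y)
    have "\<xi> y f = (\<Sum>i<r. cscale (\<xi> y (ratio (a i) k)) (X i y)) f" for f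
      using fun_cong[OF elim] .
    also have "\<dots> f = comb_op (map (\<lambda>i. (\<lambda>q. \<xi> q (ratio (a i) k), [i])) [0..<r]) f y" for f
      unfolding comb_apply comb_op_upt by (rule sum.cong) (auto simp: frame_field_def)
    finally show ?case by blast
  qed
qed (use component_holomorphic(1)[OF section_vf[OF assms]] in \<open>auto simp: frame_words_def frame_weight_def\<close>)

lemma normal_form_vfield:
  assumes "vector_field_at M z \<xi>" shows "normal_form 2 (\<lambda>f q. \<xi> q f)"
proof -
  let ?t = "\<lambda>q. \<xi> q (ratio b k) - (\<Sum>i<r. \<xi> q (ratio (a i) k) * X i q (ratio b k))"
  let ?cs = "map (\<lambda>i. (\<lambda>q. \<xi> q (ratio (a i) k), [i])) [0..<r] @ [(?t, [r])]"
  show ?thesis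
  proof (rule normal_formI[of ?cs])
    show "\<forall>\<^sub>F y in near M z. \<forall>f. holomorphic_at M y f \<longrightarrow> \<xi> y f = comb_op ?cs f y"
      using field_expansion[OF assms]
    proof eventually_elim
      case (elim y)
      have "\<xi> y f = ((\<Sum>i<r. cscale (\<xi> y (ratio (a i) k)) (X i y)) + cscale (?t y) (T y)) f" for f
        using fun_cong[OF elim] .
      also have "\<dots> f = comb_op ?cs f y" for f
      proof -
        have "(\<Sum>i<r. \<xi> y (ratio (a i) k) * X i y f) = (\<Sum>i<r. \<xi> y (ratio (a i) k) * frame_field r X T i y f)"
          by (rule sum.cong) (auto simp: frame_field_def)
        then show ?thesis
          unfolding plus_fun_apply comb_apply comb_op_simps(3) comb_op_upt by (simp add: frame_field_def[of r X T r] cscale_def)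
      qed
      finally show ?case by blast
    qed
  qed (use component_holomorphic[OF assms] in \<open>auto simp: frame_words_def frame_weight_def\<close>)
qed

end

lemma (in framed) frame_word_operator:
  "set w \<subseteq> {..r} \<Longrightarrow> weighted_operator M H z (sum_list (map (frame_weight r) w)) (\<lambda>f. frame_op r X T w f)"
proof (induction w)
  case Nil
  show ?case using weighted_operator.function[OF holomorphic_at_const[of M z 1], of H] by simp
next
  case (Cons i w)
  have "weighted_operator M H z (frame_weight r i) (\<lambda>f q. frame_field r X T i q f)"
    using weighted_operator.horizontal[OF X_section[of i]] weighted_operator.vfield[OF T_field, of H]
    by (cases "i < r") (auto simp: frame_field_def frame_weight_def)
  from weighted_operator.comp[OF this] Cons show ?case by simp
qed

lemma weighted_operator_normal_form:
  assumes "weighted_operator M H z l P" "framed M H k r X a T b z"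
  shows "framed.normal_form M r X T z l P"
proof -
  have "\<forall>\<^sub>F y in near M z. framed.normal_form M r X T y l P"
    using assms(1)
  proof induction
    case ("function" g)
    from holomorphic_at_near[OF this] framed.framed_near[OF assms(2)]
    show ?case by eventually_elim (rule framed.normal_form_function)
  next
    case (horizontal \<xi>)
    from section_near[OF this] framed.framed_near[OF assms(2)]
    show ?case by eventually_elim (rule framed.normal_form_horizontal)
  next
    case (vfield \<xi>)
    from vector_field_near[OF this] framed.framed_near[OF assms(2)]
    show ?case by eventually_elim (rule framed.normal_form_vfield)
  next
    case (comp k' P l Q)
    from comp.IH near_near[OF comp.IH(2)] framed.framed_near[OF assms(2)] near_near[OF framed.framed_near[OF assms(2)]]
    show ?case
    proof eventually_elim
      case (elim y)
      have "\<forall>\<^sub>F y in near M y. \<forall>f. holomorphic_at M y f \<longrightarrow> holomorphic_at M y (Q f)"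
        using elim(3,5) by eventually_elim (auto intro: framed.normal_form_holomorphic)
      with elim show ?case by (intro framed.normal_form_comp)
    qed
  next
    case (add k' P Q)
    from add.IH framed.framed_near[OF assms(2)] show ?case by eventually_elim (rule framed.normal_form_add)
  next
    case (mono k' P l)
    from mono.IH framed.framed_near[OF assms(2)]
    show ?case by eventually_elim (rule framed.normal_form_mono[OF _ _ mono.hyps(2)])
  qed
  then show ?thesis using framed.z[OF assms(2)] by (rule near_self)
qed

context framed begin

lemma operator_holomorphic:
  "weighted_operator M H z l P \<Longrightarrow> holomorphic_at M z f \<Longrightarrow> holomorphic_at M z (P f)"
  using normal_form_holomorphic weighted_operator_normal_form framed_axioms by blast

lemma operator_words:
  assumes "weighted_operator M H z l P"
  obtains cs where "\<And>c w. (c, w) \<in> set cs \<Longrightarrow> w \<in> frame_words r l"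
    "\<And>f. holomorphic_at M z f \<Longrightarrow> P f z = (\<Sum>(c, w)\<leftarrow>cs. c * frame_op r X T w f z)"
proof -
  obtain cs where cs: "\<forall>(c, w)\<in>set cs. holomorphic_at M z c \<and> w \<in> frame_words r l"
    "\<forall>\<^sub>F y in near M z. \<forall>f. holomorphic_at M y f \<longrightarrow> P f y = comb_op cs f y"
    using weighted_operator_normal_form[OF assms framed_axioms] by (rule normal_formE)
  show ?thesis
  proof (rule that[of "map (\<lambda>(c, w). (c z, w)) cs"])
    show "\<And>c w. (c, w) \<in> set (map (\<lambda>(c, w). (c z, w)) cs) \<Longrightarrow> w \<in> frame_words r l" using cs(1) by auto
    fix f assume "holomorphic_at M z f"
    then have "P f z = comb_op cs f z" using near_self[OF cs(2) z] by blast
    also have "\<dots> = (\<Sum>(c, w)\<leftarrow>map (\<lambda>(c, w). (c z, w)) cs. c * frame_op r X T w f z)"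
      by (induction cs) auto
    finally show "P f z = (\<Sum>(c, w)\<leftarrow>map (\<lambda>(c, w). (c z, w)) cs. c * frame_op r X T w f z)" .
  qed
qed

lemma operator_germ:
  assumes "weighted_operator M H z l P" "holomorphic_at M z f" "\<forall>\<^sub>F q in near M z. f q = g q"
  shows "P f z = P g z"
proof -
  obtain cs where cs: "\<And>f. holomorphic_at M z f \<Longrightarrow> P f z = (\<Sum>(c, w)\<leftarrow>cs. c * frame_op r X T w f z)"
    using operator_words[OF assms(1)] by metis
  have "holomorphic_at M z g" by (rule holomorphic_at_cong[OF assms(2,3)])
  moreover have "frame_op r X T w f z = frame_op r X T w g z" for w
    using near_self[OF frame_op_germ[OF assms(2,3)] z] .
  ultimately show ?thesis using cs assms(2) by simp
qed

lemma operator_linear: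
  assumes "weighted_operator M H z l P" "finite J" "\<And>j. j \<in> J \<Longrightarrow> holomorphic_at M z (f j)"
  shows "P (\<lambda>q. \<Sum>j\<in>J. c j * f j q) z = (\<Sum>j\<in>J. c j * P (f j) z)"
proof -
  obtain cs where cs: "\<And>f. holomorphic_at M z f \<Longrightarrow> P f z = (\<Sum>(c, w)\<leftarrow>cs. c * frame_op r X T w f z)"
    using operator_words[OF assms(1)] by metis
  have lin: "frame_op r X T w (\<lambda>q. \<Sum>j\<in>J. c j * f j q) z = (\<Sum>j\<in>J. c j * frame_op r X T w (f j) z)" for w
    by (rule near_self[OF frame_op_linear[OF assms(3,2)] z])
  have "P (\<lambda>q. \<Sum>j\<in>J. c j * f j q) z = (\<Sum>(d, w)\<leftarrow>cs. d * (\<Sum>j\<in>J. c j * frame_op r X T w (f j) z))"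
    by (subst cs) (auto simp: lin intro!: holomorphic_at_sum holomorphic_at_cmult assms)
  also have "\<dots> = (\<Sum>j\<in>J. c j * (\<Sum>(d, w)\<leftarrow>cs. d * frame_op r X T w (f j) z))"
    by (induction cs) (auto simp: sum_distrib_left sum.distrib algebra_simps)
  also have "\<dots> = (\<Sum>j\<in>J. c j * P (f j) z)"
    by (rule sum.cong) (auto simp: cs assms(3))
  finally show ?thesis .
qed

end

section \<open>Ranks\<close>

text \<open>
  The rank of a family of rows is read off from square matrices: some of the rows, completed by
  standard basis vectors to an invertible matrix.
\<close>

definition completed_matrix :: "('w \<Rightarrow> complex ^ 'n) \<Rightarrow> ('n \<Rightarrow> 'w + 'n) \<Rightarrow> complex ^ 'n ^ 'n" where
  "completed_matrix g c = (\<chi> j. case c j of Inl w \<Rightarrow> g w | Inr i \<Rightarrow> axis i 1)"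

definition choices :: "'w set \<Rightarrow> nat \<Rightarrow> ('n::finite \<Rightarrow> 'w + 'n) set" where
  "choices W R = {c. range c \<subseteq> W <+> UNIV \<and> R \<le> card {j. isl (c j)}}"

lemma finite_choices: "finite W \<Longrightarrow> finite (choices W R :: ('n::finite \<Rightarrow> 'w + 'n) set)"
proof (rule finite_subset)
  show "choices W R \<subseteq> PiE UNIV (\<lambda>_. W <+> UNIV)" by (auto simp: choices_def PiE_def)
  show "finite W \<Longrightarrow> finite (PiE (UNIV :: 'n set) (\<lambda>_. W <+> (UNIV :: 'n set)))"
    by (intro finite_PiE finite_Plus) auto
qed

lemma completed_matrix_rows:
  fixes g :: "'w \<Rightarrow> complex ^ 'n"
  assumes c: "c \<in> choices W R" and det: "det (completed_matrix g c) \<noteq> 0"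
  obtains B where "B \<subseteq> g ` W" "vec.independent B" "card B \<ge> R" "B = {completed_matrix g c $ j | j. isl (c j)}"
proof -
  let ?A = "completed_matrix g c" and ?J = "{j. isl (c j)}"
  have inj: "inj (\<lambda>j. ?A $ j)"
  proof (rule injI, rule ccontr)
    fix i j assume "?A $ i = ?A $ j" "i \<noteq> j"
    then have "det ?A = 0" by (intro det_identical_rows[of i j]) (simp_all add: row_def)
    with det show False by simp
  qed
  have ind: "vec.independent (rows ?A)" using det det_dependent_rows by blast
  have sub: "(\<lambda>j. ?A $ j) ` ?J \<subseteq> rows ?A" by (auto simp: rows_def row_def)
  have "card ((\<lambda>j. ?A $ j) ` ?J) = card ?J" by (rule card_image) (rule inj_on_subset[OF inj], simp)
  moreover have "(\<lambda>j. ?A $ j) ` ?J \<subseteq> g ` W"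
  proof
    fix v assume "v \<in> (\<lambda>j. ?A $ j) ` ?J"
    then obtain j where j: "isl (c j)" "v = ?A $ j" by blast
    moreover have "c j \<in> W <+> UNIV" using c by (auto simp: choices_def)
    ultimately show "v \<in> g ` W" by (auto simp: completed_matrix_def)
  qed
  ultimately show ?thesis
    using c vec.independent_mono[OF ind sub] by (intro that[of "(\<lambda>j. ?A $ j) ` ?J"]) (auto simp: choices_def)
qed

lemma rank_ge_iff:
  fixes g :: "'w \<Rightarrow> complex ^ 'n"
  shows "R \<le> vec.dim (vec.span (g ` W)) \<longleftrightarrow> (\<exists>c\<in>choices W R. det (completed_matrix g c) \<noteq> 0)"
proof
  assume "\<exists>c\<in>choices W R. det (completed_matrix g c) \<noteq> 0"
  then obtain c where "c \<in> choices W R" "det (completed_matrix g c) \<noteq> 0" by blast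
  from completed_matrix_rows[OF this] obtain B where B: "B \<subseteq> g ` W" "vec.independent B" "card B \<ge> R" by metis
  have "card B \<le> vec.dim (vec.span (g ` W))"
    by (rule vec.independent_card_le_dim[OF _ B(2)]) (use B(1) vec.span_superset in blast)
  with B(3) show "R \<le> vec.dim (vec.span (g ` W))" by simp
next
  assume R: "R \<le> vec.dim (vec.span (g ` W))"
  obtain B where B: "B \<subseteq> g ` W" "vec.independent B" "g ` W \<subseteq> vec.span B"
    using vec.maximal_independent_subset by blast
  have cB: "card B = vec.dim (vec.span (g ` W))"
    using vec.basis_card_eq_dim[OF B(1,3,2)] by simp
  let ?V = "B \<union> cart_basis"
  obtain B' where B': "B \<subseteq> B'" "B' \<subseteq> ?V" "vec.independent B'" "?V \<subseteq> vec.span B'"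
    using vec.maximal_independent_subset_extend[of B ?V] B(2) by blast
  have sp: "vec.span B' = UNIV"
  proof -
    have "vec.span cart_basis \<subseteq> vec.span B'" using B'(4) by (intro vec.span_minimal) auto
    then have "UNIV \<subseteq> vec.span B'" by simp
    then show ?thesis by blast
  qed
  have "card B' = vec.dim (UNIV :: (complex ^ 'n) set)"
    using vec.basis_card_eq_dim[of B' UNIV] B'(3) sp by simp
  also have "\<dots> = CARD('n)" by (simp add: vec.dim_UNIV vec.dimension_def card_cart_basis)
  finally have "card B' = CARD('n)" .
  moreover have fB': "finite B'" using B'(3) by (rule vec.finiteI_independent)
  ultimately obtain h where h: "bij_betw h (UNIV :: 'n set) B'"
    using finite_same_card_bij[of "UNIV :: 'n set" B'] by auto
  define c :: "'n \<Rightarrow> 'w + 'n" where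
    "c j = (if h j \<in> B then Inl (SOME w. w \<in> W \<and> g w = h j) else Inr (SOME i. h j = axis i 1))" for j
  have hB: "(SOME w. w \<in> W \<and> g w = h j) \<in> W \<and> g (SOME w. w \<in> W \<and> g w = h j) = h j" if "h j \<in> B" for j
  proof -
    have "h j \<in> g ` W" using that B(1) by blast
    then have "\<exists>w. w \<in> W \<and> g w = h j" by (metis imageE)
    then show ?thesis by (rule someI_ex)
  qed
  have hA: "axis (SOME i. h j = axis i 1) 1 = h j" if "h j \<notin> B" for j
  proof -
    have "h j \<in> B'" using h by (auto simp: bij_betw_def)
    with that B'(2) have "\<exists>i. h j = axis i 1" by (auto simp: cart_basis_def)
    then have "h j = axis (SOME i. h j = axis i 1) 1" by (rule someI_ex)
    then show ?thesis by (rule sym)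
  qed
  have rowsA: "completed_matrix g c $ j = h j" for j
    using hB[of j] hA[of j] by (simp add: completed_matrix_def c_def)
  have "rows (completed_matrix g c) = B'"
    using h by (auto simp: rows_def row_def rowsA bij_betw_def vec_nth_inverse)
  with sp have "det (completed_matrix g c) \<noteq> 0"
    using matrix_left_invertible_span_rows_gen[of "completed_matrix g c"]
    by (metis det_nz_iff_inj invertible_det_nz invertible_left_inverse)
  moreover have "{j. isl (c j)} = h -` B" by (auto simp: c_def)
  then have "card {j. isl (c j)} = card B"
    using h B'(1) card_vimage_inj[of h B] by (auto simp: bij_betw_def)
  then have "c \<in> choices W R"
    using R cB hB by (auto simp: choices_def c_def)
  ultimately show "\<exists>c\<in>choices W R. det (completed_matrix g c) \<noteq> 0" by blast
qed

lemma holomorphic_at_det: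
  fixes A :: "'n::finite proj \<Rightarrow> complex ^ 'm ^ 'm"
  assumes "\<And>i j. holomorphic_at M p (\<lambda>q. A q $ i $ j)"
  shows "holomorphic_at M p (\<lambda>q. det (A q))"
  unfolding det_def by (intro holomorphic_at_sum holomorphic_at_mult holomorphic_at_const holomorphic_at_prod assms)

section \<open>Jets of linear forms\<close>

definition jet_row :: "'n::finite \<Rightarrow> (('n proj \<Rightarrow> complex) \<Rightarrow> 'n proj \<Rightarrow> complex) \<Rightarrow> 'n proj \<Rightarrow> complex ^ 'n" where
  "jet_row k P y = (\<chi> j. P (ratio (axis j 1) k) y)"

text \<open>
  A linear form with coefficient vector \<open>c\<close> lies in \<open>\<m>\<^sub>y\<close> to weighted order \<open>l + 1\<close> when \<open>c\<close> is
  orthogonal to this space; its dimension is the rank of the weighted \<open>l\<close>-jet map on linear forms.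
\<close>

definition jet_space :: "'n::finite proj set \<Rightarrow> ('n proj \<Rightarrow> 'n tvec set) \<Rightarrow> 'n proj \<Rightarrow> nat \<Rightarrow> (complex ^ 'n) set" where
  "jet_space M H y l = {jet_row (SOME k. y \<in> affine_chart k) P y | P. weighted_operator M H y l P}"

definition jet_rank :: "'n::finite proj set \<Rightarrow> ('n proj \<Rightarrow> 'n tvec set) \<Rightarrow> 'n proj \<Rightarrow> nat \<Rightarrow> nat" where
  "jet_rank M H y l = vec.dim (jet_space M H y l)"

definition jump_locus :: "'n::finite proj set \<Rightarrow> ('n proj \<Rightarrow> 'n tvec set) \<Rightarrow> 'n proj set" where
  "jump_locus M H = {z \<in> M. \<not> (\<forall>\<^sub>F y in near M z. \<forall>l. jet_rank M H y l = jet_rank M H z l)}"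

lemma jet_rank_mono: "l \<le> l' \<Longrightarrow> jet_rank M H y l \<le> jet_rank M H y l'"
  unfolding jet_rank_def by (rule vec.dim_subset) (auto simp: jet_space_def intro: weighted_operator.mono)

lemma jet_rank_le: "jet_rank (M :: 'n::finite proj set) H y l \<le> CARD('n)"
  unfolding jet_rank_def using vec.dim_subset_UNIV[of "jet_space M H y l"]
  by (simp add: vec.dimension_def card_cart_basis)

context framed begin

lemma jet_row_chart:
  assumes "z \<in> affine_chart k'" "z \<in> affine_chart k''" "weighted_operator M H z l P"
  shows "\<exists>Q. weighted_operator M H z l Q \<and> jet_row k' P z = jet_row k'' Q z"
proof -
  let ?u = "ratio (axis k'' 1) k'"
  have u: "holomorphic_at M z ?u" by (rule holomorphic_at_ratio[OF assms(1)])
  have w: "weighted_operator M H z l (\<lambda>f. P (\<lambda>q. ?u q * f q))"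
    using weighted_operator.comp[OF assms(3) weighted_operator.function[OF u]] by simp
  have "P (ratio (axis j 1) k') z = P (\<lambda>q. ?u q * ratio (axis j 1) k'' q) z" for j
  proof (rule operator_germ[OF assms(3) holomorphic_at_ratio[OF assms(1)]])
    show "\<forall>\<^sub>F q in near M z. ratio (axis j 1) k' q = ?u q * ratio (axis j 1) k'' q"
      using near_open[OF open_affine_chart assms(1)] near_open[OF open_affine_chart assms(2)]
      by eventually_elim (simp add: ratio_def affine_chart_def)
  qed
  with w show ?thesis by (intro exI[of _ "\<lambda>f. P (\<lambda>q. ?u q * f q)"]) (simp add: jet_row_def)
qed

lemma jet_space_eq:
  assumes "z \<in> affine_chart k'" shows "jet_space M H z l = {jet_row k' P z | P. weighted_operator M H z l P}"
proof -
  have "z \<in> affine_chart (SOME k. z \<in> affine_chart k)" using assms by (rule someI)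
  then show ?thesis
    unfolding jet_space_def using jet_row_chart assms by (auto, blast, metis)
qed

lemma jet_space_subspace: "vec.subspace (jet_space M H z l)"
proof -
  have c: "weighted_operator M H z 0 (\<lambda>f q. c * f q)" for c
    by (rule weighted_operator.function[OF holomorphic_at_const])
  show ?thesis
    unfolding jet_space_eq[OF z_chart]
  proof (rule vec.subspaceI)
    show "0 \<in> {jet_row k P z |P. weighted_operator M H z l P}"
      using weighted_operator.mono[OF c[of 0], of l]
      by (intro CollectI exI[of _ "\<lambda>f q. 0 * f q"]) (simp add: jet_row_def vec_eq_iff)
  next
    fix x y assume "x \<in> {jet_row k P z |P. weighted_operator M H z l P}" "y \<in> {jet_row k P z |P. weighted_operator M H z l P}"
    then obtain P Q where "x = jet_row k P z" "y = jet_row k Q z" "weighted_operator M H z l P" "weighted_operator M H z l Q" by blast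
    then show "x + y \<in> {jet_row k P z |P. weighted_operator M H z l P}"
      by (intro CollectI exI[of _ "\<lambda>f q. P f q + Q f q"]) (simp add: jet_row_def vec_eq_iff weighted_operator.add)
  next
    fix d x assume "x \<in> {jet_row k P z |P. weighted_operator M H z l P}"
    then obtain P where "x = jet_row k P z" "weighted_operator M H z l P" by blast
    then show "d *s x \<in> {jet_row k P z |P. weighted_operator M H z l P}"
      using weighted_operator.comp[OF c[of d], of l P]
      by (intro CollectI exI[of _ "\<lambda>f q. d * P f q"]) (simp add: jet_row_def vec_eq_iff)
  qed
qed

definition word_row :: "nat list \<Rightarrow> 'n proj \<Rightarrow> complex ^ 'n" where
  "word_row w y = jet_row k (frame_op r X T w) y"

lemma word_row_in: "w \<in> frame_words r l \<Longrightarrow> word_row w z \<in> jet_space M H z l"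
  unfolding jet_space_eq[OF z_chart] word_row_def frame_words_def
  using weighted_operator.mono[OF frame_word_operator[of w], of l] by blast

lemma jet_space_span: "jet_space M H z l = vec.span ((\<lambda>w. word_row w z) ` frame_words r l)"
proof
  show "vec.span ((\<lambda>w. word_row w z) ` frame_words r l) \<subseteq> jet_space M H z l"
    by (rule vec.span_minimal[OF _ jet_space_subspace]) (auto intro: word_row_in)
  show "jet_space M H z l \<subseteq> vec.span ((\<lambda>w. word_row w z) ` frame_words r l)"
  proof
    fix v assume "v \<in> jet_space M H z l"
    then obtain P where P: "weighted_operator M H z l P" "v = jet_row k P z" unfolding jet_space_eq[OF z_chart] by blast
    obtain cs where cs: "\<And>c w. (c, w) \<in> set cs \<Longrightarrow> w \<in> frame_words r l"
      "\<And>f. holomorphic_at M z f \<Longrightarrow> P f z = (\<Sum>(c, w)\<leftarrow>cs. c * frame_op r X T w f z)"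
      using operator_words[OF P(1)] by metis
    have "(\<Sum>(c, w)\<leftarrow>cs. c *s word_row w z) $ j = (\<Sum>(c, w)\<leftarrow>cs. c * frame_op r X T w (ratio (axis j 1) k) z)" for j
      by (induction cs) (auto simp: word_row_def jet_row_def)
    then have "v = (\<Sum>(c, w)\<leftarrow>cs. c *s word_row w z)"
      using cs(2)[OF holomorphic_at_ratio[OF z_chart]] by (simp add: P(2) jet_row_def vec_eq_iff)
    also have "\<dots> \<in> vec.span ((\<lambda>w. word_row w z) ` frame_words r l)"
      using cs(1) by (induction cs) (auto intro!: vec.span_add vec.span_scale intro: vec.span_base vec.span_zero)
    finally show "v \<in> vec.span ((\<lambda>w. word_row w z) ` frame_words r l)" .
  qed
qed

definition minor :: "('n \<Rightarrow> nat list + 'n) \<Rightarrow> 'n proj \<Rightarrow> complex" where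
  "minor c y = det (completed_matrix (\<lambda>w. word_row w y) c)"

lemma jet_rank_ge_iff: "R \<le> jet_rank M H z l \<longleftrightarrow> (\<exists>c\<in>choices (frame_words r l) R. minor c z \<noteq> 0)"
  unfolding jet_rank_def jet_space_span minor_def by (rule rank_ge_iff)

lemma completed_holomorphic: "holomorphic_at M z (\<lambda>y. completed_matrix (\<lambda>w. word_row w y) c $ i $ j)"
  by (cases "c i") (auto simp: completed_matrix_def word_row_def jet_row_def
      intro: holomorphic_at_const frame_op_holomorphic holomorphic_at_ratio[OF z_chart])

lemma minor_holomorphic: "holomorphic_at M z (minor c)"
  unfolding minor_def[abs_def] by (rule holomorphic_at_det[OF completed_holomorphic])

text \<open>
  Where the rank is locally constant, a linear form vanishing to some weighted order at \<open>z\<close> extends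
  holomorphically to linear forms vanishing to that order at the points near \<open>z\<close>: solve by Cramer's
  rule, keeping the values of the completing basis rows fixed.
\<close>

lemma vanishing_family:
  assumes const: "\<forall>\<^sub>F y in near M z. jet_rank M H y l = jet_rank M H z l"
    and e: "\<And>v. v \<in> jet_space M H z l \<Longrightarrow> (\<Sum>j\<in>UNIV. e $ j * v $ j) = 0"
  obtains \<alpha> :: "'n proj \<Rightarrow> complex ^ 'n" where "\<And>j. holomorphic_at M z (\<lambda>y. \<alpha> y $ j)" "\<alpha> z = e"
    "\<forall>\<^sub>F y in near M z. \<forall>v\<in>jet_space M H y l. (\<Sum>j\<in>UNIV. \<alpha> y $ j * v $ j) = 0"
proof -
  let ?R = "jet_rank M H z l"
  obtain c where c: "c \<in> choices (frame_words r l) ?R" "minor c z \<noteq> 0"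
    using jet_rank_ge_iff[of ?R l] by blast
  define B where "B y = completed_matrix (\<lambda>w. word_row w y) c" for y
  define \<beta> where "\<beta> = B z *v e"
  define \<alpha> where "\<alpha> y = (\<chi> j. det (\<chi> i j'. if j' = j then \<beta> $ i else B y $ i $ j') / det (B y))" for y
  have dB: "det (B y) = minor c y" for y by (simp add: B_def minor_def)
  have cr: "B y *v x = \<beta> \<longleftrightarrow> x = \<alpha> y" if "minor c y \<noteq> 0" for x y
    unfolding \<alpha>_def by (rule cramer) (simp add: dB that)
  have \<beta>0: "\<beta> $ i = 0" if ci: "isl (c i)" for i
  proof -
    obtain w where w: "c i = Inl w" using ci by (auto simp: isl_def)
    have "c i \<in> frame_words r l <+> UNIV" using c(1) by (auto simp: choices_def)
    then have "w \<in> frame_words r l" using w by auto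
    then have "(\<Sum>j\<in>UNIV. e $ j * word_row w z $ j) = 0" by (intro e word_row_in)
    then show ?thesis by (simp add: \<beta>_def B_def completed_matrix_def w matrix_vector_mult_def mult.commute)
  qed
  show ?thesis
  proof (rule that[of \<alpha>])
    show "holomorphic_at M z (\<lambda>y. \<alpha> y $ j)" for j
    proof -
      have "holomorphic_at M z (\<lambda>y. det (\<chi> i j'. if j' = j then \<beta> $ i else B y $ i $ j'))"
      proof (rule holomorphic_at_det)
        fix i j' show "holomorphic_at M z (\<lambda>y. (\<chi> i j'. if j' = j then \<beta> $ i else B y $ i $ j') $ i $ j')"
          by (cases "j' = j") (simp_all add: B_def holomorphic_at_const completed_holomorphic)
      qed
      then show ?thesis
        unfolding \<alpha>_def vec_lambda_beta divide_inverse dB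
        by (intro holomorphic_at_mult holomorphic_at_inverse[OF minor_holomorphic z c(2)])
    qed
    show "\<alpha> z = e" using cr[OF c(2), of e] by (simp add: \<beta>_def)
    show "\<forall>\<^sub>F y in near M z. \<forall>v\<in>jet_space M H y l. (\<Sum>j\<in>UNIV. \<alpha> y $ j * v $ j) = 0"
      using const framed_near holomorphic_at_nonzero(1)[OF minor_holomorphic z c(2)]
    proof eventually_elim
      case (elim y)
      interpret y: framed M H k r X a T b y by (rule elim(2))
      have "det (completed_matrix (\<lambda>w. word_row w y) c) \<noteq> 0" using elim(3) by (simp add: minor_def)
      then obtain D where D: "D \<subseteq> (\<lambda>w. word_row w y) ` frame_words r l" "vec.independent D" "card D \<ge> ?R"
        "D = {completed_matrix (\<lambda>w. word_row w y) c $ j | j. isl (c j)}"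
        by (rule completed_matrix_rows[OF c(1)]) (rule that)
      note D = D(1-3) D(4)[folded B_def]
      have Dsub: "D \<subseteq> jet_space M H y l" using D(1) y.word_row_in by auto
      have "card D \<le> vec.dim (jet_space M H y l)" by (rule vec.independent_card_le_dim[OF Dsub D(2)])
      then have "vec.dim (jet_space M H y l) = card D" using D(3) elim(1) by (simp add: jet_rank_def)
      then have span: "jet_space M H y l \<subseteq> vec.span D"
        using vec.card_ge_dim_independent[OF Dsub D(2)] by simp
      have eq: "B y *v \<alpha> y = \<beta>" using cr[of y "\<alpha> y"] elim(3) by simp
      have "(\<Sum>j\<in>UNIV. \<alpha> y $ j * v $ j) = 0" if "v \<in> D" for v
      proof -
        obtain i where i: "v = B y $ i" "isl (c i)" using \<open>v \<in> D\<close> D(4) by blast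
        have "(B y *v \<alpha> y) $ i = 0" using eq \<beta>0[OF i(2)] by simp
        then show ?thesis by (simp add: i(1) matrix_vector_mult_def mult.commute)
      qed
      then have "D \<subseteq> {v. (\<Sum>j\<in>UNIV. \<alpha> y $ j * v $ j) = 0}" by blast
      moreover have "vec.subspace {v. (\<Sum>j\<in>UNIV. \<alpha> y $ j * v $ j) = 0}"
        by (rule vec.subspaceI)
          (auto simp: algebra_simps sum.distrib simp flip: sum_distrib_left)
      ultimately have "vec.span D \<subseteq> {v. (\<Sum>j\<in>UNIV. \<alpha> y $ j * v $ j) = 0}" by (rule vec.span_minimal)
      then show ?case using span by blast
    qed
  qed
qed

end

section \<open>The jump locus\<close>

lemma locally_closed_submanifold_Int:
  assumes "locally_closed_submanifold M" "open N"
  shows "locally_closed_submanifold (M \<inter> N)"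
  unfolding locally_closed_submanifold_def
proof
  fix p assume p: "p \<in> M \<inter> N"
  from bspec[OF assms(1)[unfolded locally_closed_submanifold_def] IntD1[OF p]]
  obtain U and g :: "nat \<Rightarrow> 'a proj \<Rightarrow> complex" and r where U: "open U" "p \<in> U"
    and g: "\<forall>j<r. proj_holomorphic_on (g j) U" and MU: "M \<inter> U = {q\<in>U. \<forall>j<r. g j q = 0}"
    and ind: "\<forall>x\<in>cone U. \<forall>a. (\<forall>v. (\<Sum>j<r. a j * frechet_derivative (\<lambda>y. g j (line y)) (at x) v) = 0)
          \<longrightarrow> (\<forall>j<r. a j = (0::complex))"
    by (elim exE conjE) (rule that)
  have "open (U \<inter> N)" "p \<in> U \<inter> N" using U p assms(2) by auto
  moreover have "\<forall>j<r. proj_holomorphic_on (g j) (U \<inter> N)"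
    using g proj_holomorphic_on_subset \<open>open (U \<inter> N)\<close> by blast
  moreover have "(M \<inter> N) \<inter> (U \<inter> N) = {q\<in>U \<inter> N. \<forall>j<r. g j q = 0}" using MU by auto
  moreover have "\<forall>x\<in>cone (U \<inter> N). \<forall>a. (\<forall>v. (\<Sum>j<r. a j * frechet_derivative (\<lambda>y. g j (line y)) (at x) v) = 0)
          \<longrightarrow> (\<forall>j<r. a j = (0::complex))"
    using ind cone_mono[of "U \<inter> N" U] by blast
  ultimately show "\<exists>U (g :: nat \<Rightarrow> 'a proj \<Rightarrow> complex) r. open U \<and> p \<in> U \<and> (\<forall>i<r. proj_holomorphic_on (g i) U)
     \<and> (M \<inter> N) \<inter> U = {q\<in>U. \<forall>i<r. g i q = 0}
     \<and> (\<forall>x\<in>cone U. \<forall>a. (\<forall>v. (\<Sum>i<r. a i * frechet_derivative (\<lambda>y. g i (line y)) (at x) v) = 0)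
          \<longrightarrow> (\<forall>i<r. a i = (0::complex)))"
    by (intro exI[of _ "U \<inter> N"] exI[of _ g] exI[of _ r] conjI)
qed

lemma identity_theorem_within:
  fixes M :: "'n::finite proj set"
  assumes M: "locally_closed_submanifold M" and p: "p \<in> M" and N: "open N" "p \<in> N"
  obtains U where "open U" "p \<in> U" "U \<subseteq> N"
    "uniqueness_domain M U"
proof -
  have pMN: "p \<in> M \<inter> N" using p N by simp
  obtain U where U: "open U" "p \<in> U" "uniqueness_domain (M \<inter> N) U"
    using identity_theorem[OF locally_closed_submanifold_Int[OF M N(1)] pMN] .
  have sets: "M \<inter> (U \<inter> N) = M \<inter> N \<inter> U" by blast
  have "holomorphic_at M q f \<Longrightarrow> holomorphic_at (M \<inter> N) q f" for q f
    unfolding holomorphic_at_def by blast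
  with U(3) have "uniqueness_domain M (U \<inter> N)"
    unfolding uniqueness_domain_def sets by meson
  with U N show ?thesis by (intro that[of "U \<inter> N"]) auto
qed

text \<open>
  Near a point each rank takes its maximum off the common zeros of finitely many minors, and by the
  identity theorem on a dense set. Only finitely many weights matter, since the ranks increase
  with the weight and are bounded.
\<close>

lemma jump_locus_local:
  fixes M :: "'n::finite proj set"
  assumes M: "locally_closed_submanifold M" and H: "corank_one_subbundle M H" and p: "p \<in> M"
  obtains U F where "open U" "p \<in> U" "finite F" "\<forall>f\<in>F. \<forall>q\<in>M \<inter> U. holomorphic_at M q f"
    "jump_locus M H \<inter> U = {q\<in>M \<inter> U. \<forall>f\<in>F. f q = 0}"
    "\<And>B. open B \<Longrightarrow> M \<inter> U \<inter> B \<noteq> {} \<Longrightarrow> \<exists>y\<in>M \<inter> U \<inter> B. y \<notin> jump_locus M H"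
proof -
  obtain k r X a T b where fr: "\<forall>\<^sub>F q in near M p. adapted_frame M H k r X a T b q"
    using adapted_frame_exists[OF M H p] .
  have framed: "framed M H k r X a T b p" using p fr by (simp add: framed_def)
  obtain N where N: "open N" "p \<in> N" "\<And>q. q \<in> M \<inter> N \<Longrightarrow> framed M H k r X a T b q"
    using framed.framed_near[OF framed] unfolding eventually_near by blast
  obtain U where U: "open U" "p \<in> U" "U \<subseteq> N" "uniqueness_domain M U"
    using identity_theorem_within[OF M p N(1,2)] .
  have ident: "f q = 0" if "\<And>q. q \<in> M \<inter> U \<Longrightarrow> holomorphic_at M q f" "open B" "M \<inter> U \<inter> B \<noteq> {}"
      "\<And>q. q \<in> M \<inter> U \<inter> B \<Longrightarrow> f q = 0" "q \<in> M \<inter> U" for f B q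
    using U(4)[unfolded uniqueness_domain_def, rule_format, of f B q] that by blast
  have fU: "framed M H k r X a T b q" if "q \<in> M \<inter> U" for q using that N(3) U(3) by blast
  define rank where "rank q l = jet_rank M H q l" for q l
  define minor where "minor c q = framed.minor k r X T c q" for c :: "'n \<Rightarrow> nat list + 'n" and q
  define C where "C l R = (choices (frame_words r l) R :: ('n \<Rightarrow> nat list + 'n) set)" for l R
  have rank_iff: "R \<le> rank q l \<longleftrightarrow> (\<exists>c\<in>C l R. minor c q \<noteq> 0)" if "q \<in> M \<inter> U" for q l R
    unfolding rank_def minor_def C_def by (rule framed.jet_rank_ge_iff[OF fU[OF that]])
  have holo: "holomorphic_at M q (minor c)" if "q \<in> M \<inter> U" for q c
    unfolding minor_def by (rule framed.minor_holomorphic[OF fU[OF that]])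
  define R where "R l = Max ((\<lambda>q. rank q l) ` (M \<inter> U))" for l
  have bound: "rank q l \<le> CARD('n)" for q l unfolding rank_def by (rule jet_rank_le)
  have fin: "finite ((\<lambda>q. rank q l) ` (M \<inter> U))" for l
  proof (rule finite_subset)
    show "(\<lambda>q. rank q l) ` (M \<inter> U) \<subseteq> {..CARD('n)}" by (rule image_subsetI) (simp add: bound)
  qed simp
  have R_ge: "rank q l \<le> R l" if "q \<in> M \<inter> U" for q l
    unfolding R_def by (rule Max_ge[OF fin imageI[OF that]])
  have R_att: "\<exists>q\<in>M \<inter> U. rank q l = R l" for l
  proof -
    have "p \<in> M \<inter> U" using p U(2) by simp
    then have "(\<lambda>q. rank q l) ` (M \<inter> U) \<noteq> {}" by blast
    from Max_in[OF fin this] obtain q where "R l = rank q l" "q \<in> M \<inter> U" unfolding R_def by (rule imageE)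
    then show ?thesis by (intro bexI[of _ q]) simp_all
  qed
  have rank_mono: "rank q l \<le> rank q l'" if "l \<le> l'" for q l l'
    unfolding rank_def by (rule jet_rank_mono[OF that])
  have R_mono: "R l \<le> R l'" if "l \<le> l'" for l l'
  proof -
    obtain q where q: "q \<in> M \<inter> U" "rank q l = R l" using R_att[of l] by (rule bexE)
    have "R l \<le> rank q l'" using rank_mono[OF that, of q] by (simp add: q(2))
    also have "\<dots> \<le> R l'" by (rule R_ge[OF q(1)])
    finally show ?thesis .
  qed
  have "finite (range R)"
  proof (rule finite_subset)
    show "range R \<subseteq> {..CARD('n)}"
    proof (rule image_subsetI)
      fix l
      obtain q where "rank q l = R l" using R_att[of l] by (rule bexE)
      then show "R l \<in> {..CARD('n)}" using bound[of q l] by simp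
    qed
  qed simp
  from Max_in[OF this] obtain K where K: "Max (range R) = R K" by (auto elim: rangeE)
  have R_stable: "R l = R K" if "K \<le> l" for l
    using R_mono[OF that] Max_ge[OF \<open>finite (range R)\<close> rangeI, of l] unfolding K by simp
  have dense: "\<exists>y\<in>M \<inter> U \<inter> B. \<forall>l<n. rank y l = R l" if "open B" "M \<inter> U \<inter> B \<noteq> {}" for n B
    using that
  proof (induction n arbitrary: B)
    case (Suc n)
    obtain q where q: "q \<in> M \<inter> U" "rank q n = R n" using R_att by blast
    then obtain c where c: "c \<in> C n (R n)" "minor c q \<noteq> 0" using rank_iff[OF q(1), of "R n" n] by auto
    have "\<exists>y\<in>M \<inter> U \<inter> B. minor c y \<noteq> 0"
    proof (rule ccontr)
      assume "\<not> (\<exists>y\<in>M \<inter> U \<inter> B. minor c y \<noteq> 0)"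
      then have "minor c q = 0" by (intro ident[OF holo Suc.prems _ q(1)]) auto
      with c(2) show False by simp
    qed
    then obtain y where y: "y \<in> M \<inter> U \<inter> B" "minor c y \<noteq> 0" by blast
    then have "\<forall>\<^sub>F x in near M y. minor c x \<noteq> 0"
      by (intro holomorphic_at_nonzero(1) holo) auto
    then obtain B' where B': "open B'" "y \<in> B'" "\<forall>x\<in>M \<inter> B'. minor c x \<noteq> 0" unfolding eventually_near by blast
    have "\<exists>x\<in>M \<inter> U \<inter> (B \<inter> B'). \<forall>l<n. rank x l = R l"
      by (rule Suc.IH) (use Suc.prems B' y in auto)
    then obtain x where x: "x \<in> M \<inter> U \<inter> (B \<inter> B')" "\<forall>l<n. rank x l = R l" by blast
    have "R n \<le> rank x n" using rank_iff[of x "R n" n] x(1) B'(3) c(1) by blast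
    then have "rank x n = R n" using R_ge[of x n] x(1) by simp
    then show ?case using x by (intro bexI[of _ x]) (auto simp: less_Suc_eq)
  qed auto
  have near_ge: "\<forall>\<^sub>F y in near M z. rank z l \<le> rank y l" if zU: "z \<in> M \<inter> U" for z l
  proof -
    obtain c where c: "c \<in> C l (rank z l)" "minor c z \<noteq> 0" using rank_iff[OF zU, of "rank z l" l] by blast
    have "\<forall>\<^sub>F y in near M z. y \<in> U" by (rule near_open[OF U(1)]) (use zU in simp)
    with holomorphic_at_nonzero(1)[OF holo[OF zU] IntD1[OF zU] c(2)] near_in show ?thesis
    proof eventually_elim
      case (elim y)
      then show ?case using rank_iff[of y "rank z l" l] c(1) by blast
    qed
  qed
  have jump: "z \<in> jump_locus M H \<longleftrightarrow> (\<exists>l\<le>K. rank z l < R l)" if z: "z \<in> M \<inter> U" for z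
  proof
    assume "\<exists>l\<le>K. rank z l < R l"
    then obtain l where l: "rank z l < R l" by blast
    show "z \<in> jump_locus M H"
    proof (rule ccontr)
      assume "z \<notin> jump_locus M H"
      then have "\<forall>\<^sub>F y in near M z. \<forall>l. jet_rank M H y l = jet_rank M H z l" using z by (simp add: jump_locus_def)
      then obtain B where B: "open B" "z \<in> B" "\<forall>y\<in>M \<inter> B. rank y l = rank z l" unfolding eventually_near rank_def by blast
      have "M \<inter> U \<inter> B \<noteq> {}" using z B by blast
      from dense[OF B(1) this, of "Suc l"] obtain y where "y \<in> M \<inter> U \<inter> B" "rank y l = R l" by blast
      with B(3) l show False by auto
    qed
  next
    assume j: "z \<in> jump_locus M H"
    show "\<exists>l\<le>K. rank z l < R l"
    proof (rule ccontr)
      assume "\<not> (\<exists>l\<le>K. rank z l < R l)"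
      then have eq: "rank z l = R l" if "l \<le> K" for l using that R_ge[OF z, of l] by (meson le_antisym not_le)
      have "\<forall>\<^sub>F y in near M z. \<forall>l\<in>{..K}. rank z l \<le> rank y l"
        by (subst eventually_ball_finite_distrib) (use near_ge[OF z] in auto)
      moreover have "\<forall>\<^sub>F y in near M z. y \<in> U" by (rule near_open[OF U(1)]) (use z in simp)
      ultimately have "\<forall>\<^sub>F y in near M z. \<forall>l. rank y l = rank z l"
        using near_in
      proof eventually_elim
        case (elim y)
        have y: "y \<in> M \<inter> U" using elim by simp
        have *: "rank x l = R l" if x: "x \<in> M \<inter> U" and ge: "\<forall>l\<in>{..K}. R l \<le> rank x l" for x l
        proof (cases "l \<le> K")
          case True
          then show ?thesis using ge R_ge[OF x, of l] by (simp add: le_antisym)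
        next
          case False
          then have Kl: "K \<le> l" by simp
          have "R K \<le> rank x K" using ge by simp
          also have "\<dots> \<le> rank x l" by (rule rank_mono[OF Kl])
          finally have "R l \<le> rank x l" unfolding R_stable[OF Kl] .
          then show ?thesis using R_ge[OF x, of l] by simp
        qed
        have "\<forall>l\<in>{..K}. R l \<le> rank y l" using elim(1) eq by simp
        moreover have "\<forall>l\<in>{..K}. R l \<le> rank z l" using eq by simp
        ultimately show ?case using *[OF y] *[OF z] by simp
      qed
      then show False using j by (simp add: jump_locus_def rank_def)
    qed
  qed
  define F where "F = (\<lambda>\<sigma> q. \<Prod>l\<le>K. minor (\<sigma> l) q) ` (PiE {..K} (\<lambda>l. C l (R l)))"
  show ?thesis
  proof (rule that[of U F])
    show "open U" "p \<in> U" by fact+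
    show "finite F" unfolding F_def C_def
      by (intro finite_imageI finite_PiE finite_choices finite_frame_words) simp
    show "\<forall>f\<in>F. \<forall>q\<in>M \<inter> U. holomorphic_at M q f"
      unfolding F_def using holo by (auto intro!: holomorphic_at_prod)
    show "jump_locus M H \<inter> U = {q\<in>M \<inter> U. \<forall>f\<in>F. f q = 0}"
    proof (intro equalityI subsetI)
      fix q assume "q \<in> jump_locus M H \<inter> U"
      then have q: "q \<in> M \<inter> U" "q \<in> jump_locus M H" by (auto simp: jump_locus_def)
      then obtain l where l: "l \<le> K" "rank q l < R l" using jump by blast
      have "(\<Prod>l\<le>K. minor (\<sigma> l) q) = 0" if "\<sigma> \<in> PiE {..K} (\<lambda>l. C l (R l))" for \<sigma>
      proof (rule prod_zero)
        have "\<sigma> l \<in> C l (R l)" using that l(1) by (auto simp: PiE_iff)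
        then have "minor (\<sigma> l) q = 0" using rank_iff[OF q(1), of "R l" l] l(2) by (metis leD)
        then show "\<exists>l\<in>{..K}. minor (\<sigma> l) q = 0" using l(1) by auto
      qed simp
      then show "q \<in> {q\<in>M \<inter> U. \<forall>f\<in>F. f q = 0}" using q(1) by (auto simp: F_def)
    next
      fix q assume "q \<in> {q\<in>M \<inter> U. \<forall>f\<in>F. f q = 0}"
      then have q: "q \<in> M \<inter> U" and f0: "\<And>\<sigma>. \<sigma> \<in> PiE {..K} (\<lambda>l. C l (R l)) \<Longrightarrow> (\<Prod>l\<le>K. minor (\<sigma> l) q) = 0"
        by (auto simp: F_def)
      have "q \<in> jump_locus M H"
      proof (rule ccontr)
        assume "q \<notin> jump_locus M H"
        then have "\<forall>l\<le>K. \<exists>c\<in>C l (R l). minor c q \<noteq> 0" using jump[OF q] rank_iff[OF q] by (metis not_le)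
        then obtain \<sigma> where \<sigma>: "\<forall>l\<le>K. \<sigma> l \<in> C l (R l) \<and> minor (\<sigma> l) q \<noteq> 0" by metis
        have "(\<Prod>l\<le>K. minor (restrict \<sigma> {..K} l) q) = 0" by (rule f0) (use \<sigma> in auto)
        then show False using \<sigma> by (auto simp: prod_zero_iff)
      qed
      with q show "q \<in> jump_locus M H \<inter> U" by simp
    qed
    show "\<exists>y\<in>M \<inter> U \<inter> B. y \<notin> jump_locus M H" if B: "open B" "M \<inter> U \<inter> B \<noteq> {}" for B
    proof -
      obtain y where y: "y \<in> M \<inter> U \<inter> B" "\<forall>l<Suc K. rank y l = R l" using dense[OF B] by blast
      then have "y \<notin> jump_locus M H" using jump[of y] by (auto simp: less_Suc_eq_le)
      with y(1) show ?thesis by blast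
    qed
  qed
qed

lemma jump_locus_analytic:
  assumes "locally_closed_submanifold M" "corank_one_subbundle M H"
  shows "closed_analytic_subset M (jump_locus M H)"
  unfolding closed_analytic_subset_def
proof (intro conjI ballI)
  show "jump_locus M H \<subseteq> M" by (auto simp: jump_locus_def)
  fix p assume p: "p \<in> M"
  obtain U F where "open U" "p \<in> U" "finite F"
    "\<forall>f\<in>F. \<forall>q\<in>M \<inter> U. holomorphic_at M q f" "jump_locus M H \<inter> U = {q\<in>M \<inter> U. \<forall>f\<in>F. f q = 0}"
    by (rule jump_locus_local[OF assms p], rule that)
  then show "\<exists>U F. open U \<and> p \<in> U \<and> finite F \<and> (\<forall>f\<in>F. \<forall>q\<in>M \<inter> U. holomorphic_at M q f)
     \<and> jump_locus M H \<inter> U = {q\<in>M \<inter> U. \<forall>f\<in>F. f q = 0}" by blast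
qed

lemma jump_locus_nowhere_dense:
  assumes "locally_closed_submanifold M" "corank_one_subbundle M H"
  shows "nowhere_dense_in M (jump_locus M H)"
proof -
  have "closedin (top_of_set M) (jump_locus M H)"
    unfolding closedin_def
  proof
    have "\<exists>B. open B \<and> z \<in> B \<and> M \<inter> B \<subseteq> M - jump_locus M H" if z: "z \<in> M - jump_locus M H" for z
    proof -
      have "\<forall>\<^sub>F y in near M z. \<forall>l. jet_rank M H y l = jet_rank M H z l" using z by (auto simp: jump_locus_def)
      from near_near[OF this] this have "\<forall>\<^sub>F y in near M z. y \<notin> jump_locus M H"
      proof eventually_elim
        case (elim y)
        from elim(1) have "\<forall>\<^sub>F x in near M y. \<forall>l. jet_rank M H x l = jet_rank M H y l"
          by eventually_elim (use elim(2) in simp)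
        then show ?case by (simp add: jump_locus_def)
      qed
      then show ?thesis unfolding eventually_near by blast
    qed
    then obtain B where B: "\<And>z. z \<in> M - jump_locus M H \<Longrightarrow> open (B z) \<and> z \<in> B z \<and> M \<inter> B z \<subseteq> M - jump_locus M H" by metis
    have "M - jump_locus M H = M \<inter> (\<Union>z\<in>M - jump_locus M H. B z)" using B by blast
    moreover have "open (\<Union>z\<in>M - jump_locus M H. B z)" using B by blast
    ultimately show "openin (top_of_set M) (topspace (top_of_set M) - jump_locus M H)"
      by (metis openin_open topspace_euclidean_subtopology)
    show "jump_locus M H \<subseteq> topspace (top_of_set M)" by (auto simp: jump_locus_def)
  qed
  then have cl: "(top_of_set M) closure_of (jump_locus M H) = jump_locus M H" by (rule closure_of_closedin)
  show ?thesis
    unfolding nowhere_dense_in_def cl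
  proof (rule ccontr)
    assume "(top_of_set M) interior_of (jump_locus M H) \<noteq> {}"
    then obtain p W where W: "openin (top_of_set M) W" "p \<in> W" "W \<subseteq> jump_locus M H"
      unfolding interior_of_def by blast
    then obtain B where B: "open B" "W = M \<inter> B" by (metis openin_open)
    have p: "p \<in> M" using W B by blast
    obtain U where U: "p \<in> U" "\<And>B. open B \<Longrightarrow> M \<inter> U \<inter> B \<noteq> {} \<Longrightarrow> \<exists>y\<in>M \<inter> U \<inter> B. y \<notin> jump_locus M H"
      by (rule jump_locus_local[OF assms p], rule that)
    have "M \<inter> U \<inter> B \<noteq> {}" using p U W B by blast
    from U(2)[OF B(1) this] W B show False by blast
  qed
qed

section \<open>The symbol algebra\<close>

context framed begin

lemma X_in: "i < r \<Longrightarrow> X i z \<in> H z"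
  using section_in[OF X_section z] .

lemma section_value_expansion: "D \<in> H z \<Longrightarrow> D = (\<Sum>i<r. cscale (D (ratio (a i) k)) (X i z))"
  using adapted unfolding adapted_frame_def by blast

definition theta :: "'n tvec \<Rightarrow> complex" where
  "theta D = D (ratio b k) - (\<Sum>i<r. D (ratio (a i) k) * X i z (ratio b k))"

lemma tangent_value_expansion:
  "D \<in> tangent_space M z \<Longrightarrow> D = (\<Sum>i<r. cscale (D (ratio (a i) k)) (X i z)) + cscale (theta D) (T z)"
  using adapted unfolding adapted_frame_def theta_def by blast

lemma theta_cscale: "theta (cscale c D) = c * theta D"
  by (simp add: theta_def cscale_def sum_distrib_left right_diff_distrib mult_ac)

lemma T_tangent: "T z \<in> tangent_space M z"
  by (rule vector_field_tangent[OF T_field z])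

lemma theta_T: "theta (T z) = 1"
  by (simp add: theta_def dual)

lemma section_through:
  assumes "v \<in> H z" and sub: "\<forall>\<^sub>F q in near M z. cfun.subspace (H q)"
  obtains \<xi> where "section_at M H z \<xi>" "\<xi> z = v"
proof (rule that[of "\<lambda>q. \<Sum>i<r. cscale (v (ratio (a i) k)) (X i q)"])
  show "(\<Sum>i<r. cscale (v (ratio (a i) k)) (X i z)) = v" using section_value_expansion[OF assms(1)] by (rule sym)
  show "section_at M H z (\<lambda>q. \<Sum>i<r. cscale (v (ratio (a i) k)) (X i q))"
    unfolding section_at_iff
  proof
    show "vector_field_at M z (\<lambda>q. \<Sum>i<r. cscale (v (ratio (a i) k)) (X i q))"
      by (intro vector_field_sum vector_field_scale holomorphic_at_const section_vf[OF X_section]) simp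
    show "\<forall>\<^sub>F q in near M z. (\<Sum>i<r. cscale (v (ratio (a i) k)) (X i q)) \<in> H q"
      using sub framed_near
    proof eventually_elim
      case (elim q)
      interpret q: framed M H k r X a T b q by (rule elim(2))
      show ?case by (intro cfun.subspace_sum[OF elim(1)] cfun.subspace_scale[OF elim(1)] q.X_in) simp
    qed
  qed
qed

lemma field_through:
  assumes "D \<in> tangent_space M z"
  obtains \<xi> where "vector_field_at M z \<xi>" "\<xi> z = D"
proof (rule that[of "\<lambda>q. (\<Sum>i<r. cscale (D (ratio (a i) k)) (X i q)) + cscale (theta D) (T q)"])
  show "(\<Sum>i<r. cscale (D (ratio (a i) k)) (X i z)) + cscale (theta D) (T z) = D"
    using tangent_value_expansion[OF assms] by (rule sym)
  show "vector_field_at M z (\<lambda>q. (\<Sum>i<r. cscale (D (ratio (a i) k)) (X i q)) + cscale (theta D) (T q))"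
    by (intro vector_field_add vector_field_sum vector_field_scale holomorphic_at_const section_vf[OF X_section] T_field) simp
qed

text \<open>Second derivatives along sections, in the frame.\<close>

lemma second_derivative:
  assumes \<xi>: "section_at M H z \<xi>" and \<eta>: "section_at M H z \<eta>" and f: "holomorphic_at M z f"
  shows "\<xi> z (\<lambda>q. \<eta> q f) = (\<Sum>i<r. \<Sum>j<r. \<xi> z (ratio (a i) k) * \<eta> z (ratio (a j) k) * X i z (\<lambda>q. X j q f))
    + (\<Sum>j<r. \<xi> z (\<lambda>q. \<eta> q (ratio (a j) k)) * X j z f)"
proof -
  note D = vector_field_tangent[OF section_vf[OF \<xi>] z]
  have hc: "holomorphic_at M z (\<lambda>q. \<eta> q (ratio (a j) k))" for j
    by (rule component_holomorphic(1)[OF section_vf[OF \<eta>]])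
  have hX: "holomorphic_at M z (\<lambda>q. X j q f)" if "j < r" for j
    by (rule vector_field_holomorphic[OF section_vf[OF X_section[OF that]] z f])
  have "\<forall>\<^sub>F q in near M z. (\<Sum>j<r. \<eta> q (ratio (a j) k) * X j q f) = \<eta> q f"
    using section_expansion[OF \<eta>]
  proof eventually_elim
    case (elim q)
    have "\<eta> q f = (\<Sum>i<r. cscale (\<eta> q (ratio (a i) k)) (X i q)) f" by (rule fun_cong[OF elim])
    then show ?case unfolding comb_apply by (rule sym)
  qed
  from tangent_germ[OF D _ this]
  have "\<xi> z (\<lambda>q. \<eta> q f) = \<xi> z (\<lambda>q. \<Sum>j<r. \<eta> q (ratio (a j) k) * X j q f)"
    using holomorphic_at_sum[of "{..<r}" M z "\<lambda>j q. \<eta> q (ratio (a j) k) * X j q f"] holomorphic_at_mult[OF hc hX] by simp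
  also have "\<dots> = (\<Sum>j<r. \<xi> z (\<lambda>q. \<eta> q (ratio (a j) k) * X j q f))"
    by (rule tangent_sum[OF D]) (use holomorphic_at_mult[OF hc hX] in simp)
  also have "\<dots> = (\<Sum>j<r. \<eta> z (ratio (a j) k) * \<xi> z (\<lambda>q. X j q f) + \<xi> z (\<lambda>q. \<eta> q (ratio (a j) k)) * X j z f)"
    by (rule sum.cong[OF refl]) (simp add: tangent_mult[OF D hc hX])
  also have "\<dots> = (\<Sum>j<r. \<eta> z (ratio (a j) k) * \<xi> z (\<lambda>q. X j q f)) + (\<Sum>j<r. \<xi> z (\<lambda>q. \<eta> q (ratio (a j) k)) * X j z f)"
    by (rule sum.distrib)
  also have "(\<Sum>j<r. \<eta> z (ratio (a j) k) * \<xi> z (\<lambda>q. X j q f)) =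
      (\<Sum>j<r. \<Sum>i<r. \<xi> z (ratio (a i) k) * \<eta> z (ratio (a j) k) * X i z (\<lambda>q. X j q f))"
  proof (rule sum.cong[OF refl])
    fix j
    have "\<xi> z (\<lambda>q. X j q f) = (\<Sum>i<r. cscale (\<xi> z (ratio (a i) k)) (X i z)) (\<lambda>q. X j q f)"
      by (rule fun_cong[OF section_value_expansion[OF section_in[OF \<xi> z]]])
    then have "\<xi> z (\<lambda>q. X j q f) = (\<Sum>i<r. \<xi> z (ratio (a i) k) * X i z (\<lambda>q. X j q f))"
      unfolding comb_apply .
    then show "\<eta> z (ratio (a j) k) * \<xi> z (\<lambda>q. X j q f) = (\<Sum>i<r. \<xi> z (ratio (a i) k) * \<eta> z (ratio (a j) k) * X i z (\<lambda>q. X j q f))"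
      by (simp only: sum_distrib_left mult_ac)
  qed
  also have "\<dots> = (\<Sum>i<r. \<Sum>j<r. \<xi> z (ratio (a i) k) * \<eta> z (ratio (a j) k) * X i z (\<lambda>q. X j q f))"
    by (rule sum.swap)
  finally show ?thesis .
qed

definition frame_bracket :: "'n tvec \<Rightarrow> 'n tvec \<Rightarrow> 'n tvec" where
  "frame_bracket v w = (\<Sum>i<r. \<Sum>j<r. cscale (v (ratio (a i) k) * w (ratio (a j) k)) (lie_bracket M (X i) (X j) z))"

lemma frame_bracket_tangent: "frame_bracket v w \<in> tangent_space M z"
  unfolding frame_bracket_def
  by (intro cfun.subspace_sum[OF tangent_subspace] cfun.subspace_scale[OF tangent_subspace] lie_bracket_tangent
      section_vf[OF X_section] z) auto

lemma lie_bracket_sections: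
  assumes \<xi>: "section_at M H z \<xi>" and \<eta>: "section_at M H z \<eta>" and sub: "cfun.subspace (H z)"
  shows "lie_bracket M \<xi> \<eta> z - frame_bracket (\<xi> z) (\<eta> z) \<in> H z"
proof -
  define h where "h = (\<Sum>j<r. cscale (\<xi> z (\<lambda>q. \<eta> q (ratio (a j) k)) - \<eta> z (\<lambda>q. \<xi> q (ratio (a j) k))) (X j z))"
  have "lie_bracket M \<xi> \<eta> z f = frame_bracket (\<xi> z) (\<eta> z) f + h f" for f
  proof (cases "holomorphic_at M z f")
    case False
    have "h f = 0"
      unfolding h_def comb_apply
      by (rule sum.neutral) (use tangent_off[OF vector_field_tangent[OF section_vf[OF X_section] z] False] in auto)
    then show ?thesis using tangent_off[OF frame_bracket_tangent False] False by (simp add: lie_bracket_def)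
  next
    case True
    have e: "\<And>u. frame_bracket (\<xi> z) (\<eta> z) f = (\<Sum>i<r. \<Sum>j<r. \<xi> z (ratio (a i) k) * \<eta> z (ratio (a j) k) * X i z (\<lambda>q. X j q f))
       - (\<Sum>i<r. \<Sum>j<r. \<xi> z (ratio (a i) k) * \<eta> z (ratio (a j) k) * X j z (\<lambda>q. X i q f))"
      using True by (simp add: frame_bracket_def sum_fun_apply cscale_def lie_bracket_def right_diff_distrib sum_subtractf)
    have sw: "(\<Sum>i<r. \<Sum>j<r. \<xi> z (ratio (a i) k) * \<eta> z (ratio (a j) k) * X j z (\<lambda>q. X i q f)) =
       (\<Sum>i<r. \<Sum>j<r. \<eta> z (ratio (a i) k) * \<xi> z (ratio (a j) k) * X i z (\<lambda>q. X j q f))"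
      by (subst sum.swap) (simp only: mult_ac)
    have hf: "h f = (\<Sum>j<r. \<xi> z (\<lambda>q. \<eta> q (ratio (a j) k)) * X j z f) - (\<Sum>j<r. \<eta> z (\<lambda>q. \<xi> q (ratio (a j) k)) * X j z f)"
      unfolding h_def comb_apply by (simp only: left_diff_distrib sum_subtractf)
    show ?thesis
      unfolding e sw hf using second_derivative[OF \<xi> \<eta> True] second_derivative[OF \<eta> \<xi> True] True
      by (simp add: lie_bracket_def)
  qed
  then have "lie_bracket M \<xi> \<eta> z - frame_bracket (\<xi> z) (\<eta> z) = h" by (simp add: fun_eq_iff)
  moreover have "h \<in> H z"
    unfolding h_def by (intro cfun.subspace_sum[OF sub] cfun.subspace_scale[OF sub] X_in) simp
  ultimately show ?thesis by simp
qed

lemma bracket_form_eq: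
  assumes sub: "cfun.subspace (H z)" "\<forall>\<^sub>F q in near M z. cfun.subspace (H q)" and v: "v \<in> H z" and w: "w \<in> H z"
  shows "bracket_form M H z v w = coset (H z) (frame_bracket v w)"
proof -
  have eq: "coset (H z) (lie_bracket M \<xi> \<eta> z) = coset (H z) (frame_bracket (\<xi> z) (\<eta> z))"
    if "section_at M H z \<xi>" "section_at M H z \<eta>" for \<xi> \<eta>
    unfolding coset_eq_iff[OF sub(1)] by (rule lie_bracket_sections[OF that sub(1)])
  obtain \<xi> where \<xi>: "section_at M H z \<xi>" "\<xi> z = v" using section_through[OF v sub(2)] .
  obtain \<eta> where \<eta>: "section_at M H z \<eta>" "\<eta> z = w" using section_through[OF w sub(2)] .
  show ?thesis
    unfolding bracket_form_def
  proof (rule the_equality)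
    show "\<exists>\<xi> \<eta>. section_at M H z \<xi> \<and> section_at M H z \<eta> \<and> \<xi> z = v \<and> \<eta> z = w \<and>
        coset (H z) (frame_bracket v w) = coset (H z) (lie_bracket M \<xi> \<eta> z)"
      using \<xi> \<eta> eq by metis
  next
    fix C assume "\<exists>\<xi> \<eta>. section_at M H z \<xi> \<and> section_at M H z \<eta> \<and> \<xi> z = v \<and> \<eta> z = w \<and> C = coset (H z) (lie_bracket M \<xi> \<eta> z)"
    then show "C = coset (H z) (frame_bracket v w)" using eq by metis
  qed
qed

lemma frame_bracket_bilinear:
  "frame_bracket (v + v') w = frame_bracket v w + frame_bracket v' w"
  "frame_bracket w (v + v') = frame_bracket w v + frame_bracket w v'"
  "frame_bracket (cscale c v) w = cscale c (frame_bracket v w)"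
  "frame_bracket v (cscale c w) = cscale c (frame_bracket v w)"
  by (simp_all add: frame_bracket_def fun_eq_iff sum_fun_apply cscale_def sum.distrib sum_distrib_left algebra_simps)

lemma frame_bracket_zero: "frame_bracket 0 w = 0" "frame_bracket v 0 = 0"
  using frame_bracket_bilinear(3)[of 0 0 w] frame_bracket_bilinear(4)[of v 0 0] by simp_all

end

lemma complex_field_simps [simp]:
  "carrier complex_field = UNIV" "x \<otimes>\<^bsub>complex_field\<^esub> y = x * y" "\<one>\<^bsub>complex_field\<^esub> = 1"
  "\<zero>\<^bsub>complex_field\<^esub> = 0" "x \<oplus>\<^bsub>complex_field\<^esub> y = x + y"
  by (simp_all add: complex_field_def)

lemma cring_complex_field: "cring complex_field"
proof (rule cringI)
  show "abelian_group complex_field"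
    by (rule abelian_groupI) (auto simp: algebra_simps intro: exI[of _ "- x" for x])
  show "comm_monoid complex_field"
    by (rule comm_monoidI) (auto simp: algebra_simps)
qed (auto simp: algebra_simps)

locale contact_framed = framed +
  assumes corank: "corank_one_subbundle M H"
    and nondegenerate: "\<And>v. v \<in> H z \<Longrightarrow> (\<And>w. w \<in> H z \<Longrightarrow> bracket_form M H z v w = H z) \<Longrightarrow> v = 0"
begin

abbreviation "\<nn> \<equiv> symbol_algebra M H z"
abbreviation "cs \<equiv> coset (H z)"

lemma H_sub: "cfun.subspace (H z)" and H_tangent: "v \<in> H z \<Longrightarrow> v \<in> tangent_space M z"
  using corank z unfolding corank_one_subbundle_def by blast+

lemma H_sub_near: "\<forall>\<^sub>F q in near M z. cfun.subspace (H q)"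
  using near_in by eventually_elim (use corank in \<open>auto simp: corank_one_subbundle_def\<close>)

lemma coset_eq_theta:
  assumes "D \<in> tangent_space M z" "E \<in> tangent_space M z"
  shows "cs D = cs E \<longleftrightarrow> theta D = theta E"
proof -
  have lin: "theta (D - E) = theta D - theta E"
    by (simp add: theta_def left_diff_distrib sum_subtractf algebra_simps)
  have DE: "D - E \<in> tangent_space M z" by (rule cfun.subspace_diff[OF tangent_subspace assms])
  have "D - E \<in> H z \<longleftrightarrow> theta (D - E) = 0"
  proof
    assume "D - E \<in> H z"
    then have "(D - E) (ratio b k) = (\<Sum>i<r. cscale ((D - E) (ratio (a i) k)) (X i z)) (ratio b k)"
      by (rule fun_cong[OF section_value_expansion])
    then show "theta (D - E) = 0" unfolding theta_def comb_apply by simp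
  next
    assume 0: "theta (D - E) = 0"
    have "(\<Sum>i<r. cscale ((D - E) (ratio (a i) k)) (X i z)) \<in> H z"
      by (intro cfun.subspace_sum[OF H_sub] cfun.subspace_scale[OF H_sub] X_in) simp
    moreover have "D - E = (\<Sum>i<r. cscale ((D - E) (ratio (a i) k)) (X i z))"
      using tangent_value_expansion[OF DE] unfolding 0 cfun.scale_zero_left add_0_right .
    ultimately show "D - E \<in> H z" by (rule ssubst[rotated])
  qed
  then show ?thesis unfolding coset_eq_iff[OF H_sub] lin by simp
qed

lemma T_not_in: "T z \<notin> H z"
proof
  assume "T z \<in> H z"
  then have "cs (T z) = cs 0" by (subst coset_eq_iff[OF H_sub]) simp
  then have "theta (T z) = theta 0"
    using coset_eq_theta[OF T_tangent cfun.subspace_0[OF tangent_subspace]] by simp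
  then show False by (simp add: theta_T theta_def[of 0])
qed

lemma symbol_simps:
  "carrier \<nn> = H z \<times> cs ` tangent_space M z" "\<zero>\<^bsub>\<nn>\<^esub> = (0, cs 0)"
  "(v, cs D) \<oplus>\<^bsub>\<nn>\<^esub> (w, cs E) = (v + w, cs (D + E))"
  "c \<odot>\<^bsub>\<nn>\<^esub> (v, cs D) = (cscale c v, cs (cscale c D))"
  "v \<in> H z \<Longrightarrow> w \<in> H z \<Longrightarrow> bracket \<nn> (v, cs D) (w, cs E) = (0, cs (frame_bracket v w))"
  "grade \<nn> 1 = H z \<times> {cs 0}" "grade \<nn> (Suc 0) = H z \<times> {cs 0}" "grade \<nn> 2 = {0} \<times> cs ` tangent_space M z"
  "d \<noteq> 1 \<Longrightarrow> d \<noteq> 2 \<Longrightarrow> grade \<nn> d = {(0, cs 0)}"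
  using bracket_form_eq[OF H_sub H_sub_near]
  by (simp_all add: symbol_algebra_def coset_add_coset[OF H_sub] coset_scale_coset[OF H_sub] coset_zero)

lemma symbol_carrierE:
  assumes "x \<in> carrier \<nn>" obtains v D where "v \<in> H z" "D \<in> tangent_space M z" "x = (v, cs D)"
  using assms by (auto simp: symbol_simps)

lemma symbol_carrierI: "v \<in> H z \<Longrightarrow> D \<in> tangent_space M z \<Longrightarrow> (v, cs D) \<in> carrier \<nn>"
  by (simp add: symbol_simps)

lemmas tangent_closed = cfun.subspace_0[OF tangent_subspace] cfun.subspace_add[OF tangent_subspace]
  cfun.subspace_scale[OF tangent_subspace] cfun.subspace_neg[OF tangent_subspace]
lemmas H_closed = cfun.subspace_0[OF H_sub] cfun.subspace_add[OF H_sub] cfun.subspace_scale[OF H_sub] cfun.subspace_neg[OF H_sub]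

lemma symbol_module: "Module.module complex_field \<nn>"
proof (rule moduleI)
  show "abelian_group \<nn>"
  proof (rule abelian_groupI)
    fix x y assume "x \<in> carrier \<nn>" "y \<in> carrier \<nn>"
    then show "x \<oplus>\<^bsub>\<nn>\<^esub> y \<in> carrier \<nn>" "x \<oplus>\<^bsub>\<nn>\<^esub> y = y \<oplus>\<^bsub>\<nn>\<^esub> x"
      by (auto elim!: symbol_carrierE simp: symbol_simps(3) add.commute intro!: symbol_carrierI tangent_closed H_closed)
  next
    fix x y w assume "x \<in> carrier \<nn>" "y \<in> carrier \<nn>" "w \<in> carrier \<nn>"
    then show "x \<oplus>\<^bsub>\<nn>\<^esub> y \<oplus>\<^bsub>\<nn>\<^esub> w = x \<oplus>\<^bsub>\<nn>\<^esub> (y \<oplus>\<^bsub>\<nn>\<^esub> w)"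
      by (auto elim!: symbol_carrierE simp: symbol_simps(3) add.assoc)
  next
    fix x assume "x \<in> carrier \<nn>"
    then obtain v D where x: "v \<in> H z" "D \<in> tangent_space M z" "x = (v, cs D)" by (rule symbol_carrierE)
    show "\<zero>\<^bsub>\<nn>\<^esub> \<oplus>\<^bsub>\<nn>\<^esub> x = x" unfolding symbol_simps(2) x(3) symbol_simps(3) by simp
    have "(- v, cs (- D)) \<oplus>\<^bsub>\<nn>\<^esub> x = \<zero>\<^bsub>\<nn>\<^esub>" unfolding symbol_simps(2) x(3) symbol_simps(3) by simp
    moreover have "(- v, cs (- D)) \<in> carrier \<nn>" by (intro symbol_carrierI tangent_closed H_closed x)
    ultimately show "\<exists>y\<in>carrier \<nn>. y \<oplus>\<^bsub>\<nn>\<^esub> x = \<zero>\<^bsub>\<nn>\<^esub>" by blast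
  qed (auto simp: symbol_simps(2) intro!: symbol_carrierI tangent_closed H_closed)
qed (auto elim!: symbol_carrierE simp: cring_complex_field symbol_simps(3,4) cfun.scale_left_distrib cfun.scale_right_distrib
    intro!: symbol_carrierI tangent_closed H_closed)

sublocale n: Module.module complex_field \<nn>
  by (rule symbol_module)

lemma frame_bracket_self: "v \<in> H z \<Longrightarrow> cs (frame_bracket v v) = cs 0"
proof -
  assume v: "v \<in> H z"
  obtain \<xi> where \<xi>: "section_at M H z \<xi>" "\<xi> z = v" using section_through[OF v H_sub_near] .
  have "lie_bracket M \<xi> \<xi> z = 0" by (simp add: lie_bracket_def fun_eq_iff)
  then have "0 - frame_bracket v v \<in> H z" using lie_bracket_sections[OF \<xi>(1) \<xi>(1) H_sub] \<xi>(2) by simp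
  then show ?thesis by (subst eq_commute, subst coset_eq_iff[OF H_sub])
qed

lemma symbol_lie_algebra: "lie_algebra \<nn>"
  unfolding lie_algebra_def
proof (intro conjI ballI allI)
  fix x y assume "x \<in> carrier \<nn>" "y \<in> carrier \<nn>"
  then obtain v D w E where x: "v \<in> H z" "D \<in> tangent_space M z" "x = (v, cs D)"
    and y: "w \<in> H z" "E \<in> tangent_space M z" "y = (w, cs E)" by (auto elim!: symbol_carrierE)
  show "bracket \<nn> x y \<in> carrier \<nn>"
    unfolding x y symbol_simps(5)[OF x(1) y(1)] by (intro symbol_carrierI H_closed frame_bracket_tangent)
  fix c
  show "bracket \<nn> (c \<odot>\<^bsub>\<nn>\<^esub> x) y = c \<odot>\<^bsub>\<nn>\<^esub> bracket \<nn> x y"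
    "bracket \<nn> x (c \<odot>\<^bsub>\<nn>\<^esub> y) = c \<odot>\<^bsub>\<nn>\<^esub> bracket \<nn> x y"
    unfolding x(3) y(3) symbol_simps(4,5) using x y
    by (simp_all only: symbol_simps(4,5) H_closed frame_bracket_bilinear cfun.scale_zero_right)
next
  fix x y u assume "x \<in> carrier \<nn>" "y \<in> carrier \<nn>" "u \<in> carrier \<nn>"
  then obtain v D w E s G where x: "v \<in> H z" "x = (v, cs D)"
    and y: "w \<in> H z" "y = (w, cs E)" and u: "s \<in> H z" "u = (s, cs G)" by (auto elim!: symbol_carrierE)
  show "bracket \<nn> (x \<oplus>\<^bsub>\<nn>\<^esub> y) u = bracket \<nn> x u \<oplus>\<^bsub>\<nn>\<^esub> bracket \<nn> y u"
    "bracket \<nn> u (x \<oplus>\<^bsub>\<nn>\<^esub> y) = bracket \<nn> u x \<oplus>\<^bsub>\<nn>\<^esub> bracket \<nn> u y"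
    "bracket \<nn> x (bracket \<nn> y u) \<oplus>\<^bsub>\<nn>\<^esub> bracket \<nn> y (bracket \<nn> u x) \<oplus>\<^bsub>\<nn>\<^esub> bracket \<nn> u (bracket \<nn> x y) = \<zero>\<^bsub>\<nn>\<^esub>"
    unfolding x(2) y(2) u(2) using x(1) y(1) u(1)
    by (simp_all only: symbol_simps(2,3,5) H_closed frame_bracket_bilinear frame_bracket_zero add_0)
next
  fix x assume "x \<in> carrier \<nn>"
  then obtain v D where x: "v \<in> H z" "x = (v, cs D)" by (auto elim!: symbol_carrierE)
  show "bracket \<nn> x x = \<zero>\<^bsub>\<nn>\<^esub>"
    unfolding x(2) symbol_simps(2) symbol_simps(5)[OF x(1) x(1)] frame_bracket_self[OF x(1)] ..
qed (rule symbol_module)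

lemma symbol_finite_dimensional: "finite_dimensional \<nn>"
  unfolding finite_dimensional_def
proof (intro exI conjI allI impI)
  let ?B = "insert (0, cs (T z)) ((\<lambda>i. (X i z, cs 0)) ` {..<r})"
  show "finite ?B" by simp
  show "?B \<subseteq> carrier \<nn>"
    by (auto intro!: symbol_carrierI H_closed tangent_closed T_tangent X_in)
  fix Y assume Y: "submodule Y complex_field \<nn> \<and> ?B \<subseteq> Y"
  note Y' = n.submoduleE[OF conjunct1[OF Y]]
  have z0: "\<zero>\<^bsub>\<nn>\<^esub> \<in> Y" using subgroup.one_closed[OF submodule.axioms(1)[OF conjunct1[OF Y]]] by simp
  have sums: "((\<Sum>i<m. cscale (c i) (X i z)), cs 0) \<in> Y" if "m \<le> r" for m c
    using that
  proof (induction m)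
    case 0
    then show ?case using z0 by (simp add: symbol_simps(2) flip: zero_fun_def)
  next
    case (Suc m)
    have "c m \<odot>\<^bsub>\<nn>\<^esub> (X m z, cs 0) \<in> Y" by (rule Y'(4)) (use Y Suc.prems in auto)
    with Suc have "((\<Sum>i<m. cscale (c i) (X i z)), cs 0) \<oplus>\<^bsub>\<nn>\<^esub> (c m \<odot>\<^bsub>\<nn>\<^esub> (X m z, cs 0)) \<in> Y"
      by (intro Y'(5)[OF Suc.IH]) simp_all
    then show ?case unfolding symbol_simps(3,4) sum.lessThan_Suc cfun.scale_zero_right add_0_right .
  qed
  have "x \<in> Y" if "x \<in> carrier \<nn>" for x
  proof -
    obtain v D where x: "v \<in> H z" "D \<in> tangent_space M z" "x = (v, cs D)" using \<open>x \<in> carrier \<nn>\<close> by (rule symbol_carrierE)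
    have 1: "(v, cs 0) \<in> Y" using sums[OF order_refl, of "\<lambda>i. v (ratio (a i) k)"] section_value_expansion[OF x(1)] by simp
    have 2: "theta D \<odot>\<^bsub>\<nn>\<^esub> (0, cs (T z)) \<in> Y" by (rule Y'(4)) (use Y in auto)
    have "cs (cscale (theta D) (T z)) = cs D"
      by (subst coset_eq_theta) (simp_all add: x tangent_closed T_tangent theta_cscale theta_T)
    then have "(v, cs 0) \<oplus>\<^bsub>\<nn>\<^esub> (theta D \<odot>\<^bsub>\<nn>\<^esub> (0, cs (T z))) = x"
      by (simp add: symbol_simps(3,4) x(3))
    then show ?thesis using Y'(5)[OF 1 2] by simp
  qed
  then show "Y = carrier \<nn>" using Y'(1) by blast
qed

lemma symbol_neg: "v \<in> H z \<Longrightarrow> D \<in> tangent_space M z \<Longrightarrow> \<ominus>\<^bsub>\<nn>\<^esub> (v, cs D) = (- v, cs (- D))"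
  by (rule n.M.minus_equality)
    (simp_all only: symbol_simps(2,3) left_minus symbol_carrierI H_closed tangent_closed)

lemma symbol_heisenberg: "graded_heisenberg \<nn>"
  unfolding graded_heisenberg_def
proof (intro conjI)
  show "lie_algebra \<nn>" "finite_dimensional \<nn>" by (rule symbol_lie_algebra symbol_finite_dimensional)+
  have gc: "grade \<nn> 1 \<subseteq> carrier \<nn>" "grade \<nn> 2 \<subseteq> carrier \<nn>"
    by (auto simp: symbol_simps H_closed tangent_closed)
  show "submodule (grade \<nn> 1) complex_field \<nn>"
  proof (rule n.submoduleI[OF gc(1)])
    fix x y assume "x \<in> grade \<nn> 1" "y \<in> grade \<nn> 1"
    then obtain v w where x: "x = (v, cs 0)" "v \<in> H z" and y: "y = (w, cs 0)" "w \<in> H z" by (auto simp: symbol_simps)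
    show "x \<oplus>\<^bsub>\<nn>\<^esub> y \<in> grade \<nn> 1" using x y by (simp add: symbol_simps(3,6,7) H_closed)
    show "\<ominus>\<^bsub>\<nn>\<^esub> x \<in> grade \<nn> 1"
      using x symbol_neg[of v 0] by (simp add: symbol_simps(6,7) symbol_carrierI H_closed tangent_closed)
    show "c \<odot>\<^bsub>\<nn>\<^esub> x \<in> grade \<nn> 1" for c using x by (simp add: symbol_simps(4,6,7) H_closed)
  qed (simp add: symbol_simps(2,6,7) H_closed)
  show "submodule (grade \<nn> 2) complex_field \<nn>"
  proof (rule n.submoduleI[OF gc(2)])
    fix x y assume "x \<in> grade \<nn> 2" "y \<in> grade \<nn> 2"
    then obtain D E where x: "x = (0, cs D)" "D \<in> tangent_space M z" and y: "y = (0, cs E)" "E \<in> tangent_space M z" by (auto simp: symbol_simps)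
    show "x \<oplus>\<^bsub>\<nn>\<^esub> y \<in> grade \<nn> 2" using x y by (simp add: symbol_simps(3,8) tangent_closed)
    show "\<ominus>\<^bsub>\<nn>\<^esub> x \<in> grade \<nn> 2"
      using x symbol_neg[of 0 D] by (simp add: symbol_simps(8) symbol_carrierI H_closed tangent_closed)
    show "c \<odot>\<^bsub>\<nn>\<^esub> x \<in> grade \<nn> 2" for c using x by (simp add: symbol_simps(4,8) tangent_closed)
  qed (simp add: symbol_simps(2,8) tangent_closed)
  show "\<forall>d. d \<noteq> 1 \<and> d \<noteq> 2 \<longrightarrow> grade \<nn> d = {\<zero>\<^bsub>\<nn>\<^esub>}" by (simp add: symbol_simps(2,9))
  show "\<forall>x\<in>carrier \<nn>. \<exists>!p. p \<in> grade \<nn> 1 \<times> grade \<nn> 2 \<and> x = fst p \<oplus>\<^bsub>\<nn>\<^esub> snd p"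
  proof
    fix x assume "x \<in> carrier \<nn>"
    then obtain v D where x: "v \<in> H z" "D \<in> tangent_space M z" "x = (v, cs D)" by (rule symbol_carrierE)
    show "\<exists>!p. p \<in> grade \<nn> 1 \<times> grade \<nn> 2 \<and> x = fst p \<oplus>\<^bsub>\<nn>\<^esub> snd p"
    proof (rule ex1I[of _ "((v, cs 0), (0, cs D))"])
      show "((v, cs 0), (0, cs D)) \<in> grade \<nn> 1 \<times> grade \<nn> 2 \<and> x = fst ((v, cs 0), (0, cs D)) \<oplus>\<^bsub>\<nn>\<^esub> snd ((v, cs 0), (0, cs D))"
        using x by (simp add: symbol_simps(3,6,7,8))
    next
      fix p assume "p \<in> grade \<nn> 1 \<times> grade \<nn> 2 \<and> x = fst p \<oplus>\<^bsub>\<nn>\<^esub> snd p"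
      then obtain w E where "p = ((w, cs 0), (0, cs E))" "x = (w, cs 0) \<oplus>\<^bsub>\<nn>\<^esub> (0, cs E)" by (auto simp: symbol_simps(6,7,8))
      then show "p = ((v, cs 0), (0, cs D))" using x by (simp add: symbol_simps(3))
    qed
  qed
  show "\<forall>i j. \<forall>x\<in>grade \<nn> i. \<forall>y\<in>grade \<nn> j. bracket \<nn> x y \<in> grade \<nn> (i + j)"
  proof (intro allI ballI)
    fix i j x y assume x: "x \<in> grade \<nn> i" and y: "y \<in> grade \<nn> j"
    have gr: "\<exists>v D. u = (v, cs D) \<and> v \<in> H z \<and> (d \<noteq> 1 \<longrightarrow> v = 0)" if "u \<in> grade \<nn> d" for u d
      using that by (cases "d = 1"; cases "d = 2") (auto simp: symbol_simps(6,7,8,9) H_closed)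
    obtain v D where v: "x = (v, cs D)" "v \<in> H z" "i \<noteq> 1 \<longrightarrow> v = 0" using gr[OF x] by blast
    obtain w E where w: "y = (w, cs E)" "w \<in> H z" "j \<noteq> 1 \<longrightarrow> w = 0" using gr[OF y] by blast
    have b: "bracket \<nn> x y = (0, cs (frame_bracket v w))" unfolding v(1) w(1) by (rule symbol_simps(5)[OF v(2) w(2)])
    show "bracket \<nn> x y \<in> grade \<nn> (i + j)"
    proof (cases "i = 1 \<and> j = 1")
      case True
      then have "i + j = 2" by simp
      then show ?thesis unfolding b by (simp only: symbol_simps(8)) (simp add: frame_bracket_tangent)
    next
      case False
      then have "frame_bracket v w = 0" using v(3) w(3) frame_bracket_zero by metis
      moreover have "(0, cs 0) \<in> grade \<nn> d" for d
        by (cases "d = 1"; cases "d = 2") (auto simp: symbol_simps(6,7,8,9) H_closed tangent_closed)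
      ultimately show ?thesis unfolding b by simp
    qed
  qed
  have zero_iff: "v = 0" if "v \<in> H z" "\<And>w. w \<in> H z \<Longrightarrow> cs (frame_bracket v w) = cs 0" for v
    by (rule nondegenerate[OF that(1)]) (simp add: bracket_form_eq[OF H_sub H_sub_near that(1)] that(2) coset_zero)
  show "{x \<in> carrier \<nn>. \<forall>y\<in>carrier \<nn>. bracket \<nn> x y = \<zero>\<^bsub>\<nn>\<^esub>} = grade \<nn> 2"
  proof (intro equalityI subsetI)
    fix x assume "x \<in> {x \<in> carrier \<nn>. \<forall>y\<in>carrier \<nn>. bracket \<nn> x y = \<zero>\<^bsub>\<nn>\<^esub>}"
    then obtain v D where x: "v \<in> H z" "D \<in> tangent_space M z" "x = (v, cs D)" and c: "\<forall>y\<in>carrier \<nn>. bracket \<nn> x y = \<zero>\<^bsub>\<nn>\<^esub>"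
      by (auto elim!: symbol_carrierE)
    have "v = 0"
    proof (rule zero_iff[OF x(1)])
      fix w assume w: "w \<in> H z"
      have "bracket \<nn> (v, cs D) (w, cs 0) = (0, cs 0)"
        using c x(3) symbol_carrierI[OF w tangent_closed(1)] symbol_simps(2) by metis
      then show "cs (frame_bracket v w) = cs 0" unfolding symbol_simps(5)[OF x(1) w] by simp
    qed
    then show "x \<in> grade \<nn> 2" using x by (simp add: symbol_simps(8))
  next
    fix x assume "x \<in> grade \<nn> 2"
    then obtain D where x: "D \<in> tangent_space M z" "x = (0, cs D)" by (auto simp: symbol_simps(8))
    have "bracket \<nn> x y = \<zero>\<^bsub>\<nn>\<^esub>" if "y \<in> carrier \<nn>" for y
      using that
    proof (rule symbol_carrierE)
      fix w E assume "w \<in> H z" "y = (w, cs E)"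
      then show ?thesis unfolding x(2) symbol_simps(2) by (simp only: symbol_simps(5) H_closed frame_bracket_zero)
    qed
    then show "x \<in> {x \<in> carrier \<nn>. \<forall>y\<in>carrier \<nn>. bracket \<nn> x y = \<zero>\<^bsub>\<nn>\<^esub>}"
      using x by (simp add: symbol_carrierI H_closed)
  qed
  show "\<exists>e\<in>grade \<nn> 2. e \<noteq> \<zero>\<^bsub>\<nn>\<^esub> \<and> (\<forall>x\<in>grade \<nn> 2. \<exists>c. x = c \<odot>\<^bsub>\<nn>\<^esub> e)"
  proof (intro bexI[of _ "(0, cs (T z))"] conjI ballI)
    show "(0, cs (T z)) \<noteq> \<zero>\<^bsub>\<nn>\<^esub>" using T_not_in coset_eq_iff[OF H_sub, of "T z" 0] by (simp add: symbol_simps(2))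
    fix x assume "x \<in> grade \<nn> 2"
    then obtain D where x: "D \<in> tangent_space M z" "x = (0, cs D)" by (auto simp: symbol_simps(8))
    have "cs (cscale (theta D) (T z)) = cs D"
      by (subst coset_eq_theta) (simp_all add: x tangent_closed T_tangent theta_cscale theta_T)
    then have "x = theta D \<odot>\<^bsub>\<nn>\<^esub> (0, cs (T z))" by (simp add: x(2) symbol_simps(4))
    then show "\<exists>c. x = c \<odot>\<^bsub>\<nn>\<^esub> (0, cs (T z))" by blast
  qed (simp add: symbol_simps(8) T_tangent)
  show "\<forall>x\<in>grade \<nn> 1. (\<forall>y\<in>grade \<nn> 1. bracket \<nn> x y = \<zero>\<^bsub>\<nn>\<^esub>) \<longrightarrow> x = \<zero>\<^bsub>\<nn>\<^esub>"
  proof (intro ballI impI)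
    fix x assume "x \<in> grade \<nn> 1" and c: "\<forall>y\<in>grade \<nn> 1. bracket \<nn> x y = \<zero>\<^bsub>\<nn>\<^esub>"
    then obtain v where x: "v \<in> H z" "x = (v, cs 0)" by (auto simp: symbol_simps(6,7))
    have "v = 0"
    proof (rule zero_iff[OF x(1)])
      fix w assume w: "w \<in> H z"
      have "bracket \<nn> (v, cs 0) (w, cs 0) = (0, cs 0)"
        using c x(2) w symbol_simps(2,6) by (metis SigmaI singletonI)
      then show "cs (frame_bracket v w) = cs 0" unfolding symbol_simps(5)[OF x(1) w] by simp
    qed
    then show "x = \<zero>\<^bsub>\<nn>\<^esub>" by (simp add: x(2) symbol_simps(2))
  qed
qed

end

section \<open>Symbols of jets\<close>

lemma uea_dual_subspace: "cfun.subspace (uea_dual \<hh> k)"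
  by (rule cfun.subspaceI) (auto simp: uea_dual_def lin_dual_def cscale_def algebra_simps)

lemma lin_dual_subspace: "cfun.subspace (lin_dual V)"
  by (rule cfun.subspaceI) (auto simp: lin_dual_def cscale_def algebra_simps)

context framed begin

lemma operator_comb:
  assumes P: "weighted_operator M H z l P" and f: "holomorphic_at M z f" and g: "holomorphic_at M z g"
  shows "P (\<lambda>q. c * f q + d * g q) z = c * P f z + d * P g z"
proof -
  let ?f = "\<lambda>j::nat. if j = 0 then f else g" and ?c = "\<lambda>j::nat. if j = 0 then c else d"
  have "P (\<lambda>q. \<Sum>j\<in>{0, 1}. ?c j * ?f j q) z = (\<Sum>j\<in>{0, 1}. ?c j * P (?f j) z)"
    by (rule operator_linear[OF P]) (use f g in auto)
  then show ?thesis by simp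
qed

lemma operator_zero: "weighted_operator M H z l P \<Longrightarrow> P (\<lambda>q. 0) z = 0"
  using operator_linear[of l P "{}"] by simp

lemma weighted_ideal_comb:
  assumes "f \<in> weighted_ideal M H z l" "g \<in> weighted_ideal M H z l"
  shows "(\<lambda>q. c * f q + d * g q) \<in> weighted_ideal M H z l"
proof -
  have f: "holomorphic_at M z f" "\<And>j P. j < l \<Longrightarrow> weighted_operator M H z j P \<Longrightarrow> P f z = 0"
    and g: "holomorphic_at M z g" "\<And>j P. j < l \<Longrightarrow> weighted_operator M H z j P \<Longrightarrow> P g z = 0"
    using assms by (simp_all add: weighted_ideal_def)
  have "P (\<lambda>q. c * f q + d * g q) z = 0" if "j < l" "weighted_operator M H z j P" for j P
    unfolding operator_comb[OF that(2) f(1) g(1)] f(2)[OF that] g(2)[OF that] by simp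
  with f(1) g(1) show ?thesis
    unfolding weighted_ideal_def by (intro CollectI conjI allI impI holomorphic_at_add holomorphic_at_cmult)
qed

lemma weighted_ideal_0: "f \<in> weighted_ideal M H z 0 \<longleftrightarrow> holomorphic_at M z f"
  by (simp add: weighted_ideal_def)

lemma weighted_ideal_antimono: "l \<le> l' \<Longrightarrow> weighted_ideal M H z l' \<subseteq> weighted_ideal M H z l"
  unfolding weighted_ideal_def by clarsimp (meson less_le_trans)

lemma weighted_idealI:
  assumes f: "holomorphic_at M z f" and w: "\<And>w j. j < l \<Longrightarrow> w \<in> frame_words r j \<Longrightarrow> frame_op r X T w f z = 0"
  shows "f \<in> weighted_ideal M H z l"
  unfolding weighted_ideal_def
proof (intro CollectI conjI allI impI f)
  fix j P assume j: "j < l" and P: "weighted_operator M H z j P"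
  obtain cs where cs: "\<And>c w. (c, w) \<in> set cs \<Longrightarrow> w \<in> frame_words r j"
    "P f z = (\<Sum>(c, w)\<leftarrow>cs. c * frame_op r X T w f z)"
    using operator_words[OF P] f by metis
  have "\<forall>(c, w)\<in>set cs. w \<in> frame_words r j" using cs(1) by blast
  then have "(\<Sum>(c, w)\<leftarrow>cs. c * frame_op r X T w f z) = 0"
    by (induction cs) (auto simp: w[OF j])
  then show "P f z = 0" using cs(2) by simp
qed

end

context contact_framed begin

definition symbol_word :: "('a tvec \<times> 'a tvec set) list \<Rightarrow> nat list \<Rightarrow> 'a vfield list \<Rightarrow> bool" where
  "symbol_word w ds \<xi>s \<longleftrightarrow> homogeneous_word \<nn> w ds \<and> length \<xi>s = length w
     \<and> (\<forall>i<length w. represents M H z (ds ! i) (w ! i) (\<xi>s ! i))"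

lemma symbol_word_Nil: "symbol_word [] ds \<xi>s \<longleftrightarrow> ds = [] \<and> \<xi>s = []"
  by (auto simp: symbol_word_def homogeneous_word_def)

lemma symbol_word_Cons: "symbol_word (x # w) (d # ds) (\<xi> # \<xi>s) \<longleftrightarrow>
    d \<in> {1, 2} \<and> x \<in> grade \<nn> d \<and> represents M H z d x \<xi> \<and> symbol_word w ds \<xi>s"
  unfolding symbol_word_def homogeneous_word_def list.rel_inject list.size Suc_inject All_less_Suc2
  by (auto simp: nth_Cons_0 nth_Cons_Suc All_less_Suc2)

lemma symbol_word_ConsE:
  assumes "symbol_word (x # w) ds' \<xi>s'"
  obtains d ds \<xi> \<xi>s where "ds' = d # ds" "\<xi>s' = \<xi> # \<xi>s" "d \<in> {1, 2}" "x \<in> grade \<nn> d"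
    "represents M H z d x \<xi>" "symbol_word w ds \<xi>s"
proof -
  obtain d ds where ds: "ds' = d # ds"
    using assms unfolding symbol_word_def homogeneous_word_def by (cases ds') auto
  obtain \<xi> \<xi>s where \<xi>s: "\<xi>s' = \<xi> # \<xi>s"
    using assms unfolding symbol_word_def by (cases \<xi>s') auto
  from assms[unfolded ds \<xi>s symbol_word_Cons] show ?thesis by (intro that[OF ds \<xi>s]) auto
qed

lemma represents_field:
  assumes "represents M H z d x \<xi>"
  shows "vector_field_at M z \<xi>" "weighted_operator M H z d (\<lambda>f q. \<xi> q f)"
  using assms weighted_operator.horizontal weighted_operator.vfield section_vf unfolding represents_def by blast+

lemma represented:
  assumes "x \<in> grade \<nn> d" "d \<in> {1, 2}"
  obtains \<xi> where "represents M H z d x \<xi>"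
proof (cases "d = 1")
  case True
  with assms obtain v where v: "v \<in> H z" "x = (v, H z)" by (auto simp: symbol_simps(6,7) coset_zero)
  obtain \<xi> where "section_at M H z \<xi>" "\<xi> z = v" using section_through[OF v(1) H_sub_near] .
  then show ?thesis using v True by (intro that[of \<xi>]) (simp add: represents_def)
next
  case False
  with assms have d: "d = 2" by simp
  with assms obtain D where D: "D \<in> tangent_space M z" "x = (0, cs D)" by (auto simp: symbol_simps(8))
  obtain \<xi> where "vector_field_at M z \<xi>" "\<xi> z = D" using field_through[OF D(1)] .
  then show ?thesis using D d by (intro that[of \<xi>]) (simp add: represents_def)
qed

lemma symbol_word_exists:
  assumes "homogeneous_word \<nn> w ds" shows "\<exists>\<xi>s. symbol_word w ds \<xi>s"
  using assms
proof (induction w arbitrary: ds)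
  case Nil
  then show ?case by (simp add: symbol_word_Nil homogeneous_word_def)
next
  case (Cons x w)
  from Cons.prems obtain d ds' where ds: "ds = d # ds'" "d \<in> {1, 2}" "x \<in> grade \<nn> d" "homogeneous_word \<nn> w ds'"
    unfolding homogeneous_word_def by (auto simp: list_all2_Cons1)
  obtain \<xi>s where "symbol_word w ds' \<xi>s" using Cons.IH[OF ds(4)] by blast
  moreover obtain \<xi> where "represents M H z d x \<xi>" using represented[OF ds(3,2)] .
  ultimately have "symbol_word (x # w) (d # ds') (\<xi> # \<xi>s)" using ds(2,3) by (simp only: symbol_word_Cons simp_thms)
  then show ?case unfolding ds(1) by blast
qed

lemma symbol_word_operator:
  "symbol_word w ds \<xi>s \<Longrightarrow> weighted_operator M H z (sum_list ds) (\<lambda>f. foldr (\<lambda>\<xi> f q. \<xi> q f) \<xi>s f)"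
proof (induction w arbitrary: ds \<xi>s)
  case Nil
  then show ?case
    using weighted_operator.function[OF holomorphic_at_const[of M z 1], of H] by (simp add: symbol_word_Nil)
next
  case (Cons x w)
  from Cons.prems obtain d ds' \<xi> \<xi>s' where e: "ds = d # ds'" "\<xi>s = \<xi> # \<xi>s'" "represents M H z d x \<xi>" "symbol_word w ds' \<xi>s'"
    by (rule symbol_word_ConsE)
  from weighted_operator.comp[OF represents_field(2)[OF e(3)] Cons.IH[OF e(4)]]
  show ?case unfolding e(1,2) by simp
qed

lemma jet_symbol_iff:
  "jet_symbol M H z l f L \<longleftrightarrow> f \<in> weighted_ideal M H z l \<and> L \<in> uea_dual \<nn> l
     \<and> (\<forall>w ds \<xi>s. symbol_word w ds \<xi>s \<longrightarrow> sum_list ds = l \<longrightarrow> L (uea_monomial \<nn> w) = foldr (\<lambda>\<xi> f q. \<xi> q f) \<xi>s f z)"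
  unfolding jet_symbol_def symbol_word_def by blast

lemma symbol_grades: "grade \<nn> 1 \<subseteq> carrier \<nn>" "grade \<nn> 2 \<subseteq> carrier \<nn>"
  by (auto simp: symbol_simps H_closed tangent_closed)

lemma symbol_bracket_closed: "x \<in> carrier \<nn> \<Longrightarrow> y \<in> carrier \<nn> \<Longrightarrow> bracket \<nn> x y \<in> carrier \<nn>"
  using symbol_lie_algebra unfolding lie_algebra_def by blast

lemma symbol_decomposition: "x \<in> carrier \<nn> \<Longrightarrow> \<exists>y\<in>grade \<nn> 1. \<exists>w\<in>grade \<nn> 2. x = y \<oplus>\<^bsub>\<nn>\<^esub> w"
proof -
  assume "x \<in> carrier \<nn>"
  then obtain v D where x: "v \<in> H z" "D \<in> tangent_space M z" "x = (v, cs D)" by (rule symbol_carrierE)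
  show ?thesis
    by (intro bexI[of _ "(v, cs 0)"] bexI[of _ "(0, cs D)"])
      (use x in \<open>simp_all add: symbol_simps(3,6,7,8)\<close>)
qed

lemma symbol_dual_eqI:
  assumes "L \<in> uea_dual \<nn> l" "L' \<in> uea_dual \<nn> l"
    and "\<And>w ds \<xi>s. symbol_word w ds \<xi>s \<Longrightarrow> sum_list ds = l \<Longrightarrow> L (uea_monomial \<nn> w) = L' (uea_monomial \<nn> w)"
  shows "L = L'"
proof (rule uea_dual_eqI[OF symbol_module symbol_bracket_closed symbol_grades symbol_decomposition assms(1,2)])
  fix w ds assume h: "homogeneous_word \<nn> w ds" "sum_list ds = l"
  obtain \<xi>s where "symbol_word w ds \<xi>s" using symbol_word_exists[OF h(1)] by blast
  then show "L (uea_monomial \<nn> w) = L' (uea_monomial \<nn> w)" by (rule assms(3)[OF _ h(2)])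
qed

lemma jet_symbol_unique:
  assumes "jet_symbol M H z l f L" "jet_symbol M H z l f L'" shows "L = L'"
  by (rule symbol_dual_eqI[of _ l]) (use assms in \<open>simp_all add: jet_symbol_iff\<close>)

lemma jet_symbol_comb:
  assumes "jet_symbol M H z l f L" "jet_symbol M H z l g K"
  shows "jet_symbol M H z l (\<lambda>q. c * f q + d * g q) (cscale c L + cscale d K)"
  unfolding jet_symbol_iff
proof (intro conjI allI impI)
  show "(\<lambda>q. c * f q + d * g q) \<in> weighted_ideal M H z l"
    by (rule weighted_ideal_comb) (use assms in \<open>simp_all add: jet_symbol_iff\<close>)
  show "cscale c L + cscale d K \<in> uea_dual \<nn> l"
    by (intro cfun.subspace_add cfun.subspace_scale uea_dual_subspace) (use assms in \<open>simp_all add: jet_symbol_iff\<close>)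
  fix w ds \<xi>s assume w: "symbol_word w ds \<xi>s" "sum_list ds = l"
  have "holomorphic_at M z f" "holomorphic_at M z g"
    using assms by (simp_all add: jet_symbol_iff weighted_ideal_def)
  from operator_comb[OF symbol_word_operator[OF w(1)] this]
  show "(cscale c L + cscale d K) (uea_monomial \<nn> w) = foldr (\<lambda>\<xi> f q. \<xi> q f) \<xi>s (\<lambda>q. c * f q + d * g q) z"
    using assms w by (simp add: jet_symbol_iff cscale_def)
qed

lemma jet_symbol_germ:
  assumes "jet_symbol M H z l f L" "\<forall>\<^sub>F q in near M z. f q = g q"
  shows "jet_symbol M H z l g L"
proof -
  have f: "f \<in> weighted_ideal M H z l" "L \<in> uea_dual \<nn> l"
    "\<And>w ds \<xi>s. symbol_word w ds \<xi>s \<Longrightarrow> sum_list ds = l \<Longrightarrow> L (uea_monomial \<nn> w) = foldr (\<lambda>\<xi> f q. \<xi> q f) \<xi>s f z"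
    using assms(1) by (simp_all add: jet_symbol_iff)
  have hf: "holomorphic_at M z f" using f(1) by (simp add: weighted_ideal_def)
  have eq: "P f z = P g z" if "weighted_operator M H z j P" for j P by (rule operator_germ[OF that hf assms(2)])
  show ?thesis
    unfolding jet_symbol_iff
  proof (intro conjI allI impI f(2))
    show "g \<in> weighted_ideal M H z l"
      unfolding weighted_ideal_def
    proof (intro CollectI conjI allI impI holomorphic_at_cong[OF hf assms(2)])
      fix j P assume j: "j < l" and P: "weighted_operator M H z j P"
      have "P f z = 0" using f(1) j P unfolding weighted_ideal_def by blast
      then show "P g z = 0" unfolding eq[OF P] .
    qed
    fix w ds \<xi>s assume w: "symbol_word w ds \<xi>s" "sum_list ds = l"
    show "L (uea_monomial \<nn> w) = foldr (\<lambda>\<xi> f q. \<xi> q f) \<xi>s g z"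
      unfolding f(3)[OF w] by (rule eq[OF symbol_word_operator[OF w(1)]])
  qed
qed

section \<open>Local trivializations of the hyperplane bundle\<close>

lemma trivialization_unit:
  assumes "local_trivialization M z s"
  obtains u where "holomorphic_at M z u" "u z \<noteq> 0"
    "\<And>e f. equals_product_at M z (lform e) f s \<longleftrightarrow> (\<forall>\<^sub>F q in near M z. f q = u q * ratio e k q)"
proof -
  obtain U F where U: "open U" "z \<in> U" and F: "cholomorphic_on F (cone U)"
    and hom: "\<And>v c. v \<in> cone U \<Longrightarrow> c \<noteq> 0 \<Longrightarrow> F (c *s v) = c * F v"
    and sF: "\<And>v. v \<in> cone (M \<inter> U) \<Longrightarrow> s v = F v"
    using assms unfolding local_trivialization_def hyperplane_section_at_def by blast
  let ?G = "\<lambda>q. F (sect k q)"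
  have sect: "sect k q \<in> cone N" if "q \<in> affine_chart k" "q \<in> N" for q N
    using that by (simp add: in_cone_iff line_sect sect_nonzero)
  have G: "holomorphic_at M z ?G"
    by (rule holomorphic_at_comp_sect[OF F open_cone[OF U(1)] z_chart sect[OF z_chart U(2)]])
  have "s (sect k z) \<noteq> 0"
    using assms sect[OF z_chart, of "{z}"] unfolding local_trivialization_def by blast
  then have Gz: "?G z \<noteq> 0" using sF[OF sect[OF z_chart, of "M \<inter> U"]] z U(2) by simp
  note near = holomorphic_at_nonzero(1)[OF G z Gz] near_open[OF U] near_open[OF open_affine_chart z_chart] near_in
  show ?thesis
  proof (rule that[of "\<lambda>q. inverse (?G q)"])
    show "holomorphic_at M z (\<lambda>q. inverse (?G q))" by (rule holomorphic_at_inverse[OF G z Gz])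
    show "inverse (?G z) \<noteq> 0" using Gz by simp
    fix e f
    have sk: "sect k q $ k = 1" if "q \<in> affine_chart k" for q using that by (simp add: sect_component ratio_self)
    have le: "lform e (sect k q) = ratio e k q" if "q \<in> affine_chart k" for q
      using ratio_line[OF sect_nonzero[OF that], of e k] that by (simp add: line_sect sk)
    show "equals_product_at M z (lform e) f s \<longleftrightarrow> (\<forall>\<^sub>F q in near M z. f q = inverse (?G q) * ratio e k q)"
    proof
      assume "equals_product_at M z (lform e) f s"
      then obtain V where V: "open V" "z \<in> V" "\<And>v. v \<in> cone (M \<inter> V) \<Longrightarrow> lform e v = f (line v) * s v"
        unfolding equals_product_at_def by blast
      show "\<forall>\<^sub>F q in near M z. f q = inverse (?G q) * ratio e k q"
        using near near_open[OF V(1,2)]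
      proof eventually_elim
        case (elim q)
        have "lform e (sect k q) = f (line (sect k q)) * s (sect k q)" by (rule V(3)[OF sect]) (use elim in simp_all)
        then have "ratio e k q = f q * ?G q" using elim sF[OF sect[of q "M \<inter> U"]] by (simp add: le line_sect)
        then show ?case using elim by simp
      qed
    next
      assume "\<forall>\<^sub>F q in near M z. f q = inverse (?G q) * ratio e k q"
      with near have "\<forall>\<^sub>F q in near M z. f q = inverse (?G q) * ratio e k q \<and> q \<in> affine_chart k \<and> q \<in> U \<and> ?G q \<noteq> 0"
        by eventually_elim simp
      then obtain V where V: "open V" "z \<in> V"
        "\<And>q. q \<in> M \<inter> V \<Longrightarrow> f q = inverse (?G q) * ratio e k q \<and> q \<in> affine_chart k \<and> q \<in> U \<and> ?G q \<noteq> 0"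
        unfolding eventually_near by blast
      show "equals_product_at M z (lform e) f s"
        unfolding equals_product_at_def
      proof (intro exI[of _ V] conjI ballI V(1,2))
        fix v assume v: "v \<in> cone (M \<inter> V)"
        let ?q = "line v"
        have v0: "v \<noteq> 0" and q: "?q \<in> M \<inter> V" using v by (simp_all add: in_cone_iff)
        note q' = V(3)[OF q]
        have vk: "v $ k \<noteq> 0" using q' affine_chart_line[OF v0] by simp
        then have vs: "v = v $ k *s sect k ?q" by (simp add: sect_line[OF v0] vec_eq_iff)
        have "s v = F v" by (rule sF) (use v0 q q' in \<open>simp add: in_cone_iff\<close>)
        also have "\<dots> = F (v $ k *s sect k ?q)" using vs by simp
        also have "\<dots> = v $ k * ?G ?q" by (rule hom[OF sect vk]) (use q' in simp_all)
        finally have "f ?q * s v = v $ k * ratio e k ?q" using q' by simp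
        also have "\<dots> = lform e v" using vk by (simp add: ratio_line[OF v0])
        finally show "lform e v = f ?q * s v" by (rule sym)
      qed
    qed
  qed
qed

end

locale contact_unit = contact_framed +
  fixes u assumes u: "holomorphic_at M z u" "u z \<noteq> 0"
begin

definition form_germ :: "complex ^ 'a \<Rightarrow> 'a proj \<Rightarrow> complex" where
  "form_germ e = (\<lambda>q. u q * ratio e k q)"

definition symbols :: "nat \<Rightarrow> ((('a tvec \<times> 'a tvec set) list \<Rightarrow> complex) set \<Rightarrow> complex) set" where
  "symbols l = {L. \<exists>e. jet_symbol M H z l (form_germ e) L}"

lemma form_germ_holomorphic: "holomorphic_at M z (form_germ e)"
  unfolding form_germ_def by (intro holomorphic_at_mult u(1) holomorphic_at_ratio z_chart)

lemma form_germ_comb: "form_germ (c *s e + d *s e') = (\<lambda>q. c * form_germ e q + d * form_germ e' q)"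
  by (simp add: form_germ_def fun_eq_iff ratio_linear algebra_simps)

lemma form_germ_expand: "form_germ e = (\<lambda>q. \<Sum>j\<in>UNIV. e $ j * form_germ (axis j 1) q)"
  by (simp add: form_germ_def fun_eq_iff ratio_expand[of e] sum_distrib_left mult_ac)

lemma ratio_form_germ: "\<forall>\<^sub>F q in near M z. ratio e k q = inverse (u q) * form_germ e q"
  using holomorphic_at_nonzero(1)[OF u(1) z u(2)] by eventually_elim (simp add: form_germ_def)

lemma symbols_dual: "symbols l \<subseteq> uea_dual \<nn> l"
  by (auto simp: symbols_def jet_symbol_def)

lemma jet_symbol_zero: "jet_symbol M H z l (\<lambda>q. 0) 0"
  unfolding jet_symbol_iff weighted_ideal_def
proof (intro CollectI conjI allI impI holomorphic_at_const cfun.subspace_0[OF uea_dual_subspace])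
  show "P (\<lambda>q. 0) z = 0" if "weighted_operator M H z j P" for j P by (rule operator_zero[OF that])
  fix w ds \<xi>s assume "symbol_word w ds \<xi>s"
  from operator_zero[OF symbol_word_operator[OF this]]
  show "0 (uea_monomial \<nn> w) = foldr (\<lambda>\<xi> f q. \<xi> q f) \<xi>s (\<lambda>q. 0) z" by simp
qed

lemma form_germ_zero: "form_germ 0 = (\<lambda>q. 0)"
  by (simp add: form_germ_def ratio_expand[of 0] fun_eq_iff)

lemma symbols_subspace: "cfun.subspace (symbols l)"
proof (rule cfun.subspaceI)
  have z0: "jet_symbol M H z l (form_germ 0) 0" unfolding form_germ_zero by (rule jet_symbol_zero)
  then show "0 \<in> symbols l" unfolding symbols_def by (intro CollectI exI)
  have comb: "cscale c x + cscale d y \<in> symbols l" if xy: "x \<in> symbols l" "y \<in> symbols l" for c d x y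
  proof -
    obtain e e' where "jet_symbol M H z l (form_germ e) x" "jet_symbol M H z l (form_germ e') y"
      using xy by (auto simp: symbols_def)
    from jet_symbol_comb[OF this, of c d]
    have "jet_symbol M H z l (form_germ (c *s e + d *s e')) (cscale c x + cscale d y)" unfolding form_germ_comb .
    then show ?thesis unfolding symbols_def by (intro CollectI exI)
  qed
  show "x + y \<in> symbols l" if "x \<in> symbols l" "y \<in> symbols l" for x y
    using comb[OF that, of 1 1] by (simp only: cfun.scale_one)
  show "cscale c x \<in> symbols l" if "x \<in> symbols l" for c x
    using comb[OF that that, of c 0] by (simp only: cfun.scale_zero_left add_0_right)
qed

definition vanishing_forms :: "nat \<Rightarrow> (complex ^ 'a) set" where
  "vanishing_forms l = {e. form_germ e \<in> weighted_ideal M H z l}"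

lemma vanishing_forms_subspace: "vec.subspace (vanishing_forms l)"
proof (rule vec.subspaceI)
  have "(\<lambda>q. 0) \<in> weighted_ideal M H z l"
    unfolding weighted_ideal_def by (intro CollectI conjI allI impI holomorphic_at_const operator_zero)
  then show "0 \<in> vanishing_forms l" by (simp add: vanishing_forms_def form_germ_zero)
  have comb: "c *s x + d *s y \<in> vanishing_forms l" if "x \<in> vanishing_forms l" "y \<in> vanishing_forms l" for c d x y
    using that weighted_ideal_comb[of "form_germ x" l "form_germ y" c d] by (simp add: vanishing_forms_def form_germ_comb)
  show "x + y \<in> vanishing_forms l" if "x \<in> vanishing_forms l" "y \<in> vanishing_forms l" for x y
    using comb[OF that, of 1 1] by simp
  show "c *s x \<in> vanishing_forms l" if "x \<in> vanishing_forms l" for c x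
    using comb[OF that that, of c 0] by simp
qed

text \<open>
  The spaces of linear forms vanishing to weighted order \<open>l\<close> decrease, hence become stationary; a
  form that vanishes to order \<open>l + 1\<close> has zero symbol in degree \<open>l\<close>.
\<close>

lemma symbols_eventually_zero: "\<exists>n. \<forall>l\<ge>n. symbols l \<subseteq> {0}"
proof -
  let ?d = "\<lambda>l. vec.dim (vanishing_forms l)"
  obtain n where n: "\<And>l. ?d n \<le> ?d l" using ex_has_least_nat[of "\<lambda>_. True" _ ?d] by blast
  have anti: "vanishing_forms l' \<subseteq> vanishing_forms l" if "l \<le> l'" for l l'
    using weighted_ideal_antimono[OF that] by (auto simp: vanishing_forms_def)
  have "L = 0" if l: "n \<le> l" and L: "L \<in> symbols l" for l L
  proof -
    obtain e where e: "jet_symbol M H z l (form_germ e) L" using L by (auto simp: symbols_def)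
    have "?d l \<le> ?d (Suc l)" using vec.dim_subset[OF anti[OF l]] n[of "Suc l"] by (rule order_trans)
    from vec.subspace_dim_equal[OF vanishing_forms_subspace vanishing_forms_subspace anti[of l "Suc l"] this]
    have "vanishing_forms (Suc l) = vanishing_forms l" by simp
    moreover have "e \<in> vanishing_forms l" using e by (simp add: jet_symbol_iff vanishing_forms_def)
    ultimately have van: "form_germ e \<in> weighted_ideal M H z (Suc l)" unfolding vanishing_forms_def by blast
    show "L = 0"
    proof (rule symbol_dual_eqI[of _ l])
      show "L \<in> uea_dual \<nn> l" using e by (simp add: jet_symbol_iff)
      show "0 \<in> uea_dual \<nn> l" by (rule cfun.subspace_0[OF uea_dual_subspace])
      fix w ds \<xi>s assume w: "symbol_word w ds \<xi>s" "sum_list ds = l"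
      have "L (uea_monomial \<nn> w) = foldr (\<lambda>\<xi> f q. \<xi> q f) \<xi>s (form_germ e) z"
        using e w by (simp add: jet_symbol_iff)
      also have "\<dots> = 0" using van symbol_word_operator[OF w(1)] w(2) unfolding weighted_ideal_def by blast
      finally show "L (uea_monomial \<nn> w) = 0 (uea_monomial \<nn> w)" by simp
    qed
  qed
  then show ?thesis by blast
qed

lemma symbols_finite: "\<exists>B. finite B \<and> symbols l \<subseteq> cfun.span B"
proof -
  define D where "D = {e. \<exists>L. jet_symbol M H z l (form_germ e) L}"
  obtain B where B: "B \<subseteq> D" "vec.independent B" "D \<subseteq> vec.span B"
    by (rule vec.basis_exists[of D], rule that)
  have fin: "finite B" by (rule vec.finiteI_independent[OF B(2)])
  have "\<forall>e\<in>B. \<exists>L. jet_symbol M H z l (form_germ e) L" using B(1) by (auto simp: D_def)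
  from bchoice[OF this] obtain sym where sym: "\<forall>e\<in>B. jet_symbol M H z l (form_germ e) (sym e)" by (rule exE)
  have "\<exists>L\<in>cfun.span (sym ` B). jet_symbol M H z l (form_germ e) L" if "e \<in> vec.span B" for e
    using that
  proof (induction rule: vec.span_induct_alt)
    case base
    show ?case unfolding form_germ_zero by (intro bexI[of _ 0] jet_symbol_zero cfun.span_zero)
  next
    case (step c x y)
    then obtain L where L: "L \<in> cfun.span (sym ` B)" "jet_symbol M H z l (form_germ y) L" by blast
    from jet_symbol_comb[OF bspec[OF sym step(1)] L(2), of c 1]
    have "jet_symbol M H z l (form_germ (c *s x + y)) (cscale c (sym x) + cscale 1 L)"
      unfolding form_germ_comb[of c x 1 y, symmetric] by simp
    moreover have "cscale c (sym x) + cscale 1 L \<in> cfun.span (sym ` B)"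
      by (intro cfun.span_add cfun.span_scale L(1) cfun.span_base imageI step(1))
    ultimately show ?case by (rule bexI)
  qed
  note span = this
  have "symbols l \<subseteq> cfun.span (sym ` B)"
  proof
    fix L assume "L \<in> symbols l"
    then obtain e where e: "jet_symbol M H z l (form_germ e) L" by (auto simp: symbols_def)
    then have "e \<in> D" unfolding D_def by (intro CollectI exI)
    then have "e \<in> vec.span B" using B(3) by (rule rev_subsetD)
    from span[OF this] obtain L' where L': "L' \<in> cfun.span (sym ` B)" "jet_symbol M H z l (form_germ e) L'" by (rule bexE)
    show "L \<in> cfun.span (sym ` B)" unfolding jet_symbol_unique[OF e L'(2)] by (rule L'(1))
  qed
  with fin show ?thesis by (intro exI[of _ "sym ` B"] conjI finite_imageI)
qed

lemma symbols_span_finite: "\<exists>B. finite B \<and> cfun.span (\<Union>l. symbols l) \<subseteq> cfun.span B"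
proof -
  obtain n where n: "\<And>l. n \<le> l \<Longrightarrow> symbols l \<subseteq> {0}" using symbols_eventually_zero by blast
  have "\<forall>l. \<exists>B. finite B \<and> symbols l \<subseteq> cfun.span B" using symbols_finite by (rule allI)
  from choice[OF this] obtain B where B: "\<forall>l. finite (B l) \<and> symbols l \<subseteq> cfun.span (B l)" by (rule exE)
  have "symbols l \<subseteq> cfun.span (\<Union>l<n. B l)" for l
  proof (cases "l < n")
    case True
    then have "B l \<subseteq> (\<Union>l<n. B l)" by blast
    from cfun.span_mono[OF this] conjunct2[OF spec[OF B, of l]] show ?thesis by (rule order_trans[rotated])
  next
    case False
    then show ?thesis using n[of l] cfun.span_zero by auto
  qed
  then have "(\<Union>l. symbols l) \<subseteq> cfun.span (\<Union>l<n. B l)" by blast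
  then have "cfun.span (\<Union>l. symbols l) \<subseteq> cfun.span (\<Union>l<n. B l)"
    by (rule cfun.span_minimal[OF _ cfun.subspace_span])
  moreover have "finite (\<Union>l<n. B l)" using B by simp
  ultimately show ?thesis by (intro exI[of _ "\<Union>l<n. B l"] conjI)
qed

section \<open>Invariance under right-invariant fields\<close>

text \<open>
  Where the jet ranks are locally constant, a form vanishing to order \<open>l\<close> at \<open>z\<close> moves in a family of
  forms with this property. Differentiating \<open>P (\<Sum>\<^sub>j \<alpha>\<^sub>j f\<^sub>j) = 0\<close> along \<open>\<xi>\<close> shows that the derivative of the
  family represents minus the functional \<open>P \<mapsto> \<xi> P\<close>.
\<close>

lemma differentiated_family:
  assumes z': "z \<notin> jump_locus M H" and e: "form_germ e \<in> weighted_ideal M H z (Suc l)" and \<xi>: "vector_field_at M z \<xi>"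
  obtains e' where "\<And>P. weighted_operator M H z l P \<Longrightarrow> P (form_germ e') z = - \<xi> z (P (form_germ e))"
proof -
  note D = vector_field_tangent[OF \<xi> z]
  have mult: "weighted_operator M H z j (\<lambda>f. P (\<lambda>q. g q * f q))"
    if "weighted_operator M H z j P" "holomorphic_at M z g" for j P g
    using weighted_operator.comp[OF that(1) weighted_operator.function[OF that(2)]] by simp
  have orth: "(\<Sum>j\<in>UNIV. e $ j * v $ j) = 0" if "v \<in> jet_space M H z l" for v
  proof -
    obtain P where P: "weighted_operator M H z l P" "v = jet_row k P z"
      using \<open>v \<in> jet_space M H z l\<close>[unfolded jet_space_eq[OF z_chart]] by (elim CollectE exE conjE) (rule that)
    note Q = mult[OF P(1) holomorphic_at_inverse[OF u(1) z u(2)]]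
    have "(\<Sum>j\<in>UNIV. e $ j * P (ratio (axis j 1) k) z) = P (\<lambda>q. \<Sum>j\<in>UNIV. e $ j * ratio (axis j 1) k q) z"
      by (rule operator_linear[OF P(1), symmetric]) (simp_all add: holomorphic_at_ratio[OF z_chart])
    also have "\<dots> = P (ratio e k) z" unfolding ratio_expand[of e, abs_def] ..
    also have "\<dots> = P (\<lambda>q. inverse (u q) * form_germ e q) z"
      by (rule operator_germ[OF P(1) holomorphic_at_ratio[OF z_chart] ratio_form_germ])
    also have "\<dots> = 0" using e Q unfolding weighted_ideal_def by blast
    finally show ?thesis by (simp add: P(2) jet_row_def)
  qed
  have const: "\<forall>\<^sub>F y in near M z. jet_rank M H y l = jet_rank M H z l"
  proof -
    have "\<forall>\<^sub>F y in near M z. \<forall>l. jet_rank M H y l = jet_rank M H z l" using z' z by (simp add: jump_locus_def)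
    then show ?thesis by eventually_elim (rule spec)
  qed
  obtain \<alpha> :: "'a proj \<Rightarrow> complex ^ 'a" where \<alpha>: "\<And>j. holomorphic_at M z (\<lambda>y. \<alpha> y $ j)" "\<alpha> z = e"
    and \<alpha>0: "\<forall>\<^sub>F y in near M z. \<forall>v\<in>jet_space M H y l. (\<Sum>j\<in>UNIV. \<alpha> y $ j * v $ j) = 0"
    by (rule vanishing_family[OF const orth], assumption, rule that)
  define e' :: "complex ^ 'a" where "e' = (\<chi> j. \<xi> z (\<lambda>y. \<alpha> y $ j))"
  show ?thesis
  proof (rule that[of e'])
    fix P assume P: "weighted_operator M H z l P"
    let ?g = "\<lambda>j. form_germ (axis j 1)"
    have Pg: "holomorphic_at M z (P (?g j))" for j by (rule operator_holomorphic[OF P form_germ_holomorphic])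
    have zero: "\<forall>\<^sub>F y in near M z. (\<Sum>j\<in>UNIV. \<alpha> y $ j * P (?g j) y) = 0"
      using \<alpha>0 weighted_operator_near[OF mult[OF P u(1)]] framed_near
    proof eventually_elim
      case (elim y)
      interpret y: framed M H k r X a T b y by (rule elim(3))
      have "jet_row k (\<lambda>f. P (\<lambda>q. u q * f q)) y \<in> jet_space M H y l"
        unfolding y.jet_space_eq[OF y.z_chart] using elim(2) by (intro CollectI exI conjI) simp_all
      from bspec[OF elim(1) this] show ?case by (simp add: jet_row_def form_germ_def)
    qed
    have "0 = \<xi> z (\<lambda>y. 0)" by (rule tangent_const[OF D, symmetric])
    also have "\<dots> = \<xi> z (\<lambda>y. \<Sum>j\<in>UNIV. \<alpha> y $ j * P (?g j) y)"
      by (rule tangent_germ[OF D holomorphic_at_const]) (use zero in eventually_elim, simp)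
    also have "\<dots> = (\<Sum>j\<in>UNIV. \<xi> z (\<lambda>y. \<alpha> y $ j * P (?g j) y))"
      by (rule tangent_sum[OF D]) (intro holomorphic_at_mult \<alpha>(1) Pg)
    also have "\<dots> = (\<Sum>j\<in>UNIV. e $ j * \<xi> z (P (?g j)) + e' $ j * P (?g j) z)"
      by (rule sum.cong[OF refl]) (simp add: tangent_mult[OF D \<alpha>(1) Pg] \<alpha>(2) e'_def mult.commute)
    also have "\<dots> = (\<Sum>j\<in>UNIV. e $ j * \<xi> z (P (?g j))) + (\<Sum>j\<in>UNIV. e' $ j * P (?g j) z)"
      by (rule sum.distrib)
    also have "(\<Sum>j\<in>UNIV. e' $ j * P (?g j) z) = P (form_germ e') z"
      unfolding form_germ_expand[of e'] by (rule operator_linear[OF P, symmetric]) (simp_all add: form_germ_holomorphic)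
    also have "(\<Sum>j\<in>UNIV. e $ j * \<xi> z (P (?g j))) = \<xi> z (P (form_germ e))"
      unfolding form_germ_expand[of e]
      by (rule operator_linear[OF weighted_operator.comp[OF weighted_operator.vfield[OF \<xi>] P], symmetric])
        (simp_all add: form_germ_holomorphic)
    finally show "P (form_germ e') z = - \<xi> z (P (form_germ e))" by (simp add: eq_neg_iff_add_eq_0 add.commute)
  qed
qed

lemma shift_monomial:
  assumes "L \<in> lin_dual (uea \<nn>)" "x \<in> carrier \<nn>"
  shows "shift \<nn> x L \<in> lin_dual (uea \<nn>)"
    and "w \<in> lists (carrier \<nn>) \<Longrightarrow> shift \<nn> x L (uea_monomial \<nn> w) = L (uea_monomial \<nn> (x # w))"
  using shift[OF assms(1) symbol_module symbol_bracket_closed assms(2)] by blast+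

lemma symbol_word_lists: "homogeneous_word \<nn> w ds \<Longrightarrow> w \<in> lists (carrier \<nn>)"
  by (rule homogeneous_in_lists[OF _ symbol_grades])

lemma symbols_shift_homogeneous:
  assumes z': "z \<notin> jump_locus M H" and x: "x \<in> grade \<nn> d" "d \<in> {1, 2}" and L: "L \<in> symbols l"
  shows "shift \<nn> x L \<in> cfun.span (\<Union>l. symbols l)"
proof -
  obtain e where e: "jet_symbol M H z l (form_germ e) L" using L by (auto simp: symbols_def)
  have Ldual: "L \<in> uea_dual \<nn> l" using e by (simp add: jet_symbol_iff)
  then have Llin: "L \<in> lin_dual (uea \<nn>)" by (simp add: uea_dual_def)
  have xc: "x \<in> carrier \<nn>" using x symbol_grades by auto
  obtain \<xi> where \<xi>: "represents M H z d x \<xi>" using represented[OF x] .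
  have hom: "homogeneous_word \<nn> (x # w) (d # ds)" if "homogeneous_word \<nn> w ds" for w ds
    using that x by (simp add: homogeneous_word_def)
  have off: "shift \<nn> x L (uea_monomial \<nn> w) = 0" if "homogeneous_word \<nn> w ds" "d + sum_list ds \<noteq> l" for w ds
  proof -
    have "L (uea_monomial \<nn> (x # w)) = 0"
      using Ldual hom[OF that(1)] that(2) unfolding uea_dual_iff[OF symbol_grades] by (metis sum_list.Cons)
    then show ?thesis using shift_monomial(2)[OF Llin xc symbol_word_lists[OF that(1)]] by simp
  qed
  show ?thesis
  proof (cases "d \<le> l")
    case False
    then have "shift \<nn> x L \<in> uea_dual \<nn> 0"
      unfolding uea_dual_iff[OF symbol_grades] using shift_monomial(1)[OF Llin xc] off by auto
    then have "shift \<nn> x L = 0"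
      by (rule symbol_dual_eqI[OF _ cfun.subspace_0[OF uea_dual_subspace]])
        (use off False in \<open>auto simp: symbol_word_def\<close>)
    then show ?thesis by (simp only: cfun.span_zero)
  next
    case True
    then obtain m where m: "l = d + m" by (auto simp: le_iff_add)
    define n where "n = l - 1"
    have n: "l = Suc n" "m \<le> n" using m x(2) by (auto simp: n_def)
    obtain e' where e': "\<And>P. weighted_operator M H z n P \<Longrightarrow> P (form_germ e') z = - \<xi> z (P (form_germ e))"
      by (rule differentiated_family[OF z' _ represents_field(1)[OF \<xi>], of e n])
        (use e in \<open>simp add: jet_symbol_iff n(1)\<close>, rule that)
    have comp: "weighted_operator M H z (d + j) (\<lambda>f q. \<xi> q (P f))" if "weighted_operator M H z j P" for j P
      by (rule weighted_operator.comp[OF represents_field(2)[OF \<xi>] that])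
    have van: "P (form_germ e) z = 0" if "i < l" "weighted_operator M H z i P" for i P
    proof -
      have "form_germ e \<in> weighted_ideal M H z l" using e by (simp add: jet_symbol_iff)
      then show ?thesis using that unfolding weighted_ideal_def by blast
    qed
    have val: "L (uea_monomial \<nn> w) = foldr (\<lambda>\<xi> f q. \<xi> q f) \<xi>s (form_germ e) z"
      if "symbol_word w ds \<xi>s" "sum_list ds = l" for w ds \<xi>s
      using e that by (simp add: jet_symbol_iff)
    have "jet_symbol M H z m (form_germ e') (cscale (- 1) (shift \<nn> x L))"
      unfolding jet_symbol_iff
    proof (intro conjI allI impI)
      show "form_germ e' \<in> weighted_ideal M H z m"
        unfolding weighted_ideal_def
      proof (intro CollectI conjI allI impI form_germ_holomorphic)
        fix j P assume j: "j < m" and P: "weighted_operator M H z j P"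
        have "\<xi> z (P (form_germ e)) = 0" by (rule van[OF _ comp[OF P]]) (use j m in simp)
        then show "P (form_germ e') z = 0"
          using e'[OF weighted_operator.mono[OF P]] j n(2) by simp
      qed
      have "shift \<nn> x L \<in> uea_dual \<nn> m"
        unfolding uea_dual_iff[OF symbol_grades] using shift_monomial(1)[OF Llin xc] off by (auto simp: m)
      then show "cscale (- 1) (shift \<nn> x L) \<in> uea_dual \<nn> m" by (rule cfun.subspace_scale[OF uea_dual_subspace])
      fix w ds \<xi>s assume w: "symbol_word w ds \<xi>s" "sum_list ds = m"
      have "symbol_word (x # w) (d # ds) (\<xi> # \<xi>s)" unfolding symbol_word_Cons using x \<xi> w(1) by blast
      from val[OF this] have "L (uea_monomial \<nn> (x # w)) = \<xi> z (foldr (\<lambda>\<xi> f q. \<xi> q f) \<xi>s (form_germ e))"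
        using w(2) m by simp
      moreover have "w \<in> lists (carrier \<nn>)" using w(1) symbol_word_lists unfolding symbol_word_def by blast
      moreover have "foldr (\<lambda>\<xi> f q. \<xi> q f) \<xi>s (form_germ e') z = - \<xi> z (foldr (\<lambda>\<xi> f q. \<xi> q f) \<xi>s (form_germ e))"
        by (rule e'[OF weighted_operator.mono[OF symbol_word_operator[OF w(1)]]]) (use w(2) n(2) in simp)
      ultimately show "cscale (- 1) (shift \<nn> x L) (uea_monomial \<nn> w) = foldr (\<lambda>\<xi> f q. \<xi> q f) \<xi>s (form_germ e') z"
        using shift_monomial(2)[OF Llin xc, of w] by (simp add: cscale_def)
    qed
    then have "cscale (- 1) (shift \<nn> x L) \<in> (\<Union>l. symbols l)" unfolding symbols_def by blast
    from cfun.span_scale[OF cfun.span_base[OF this], of "- 1"]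
    show ?thesis by (simp add: cscale_def)
  qed
qed

lemma symbols_shift:
  assumes z': "z \<notin> jump_locus M H" and x: "x \<in> carrier \<nn>" and L: "L \<in> cfun.span (\<Union>l. symbols l)"
  shows "shift \<nn> x L \<in> cfun.span (\<Union>l. symbols l)"
proof -
  let ?S = "cfun.span (\<Union>l. symbols l)"
  obtain y w where y: "y \<in> grade \<nn> 1" and w: "w \<in> grade \<nn> 2" and xyw: "x = y \<oplus>\<^bsub>\<nn>\<^esub> w"
    using symbol_decomposition[OF x] by blast
  have yc: "y \<in> carrier \<nn>" "w \<in> carrier \<nn>" using y w symbol_grades by blast+
  have base: "shift \<nn> x K \<in> ?S" if K: "K \<in> symbols l" for K l
  proof -
    have Kl: "K \<in> lin_dual (uea \<nn>)" using K symbols_dual by (auto simp: uea_dual_def)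
    have "shift \<nn> x K = shift \<nn> y K + shift \<nn> w K"
    proof (rule lin_dual_eqI)
      show "shift \<nn> x K \<in> lin_dual (uea \<nn>)" by (rule shift_monomial(1)[OF Kl x])
      show "shift \<nn> y K + shift \<nn> w K \<in> lin_dual (uea \<nn>)"
        by (intro cfun.subspace_add[OF lin_dual_subspace] shift_monomial(1)[OF Kl] yc)
      fix v assume v: "v \<in> lists (carrier \<nn>)"
      have "K (uea_monomial \<nn> ([] @ [y \<oplus>\<^bsub>\<nn>\<^esub> w] @ v)) = K (uea_monomial \<nn> ([] @ [y] @ v)) + K (uea_monomial \<nn> ([] @ [w] @ v))"
        by (rule word_functionalD(1)[OF word_functional_of_dual[OF Kl symbol_module symbol_bracket_closed]]) (use v yc in auto)
      then show "shift \<nn> x K (uea_monomial \<nn> v) = (shift \<nn> y K + shift \<nn> w K) (uea_monomial \<nn> v)"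
        using shift_monomial(2)[OF Kl _ v] x yc by (simp add: xyw)
    qed
    moreover have "shift \<nn> y K \<in> ?S" "shift \<nn> w K \<in> ?S"
      by (rule symbols_shift_homogeneous[OF z' y _ K], simp, rule symbols_shift_homogeneous[OF z' w _ K], simp)
    ultimately show ?thesis by (simp only: cfun.span_add)
  qed
  have "L \<in> lin_dual (uea \<nn>) \<and> shift \<nn> x L \<in> ?S"
    using L
  proof (induction rule: cfun.span_induct_alt)
    case base
    have "shift \<nn> x 0 = 0"
    proof (rule lin_dual_eqI)
      have 0: "0 \<in> lin_dual (uea \<nn>)" by (rule cfun.subspace_0[OF lin_dual_subspace])
      show "shift \<nn> x 0 \<in> lin_dual (uea \<nn>)" "0 \<in> lin_dual (uea \<nn>)" by (rule shift_monomial(1)[OF 0 x], rule 0)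
      show "shift \<nn> x 0 (uea_monomial \<nn> v) = 0 (uea_monomial \<nn> v)" if "v \<in> lists (carrier \<nn>)" for v
        using shift_monomial(2)[OF 0 x that] by simp
    qed
    then show ?case by (simp only: cfun.span_zero cfun.subspace_0[OF lin_dual_subspace] simp_thms)
  next
    case (step c K K')
    then obtain l where K: "K \<in> symbols l" by blast
    then have Kl: "K \<in> lin_dual (uea \<nn>)" using symbols_dual by (auto simp: uea_dual_def)
    have K'l: "K' \<in> lin_dual (uea \<nn>)" by (rule conjunct1[OF step(2)])
    have KK: "cscale c K + K' \<in> lin_dual (uea \<nn>)"
      by (intro cfun.subspace_add cfun.subspace_scale lin_dual_subspace Kl K'l)
    have "shift \<nn> x (cscale c K + K') = cscale c (shift \<nn> x K) + shift \<nn> x K'"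
    proof (rule lin_dual_eqI)
      show "shift \<nn> x (cscale c K + K') \<in> lin_dual (uea \<nn>)" by (rule shift_monomial(1)[OF KK x])
      show "cscale c (shift \<nn> x K) + shift \<nn> x K' \<in> lin_dual (uea \<nn>)"
        by (intro cfun.subspace_add cfun.subspace_scale lin_dual_subspace shift_monomial(1) Kl K'l x)
      show "shift \<nn> x (cscale c K + K') (uea_monomial \<nn> v) = (cscale c (shift \<nn> x K) + shift \<nn> x K') (uea_monomial \<nn> v)"
        if v: "v \<in> lists (carrier \<nn>)" for v
        using shift_monomial(2)[OF KK x v] shift_monomial(2)[OF Kl x v] shift_monomial(2)[OF K'l x v] by (simp add: cscale_def)
    qed
    then have "shift \<nn> x (cscale c K + K') \<in> ?S"
      by (simp only:) (intro cfun.span_add cfun.span_scale base[OF K] conjunct2[OF step(2)])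
    with KK show ?case by (rule conjI)
  qed
  then show ?thesis by (rule conjunct2)
qed

end

section \<open>The symbols of degree at most two\<close>

context contact_unit begin

abbreviation unit_form :: "complex ^ 'a" where "unit_form \<equiv> axis k 1"

lemma unit_form_near: "\<forall>\<^sub>F q in near M z. ratio unit_form k q = 1"
  using near_open[OF open_affine_chart z_chart] by eventually_elim (rule ratio_self)

lemma symbols_0: "symbols 0 = uea_dual \<nn> 0"
proof
  show "symbols 0 \<subseteq> uea_dual \<nn> 0" by (rule symbols_dual)
  show "uea_dual \<nn> 0 \<subseteq> symbols 0"
  proof
    fix L assume L: "L \<in> uea_dual \<nn> 0"
    define c where "c = L (uea_monomial \<nn> []) / u z"
    have "jet_symbol M H z 0 (form_germ (c *s unit_form)) L"
      unfolding jet_symbol_iff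
    proof (intro conjI allI impI L)
      show "form_germ (c *s unit_form) \<in> weighted_ideal M H z 0"
        unfolding weighted_ideal_0 by (rule form_germ_holomorphic)
      fix w ds \<xi>s assume w: "symbol_word w ds \<xi>s" "sum_list ds = 0"
      have "w = []"
      proof (cases w)
        case (Cons x w')
        with w(1) obtain d ds' where "ds = d # ds'" "d \<in> {1, 2}" by (auto elim: symbol_word_ConsE)
        then show ?thesis using w(2) by auto
      qed
      moreover have "form_germ (c *s unit_form) z = L (uea_monomial \<nn> [])"
        using ratio_linear[of c unit_form 0 0 k z] ratio_self[OF z_chart] u(2) by (simp add: form_germ_def c_def)
      ultimately show "L (uea_monomial \<nn> w) = foldr (\<lambda>\<xi> f q. \<xi> q f) \<xi>s (form_germ (c *s unit_form)) z"
        using w(1) by (simp add: symbol_word_Nil)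
    qed
    then show "L \<in> symbols 0" unfolding symbols_def by (intro CollectI exI)
  qed
qed

lemma dual_letter:
  assumes L: "L \<in> lin_dual (uea \<nn>)"
  shows "x \<in> carrier \<nn> \<Longrightarrow> y \<in> carrier \<nn> \<Longrightarrow>
      L (uea_monomial \<nn> [x \<oplus>\<^bsub>\<nn>\<^esub> y]) = L (uea_monomial \<nn> [x]) + L (uea_monomial \<nn> [y])"
    and "x \<in> carrier \<nn> \<Longrightarrow> L (uea_monomial \<nn> [c \<odot>\<^bsub>\<nn>\<^esub> x]) = c * L (uea_monomial \<nn> [x])"
  using word_functionalD(1,2)[OF word_functional_of_dual[OF L symbol_module symbol_bracket_closed], of "[]" "[]"] by simp_all

text \<open>At \<open>z\<close> a derivation of the product with the unit sees only the unit's value, when the other factor vanishes there.\<close>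

lemma tangent_form_germ:
  assumes "D \<in> tangent_space M z" "ratio e k z = 0"
  shows "D (form_germ e) = u z * D (ratio e k)"
  unfolding form_germ_def using tangent_mult[OF assms(1) u(1) holomorphic_at_ratio[OF z_chart]] assms(2) by simp

lemma ratio_sum: "ratio (\<Sum>i<(m::nat). c i *s e i) k q = (\<Sum>i<m. c i * ratio (e i) k q)"
proof (induction m)
  case (Suc m)
  then show ?case using ratio_linear[of 1 "\<Sum>i<m. c i *s e i" "c m" "e m" k q] by simp
qed (simp add: ratio_expand[of 0])

text \<open>The linear form with prescribed derivatives along the frame that vanishes at \<open>z\<close>.\<close>

definition centred :: "complex ^ 'a \<Rightarrow> complex ^ 'a" where
  "centred e = e + (- ratio e k z) *s unit_form"

lemma centred:
  "ratio (centred e) k z = 0" "D \<in> tangent_space M z \<Longrightarrow> D (ratio (centred e) k) = D (ratio e k)"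
proof -
  have r: "ratio (centred e) k q = 1 * ratio e k q + (- ratio e k z) * ratio unit_form k q" for q
    unfolding centred_def using ratio_linear[of 1 e "- ratio e k z" unit_form k q] by simp
  show "ratio (centred e) k z = 0" unfolding r ratio_self[OF z_chart] by simp
  assume D: "D \<in> tangent_space M z"
  have "D (ratio (centred e) k) = D (\<lambda>q. ratio e k q - ratio e k z)"
    by (rule tangent_germ[OF D holomorphic_at_ratio[OF z_chart]])
      (use unit_form_near in eventually_elim, simp add: r)
  also have "\<dots> = D (ratio e k)"
    using tangent_diff[OF D holomorphic_at_ratio[OF z_chart] holomorphic_at_const] tangent_const[OF D] by simp
  finally show "D (ratio (centred e) k) = D (ratio e k)" .
qed

lemma tangent_ratio_sum:
  assumes "D \<in> tangent_space M z" shows "D (ratio (\<Sum>i<(m::nat). c i *s e i) k) = (\<Sum>i<m. c i * D (ratio (e i) k))"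
proof -
  have "D (ratio (\<Sum>i<m. c i *s e i) k) = D (\<lambda>q. \<Sum>i<m. c i * ratio (e i) k q)"
    unfolding ratio_sum[abs_def] ..
  also have "\<dots> = (\<Sum>i<m. D (\<lambda>q. c i * ratio (e i) k q))"
    by (rule tangent_sum[OF assms]) (intro holomorphic_at_cmult holomorphic_at_ratio z_chart)
  also have "\<dots> = (\<Sum>i<m. c i * D (ratio (e i) k))"
    by (simp add: tangent_cmult[OF assms holomorphic_at_ratio[OF z_chart]])
  finally show ?thesis .
qed

lemma symbols_1: "symbols 1 = uea_dual \<nn> 1"
proof
  show "symbols 1 \<subseteq> uea_dual \<nn> 1" by (rule symbols_dual)
  show "uea_dual \<nn> 1 \<subseteq> symbols 1"
  proof
    fix L assume L: "L \<in> uea_dual \<nn> 1"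
    then have Ll: "L \<in> lin_dual (uea \<nn>)" by (simp add: uea_dual_def)
    define lam where "lam v = L (uea_monomial \<nn> [(v, cs 0)])" for v
    have lam_add: "lam (v + cscale c w) = lam v + c * lam w" if "v \<in> H z" "w \<in> H z" for v w c
    proof -
      have vw: "(v, cs 0) \<in> carrier \<nn>" "(w, cs 0) \<in> carrier \<nn>" "c \<odot>\<^bsub>\<nn>\<^esub> (w, cs 0) \<in> carrier \<nn>"
        using that by (simp_all only: symbol_simps(4) symbol_carrierI H_closed tangent_closed)
      have "(v + cscale c w, cs 0) = (v, cs 0) \<oplus>\<^bsub>\<nn>\<^esub> (c \<odot>\<^bsub>\<nn>\<^esub> (w, cs 0))"
        unfolding symbol_simps(3,4) cfun.scale_zero_right add_0_right ..
      then show ?thesis unfolding lam_def using dual_letter[OF Ll] vw by simp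
    qed
    have lam_0: "lam 0 = 0" using lam_add[of 0 0 "-1"] H_closed(1) by (simp add: cfun.scale_zero_right)
    have lam_sum: "lam (\<Sum>i<m. cscale (c i) (X i z)) = (\<Sum>i<m. c i * lam (X i z))" if "m \<le> r" for m c
      using that
    proof (induction m)
      case 0
      show ?case unfolding lessThan_0 sum.empty by (rule lam_0)
    next
      case (Suc m)
      have "(\<Sum>i<m. cscale (c i) (X i z)) \<in> H z"
        by (intro cfun.subspace_sum[OF H_sub] H_closed X_in) (use Suc.prems in simp)
      then have "lam ((\<Sum>i<m. cscale (c i) (X i z)) + cscale (c m) (X m z)) = lam (\<Sum>i<m. cscale (c i) (X i z)) + c m * lam (X m z)"
        by (rule lam_add) (use Suc.prems X_in in simp)
      also have "lam (\<Sum>i<m. cscale (c i) (X i z)) = (\<Sum>i<m. c i * lam (X i z))" using Suc by simp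
      finally show ?case unfolding sum.lessThan_Suc .
    qed
    define e where "e = centred (\<Sum>i<r. (lam (X i z) / u z) *s a i)"
    have der: "v (form_germ e) = lam v" if "v \<in> H z" for v
    proof -
      note D = H_tangent[OF that]
      have "v (form_germ e) = u z * (\<Sum>i<r. lam (X i z) / u z * v (ratio (a i) k))"
        unfolding tangent_form_germ[OF D centred(1)[of "\<Sum>i<r. (lam (X i z) / u z) *s a i", folded e_def]]
        unfolding e_def centred(2)[OF D] tangent_ratio_sum[OF D] ..
      also have "\<dots> = (\<Sum>i<r. v (ratio (a i) k) * lam (X i z))"
        using u(2) by (simp add: sum_distrib_left mult_ac)
      also have "\<dots> = lam (\<Sum>i<r. cscale (v (ratio (a i) k)) (X i z))" by (rule lam_sum[OF order_refl, symmetric])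
      also have "(\<Sum>i<r. cscale (v (ratio (a i) k)) (X i z)) = v" by (rule section_value_expansion[OF that, symmetric])
      finally show ?thesis .
    qed
    have "jet_symbol M H z 1 (form_germ e) L"
      unfolding jet_symbol_iff
    proof (intro conjI allI impI L)
      show "form_germ e \<in> weighted_ideal M H z 1"
      proof (rule weighted_idealI[OF form_germ_holomorphic])
        fix w and j :: nat assume j: "j < 1" "w \<in> frame_words r j"
        have "frame_weight r i \<noteq> 0" for i by (simp add: frame_weight_def)
        with j have "w = []" by (cases w) (auto simp: frame_words_def)
        then show "frame_op r X T w (form_germ e) z = 0" by (simp add: form_germ_def e_def centred(1))
      qed
      fix w ds \<xi>s assume w: "symbol_word w ds \<xi>s" "sum_list ds = 1"
      then obtain x w' where "w = x # w'" by (cases w) (auto simp: symbol_word_Nil)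
      with w(1) obtain d ds' \<xi> \<xi>s' where e: "ds = d # ds'" "\<xi>s = \<xi> # \<xi>s'" "d \<in> {1, 2}" "x \<in> grade \<nn> d"
        "represents M H z d x \<xi>" "symbol_word w' ds' \<xi>s'" by (auto elim: symbol_word_ConsE)
      have d: "d = 1" "sum_list ds' = 0" using e(1,3) w(2) by auto
      have "w' = []"
      proof (cases w')
        case (Cons x' w'')
        with e(6) obtain d' ds'' where "ds' = d' # ds''" "d' \<in> {1, 2}" by (auto elim: symbol_word_ConsE)
        then show ?thesis using d(2) by auto
      qed
      then have \<xi>s: "\<xi>s = [\<xi>]" "w = [x]" using e(2,6) \<open>w = x # w'\<close> by (simp_all add: symbol_word_Nil)
      have \<xi>: "section_at M H z \<xi>" "x = (\<xi> z, cs 0)" using e(5) d(1) by (simp_all add: represents_def coset_zero)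
      show "L (uea_monomial \<nn> w) = foldr (\<lambda>\<xi> f q. \<xi> q f) \<xi>s (form_germ e) z"
        using der[OF section_in[OF \<xi>(1) z]] by (simp add: \<xi>s \<xi>(2) lam_def)
    qed
    then show "L \<in> symbols 1" unfolding symbols_def by (intro CollectI exI)
  qed
qed

text \<open>
  The functional on \<open>U(\<nn>)\<close> given by a germ \<open>f\<close> whose weighted order at \<open>z\<close> is two: a monomial
  \<open>v w\<close> with \<open>v\<close>, \<open>w\<close> in degree one goes to the second derivative, a letter of degree two to the
  derivative along \<open>T\<close>. The commutator relation holds because the second derivatives
  differ by the Lie bracket.
\<close>

definition symbol_theta :: "'a tvec set \<Rightarrow> complex" where
  "symbol_theta A = theta (SOME D. D \<in> tangent_space M z \<and> cs D = A)"

lemma symbol_theta: "D \<in> tangent_space M z \<Longrightarrow> symbol_theta (cs D) = theta D"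
proof -
  assume D: "D \<in> tangent_space M z"
  have "\<exists>E. E \<in> tangent_space M z \<and> cs E = cs D" using D by (intro exI[of _ D] conjI refl)
  from someI_ex[OF this] have "(SOME E. E \<in> tangent_space M z \<and> cs E = cs D) \<in> tangent_space M z"
    "cs (SOME E. E \<in> tangent_space M z \<and> cs E = cs D) = cs D" by (rule conjunct1, rule conjunct2)
  then show ?thesis unfolding symbol_theta_def using coset_eq_theta[OF _ D] by simp
qed

definition second_form :: "('a proj \<Rightarrow> complex) \<Rightarrow> 'a tvec \<Rightarrow> 'a tvec \<Rightarrow> complex" where
  "second_form f v w = (\<Sum>i<r. \<Sum>j<r. v (ratio (a i) k) * w (ratio (a j) k) * X i z (\<lambda>q. X j q f))"

fun second_symbol :: "('a proj \<Rightarrow> complex) \<Rightarrow> ('a tvec \<times> 'a tvec set) list \<Rightarrow> complex" where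
  "second_symbol f [(v, A)] = symbol_theta A * T z f"
| "second_symbol f [(v, A), (w, B)] = second_form f v w"
| "second_symbol f _ = 0"

lemma second_form_bilinear:
  "second_form f (v + v') w = second_form f v w + second_form f v' w"
  "second_form f w (v + v') = second_form f w v + second_form f w v'"
  "second_form f (cscale c v) w = c * second_form f v w"
  "second_form f w (cscale c v) = c * second_form f w v"
  "second_form f 0 w = 0" "second_form f w 0 = 0"
  by (simp_all add: second_form_def cscale_def sum.distrib sum_distrib_left algebra_simps)

lemma theta_add: "theta (D + E) = theta D + theta E"
  by (simp add: theta_def sum.distrib algebra_simps)

lemma theta_zero: "theta 0 = 0"
  by (simp add: theta_def)

lemma tangent_value:
  assumes "D \<in> tangent_space M z" "\<And>i. i < r \<Longrightarrow> X i z f = 0"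
  shows "D f = theta D * T z f"
proof -
  have "D f = ((\<Sum>i<r. cscale (D (ratio (a i) k)) (X i z)) + cscale (theta D) (T z)) f"
    by (rule fun_cong[OF tangent_value_expansion[OF assms(1)]])
  then show ?thesis unfolding plus_fun_apply comb_apply using assms(2) by (simp add: cscale_def)
qed

lemma second_form_commutator:
  assumes f: "holomorphic_at M z f" "\<And>i. i < r \<Longrightarrow> X i z f = 0"
  shows "second_form f v w = second_form f w v + theta (frame_bracket v w) * T z f"
proof -
  have "theta (frame_bracket v w) * T z f = frame_bracket v w f"
    by (rule tangent_value[OF frame_bracket_tangent f(2), symmetric])
  also have "\<dots> = second_form f v w - (\<Sum>i<r. \<Sum>j<r. v (ratio (a i) k) * w (ratio (a j) k) * X j z (\<lambda>q. X i q f))"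
    using f(1) by (simp add: frame_bracket_def second_form_def sum_fun_apply cscale_def lie_bracket_def right_diff_distrib sum_subtractf)
  also have "(\<Sum>i<r. \<Sum>j<r. v (ratio (a i) k) * w (ratio (a j) k) * X j z (\<lambda>q. X i q f)) = second_form f w v"
    unfolding second_form_def by (subst sum.swap) (simp only: mult_ac)
  finally show ?thesis by simp
qed

lemma second_symbol_functional:
  assumes f: "holomorphic_at M z f" "\<And>i. i < r \<Longrightarrow> X i z f = 0"
  shows "word_functional \<nn> (second_symbol f)"
  unfolding word_functional_def
proof (intro ballI)
  fix g h x y assume gh: "g \<in> lists (carrier \<nn>)" "h \<in> lists (carrier \<nn>)" and "x \<in> carrier \<nn>" "y \<in> carrier \<nn>"
  then obtain v D w E where x: "v \<in> H z" "D \<in> tangent_space M z" "x = (v, cs D)"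
    and y: "w \<in> H z" "E \<in> tangent_space M z" "y = (w, cs E)" by (auto elim!: symbol_carrierE)
  have th: "symbol_theta (cs (D + E)) = symbol_theta (cs D) + symbol_theta (cs E)"
    "symbol_theta (cs (cscale c D)) = c * symbol_theta (cs D)"
    "symbol_theta (cs (frame_bracket v w)) = theta (frame_bracket v w)" for c
    using x(2) y(2) by (simp_all add: symbol_theta tangent_closed frame_bracket_tangent theta_add theta_cscale)
  have add: "x \<oplus>\<^bsub>\<nn>\<^esub> y = (v + w, cs (D + E))" and scale: "c \<odot>\<^bsub>\<nn>\<^esub> x = (cscale c v, cs (cscale c D))"
    and br: "bracket \<nn> x y = (0, cs (frame_bracket v w))" for c
    unfolding x(3) y(3) by (rule symbol_simps(3), rule symbol_simps(4), rule symbol_simps(5)[OF x(1) y(1)])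
  have comm: "second_form f v w = second_form f w v + theta (frame_bracket v w) * T z f"
    by (rule second_form_commutator[OF f(1)]) (rule f(2))
  have size: "t = [] \<or> (\<exists>p A. t = [(p, A)]) \<or> 2 \<le> length t" for t :: "('a tvec \<times> 'a tvec set) list"
    by (cases t rule: remdups_adj.cases) auto
  consider "g = []" "h = []" | p A where "g = [(p, A)]" "h = []" | p A where "g = []" "h = [(p, A)]"
    | "length g + length h \<ge> 2"
    using size[of g] size[of h] by (elim disjE exE) auto
  then show "second_symbol f (g @ [x \<oplus>\<^bsub>\<nn>\<^esub> y] @ h) = second_symbol f (g @ [x] @ h) + second_symbol f (g @ [y] @ h)
     \<and> (\<forall>c. second_symbol f (g @ [c \<odot>\<^bsub>\<nn>\<^esub> x] @ h) = c * second_symbol f (g @ [x] @ h))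
     \<and> second_symbol f (g @ [x, y] @ h) = second_symbol f (g @ [y, x] @ h) + second_symbol f (g @ [bracket \<nn> x y] @ h)"
  proof cases
    case 1
    show ?thesis
      unfolding 1 add scale br unfolding x(3) y(3)
      using comm by (simp add: th algebra_simps)
  next
    case 2
    show ?thesis unfolding 2 add scale br unfolding x(3) y(3) by (simp add: second_form_bilinear)
  next
    case 3
    show ?thesis unfolding 3 add scale br unfolding x(3) y(3) by (simp add: second_form_bilinear)
  next
    case 4
    have long: "second_symbol f t = 0" if "length t \<ge> 3" for t
      using that by (cases "(f, t)" rule: second_symbol.cases) auto
    show ?thesis using 4 by (simp add: long)
  qed
qed

lemma second_jet_symbol:
  assumes f: "holomorphic_at M z f" "f z = 0" "\<And>i. i < r \<Longrightarrow> X i z f = 0"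
  shows "jet_symbol M H z 2 f (functional_of \<nn> (second_symbol f))"
  unfolding jet_symbol_iff
proof (intro conjI allI impI)
  have "word_functional \<nn> (second_symbol f)" by (rule second_symbol_functional[OF f(1)]) (rule f(3))
  note F = functional_of[OF this]
  have eval: "functional_of \<nn> (second_symbol f) (uea_monomial \<nn> w) = second_symbol f w" if "homogeneous_word \<nn> w ds" for w ds
    by (rule F(2)[OF symbol_word_lists[OF that]])
  show "f \<in> weighted_ideal M H z 2"
  proof (rule weighted_idealI[OF f(1)])
    fix w and j :: nat assume j: "j < 2" and w: "w \<in> frame_words r j"
    show "frame_op r X T w f z = 0"
    proof (cases w)
      case (Cons i w')
      have i: "i < r" using w j by (auto simp: Cons frame_words_def frame_weight_def split: if_splits)
      have "w' = []" using w j by (cases w') (auto simp: Cons frame_words_def frame_weight_def split: if_splits)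
      then show ?thesis using f(3)[OF i] i by (simp add: Cons frame_field_def)
    qed (simp add: f(2))
  qed
  have letter: "(\<exists>v. x = (v, cs 0) \<and> v \<in> H z \<and> d = 1) \<or> (\<exists>D. x = (0, cs D) \<and> D \<in> tangent_space M z \<and> d = 2)"
    if "d \<in> {1, 2}" "x \<in> grade \<nn> d" for x d
    using that by (auto simp: symbol_simps)
  show "functional_of \<nn> (second_symbol f) \<in> uea_dual \<nn> 2"
    unfolding uea_dual_iff[OF symbol_grades]
  proof (intro conjI allI impI F(1))
    fix w ds assume w: "homogeneous_word \<nn> w ds" "sum_list ds \<noteq> 2"
    have "second_symbol f w = 0"
    proof (cases w)
      case (Cons x w')
      then obtain d ds' where d: "ds = d # ds'" "d \<in> {1, 2}" "x \<in> grade \<nn> d" "homogeneous_word \<nn> w' ds'"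
        using w(1) unfolding homogeneous_word_def by (auto simp: list_all2_Cons1)
      note lx = letter[OF d(2,3)]
      show ?thesis
      proof (cases w')
        case Nil
        then have "d \<noteq> 2" using d(1,4) w(2) by (auto simp: homogeneous_word_def)
        then obtain v where "x = (v, cs 0)" using lx by blast
        then show ?thesis by (simp add: Cons Nil symbol_theta tangent_closed theta_zero)
      next
        case w': (Cons y w'')
        obtain d' ds'' where d': "ds' = d' # ds''" "d' \<in> {1, 2}" "y \<in> grade \<nn> d'" "homogeneous_word \<nn> w'' ds''"
          using d(4) unfolding w' homogeneous_word_def by (auto simp: list_all2_Cons1)
        note ly = letter[OF d'(2,3)]
        show ?thesis
        proof (cases w'')
          case Nil
          then have "d = 2 \<or> d' = 2" using d d' w(2) by (auto simp: homogeneous_word_def)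
          then show ?thesis using lx ly by (auto simp: Cons w' Nil second_form_bilinear)
        next
          case (Cons t s)
          then show ?thesis unfolding \<open>w = x # w'\<close> w' by (cases x; cases y) simp
        qed
      qed
    qed simp
    then show "functional_of \<nn> (second_symbol f) (uea_monomial \<nn> w) = 0" using eval[OF w(1)] by simp
  qed
  fix w ds \<xi>s assume w: "symbol_word w ds \<xi>s" "sum_list ds = 2"
  have "second_symbol f w = foldr (\<lambda>\<xi> f q. \<xi> q f) \<xi>s f z"
  proof (cases w)
    case Nil
    with w show ?thesis by (simp add: symbol_word_Nil)
  next
    case (Cons x w')
    with w(1) obtain d ds' \<xi> \<xi>s' where e: "ds = d # ds'" "\<xi>s = \<xi> # \<xi>s'" "d \<in> {1, 2}"
      "represents M H z d x \<xi>" "symbol_word w' ds' \<xi>s'" by (auto elim: symbol_word_ConsE)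
    show ?thesis
    proof (cases w')
      case Nil
      then have n: "\<xi>s' = []" "d = 2" using e(1,5) w(2) by (simp_all add: symbol_word_Nil)
      then have \<xi>: "vector_field_at M z \<xi>" "x = (0, cs (\<xi> z))" using e(4) by (simp_all add: represents_def)
      note D = vector_field_tangent[OF \<xi>(1) z]
      show ?thesis using tangent_value[OF D f(3)] by (simp add: Cons Nil n e(2) \<xi>(2) symbol_theta[OF D])
    next
      case w': (Cons y w'')
      with e(5) obtain d' ds'' \<eta> \<xi>s'' where e': "ds' = d' # ds''" "\<xi>s' = \<eta> # \<xi>s''" "d' \<in> {1, 2}"
        "represents M H z d' y \<eta>" "symbol_word w'' ds'' \<xi>s''" by (auto elim: symbol_word_ConsE)
      have dd: "d = 1" "d' = 1" "sum_list ds'' = 0" using e e' w(2) by auto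
      have "w'' = []"
      proof (cases w'')
        case (Cons t s)
        with e'(5) obtain c cs' where "ds'' = c # cs'" "c \<in> {1, 2}" by (auto elim: symbol_word_ConsE)
        then show ?thesis using dd(3) by auto
      qed
      then have n: "\<xi>s'' = []" "w'' = []" using e'(5) by (simp_all add: symbol_word_Nil)
      have \<xi>: "section_at M H z \<xi>" "x = (\<xi> z, H z)" and \<eta>: "section_at M H z \<eta>" "y = (\<eta> z, H z)"
        using e(4) e'(4) dd by (simp_all add: represents_def)
      show ?thesis
        using second_derivative[OF \<xi>(1) \<eta>(1) f(1)] f(3) by (simp add: Cons w' n e(2) e'(2) \<xi>(2) \<eta>(2) second_form_def)
    qed
  qed
  moreover have "homogeneous_word \<nn> w ds" using w(1) by (simp add: symbol_word_def)
  ultimately show "functional_of \<nn> (second_symbol f) (uea_monomial \<nn> w) = foldr (\<lambda>\<xi> f q. \<xi> q f) \<xi>s f z"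
    using eval by simp
qed

lemma symbols_2: "restrict_h2 \<nn> ` symbols 2 = lin_dual (\<nn>\<lparr>carrier := grade \<nn> 2\<rparr>)"
proof (intro equalityI subsetI)
  fix m assume "m \<in> restrict_h2 \<nn> ` symbols 2"
  then obtain L where L: "L \<in> symbols 2" "m = restrict_h2 \<nn> L" by blast
  have Ll: "L \<in> lin_dual (uea \<nn>)" using L(1) symbols_dual by (auto simp: uea_dual_def)
  have closed: "x \<oplus>\<^bsub>\<nn>\<^esub> y \<in> grade \<nn> 2" "c \<odot>\<^bsub>\<nn>\<^esub> x \<in> grade \<nn> 2" if "x \<in> grade \<nn> 2" "y \<in> grade \<nn> 2" for x y c
    using that by (auto simp: symbol_simps(3,4,8) tangent_closed)
  note gr2 = subsetD[OF symbol_grades(2)]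
  show "m \<in> lin_dual (\<nn>\<lparr>carrier := grade \<nn> 2\<rparr>)"
    unfolding lin_dual_def L(2) restrict_h2_def
    using closed dual_letter(1)[OF Ll gr2 gr2] dual_letter(2)[OF Ll gr2] by simp
next
  fix m assume m: "m \<in> lin_dual (\<nn>\<lparr>carrier := grade \<nn> 2\<rparr>)"
  have moff: "m x = 0" if "x \<notin> grade \<nn> 2" for x using m that unfolding lin_dual_def by (cases x) simp
  define c where "c = m (0, cs (T z))"
  have mval: "m (0, cs D) = theta D * c" if D: "D \<in> tangent_space M z" for D
  proof -
    have "cs (cscale (theta D) (T z)) = cs D"
      by (subst coset_eq_theta) (simp_all add: D tangent_closed T_tangent theta_cscale theta_T)
    then have "(0, cs D) = theta D \<odot>\<^bsub>\<nn>\<^esub> (0, cs (T z))"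
      unfolding symbol_simps(4) by (simp only: cfun.scale_zero_right)
    moreover have "(0, cs (T z)) \<in> grade \<nn> 2" by (simp add: symbol_simps(8) T_tangent)
    ultimately show ?thesis using m by (simp add: lin_dual_def c_def)
  qed
  define e0 where "e0 = (\<Sum>i<r. (- X i z (ratio b k)) *s a i)"
  define e where "e = centred ((c / u z) *s b + (c / u z) *s e0)"
  have D: "D (form_germ e) = c * (D (ratio b k) - (\<Sum>i<r. X i z (ratio b k) * D (ratio (a i) k)))"
    if D: "D \<in> tangent_space M z" for D
  proof -
    have "D (ratio ((c / u z) *s b + (c / u z) *s e0) k) = D (\<lambda>q. c / u z * ratio b k q + c / u z * ratio e0 k q)"
      unfolding ratio_linear[abs_def] ..
    also have "\<dots> = D (\<lambda>q. c / u z * ratio b k q) + D (\<lambda>q. c / u z * ratio e0 k q)"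
      by (intro tangent_add[OF D] holomorphic_at_cmult holomorphic_at_ratio z_chart)
    also have "\<dots> = c / u z * D (ratio b k) + c / u z * D (ratio e0 k)"
      by (simp only: tangent_cmult[OF D holomorphic_at_ratio[OF z_chart]])
    also have "D (ratio e0 k) = (\<Sum>i<r. (- X i z (ratio b k)) * D (ratio (a i) k))"
      unfolding e0_def by (rule tangent_ratio_sum[OF D])
    finally have "D (ratio ((c / u z) *s b + (c / u z) *s e0) k) =
        c / u z * (D (ratio b k) - (\<Sum>i<r. X i z (ratio b k) * D (ratio (a i) k)))"
      by (simp add: sum_negf right_diff_distrib)
    then show ?thesis
      using tangent_form_germ[OF D, of e] centred(1) centred(2)[OF D] u(2) by (simp add: e_def)
  qed
  have Xe: "X i z (form_germ e) = 0" if "i < r" for i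
  proof -
    have "(\<Sum>j<r. X j z (ratio b k) * X i z (ratio (a j) k)) = (\<Sum>j<r. if i = j then X j z (ratio b k) else 0)"
      by (rule sum.cong[OF refl]) (simp add: dual(1)[OF that])
    then show ?thesis using D[OF H_tangent[OF X_in[OF that]]] that by simp
  qed
  have Te: "T z (form_germ e) = c"
    using D[OF T_tangent] by (simp add: dual)
  let ?f = "form_germ e"
  have f0: "?f z = 0" by (simp add: form_germ_def e_def centred(1))
  have sym: "jet_symbol M H z 2 ?f (functional_of \<nn> (second_symbol ?f))"
    by (rule second_jet_symbol[OF form_germ_holomorphic f0]) (rule Xe)
  have "word_functional \<nn> (second_symbol ?f)" by (rule second_symbol_functional[OF form_germ_holomorphic]) (rule Xe)
  note F = functional_of(2)[OF this]
  have "restrict_h2 \<nn> (functional_of \<nn> (second_symbol ?f)) x = m x" for x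
  proof (cases "x \<in> grade \<nn> 2")
    case True
    then obtain D where D: "D \<in> tangent_space M z" "x = (0, cs D)" by (auto simp: symbol_simps(8))
    have "[x] \<in> lists (carrier \<nn>)" using True symbol_grades by auto
    then have "functional_of \<nn> (second_symbol ?f) (uea_monomial \<nn> [x]) = second_symbol ?f [x]" by (rule F)
    then show ?thesis using True mval[OF D(1)] by (simp add: restrict_h2_def D(2) symbol_theta[OF D(1)] Te)
  next
    case False
    then show ?thesis by (simp add: restrict_h2_def moff)
  qed
  then have "m = restrict_h2 \<nn> (functional_of \<nn> (second_symbol ?f))" by (simp add: fun_eq_iff)
  moreover have "functional_of \<nn> (second_symbol ?f) \<in> symbols 2"
    unfolding symbols_def using sym by (intro CollectI exI)
  ultimately show "m \<in> restrict_h2 \<nn> ` symbols 2" by (rule image_eqI)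
qed

lemma symbols_contact_symbol_system:
  assumes "z \<notin> jump_locus M H" shows "contact_symbol_system \<nn> symbols"
  unfolding contact_symbol_system_def
proof (intro conjI allI ballI)
  show "graded_heisenberg \<nn>" by (rule symbol_heisenberg)
  show "cfun.subspace (symbols l)" "symbols l \<subseteq> uea_dual \<nn> l" for l by (rule symbols_subspace, rule symbols_dual)
  show "\<exists>B. finite B \<and> cfun.span (\<Union>l. symbols l) \<subseteq> cfun.span B" by (rule symbols_span_finite)
  show "symbols 0 = uea_dual \<nn> 0" by (rule symbols_0)
  show "symbols 1 = uea_dual \<nn> 1" by (rule symbols_1)
  show "restrict_h2 \<nn> ` symbols 2 = lin_dual (\<nn>\<lparr>carrier := grade \<nn> 2\<rparr>)" by (rule symbols_2)
  have "heisenberg_coordinates \<nn>"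
  proof
    show "lie_algebra \<nn>" by (rule symbol_lie_algebra)
    fix x y w assume "x \<in> carrier \<nn>" "y \<in> carrier \<nn>" "w \<in> carrier \<nn>"
    then obtain v D v' D' v'' D'' where x: "v \<in> H z" "x = (v, cs D)" and y: "v' \<in> H z" "y = (v', cs D')"
      and w: "v'' \<in> H z" "w = (v'', cs D'')" by (auto elim!: symbol_carrierE)
    show "bracket \<nn> x (bracket \<nn> y w) = \<zero>\<^bsub>\<nn>\<^esub>"
      unfolding x(2) y(2) w(2) symbol_simps(5)[OF y(1) w(1)] symbol_simps(5)[OF x(1) H_closed(1)] symbol_simps(2)
      by (simp only: frame_bracket_zero)
  qed
  moreover have "cfun.span (\<Union>l. symbols l) \<subseteq> lin_dual (uea \<nn>)"
    by (rule cfun.span_minimal[OF _ lin_dual_subspace]) (use symbols_dual in \<open>auto simp: uea_dual_def\<close>)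
  ultimately show "right_invariant \<nn> x f \<in> functions_of \<nn> (cfun.span (\<Union>l. symbols l))"
    if "x \<in> carrier \<nn>" "f \<in> functions_of \<nn> (cfun.span (\<Union>l. symbols l))" for x f
    by (rule heisenberg_coordinates.functions_of_right_invariant[OF _ _ symbols_shift[OF assms that(1)] that])
qed

end

theorem theorem1p6:
  fixes M :: "'n::finite proj set"
    and H :: "'n proj \<Rightarrow> 'n tvec set"
  assumes "locally_closed_submanifold M"
    and "contact_structure M H"
  shows "\<exists>A. closed_analytic_subset M A \<and> nowhere_dense_in M A
    \<and> (\<forall>z\<in>M - A. \<forall>s. local_trivialization M z s
          \<longrightarrow> contact_symbol_system (symbol_algebra M H z) (contact_fundamental_forms M H z s))"
proof (intro exI[of _ "jump_locus M H"] conjI ballI allI impI)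
  have corank: "corank_one_subbundle M H" using assms(2) by (simp add: contact_structure_def)
  show "closed_analytic_subset M (jump_locus M H)" by (rule jump_locus_analytic[OF assms(1) corank])
  show "nowhere_dense_in M (jump_locus M H)" by (rule jump_locus_nowhere_dense[OF assms(1) corank])
  fix z s assume zA: "z \<in> M - jump_locus M H" and s: "local_trivialization M z s"
  obtain k r X a T b where fr: "\<forall>\<^sub>F q in near M z. adapted_frame M H k r X a T b q"
    using adapted_frame_exists[OF assms(1) corank DiffD1[OF zA]] .
  interpret contact_framed M H k r X a T b z
  proof
    show "z \<in> M" using zA by simp
    show "\<forall>\<^sub>F q in near M z. adapted_frame M H k r X a T b q" by (rule fr)
    show "corank_one_subbundle M H" by (rule corank)
    show "v = 0" if "v \<in> H z" "\<And>w. w \<in> H z \<Longrightarrow> bracket_form M H z v w = H z" for v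
      using assms(2) zA that unfolding contact_structure_def by blast
  qed
  obtain u where unit: "holomorphic_at M z u" "u z \<noteq> 0"
    "\<And>e f. equals_product_at M z (lform e) f s \<longleftrightarrow> (\<forall>\<^sub>F q in near M z. f q = u q * ratio e k q)"
    by (rule trivialization_unit[OF s], rule that)
  interpret contact_unit M H k r X a T b z u by unfold_locales (rule unit(1), rule unit(2))
  have "contact_fundamental_forms M H z s l = symbols l" for l
  proof (intro equalityI subsetI)
    fix L assume "L \<in> contact_fundamental_forms M H z s l"
    then obtain \<sigma> f where \<sigma>: "\<sigma> \<in> linear_forms" "equals_product_at M z \<sigma> f s" "jet_symbol M H z l f L"
      unfolding contact_fundamental_forms_def weighted_system_def by blast
    obtain e where e: "\<sigma> = lform e" using \<sigma>(1) unfolding linear_forms_eq by (rule rangeE)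
    have "jet_symbol M H z l (form_germ e) L"
      by (rule jet_symbol_germ[OF \<sigma>(3)]) (use \<sigma>(2) unit(3) in \<open>simp add: e form_germ_def\<close>)
    then show "L \<in> symbols l" unfolding symbols_def by (intro CollectI exI)
  next
    fix L assume "L \<in> symbols l"
    then obtain e where e: "jet_symbol M H z l (form_germ e) L" by (auto simp: symbols_def)
    have prod: "equals_product_at M z (lform e) (form_germ e) s" unfolding unit(3) form_germ_def by simp
    have "lform e \<in> weighted_system M H z l"
      unfolding weighted_system_def linear_forms_eq
    proof (intro CollectI conjI rangeI bexI[of _ "form_germ e"] exI[of _ s] prod)
      show "hyperplane_section_at M z s" using s by (simp add: local_trivialization_def)
      show "form_germ e \<in> weighted_ideal M H z l" using e by (simp add: jet_symbol_iff)
    qed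
    with prod e show "L \<in> contact_fundamental_forms M H z s l"
      unfolding contact_fundamental_forms_def by (intro CollectI bexI[of _ "lform e"] exI[of _ "form_germ e"] conjI)
  qed
  then have eq: "contact_fundamental_forms M H z s = symbols" by (rule ext)
  show "contact_symbol_system (symbol_algebra M H z) (contact_fundamental_forms M H z s)"
    unfolding eq by (rule symbols_contact_symbol_system) (use zA in simp)
qed

end
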